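(* Let $0\le k\le n$, let $\mathcal B_k$ be the Gelfand-Zetlin algebra acting on $(V(z_1)\otimes\cdots\otimes V(z_n))_k$, and let $A_k=H^*_{GL_n\times\mathbb C^\times}(T^*\mathrm{Gr}_k(\mathbb C^n))\otimes_{\mathbb C[y]}\mathbb C[y^{\pm1}]$. The assignment $$\alpha:\quad \tilde L_{22,s}(y)\mapsto [a_s(\gamma_{1,1},\dots,\gamma_{1,k},y)]\cdot\delta,\qquad \widetilde{\mathrm{Det}}_s(y)\mapsto [b_s(\boldsymbol z,y)],\qquad s\in\mathbb Z_{\ge0},$$ (with $\alpha$ being $\mathbb C[y^{\pm1}]$-linear) defines an isomorphism of the algebra $\mathcal B_k$ acting on $(V(z_1)\otimes\cdots\otimes V(z_n))_k$ onto the algebra $A_k\otimes\mathbb C[\delta^{\pm1}]$ acting on $H^*_T(T^*\mathrm{Gr}_k(\mathbb C^n))\otimes\mathcal L_{\lambda,(\boldsymbol z,y)}$ (elements of $A_k$ act by multiplication, $\delta$ acts by the shift $\lambda\mapsto\lambda+y$). Moreover, $\alpha$ and $\mathrm{Stab}_{\mathrm{id}}:(V(z_1)\otimes\cdots\otimes V(z_n))_k\to H^*_T(T^*\mathrm{Gr}_k(\mathbb C^n))\otimes\mathcal L_{\lambda,(\boldsymbol z,y)}$ define an isomorphism of the $\mathcal B_k$-module $(V(z_1)\otimes\cdots\otimes V(z_n))_k$ and the $A_k\otimes\mathbb C[\delta^{\pm1}]$-module $H^*_T(T^*\mathrm{Gr}_k(\mathbb C^n))\otimes\mathcal L_{\lambda,(\boldsymbol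 z,y)}$; that is, $\mathrm{Stab}_{\mathrm{id}}$ is bijective and $\mathrm{Stab}_{\mathrm{id}}(b\,\zeta)=\alpha(b)\,\mathrm{Stab}_{\mathrm{id}}(\zeta)$ for all $b\in\mathcal B_k$, $\zeta\in (V(z_1)\otimes\cdots\otimes V(z_n))_k$.
   Context: **Notation.** $n\ge1$, $0\le k\le n$, $[n]=\{1,\dots,n\}$; $\mathcal I_k$ is the set of $k$-element subsets of $[n]$; $\bar I=[n]\setminus I$; $\boldsymbol z=(z_1,\dots,z_n)$; $\lambda,y$ are further variables. **Rings.** $\mathcal L_{\lambda,y}$: rational functions $f/g$, $f\in\mathbb C[\lambda,y]$, $g$ a finite product of factors $\lambda+ly$, $l\in\mathbb Z$. $\mathcal L_{(\boldsymbol z,y)}=\mathbb C(\boldsymbol z,y)$. $\mathcal L_{\lambda,(\boldsymbol z,y)}=\mathcal L_{\lambda,y}\otimes_{\mathbb C[y]}\mathcal L_{(\boldsymbol z,y)}$. For a $\mathbb C[\boldsymbol z,y]$-module $M$, $M\otimes\mathcal L_{\lambda,(\boldsymbol z,y)}$ is the tensor product over $\mathbb C[\boldsymbol z,y]$. **Cohomology.** $T=(\mathbb C^\times)^n\times\mathbb C^\times\subset GL_n\times\mathbb C^\times$; the diagonal torus acts via $\mathbb C^n$, the extra $\mathbb C^\times$ scales the fibers of $T^*\mathrm{Gr}_k(\mathbb C^n)$. With $\Gamma=\{\gamma_{1,1},\dots,\gamma_{1,k},\gamma_{2,1},\dots,\gamma_{2,n-k}\}$, $H^*_T(T^*\mathrm{Gr}_k(\mathbb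 C^n))=\mathbb C[\Gamma,\boldsymbol z,y]^{S_k\times S_{n-k}}/\mathcal J$, $H^*_{GL_n\times\mathbb C^\times}(T^*\mathrm{Gr}_k(\mathbb C^n))=\mathbb C[\Gamma,\boldsymbol z,y]^{S_k\times S_{n-k}\times S_n}/\mathcal J$, where $S_k\times S_{n-k}$ permutes the $\gamma_{1,*}$ and the $\gamma_{2,*}$, $S_n$ permutes the $z_i$, and $\mathcal J$ is the ideal generated by the coefficients in $u$ of $\prod_{i}(u-\gamma_{1,i})\prod_i(u-\gamma_{2,i})-\prod_i(u-z_i)$. The second algebra embeds in the first. Restriction to the fixed point $x_I$ (the coordinate subspace of $I\in\mathcal I_k$) is the substitution $\{\gamma_{1,*}\}\mapsto\{z_a\}_{a\in I}$, $\{\gamma_{2,*}\}\mapsto\{z_a\}_{a\in\bar I}$, written $f(\Gamma,\boldsymbol z,y)\mapsto f(\boldsymbol z_I,\boldsymbol z,y)$; after tensoring with $\mathcal L_{\lambda,(\boldsymbol z,y)}$ the map to the direct sum over all fixed points is an isomorphism. The shift operator $\delta$ acts on $H^*_T\otimes\mathcal L_{\lambda,(\boldsymbol z,y)}$ by $[f(\lambda,\Gamma,\boldsymbol z,y)]\mapsto[f(\lambda+y,\Gamma,\boldsymbol z,y)]$. **Weight functions and $\mathrm{Stab}_{\mathrm{id}}$.** For $i\in I$ put $w(i,I)=\#\{j>i:j\in I\}-\#\{j>i:j\in\bar I\}$ ($j\in[n]$). For $I=\{i_1<\dots<i_k\}$ let $l_I(r,a)=t_r-z_a+y$ if $a<i_r$;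 $=\lambda+t_r-z_a-w(i_r,I)y$ if $a=i_r$; $=t_r-z_a$ if $a>i_r$. Let $W_I(\lambda,\boldsymbol t,\boldsymbol z,y)=y^k\sum_{\pi\in S_k}\Big(\prod_{r=1}^k\prod_{a=1}^n l_I(r,a)\prod_{1\le a<b\le k}\frac{t_a-t_b+y}{t_a-t_b}\Big)\Big|_{t_i\to t_{\pi(i)}}$, $e_k=\prod_{a,b=1}^k(t_a-t_b+y)$, $C^{(r)}_{\mathrm{id},I}=\prod_{i\in I}(\lambda-(w(i,I)+r)y)$, $\tilde W^+_I=W_I/(C^{(0)}_{\mathrm{id},I}C^{(1)}_{\mathrm{id},I}e_k)$. The class $\kappa_{\mathrm{id},I}$ is the unique one with $\kappa_{\mathrm{id},I}|_{x_J}=\tilde W^+_I(\lambda,\boldsymbol z_J,\boldsymbol z,y)$ for all $J\in\mathcal I_k$ ($\boldsymbol t$ replaced by $\{z_j\}_{j\in J}$). $\mathbb C^2$ has basis $v_1,v_2$; $v_I=v_{i_1}\otimes\dots\otimes v_{i_n}$ with $i_j=1$ if $j\in I$ and $i_j=2$ otherwise; $(\mathbb C^2)^{\otimes n}_k=\mathrm{span}\{v_I:|I|=k\}$. $\mathrm{Stab}_{\mathrm{id}}$ is the $\mathcal L_{\lambda,(\boldsymbol z,y)}$-linear map $v_I\mapsto\kappa_{\mathrm{id},I}$. **R-matrix.** In the basis $v_1\otimes v_1,v_1\otimes v_2,v_2\otimes v_1,v_2\otimes v_2$ (columns are images of basis vectors) $$R(\lambda,z,y)=\begin{pmatrix}1&0&0&0\\0&\frac{(\lambda+y)z}{\lambda(z-y)}&-\frac{(\lambda+z)y}{\lambda(z-y)}&0\\0&-\frac{(\lambda-z)y}{\lambda(z-y)}&\frac{(\lambda-y)z}{\lambda(z-y)}&0\\0&0&0&1\end{pmatrix}.$$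 $R^{(i,j)}$ acts in the $i$-th and $j$-th tensor factors; $h^{(j)}$ acts on the $j$-th factor by $v_1\mapsto v_1$, $v_2\mapsto-v_2$; an argument $\lambda-y\sum h^{(j)}$ means that on a vector on which $\sum h^{(j)}$ acts as $\mu$ one substitutes $\lambda-y\mu$. **Module $V(z_1)\otimes\cdots\otimes V(z_n)$.** This is $(\mathbb C^2)^{\otimes n}\otimes\mathcal L_{\lambda,(\boldsymbol z,y)}$, with $k$-part $(\mathbb C^2)^{\otimes n}_k\otimes\mathcal L_{\lambda,(\boldsymbol z,y)}$, on which $h$ acts as $2k-n$. With an auxiliary factor $\mathbb C^2$ numbered $0$, $L(\lambda,w,y)=R^{(0,1)}(\lambda-y\sum_{j=2}^nh^{(j)},w-z_1,y)R^{(0,2)}(\lambda-y\sum_{j=3}^nh^{(j)},w-z_2,y)\cdots R^{(0,n)}(\lambda,w-z_n,y)$, and $L_{ij}(\lambda,w,y)$ is defined by $L(v_j\otimes u)=\sum_iv_i\otimes L_{ij}u$. With $\delta:\zeta(\lambda,\boldsymbol z,y)\mapsto\zeta(\lambda+y,\boldsymbol z,y)$ (coefficientwise in the basis $v_I$), $\tilde L_{i1}(w,y)=L_{i1}(\lambda,w,y)\delta^{-1}$, $\tilde L_{i2}(w,y)=L_{i2}(\lambda,w,y)\delta$, $i=1,2$. Put $\widetilde{\mathrm{Det}}(w,y)=\frac{\lambda}{\lambda-yh}\big(\tilde L_{22}(w+y,y)\tilde L_{11}(w,y)-\tilde L_{12}(w+y,y)\tilde L_{21}(w,y)\big)$. Expand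 at $w=\infty$: $\tilde L_{22}(w,y)=\sum_{s\ge0}\tilde L_{22,s}(y)w^{-s}$, $\widetilde{\mathrm{Det}}(w,y)=\sum_{s\ge0}\widetilde{\mathrm{Det}}_s(y)w^{-s}$. The operator $\tilde L_{22,0}(y)$ is invertible. The Gelfand-Zetlin algebra $\mathcal B$ is the unital algebra of operators generated by all $\tilde L_{22,s}(y)$, $\widetilde{\mathrm{Det}}_s(y)$ ($s\ge0$), $\tilde L_{22,0}(y)^{-1}$ and $\mathbb C[y^{\pm1}]$; it is commutative and preserves each $k$-part; $\mathcal B_k$ is its restriction to the $k$-part. **Elements $a_s,b_s$.** $\prod_{i=1}^k\frac{w-\gamma_{1,i}}{w-\gamma_{1,i}-y}=\sum_{s\ge0}a_s(\gamma_{1,1},\dots,\gamma_{1,k},y)w^{-s}$, $\prod_{i=1}^n\frac{w-z_i+y}{w-z_i}=\sum_{s\ge0}b_s(\boldsymbol z,y)w^{-s}$. *)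

theory Defs
  imports
    "HOL-Library.Poly_Mapping"
    "HOL-Library.Countable"
    "HOL-Library.FuncSet"
    "HOL-Combinatorics.Permutations"
    "HOL-Computational_Algebra.Polynomial"
    "HOL-Computational_Algebra.Fraction_Field"
    "HOL-Computational_Algebra.Formal_Laurent_Series"
    "HOL-Algebra.QuotRing"
    "HOL-Algebra.Module"
begin

section \<open>Polynomials and rational functions\<close>

text \<open>
  All rings below are subrings (or quotients of subrings) of one field of rational functions over
  the complex numbers.  Its variables are \<open>\<lambda>\<close>, \<open>y\<close>, the spectral
  parameter \<open>w\<close>, \<open>z\<^sub>i\<close>, and the Chern roots \<open>\<gamma>\<^bsub>1,i\<^esub>\<close> and
  \<open>\<gamma>\<^bsub>2,i\<^esub>\<close>; indices start at 1.
\<close>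

datatype var = VLam | VY | VW | VZ nat | VG1 nat | VG2 nat

instance var :: countable
  by countable_datatype

text \<open>The order has no mathematical role: the library needs one on the variables in order to
  make polynomials an integral domain.\<close>

instantiation var :: linorder
begin
definition "v \<le> v' \<longleftrightarrow> to_nat (v :: var) \<le> to_nat v'"
definition "v < v' \<longleftrightarrow> to_nat (v :: var) < to_nat v'"
instance
  by standard (auto simp: less_eq_var_def less_var_def)
end

type_synonym mpoly = "(var \<Rightarrow>\<^sub>0 nat) \<Rightarrow>\<^sub>0 complex"
type_synonym ratf = "mpoly fract"

definition cst :: "complex \<Rightarrow> ratf" where
  "cst c = Fraction_Field.Fract (Poly_Mapping.single 0 c) 1"

definition X :: "var \<Rightarrow> ratf" where
  "X v = Fraction_Field.Fract (Poly_Mapping.single (Poly_Mapping.single v 1) 1) 1"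

abbreviation lam :: ratf where "lam \<equiv> X VLam"
abbreviation yy :: ratf where "yy \<equiv> X VY"
abbreviation ww :: ratf where "ww \<equiv> X VW"
abbreviation zz :: "nat \<Rightarrow> ratf" where "zz i \<equiv> X (VZ i)"
abbreviation g1 :: "nat \<Rightarrow> ratf" where "g1 i \<equiv> X (VG1 i)"
abbreviation g2 :: "nat \<Rightarrow> ratf" where "g2 i \<equiv> X (VG2 i)"

definition mpoly_eval :: "(complex \<Rightarrow> 'b::field) \<Rightarrow> (var \<Rightarrow> 'b) \<Rightarrow> mpoly \<Rightarrow> 'b" where
  "mpoly_eval emb \<sigma> p =
     (\<Sum>m\<in>Poly_Mapping.keys p. emb (Poly_Mapping.lookup p m)
        * (\<Prod>v\<in>Poly_Mapping.keys m. \<sigma> v ^ Poly_Mapping.lookup m v))"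

text \<open>Substitution of \<open>\<sigma> v\<close> for each variable \<open>v\<close> in a rational function: any way of writing it
  as a fraction whose denominator does not become zero gives the same value, and the result is
  unspecified if there is none.\<close>

definition subst_into :: "(complex \<Rightarrow> 'b::field) \<Rightarrow> (var \<Rightarrow> 'b) \<Rightarrow> ratf \<Rightarrow> 'b" where
  "subst_into emb \<sigma> f =
     (THE r. \<exists>a b. f = Fraction_Field.Fract a b \<and> mpoly_eval emb \<sigma> b \<noteq> 0
        \<and> r = mpoly_eval emb \<sigma> a / mpoly_eval emb \<sigma> b)"

abbreviation subst :: "(var \<Rightarrow> ratf) \<Rightarrow> ratf \<Rightarrow> ratf" where
  "subst \<equiv> subst_into cst"

text \<open>The coefficient of \<open>w\<close> to the power \<open>-s\<close> in the expansion at \<open>w = \<infinity>\<close>, via the embedding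
  into Laurent series in \<open>1/w\<close>.\<close>

definition winf_coeff :: "nat \<Rightarrow> ratf \<Rightarrow> ratf" where
  "winf_coeff s f =
     fls_nth (subst_into (\<lambda>c. fls_const (cst c))
                (\<lambda>v. if v = VW then fls_X_inv else fls_const (X v)) f) (int s)"

text \<open>\<open>polys S\<close> and \<open>ratfuns S\<close> are the polynomials and the rational functions in the variables
  in \<open>S\<close>.\<close>

definition polys :: "var set \<Rightarrow> ratf set" where
  "polys S = {Fraction_Field.Fract p 1 | p. \<forall>m\<in>Poly_Mapping.keys p. Poly_Mapping.keys m \<subseteq> S}"

definition ratfuns :: "var set \<Rightarrow> ratf set" where
  "ratfuns S = {f / g | f g. f \<in> polys S \<and> g \<in> polys S \<and> g \<noteq> 0}"

text \<open>The tensor products of rings of functions that occur here have an injective multiplication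
  map to the field of rational functions: apart from those of the polynomial ring over which the
  tensor product is taken, the two factors have no variables in common.  They are identified with
  its image.\<close>

definition prod_span :: "ratf set \<Rightarrow> ratf set \<Rightarrow> ratf set" where
  "prod_span A B =
     {\<Sum>i<N. a i * b i | (N :: nat) a b. (\<forall>i<N. a i \<in> A) \<and> (\<forall>i<N. b i \<in> B)}"

definition L_lam_y :: "ratf set" where
  "L_lam_y = {f / (\<Prod>l\<leftarrow>ls. lam + of_int l * yy) | f ls. f \<in> polys {VLam, VY}}"

definition L_zy :: "nat \<Rightarrow> ratf set" where
  "L_zy n = ratfuns (VZ ` {1..n} \<union> {VY})"

definition L_lam_zy :: "nat \<Rightarrow> ratf set" where
  "L_lam_zy n = prod_span L_lam_y (L_zy n)"

definition C_y_inv :: "ratf set" where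
  "C_y_inv = {f / yy ^ m | f m. f \<in> polys {VY}}"

text \<open>The power \<open>m\<close> of \<open>\<delta>\<close>.\<close>

definition shift :: "int \<Rightarrow> ratf \<Rightarrow> ratf" where
  "shift m = subst (\<lambda>v. if v = VLam then lam + of_int m * yy else X v)"


section \<open>Cohomology algebras\<close>

definition perm_var :: "(nat \<Rightarrow> nat) \<Rightarrow> (nat \<Rightarrow> nat) \<Rightarrow> (nat \<Rightarrow> nat) \<Rightarrow> var \<Rightarrow> var" where
  "perm_var \<sigma> \<tau> \<rho> v =
     (case v of VG1 i \<Rightarrow> VG1 (\<sigma> i) | VG2 i \<Rightarrow> VG2 (\<tau> i) | VZ i \<Rightarrow> VZ (\<rho> i) | _ \<Rightarrow> v)"

definition Gam_z_y :: "nat \<Rightarrow> nat \<Rightarrow> var set" where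
  "Gam_z_y n k = VG1 ` {1..k} \<union> VG2 ` {1..n - k} \<union> VZ ` {1..n} \<union> {VY}"

definition T_polys :: "nat \<Rightarrow> nat \<Rightarrow> ratf set" where
  "T_polys n k = {f \<in> polys (Gam_z_y n k).
     \<forall>\<sigma> \<tau>. \<sigma> permutes {1..k} \<longrightarrow> \<tau> permutes {1..n - k} \<longrightarrow>
       subst (\<lambda>v. X (perm_var \<sigma> \<tau> id v)) f = f}"

definition GL_polys :: "nat \<Rightarrow> nat \<Rightarrow> ratf set" where
  "GL_polys n k = {f \<in> polys (Gam_z_y n k).
     \<forall>\<sigma> \<tau> \<rho>. \<sigma> permutes {1..k} \<longrightarrow> \<tau> permutes {1..n - k} \<longrightarrow> \<rho> permutes {1..n} \<longrightarrow>
       subst (\<lambda>v. X (perm_var \<sigma> \<tau> \<rho> v)) f = f}"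

text \<open>The univariate polynomials are polynomials in \<open>u\<close>.\<close>

definition relations :: "nat \<Rightarrow> nat \<Rightarrow> ratf set" where
  "relations n k =
     range (coeff ((\<Prod>i=1..k. [:- g1 i, 1:]) * (\<Prod>i=1..n - k. [:- g2 i, 1:])
                    - (\<Prod>i=1..n. [:- zz i, 1:])))"

definition ring_on :: "ratf set \<Rightarrow> ratf ring" where
  "ring_on S = \<lparr>carrier = S, mult = (*), one = 1, zero = 0, add = (+)\<rparr>"

text \<open>Base change of a quotient algebra is the quotient of the base change of the ambient algebra
  by the ideal generated by the same elements.  So \<open>HT_L\<close> is the \<open>T\<close>-equivariant cohomology
  tensored with \<^const>\<open>L_lam_zy\<close> over the polynomials in \<open>z\<close> and \<open>y\<close>: its elements are the classes
  \<open>[f(\<lambda>,\<Gamma>,z,y)]\<close>.\<close>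

definition HT_ring :: "nat \<Rightarrow> nat \<Rightarrow> ratf ring" where
  "HT_ring n k = ring_on (prod_span (T_polys n k) (L_lam_zy n))"

definition HT_ideal :: "nat \<Rightarrow> nat \<Rightarrow> ratf set" where
  "HT_ideal n k = genideal (HT_ring n k) (relations n k)"

definition HT_L :: "nat \<Rightarrow> nat \<Rightarrow> ratf set ring" where
  "HT_L n k = HT_ring n k Quot HT_ideal n k"

definition HT_class :: "nat \<Rightarrow> nat \<Rightarrow> ratf \<Rightarrow> ratf set" where
  "HT_class n k f = HT_ideal n k +>\<^bsub>HT_ring n k\<^esub> f"

text \<open>\<open>A_alg n k\<close> is the algebra \<open>A\<^sub>k\<close>, that is, the \<open>GL\<^sub>n \<times> \<complex>\<^sup>\<times>\<close>-equivariant cohomology with \<open>y\<close>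
  inverted.\<close>

definition A_ring :: "nat \<Rightarrow> nat \<Rightarrow> ratf ring" where
  "A_ring n k = ring_on (prod_span (GL_polys n k) C_y_inv)"

definition A_ideal :: "nat \<Rightarrow> nat \<Rightarrow> ratf set" where
  "A_ideal n k = genideal (A_ring n k) (relations n k)"

definition A_alg :: "nat \<Rightarrow> nat \<Rightarrow> ratf set ring" where
  "A_alg n k = A_ring n k Quot A_ideal n k"

definition A_class :: "nat \<Rightarrow> nat \<Rightarrow> ratf \<Rightarrow> ratf set" where
  "A_class n k f = A_ideal n k +>\<^bsub>A_ring n k\<^esub> f"

text \<open>Maps of classes induced by maps of representatives are constant on each class, whence
  \<^const>\<open>the_elem\<close> of the image.  First the natural map from \<open>A\<^sub>k\<close>, then the powers of \<open>\<delta>\<close>, then the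
  restriction to the fixed point \<open>x\<^sub>J\<close>.\<close>

definition A_to_HT :: "nat \<Rightarrow> nat \<Rightarrow> ratf set \<Rightarrow> ratf set" where
  "A_to_HT n k c = the_elem (HT_class n k ` c)"

definition HT_shift :: "nat \<Rightarrow> nat \<Rightarrow> int \<Rightarrow> ratf set \<Rightarrow> ratf set" where
  "HT_shift n k m c = the_elem ((\<lambda>f. HT_class n k (shift m f)) ` c)"

definition fixed_pt :: "nat \<Rightarrow> nat set \<Rightarrow> var \<Rightarrow> ratf" where
  "fixed_pt n J v =
     (case v of
        VG1 i \<Rightarrow> zz (sorted_list_of_set J ! (i - 1))
      | VG2 i \<Rightarrow> zz (sorted_list_of_set ({1..n} - J) ! (i - 1))
      | _ \<Rightarrow> X v)"

definition restr :: "nat \<Rightarrow> nat set \<Rightarrow> ratf set \<Rightarrow> ratf" where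
  "restr n J c = the_elem (subst (fixed_pt n J) ` c)"

text \<open>The algebra \<open>A\<^sub>k \<otimes> \<complex>[\<delta>\<^sup>\<plusminus>]\<close>, as Laurent polynomials in \<open>\<delta>\<close> with coefficients in \<open>A\<^sub>k\<close>:
  the function \<open>f\<close> stands for the sum of \<open>f(m) \<delta>\<close>-to-the-\<open>m\<close>.  The operation \<open>\<odot>\<close> is the
  multiplication by scalars from \<^const>\<open>C_y_inv\<close>.\<close>

definition A_delta :: "nat \<Rightarrow> nat \<Rightarrow> (ratf, int \<Rightarrow> ratf set) module" where
  "A_delta n k = (let A = A_alg n k in
     \<lparr>carrier = {f. (\<forall>m. f m \<in> carrier A) \<and> finite {m. f m \<noteq> \<zero>\<^bsub>A\<^esub>}},
      mult = (\<lambda>f g m. finsum A (\<lambda>i. f i \<otimes>\<^bsub>A\<^esub> g (m - i)) {i. f i \<noteq> \<zero>\<^bsub>A\<^esub>}),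
      one = (\<lambda>m. if m = 0 then \<one>\<^bsub>A\<^esub> else \<zero>\<^bsub>A\<^esub>),
      zero = (\<lambda>m. \<zero>\<^bsub>A\<^esub>),
      add = (\<lambda>f g m. f m \<oplus>\<^bsub>A\<^esub> g m),
      smult = (\<lambda>c f m. A_class n k c \<otimes>\<^bsub>A\<^esub> f m)\<rparr>)"

definition A_delta_monom :: "nat \<Rightarrow> nat \<Rightarrow> ratf set \<Rightarrow> int \<Rightarrow> (int \<Rightarrow> ratf set)" where
  "A_delta_monom n k a d = (\<lambda>m. if m = d then a else \<zero>\<^bsub>A_alg n k\<^esub>)"

definition A_delta_act :: "nat \<Rightarrow> nat \<Rightarrow> (int \<Rightarrow> ratf set) \<Rightarrow> ratf set \<Rightarrow> ratf set" where
  "A_delta_act n k f x =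
     finsum (HT_L n k) (\<lambda>m. A_to_HT n k (f m) \<otimes>\<^bsub>HT_L n k\<^esub> HT_shift n k m x)
       {m. f m \<noteq> \<zero>\<^bsub>A_alg n k\<^esub>}"

definition a_coeff :: "nat \<Rightarrow> nat \<Rightarrow> ratf" where
  "a_coeff k s = winf_coeff s (\<Prod>i=1..k. (ww - g1 i) / (ww - g1 i - yy))"

definition b_coeff :: "nat \<Rightarrow> nat \<Rightarrow> ratf" where
  "b_coeff n s = winf_coeff s (\<Prod>i=1..n. (ww - zz i + yy) / (ww - zz i))"


section \<open>The module \<open>V(z\<^sub>1) \<otimes> \<dots> \<otimes> V(z\<^sub>n)\<close>\<close>

text \<open>A vector is the function of its coordinates in the basis \<open>v\<^sub>I\<close>, \<open>I \<subseteq> {1..n}\<close>, where the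
  \<open>j\<close>-th factor of \<open>v\<^sub>I\<close> is \<open>v\<^sub>1\<close> if \<open>j \<in> I\<close> and \<open>v\<^sub>2\<close> otherwise.  In the presence of the auxiliary
  factor the index set is \<open>{0..n}\<close>.\<close>

type_synonym vec = "nat set \<Rightarrow> ratf"

definition V :: "nat \<Rightarrow> vec set" where
  "V n = {\<zeta>. (\<forall>I. \<zeta> I \<in> L_lam_zy n) \<and> (\<forall>I. \<not> I \<subseteq> {1..n} \<longrightarrow> \<zeta> I = 0)}"

definition subsets_k :: "nat \<Rightarrow> nat \<Rightarrow> nat set set" where
  "subsets_k n k = {I. I \<subseteq> {1..n} \<and> card I = k}"

definition V_part :: "nat \<Rightarrow> nat \<Rightarrow> vec set" where
  "V_part n k = {\<zeta> \<in> V n. \<forall>I. I \<notin> subsets_k n k \<longrightarrow> \<zeta> I = 0}"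

definition Rmat :: "ratf \<Rightarrow> ratf \<Rightarrow> ratf \<Rightarrow> ratf list list" where
  "Rmat l z y =
    [[1, 0, 0, 0],
     [0, ((l + y) * z) / (l * (z - y)), - (((l + z) * y) / (l * (z - y))), 0],
     [0, - (((l - z) * y) / (l * (z - y))), ((l - y) * z) / (l * (z - y)), 0],
     [0, 0, 0, 1]]"

text \<open>The position, in the basis \<open>v\<^sub>1 \<otimes> v\<^sub>1, v\<^sub>1 \<otimes> v\<^sub>2, v\<^sub>2 \<otimes> v\<^sub>1, v\<^sub>2 \<otimes> v\<^sub>2\<close>, of the factors \<open>0\<close> and \<open>a\<close>
  of \<open>v\<^sub>S\<close>.\<close>

definition pos0 :: "nat \<Rightarrow> nat set \<Rightarrow> nat" where
  "pos0 a S = (if 0 \<in> S then 0 else 2) + (if a \<in> S then 0 else 1)"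

definition h_sum :: "nat set \<Rightarrow> nat set \<Rightarrow> int" where
  "h_sum A J = (\<Sum>j\<in>A. if j \<in> J then 1 else - 1)"

text \<open>The operator \<open>R\<close> in the factors \<open>0\<close> and \<open>a\<close>, with first argument \<open>\<lambda>\<close> minus \<open>y\<close> times the sum
  of \<open>h\<close> over the factors \<open>a + 1, \<dots>, n\<close>, and second argument \<open>w - z\<^sub>a\<close>.\<close>

definition R0 :: "nat \<Rightarrow> ratf \<Rightarrow> nat \<Rightarrow> vec \<Rightarrow> vec" where
  "R0 n w a \<zeta> J =
     (\<Sum>S\<in>Pow {0, a}.
        Rmat (lam - yy * of_int (h_sum {a + 1..n} J)) (w - zz a) yy ! pos0 a J ! pos0 a S
          * \<zeta> ((J - {0, a}) \<union> S))"

definition L_full :: "nat \<Rightarrow> ratf \<Rightarrow> vec \<Rightarrow> vec" where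
  "L_full n w \<zeta> = foldr (R0 n w) [1..<Suc n] \<zeta>"

definition aux_tensor :: "nat \<Rightarrow> vec \<Rightarrow> vec" where
  "aux_tensor j u = (\<lambda>J. if (0 \<in> J) = (j = 1) then u (J - {0}) else 0)"

text \<open>\<open>L_op n i j w\<close> is \<open>L\<^bsub>ij\<^esub>(\<lambda>,w,y)\<close>, for \<open>i\<close> and \<open>j\<close> in \<open>{1,2}\<close>.\<close>

definition L_op :: "nat \<Rightarrow> nat \<Rightarrow> nat \<Rightarrow> ratf \<Rightarrow> vec \<Rightarrow> vec" where
  "L_op n i j w u = (\<lambda>I. if I \<subseteq> {1..n}
     then L_full n w (aux_tensor j u) (if i = 1 then insert 0 I else I) else 0)"

definition vshift :: "int \<Rightarrow> vec \<Rightarrow> vec" where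
  "vshift m \<zeta> = (\<lambda>I. shift m (\<zeta> I))"

definition Lt :: "nat \<Rightarrow> nat \<Rightarrow> nat \<Rightarrow> ratf \<Rightarrow> vec \<Rightarrow> vec" where
  "Lt n i j w \<zeta> = L_op n i j w (vshift (if j = 1 then - 1 else 1) \<zeta>)"

definition Det :: "nat \<Rightarrow> ratf \<Rightarrow> vec \<Rightarrow> vec" where
  "Det n w \<zeta> = (\<lambda>I. lam / (lam - yy * of_int (h_sum {1..n} I))
      * (Lt n 2 2 (w + yy) (Lt n 1 1 w \<zeta>) I - Lt n 1 2 (w + yy) (Lt n 2 1 w \<zeta>) I))"

definition L22_coeff :: "nat \<Rightarrow> nat \<Rightarrow> vec \<Rightarrow> vec" where
  "L22_coeff n s \<zeta> = (\<lambda>I. winf_coeff s (Lt n 2 2 ww \<zeta> I))"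

definition Det_coeff :: "nat \<Rightarrow> nat \<Rightarrow> vec \<Rightarrow> vec" where
  "Det_coeff n s \<zeta> = (\<lambda>I. winf_coeff s (Det n ww \<zeta> I))"

text \<open>Operators on a set of vectors are functions that are \<^const>\<open>undefined\<close> outside that set.\<close>

inductive_set GZ :: "nat \<Rightarrow> (vec \<Rightarrow> vec) set" for n :: nat where
  scalar: "c \<in> C_y_inv \<Longrightarrow> (\<lambda>\<zeta>\<in>V n. \<lambda>I. c * \<zeta> I) \<in> GZ n"
| L22: "restrict (L22_coeff n s) (V n) \<in> GZ n"
| L22_inv: "restrict (inv_into (V n) (L22_coeff n 0)) (V n) \<in> GZ n"
| Det: "restrict (Det_coeff n s) (V n) \<in> GZ n"
| add: "f \<in> GZ n \<Longrightarrow> g \<in> GZ n \<Longrightarrow> (\<lambda>\<zeta>\<in>V n. \<lambda>I. f \<zeta> I + g \<zeta> I) \<in> GZ n"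
| comp: "f \<in> GZ n \<Longrightarrow> g \<in> GZ n \<Longrightarrow> compose (V n) f g \<in> GZ n"

definition GZ_part :: "nat \<Rightarrow> nat \<Rightarrow> (ratf, vec \<Rightarrow> vec) module" where
  "GZ_part n k = (let U = V_part n k in
     \<lparr>carrier = (\<lambda>b. restrict b U) ` GZ n,
      mult = (\<lambda>f g. compose U f g),
      one = (\<lambda>\<zeta>\<in>U. \<zeta>),
      zero = (\<lambda>\<zeta>\<in>U. \<lambda>I. 0),
      add = (\<lambda>f g. \<lambda>\<zeta>\<in>U. \<lambda>I. f \<zeta> I + g \<zeta> I),
      smult = (\<lambda>c f. \<lambda>\<zeta>\<in>U. \<lambda>I. c * f \<zeta> I)\<rparr>)"


section \<open>Weight functions and the stable envelope\<close>

definition wt :: "nat \<Rightarrow> nat \<Rightarrow> nat set \<Rightarrow> int" where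
  "wt n i I = int (card {j \<in> I. i < j}) - int (card {j \<in> {1..n} - I. i < j})"

text \<open>Below \<open>t\<close> is the tuple \<open>t\<^sub>1, \<dots>, t\<^sub>k\<close>, where \<open>k\<close> is the cardinality of \<open>I\<close>; it is an
  argument rather than a tuple of variables, so that no substitution is needed.\<close>

definition l_fun :: "nat \<Rightarrow> nat set \<Rightarrow> (nat \<Rightarrow> ratf) \<Rightarrow> nat \<Rightarrow> nat \<Rightarrow> ratf" where
  "l_fun n I t r a = (let i = sorted_list_of_set I ! (r - 1) in
     if a < i then t r - zz a + yy
     else if a = i then lam + t r - zz a - of_int (wt n i I) * yy
     else t r - zz a)"

definition W_term :: "nat \<Rightarrow> nat set \<Rightarrow> (nat \<Rightarrow> ratf) \<Rightarrow> ratf" where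
  "W_term n I t =
     (\<Prod>r=1..card I. \<Prod>a=1..n. l_fun n I t r a)
     * (\<Prod>(a, b)\<in>{(a, b). 1 \<le> a \<and> a < b \<and> b \<le> card I}. (t a - t b + yy) / (t a - t b))"

definition W_fun :: "nat \<Rightarrow> nat set \<Rightarrow> (nat \<Rightarrow> ratf) \<Rightarrow> ratf" where
  "W_fun n I t =
     yy ^ card I * (\<Sum>\<pi> | \<pi> permutes {1..card I}. W_term n I (\<lambda>i. t (\<pi> i)))"

definition e_fun :: "nat \<Rightarrow> (nat \<Rightarrow> ratf) \<Rightarrow> ratf" where
  "e_fun k t = (\<Prod>a=1..k. \<Prod>b=1..k. t a - t b + yy)"

definition C_id :: "nat \<Rightarrow> int \<Rightarrow> nat set \<Rightarrow> ratf" where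
  "C_id n r I = (\<Prod>i\<in>I. lam - of_int (wt n i I + r) * yy)"

definition W_tilde :: "nat \<Rightarrow> nat set \<Rightarrow> (nat \<Rightarrow> ratf) \<Rightarrow> ratf" where
  "W_tilde n I t = W_fun n I t / (C_id n 0 I * C_id n 1 I * e_fun (card I) t)"

definition kappa :: "nat \<Rightarrow> nat \<Rightarrow> nat set \<Rightarrow> ratf set" where
  "kappa n k I =
     (THE c. c \<in> carrier (HT_L n k) \<and>
        (\<forall>J\<in>subsets_k n k. restr n J c = W_tilde n I (\<lambda>i. zz (sorted_list_of_set J ! (i - 1)))))"

definition Stab :: "nat \<Rightarrow> nat \<Rightarrow> vec \<Rightarrow> ratf set" where
  "Stab n k \<zeta> =
     finsum (HT_L n k) (\<lambda>I. HT_class n k (\<zeta> I) \<otimes>\<^bsub>HT_L n k\<^esub> kappa n k I) (subsets_k n k)"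


section \<open>The assignment \<open>\<alpha>\<close>\<close>

text \<open>Unital homomorphisms of algebras over \<^const>\<open>C_y_inv\<close> with the prescribed values on the
  generators.\<close>

definition is_alpha :: "nat \<Rightarrow> nat \<Rightarrow> ((vec \<Rightarrow> vec) \<Rightarrow> (int \<Rightarrow> ratf set)) \<Rightarrow> bool" where
  "is_alpha n k \<alpha> \<longleftrightarrow>
     \<alpha> \<in> ring_hom (GZ_part n k) (A_delta n k) \<and>
     (\<forall>c\<in>C_y_inv. \<forall>b\<in>carrier (GZ_part n k).
        \<alpha> (c \<odot>\<^bsub>GZ_part n k\<^esub> b) = c \<odot>\<^bsub>A_delta n k\<^esub> \<alpha> b) \<and>
     (\<forall>s. \<alpha> (restrict (L22_coeff n s) (V_part n k)) = A_delta_monom n k (A_class n k (a_coeff k s)) 1) \<and>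
     (\<forall>s. \<alpha> (restrict (Det_coeff n s) (V_part n k)) = A_delta_monom n k (A_class n k (b_coeff n s)) 0)"

end

theory Submission
  imports Defs
begin

text \<open>
  Write \<open>\<langle>\<zeta>\<rangle>\<^sub>J\<close> for the restriction of \<open>Stab \<zeta>\<close> to the fixed point \<open>x\<^sub>J\<close>.  Splitting off the last tensor
  factor gives recursions in \<open>n\<close> both for the operators \<open>L\<^bsub>ij\<^esub>\<close> and for the values of the weight
  functions at the fixed points, and a simultaneous induction on \<open>n\<close> for \<open>L\<^bsub>22\<^esub>\<close> and \<open>L\<^bsub>21\<^esub>\<close> shows that
  \<open>\<langle>L\<^bsub>22\<^esub> \<zeta>\<rangle>\<^sub>J\<close> is \<open>\<Prod>\<^bsub>j\<in>J\<^esub> (w - z\<^sub>j) / (w - z\<^sub>j - y)\<close> times \<open>\<delta> \<langle>\<zeta>\<rangle>\<^sub>J\<close>.  A similar induction shows that the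
  quantum determinant is the scalar \<open>\<Prod>\<^sub>i (w - z\<^sub>i + y) / (w - z\<^sub>i)\<close>.  By triangularity the \<open>\<langle>\<zeta>\<rangle>\<^sub>J\<close> are
  coordinates on the module, and so are the restrictions to the fixed points on the cohomology
  (by Lagrange interpolation, and since a class that vanishes at all fixed points is a combination of
  the relations); hence \<open>Stab\<close> is bijective.

  In these coordinates \<open>\<B>\<^sub>k\<close> and \<open>A\<^sub>k \<otimes> \<complex>[\<delta>\<^sup>\<plusminus>]\<close> are algebras of operators on functions of \<open>\<lambda>\<close>.
  The second acts faithfully even at one fixed point: the powers of \<open>\<delta>\<close> are linearly independent
  automorphisms, and an element of \<open>A\<^sub>k\<close> is symmetric in \<open>z\<close>, so that its value at one fixed point
  determines the others.  The generators of \<open>\<B>\<^sub>k\<close> act as their images under \<open>\<alpha>\<close>, and these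
  images generate, because \<open>A\<^sub>k\<close> is generated by power sums.
\<close>

subsection \<open>The \<open>L\<close>-operators by recursion on the number of factors\<close>

text \<open>The recursion for L_22 does not close: the entry \<open>rB\<close> brings in L_21, whose
  value at J is a combination of coordinates at the sets J - {m}, and the step for L_21 produces
  terms with two points removed. These cancel only in pairs m, m', so the two formulas have to be
  proved together. Splitting off the factor n + 1 moves the dynamical parameter by y up or down
  according to whether n + 1 is in I, both in the operators and in the weight functions; the
  formulas are therefore proved for a parameter l with l + m y nonzero for all integers m, a
  condition that survives these moves.

  The algebra B_k is given by generators without a list of relations, so \<open>alpha\<close> cannot
  be defined on generators. It is read off from the action: \<open>alpha b\<close> is the unique
  Laurent polynomial in the shift that acts on fixed point values as b does, and uniqueness makes it
  a homomorphism.

  The inverse of y is what lets the a_s generate: their series only gives differences between the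
  power sums of the x_i + y and of the x_i, and solving for the power sums means dividing by
  y.\<close>

definition rA :: "'a::field \<Rightarrow> 'a \<Rightarrow> 'a \<Rightarrow> 'a" where "rA y l x = ((l + y) * x) / (l * (x - y))"
text \<open>The four functions are the entries of the middle 2x2 block of the R-matrix,
  \<open>rA\<close> and \<open>rB\<close> in its upper row, with spectral argument \<open>x\<close>
  and with \<open>l\<close> in place of lambda.\<close>

definition rB :: "'a::field \<Rightarrow> 'a \<Rightarrow> 'a \<Rightarrow> 'a" where "rB y l x = - (((l + x) * y) / (l * (x - y)))"
definition rC :: "'a::field \<Rightarrow> 'a \<Rightarrow> 'a \<Rightarrow> 'a" where "rC y l x = - (((l - x) * y) / (l * (x - y)))"
definition rD :: "'a::field \<Rightarrow> 'a \<Rightarrow> 'a \<Rightarrow> 'a" where "rD y l x = ((l - y) * x) / (l * (x - y))"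

text \<open>The entries \<open>L\<^bsub>ij\<^esub>\<close> applied to \<open>u\<close>, with the last tensor factor split off; the index \<open>1\<close> is encoded
  as \<^const>\<open>True\<close> and the index \<open>2\<close> as \<^const>\<open>False\<close>.  The dynamical parameter \<open>l\<close> is a free argument since
  the induction changes it.\<close>

primrec laxop :: "(nat \<Rightarrow> 'a::field) \<Rightarrow> 'a \<Rightarrow> 'a \<Rightarrow> nat \<Rightarrow> 'a \<Rightarrow> bool \<Rightarrow> bool \<Rightarrow> (nat set \<Rightarrow> 'a) \<Rightarrow> nat set \<Rightarrow> 'a" where
  "laxop z y w 0 l i j u I = (if i = j then u I else 0)"
| "laxop z y w (Suc n) l i j u I =
     (if j then
       (if Suc n \<in> I then laxop z y w n (l - y) i True (\<lambda>K. u (insert (Suc n) K)) (I - {Suc n})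
           + rC y l (w - z (Suc n)) * laxop z y w n (l - y) i False u (I - {Suc n})
        else rA y l (w - z (Suc n)) * laxop z y w n (l + y) i True u I)
     else
       (if Suc n \<in> I then rD y l (w - z (Suc n)) * laxop z y w n (l - y) i False (\<lambda>K. u (insert (Suc n) K)) (I - {Suc n})
        else rB y l (w - z (Suc n)) * laxop z y w n (l + y) i True (\<lambda>K. u (insert (Suc n) K)) I
           + laxop z y w n (l + y) i False u I))"

lemma laxop_linear:
  "laxop z y w n l i j (\<lambda>K. a * u K + b * v K) I = a * laxop z y w n l i j u I + b * laxop z y w n l i j v I"
proof (induction n arbitrary: l i j u v I)
  case (Suc n)
  show ?case
    unfolding laxop.simps Let_def Suc.IH
    by (simp add: ring_distribs mult_ac)
qed simp

lemma laxop_add: "laxop z y w n l i j (\<lambda>K. u K + v K) I = laxop z y w n l i j u I + laxop z y w n l i j v I"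
  using laxop_linear[of z y w n l i j 1 u 1 v I] by simp

lemma laxop_scale: "laxop z y w n l i j (\<lambda>K. a * u K) I = a * laxop z y w n l i j u I"
  using laxop_linear[of z y w n l i j a u 0 u I] by simp

lemma laxop_cong:
  assumes "\<And>K. K \<subseteq> {1..n} \<Longrightarrow> u K = v K" "I \<subseteq> {1..n}"
  shows "laxop z y w n l i j u I = laxop z y w n l i j v I"
  using assms
proof (induction n arbitrary: l i j u v I)
  case (Suc n)
  have sub: "I - {Suc n} \<subseteq> {1..n}" using Suc.prems(2) by (fastforce simp: le_Suc_eq)
  have 1: "laxop z y w n l i j u (I - {Suc n}) = laxop z y w n l i j v (I - {Suc n})" for l i j
    by (rule Suc.IH[OF _ sub]) (rule Suc.prems(1), auto simp: subset_iff)
  have 2: "laxop z y w n l i j (\<lambda>K. u (insert (Suc n) K)) (I - {Suc n})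
      = laxop z y w n l i j (\<lambda>K. v (insert (Suc n) K)) (I - {Suc n})" for l i j
    by (rule Suc.IH[OF _ sub]) (rule Suc.prems(1), auto simp: subset_iff)
  have 3: "Suc n \<notin> I \<Longrightarrow> I - {Suc n} = I" by auto
  show ?case using 1 2 3 by (cases "Suc n \<in> I") simp_all
qed simp

section \<open>Quantum minors and the quantum determinant\<close>

text \<open>All four column patterns are needed for the induction.\<close>

definition qminor :: "(nat \<Rightarrow> 'a::field) \<Rightarrow> 'a \<Rightarrow> 'a \<Rightarrow> nat \<Rightarrow> 'a \<Rightarrow> bool \<Rightarrow> bool \<Rightarrow> (nat set \<Rightarrow> 'a) \<Rightarrow> nat set \<Rightarrow> 'a" where
  "qminor z y w n l a b u I = (let l' = (if a then l - y else l + y) in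
     laxop z y (w + y) n l False a (laxop z y w n l' True b u) I
     - laxop z y (w + y) n l True a (laxop z y w n l' False b u) I)"

text \<open>Linearity of the outer operator lets the recursion for the inner one be applied under
  it. As a function of K, \<open>u (insert (Suc n) K)\<close> collects the components of
  \<open>u\<close> with v_1 in the last factor.\<close>

lemma slice1:
  assumes "I \<subseteq> {1..n}"
  shows "laxop z y w' n l' i j (\<lambda>K. laxop z y w (Suc n) l k True u (insert (Suc n) K)) I =
      laxop z y w' n l' i j (laxop z y w n (l - y) k True (\<lambda>K. u (insert (Suc n) K))) I
      + rC y l (w - z (Suc n)) * laxop z y w' n l' i j (laxop z y w n (l - y) k False u) I"
    and "laxop z y w' n l' i j (\<lambda>K. laxop z y w (Suc n) l k False u (insert (Suc n) K)) I =
      rD y l (w - z (Suc n)) *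
      laxop z y w' n l' i j (laxop z y w n (l - y) k False (\<lambda>K. u (insert (Suc n) K))) I"
    and "laxop z y w' n l' i j (laxop z y w (Suc n) l k True u) I =
      rA y l (w - z (Suc n)) *
      laxop z y w' n l' i j (laxop z y w n (l + y) k True u) I"
    and "laxop z y w' n l' i j (laxop z y w (Suc n) l k False u) I =
      rB y l (w - z (Suc n)) * laxop z y w' n l' i j (laxop z y w n (l + y) k True (\<lambda>K. u (insert (Suc n) K))) I
     + laxop z y w' n l' i j (laxop z y w n (l + y) k False u) I"
proof -
  have nin: "Suc n \<notin> K \<and> insert (Suc n) K - {Suc n} = K \<and> K - {Suc n} = K" if "K \<subseteq> {1..n}" for K
    using that by auto
  show "laxop z y w' n l' i j (\<lambda>K. laxop z y w (Suc n) l k True u (insert (Suc n) K)) I =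
      laxop z y w' n l' i j (laxop z y w n (l - y) k True (\<lambda>K. u (insert (Suc n) K))) I
      + rC y l (w - z (Suc n)) * laxop z y w' n l' i j (laxop z y w n (l - y) k False u) I"
    unfolding laxop_scale[symmetric] laxop_add[symmetric]
    by (rule laxop_cong[OF _ assms]) (simp add: nin laxop_scale)
  show "laxop z y w' n l' i j (\<lambda>K. laxop z y w (Suc n) l k False u (insert (Suc n) K)) I =
      rD y l (w - z (Suc n)) *
      laxop z y w' n l' i j (laxop z y w n (l - y) k False (\<lambda>K. u (insert (Suc n) K))) I"
    unfolding laxop_scale[symmetric] laxop_add[symmetric]
    by (rule laxop_cong[OF _ assms]) (simp add: nin laxop_scale)
  show "laxop z y w' n l' i j (laxop z y w (Suc n) l k True u) I =
      rA y l (w - z (Suc n)) *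
      laxop z y w' n l' i j (laxop z y w n (l + y) k True u) I"
    unfolding laxop_scale[symmetric] laxop_add[symmetric]
    by (rule laxop_cong[OF _ assms]) (simp add: nin laxop_scale)
  show "laxop z y w' n l' i j (laxop z y w (Suc n) l k False u) I =
      rB y l (w - z (Suc n)) * laxop z y w' n l' i j (laxop z y w n (l + y) k True (\<lambda>K. u (insert (Suc n) K))) I
     + laxop z y w' n l' i j (laxop z y w n (l + y) k False u) I"
    unfolding laxop_scale[symmetric] laxop_add[symmetric]
    by (rule laxop_cong[OF _ assms]) (simp add: nin laxop_scale)
qed

text \<open>The recursion for \<open>laxop\<close> acts on the column index and leaves the row index
  alone, so taking the difference over the two rows commutes with it and the products regroup into
  minors of the first n factors. Entries of the outer operator have the argument x + y, because its
  spectral parameter is w + y, and those of the inner one x.\<close>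

lemma qminor_Suc_in:
  fixes z y w n
  defines "N \<equiv> Suc n"
  defines "x \<equiv> w - z N"
  assumes "I \<subseteq> {1..n}"
  shows "qminor z y w N l a b u (insert N I) = (let u1 = (\<lambda>K. u (insert N K)) in
    if a then
      if b then qminor z y w n (l - y) True True u1 I
          + rC y (l - y) x * qminor z y w n (l - y) True False u I
          + rC y l (x + y) * rA y (l - y) x * qminor z y w n (l - y) False True u I
      else rD y (l - y) x * qminor z y w n (l - y) True False u1 I
          + rC y l (x + y) * rB y (l - y) x * qminor z y w n (l - y) False True u1 I
          + rC y l (x + y) * qminor z y w n (l - y) False False u I
    else
      if b then rD y l (x + y) * (qminor z y w n (l - y) False True u1 I
          + rC y (l + y) x * qminor z y w n (l - y) False False u I)
      else rD y l (x + y) * rD y (l + y) x * qminor z y w n (l - y) False False u1 I)"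
proof -
  have *: "insert N I - {N} = I" using assms(3) by (auto simp: N_def)
  have xy: "w + y - z (Suc n) = w - z (Suc n) + y" by simp
  note lax_I = laxop.simps(2)[where I = "insert (Suc n) I"]
  show ?thesis
    using *
    by (cases a; cases b)
      (simp_all only: N_def x_def qminor_def Let_def lax_I insertI1 if_True if_False slice1[OF assms(3)] xy
          diff_add_cancel add_diff_cancel simp_thms,
       simp_all only: ring_distribs minus_diff_eq diff_conv_add_uminus minus_add_distrib minus_mult_right ac_simps)
qed

lemma qminor_Suc_notin:
  fixes z y w n
  defines "N \<equiv> Suc n"
  defines "x \<equiv> w - z N"
  assumes "I \<subseteq> {1..n}"
  shows "qminor z y w N l a b u I = (let u1 = (\<lambda>K. u (insert N K)) in
    if a then
      if b then rA y l (x + y) * rA y (l - y) x * qminor z y w n (l + y) True True u I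
      else rA y l (x + y) * (rB y (l - y) x * qminor z y w n (l + y) True True u1 I
          + qminor z y w n (l + y) True False u I)
    else
      if b then rB y l (x + y) * qminor z y w n (l + y) True True u1 I
          + rB y l (x + y) * rC y (l + y) x * qminor z y w n (l + y) True False u I
          + rA y (l + y) x * qminor z y w n (l + y) False True u I
      else rB y l (x + y) * rD y (l + y) x * qminor z y w n (l + y) True False u1 I
          + rB y (l + y) x * qminor z y w n (l + y) False True u1 I
          + qminor z y w n (l + y) False False u I)"
proof -
  have *: "N \<notin> I" using assms(3) by (auto simp: N_def)
  have xy: "w + y - z (Suc n) = w - z (Suc n) + y" by simp
  note lax_I = laxop.simps(2)[where I = "I"]
  show ?thesis
    using *
    by (cases a; cases b)
      (simp_all only: N_def x_def qminor_def Let_def lax_I if_True if_False slice1[OF assms(3)] xy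
          diff_add_cancel add_diff_cancel simp_thms,
       simp_all only: ring_distribs minus_diff_eq diff_conv_add_uminus minus_add_distrib minus_mult_right ac_simps)
qed

text \<open>Once minors with equal columns are known to vanish and those with exchanged columns to
  be opposite, the recursion reduces to rational identities in \<open>l\<close>, \<open>x\<close>,
  \<open>y\<close> and the weight \<open>h\<close> of the first n factors. The factor
  \<open>(l - y * h) / l\<close> is the one that the prefactor in \<open>Det\<close>
  removes.\<close>

lemma qminor_eq:
  fixes y :: "'a::field"
  assumes "\<And>a. w \<noteq> z a" "\<And>a. w - z a \<noteq> y"
    and "\<And>m::int. l + of_int m * y \<noteq> 0" and "I \<subseteq> {1..n}"
  shows "qminor z y w n l a b u I =
     (if a = b then 0 else (if a then - 1 else 1) * ((l - y * of_int (h_sum {1..n} I)) / l)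
        * (\<Prod>a=1..n. (w - z a + y) / (w - z a)) * u I)"
  using assms(3,4)
proof (induction n arbitrary: l a b u I)
  case 0
  have "l \<noteq> 0" using 0(1)[of 0] by simp
  then show ?case using 0 by (auto simp: qminor_def Let_def h_sum_def)
next
  case (Suc n)
  let ?N = "Suc n" and ?x = "w - z (Suc n)"
  let ?P = "\<Prod>a=1..n. (w - z a + y) / (w - z a)"
  have l: "l \<noteq> 0" "l - y \<noteq> 0" "l + y \<noteq> 0"
    using Suc.prems(1)[of 0] Suc.prems(1)[of "-1"] Suc.prems(1)[of 1] by auto
  have x: "?x \<noteq> 0" "?x - y \<noteq> 0" using assms(1,2)[of ?N] by auto
  have gp: "l + y + of_int m * y \<noteq> 0" "l - y + of_int m * y \<noteq> 0" for m :: int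
    using Suc.prems(1)[of "m + 1"] Suc.prems(1)[of "m - 1"] by (auto simp: algebra_simps)
  define I' where "I' = I - {?N}"
  have I': "I' \<subseteq> {1..n}" using Suc.prems(2) unfolding I'_def by (fastforce simp: le_Suc_eq)
  note IHp = Suc.IH[of "l + y", OF gp(1) I']
  note IHm = Suc.IH[of "l - y", OF gp(2) I']
  have hI: "h_sum {1..?N} I = h_sum {1..n} I' + (if ?N \<in> I then 1 else - 1)"
  proof -
    have "h_sum {1..n} I = h_sum {1..n} I'" unfolding h_sum_def I'_def by (rule sum.cong) auto
    then show ?thesis unfolding h_sum_def by (simp add: atLeastAtMostSuc_conv)
  qed
  have PS: "(\<Prod>a=1..?N. (w - z a + y) / (w - z a)) = (?x + y) / ?x * ?P"
    by (simp add: atLeastAtMostSuc_conv)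
  define P where "P = ?P"
  define x where "x = ?x"
  define h :: 'a where "h = of_int (h_sum {1..n} I')"
  show ?case
  proof (cases "?N \<in> I")
    case True
    then have II: "insert ?N I' = I" by (auto simp: I'_def)
    have hh: "of_int (h_sum {1..?N} I) = h + 1" unfolding hI h_def using True by simp
    show ?thesis
      apply (subst II[symmetric], subst qminor_Suc_in[OF I'])
      apply (subst hh)
      unfolding IHm PS Let_def II h_def[symmetric]
      using l x unfolding P_def[symmetric] x_def[symmetric]
      by (cases a; cases b; simp add: rA_def rB_def rC_def rD_def divide_simps; (simp add: algebra_simps)?)
  next
    case False
    then have II: "I' = I" by (auto simp: I'_def)
    have hh: "of_int (h_sum {1..?N} I) = h - 1" unfolding hI h_def using False by simp
    show ?thesis
      apply (subst qminor_Suc_notin[OF I'[unfolded II]])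
      apply (subst hh)
      unfolding IHp[unfolded II] PS Let_def h_def[symmetric, unfolded II]
      using l x unfolding P_def[symmetric] x_def[symmetric]
      by (cases a; cases b; simp add: rA_def rB_def rC_def rD_def divide_simps; (simp add: algebra_simps)?)
  qed
qed

subsection \<open>The action of \<open>L\<^bsub>22\<^esub>\<close> in fixed point coordinates\<close>

text \<open>The recursion for the value of the weight function of \<open>I\<close> at the fixed point of \<open>J\<close>: if
  \<open>n + 1 \<in> I\<close>, then \<open>m\<close> is the index such that \<open>z\<^sub>m\<close> is substituted for the last of the variables \<open>t\<close>.\<close>

primrec wG :: "(nat \<Rightarrow> 'a::field) \<Rightarrow> 'a \<Rightarrow> nat \<Rightarrow> 'a \<Rightarrow> nat set \<Rightarrow> nat set \<Rightarrow> 'a" where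
  "wG z y 0 l I J = (if J = {} then 1 else 0)"
| "wG z y (Suc n) l I J =
    (if Suc n \<in> I then
       \<Sum>m\<in>J. (l + z m - z (Suc n)) / (l * (l - y)) * (\<Prod>a=1..n. z m - z a + y)
          * (\<Prod>b\<in>J - {m}. (z b - z (Suc n)) / ((z b - z m) * (z m - z b + y)))
          * wG z y n (l - y) (I - {Suc n}) (J - {m})
     else (\<Prod>j\<in>J. z j - z (Suc n)) * wG z y n (l + y) I J)"

text \<open>The value at the fixed point of J of the stable envelope of \<open>u\<close>, for a
  general parameter \<open>l\<close>. The sum may run over all subsets because \<open>wG\<close>
  vanishes unless K and J have the same size.\<close>

definition wS :: "(nat \<Rightarrow> 'a::field) \<Rightarrow> 'a \<Rightarrow> nat \<Rightarrow> 'a \<Rightarrow> (nat set \<Rightarrow> 'a) \<Rightarrow> nat set \<Rightarrow> 'a" where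
  "wS z y n l u J = (\<Sum>K\<in>Pow {1..n}. u K * wG z y n l K J)"

definition top_coeff :: "(nat \<Rightarrow> 'a::field) \<Rightarrow> 'a \<Rightarrow> nat \<Rightarrow> 'a \<Rightarrow> nat set \<Rightarrow> nat \<Rightarrow> 'a" where
  "top_coeff z y n l J m = (l + z m - z (Suc n)) / (l * (l - y)) * (\<Prod>a=1..n. z m - z a + y)
          * (\<Prod>b\<in>J - {m}. (z b - z (Suc n)) / ((z b - z m) * (z m - z b + y)))"

definition eigval22 :: "(nat \<Rightarrow> 'a::field) \<Rightarrow> 'a \<Rightarrow> 'a \<Rightarrow> nat set \<Rightarrow> 'a" where
  "eigval22 z y w J = (\<Prod>j\<in>J. (w - z j) / (w - z j - y))"

text \<open>The matrix element of L_21 from the fixed point of J - {m} to that of J: L_21 moves a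
  vector v_1 from the auxiliary factor into the module and so raises the size by one.\<close>

definition off_coeff :: "(nat \<Rightarrow> 'a::field) \<Rightarrow> 'a \<Rightarrow> 'a \<Rightarrow> nat \<Rightarrow> 'a \<Rightarrow> nat set \<Rightarrow> nat \<Rightarrow> 'a" where
  "off_coeff z y w n l J m = - (eigval22 z y w (J - {m}) * ((l - w + z m) / (l * (l - y) * (w - z m - y)))
       * (\<Prod>a=1..n. z m - z a + y) * (\<Prod>b\<in>J - {m}. 1 / ((z b - z m) * (z m - z b + y))))"

lemma wS_linear: "wS z y n l (\<lambda>K. a * u K + b * v K) J = a * wS z y n l u J + b * wS z y n l v J"
  by (simp add: wS_def sum.distrib sum_distrib_left algebra_simps)

lemma wS_add: "wS z y n l (\<lambda>K. u K + v K) J = wS z y n l u J + wS z y n l v J"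
  using wS_linear[of z y n l 1 u 1 v J] by simp

lemma wS_scale: "wS z y n l (\<lambda>K. a * u K) J = a * wS z y n l u J"
  using wS_linear[of z y n l a u 0 u J] by simp

lemma wS_cong: "(\<And>K. K \<subseteq> {1..n} \<Longrightarrow> u K = v K) \<Longrightarrow> wS z y n l u J = wS z y n l v J"
  unfolding wS_def by (rule sum.cong) auto

lemma sum_Pow_Suc: "(\<Sum>K\<in>Pow {1..Suc n}. f K) = (\<Sum>K\<in>Pow {1..n}. f K) + (\<Sum>K\<in>Pow {1..n}. f (insert (Suc n) K))"
proof -
  have "Pow {1..Suc n} = Pow {1..n} \<union> insert (Suc n) ` Pow {1..n}"
    by (simp add: atLeastAtMostSuc_conv Pow_insert)
  moreover have "inj_on (insert (Suc n)) (Pow {1..n})"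
  proof (rule inj_onI)
    fix A B assume "A \<in> Pow {1..n}" "B \<in> Pow {1..n}" and e: "insert (Suc n) A = insert (Suc n) B"
    then have "Suc n \<notin> A" "Suc n \<notin> B" by auto
    with e show "A = B" by (metis Diff_insert_absorb)
  qed
  ultimately show ?thesis
    by (subst \<open>Pow {1..Suc n} = _\<close>, subst sum.union_disjoint) (auto simp: sum.reindex)
qed

text \<open>The two terms come from the sets without and with n + 1. If n + 1 lies in J, the product
  in the first term is zero, and so is \<open>top_coeff\<close> for every m other than n + 1; in
  this sense the recursion is block triangular.\<close>

lemma wS_Suc: "wS z y (Suc n) l u J = (\<Prod>j\<in>J. z j - z (Suc n)) * wS z y n (l + y) u J
   + (\<Sum>m\<in>J. top_coeff z y n l J m * wS z y n (l - y) (\<lambda>K. u (insert (Suc n) K)) (J - {m}))"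
proof -
  have nin: "Suc n \<notin> K \<and> insert (Suc n) K - {Suc n} = K" if "K \<in> Pow {1..n}" for K
    using that by auto
  have 1: "(\<Sum>K\<in>Pow {1..n}. u K * wG z y (Suc n) l K J) = (\<Prod>j\<in>J. z j - z (Suc n)) * wS z y n (l + y) u J"
    unfolding wS_def sum_distrib_left by (rule sum.cong) (simp_all add: nin)
  have 2: "(\<Sum>K\<in>Pow {1..n}. u (insert (Suc n) K) * wG z y (Suc n) l (insert (Suc n) K) J)
    = (\<Sum>K\<in>Pow {1..n}. \<Sum>m\<in>J. top_coeff z y n l J m * (u (insert (Suc n) K) * wG z y n (l - y) K (J - {m})))"
    by (rule sum.cong) (simp_all add: nin top_coeff_def sum_distrib_left mult_ac)
  show ?thesis
    unfolding 1[symmetric]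
    apply (subst wS_def, subst sum_Pow_Suc, subst 2, subst sum.swap)
    by (simp add: wS_def sum_distrib_left)
qed

lemma wS_slice:
  shows "wS z y n l' (\<lambda>K. laxop z y w (Suc n) l k True u (insert (Suc n) K)) J =
      wS z y n l' (laxop z y w n (l - y) k True (\<lambda>K. u (insert (Suc n) K))) J
      + rC y l (w - z (Suc n)) * wS z y n l' (laxop z y w n (l - y) k False u) J" (is ?g1)
    and "wS z y n l' (\<lambda>K. laxop z y w (Suc n) l k False u (insert (Suc n) K)) J =
      rD y l (w - z (Suc n)) * wS z y n l' (laxop z y w n (l - y) k False (\<lambda>K. u (insert (Suc n) K))) J" (is ?g2)
    and "wS z y n l' (laxop z y w (Suc n) l k True u) J =
      rA y l (w - z (Suc n)) * wS z y n l' (laxop z y w n (l + y) k True u) J" (is ?g3)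
    and "wS z y n l' (laxop z y w (Suc n) l k False u) J =
      rB y l (w - z (Suc n)) * wS z y n l' (laxop z y w n (l + y) k True (\<lambda>K. u (insert (Suc n) K))) J
     + wS z y n l' (laxop z y w n (l + y) k False u) J" (is ?g4)
proof -
  have nin: "Suc n \<notin> K \<and> insert (Suc n) K - {Suc n} = K \<and> K - {Suc n} = K" if "K \<subseteq> {1..n}" for K
    using that by auto
  show ?g1 ?g2 ?g3 ?g4
    unfolding wS_scale[symmetric] wS_add[symmetric]
    by (rule wS_cong, simp add: nin)+
qed

text \<open>\<open>zy\<close> covers a = b and so contains that y is nonzero; \<open>two\<close> is
  what makes a double sum with antisymmetric terms vanish.\<close>

locale generic_points =
  fixes z :: "nat \<Rightarrow> 'a::field" and y w :: 'a
  assumes two: "(2::'a) \<noteq> 0"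
    and z_inj: "a \<noteq> b \<Longrightarrow> z a \<noteq> z b"
    and zy: "z a - z b + y \<noteq> 0"
    and wz: "w \<noteq> z a" and wzy: "w - z a \<noteq> y"
begin

lemma sum_antisym:
  fixes f :: "nat \<Rightarrow> nat \<Rightarrow> 'a"
  assumes "finite J" "\<And>a b. a \<in> J \<Longrightarrow> b \<in> J \<Longrightarrow> a \<noteq> b \<Longrightarrow> f a b + f b a = 0"
  shows "(\<Sum>a\<in>J. \<Sum>b\<in>J - {a}. f a b) = 0"
proof -
  let ?g = "\<lambda>a b. if a = b then 0 else f a b"
  have 1: "(\<Sum>a\<in>J. \<Sum>b\<in>J - {a}. f a b) = (\<Sum>a\<in>J. \<Sum>b\<in>J. ?g a b)"
    using assms(1) by (intro sum.cong[OF refl] sum.mono_neutral_cong_left) auto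
  have "(\<Sum>a\<in>J. \<Sum>b\<in>J. ?g a b) + (\<Sum>a\<in>J. \<Sum>b\<in>J. ?g a b)
      = (\<Sum>a\<in>J. \<Sum>b\<in>J. ?g a b) + (\<Sum>a\<in>J. \<Sum>b\<in>J. ?g b a)"
    using sum.swap[of ?g J J] by simp
  also have "\<dots> = (\<Sum>a\<in>J. \<Sum>b\<in>J. ?g a b + ?g b a)" by (simp add: sum.distrib)
  also have "\<dots> = 0" by (intro sum.neutral ballI) (auto simp: assms(2))
  finally have "2 * (\<Sum>a\<in>J. \<Sum>b\<in>J. ?g a b) = 0" by simp
  with two show ?thesis unfolding 1 by simp
qed

text \<open>Here \<open>p\<close> and \<open>q\<close> stand for z_m and z_m', and \<open>r\<close>
  for z_(n+1). One summand arises when m is removed by the recursion of the weight function and m'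
  by L_21, the other when it happens the other way round.\<close>

lemma pair_identity:
  fixes l p q r :: 'a
  assumes "p \<noteq> q" "p - q + y \<noteq> 0" "q - p + y \<noteq> 0" "w - p - y \<noteq> 0" "w - q - y \<noteq> 0"
  defines "f \<equiv> \<lambda>p q. (l + p - r) * (q - r) * (l - y - w + q) / ((q - p) * (p - q + y) * (w - q - y))
     - (w - q) * (l - w + p) * (p - r + y) * (l - y + q - r) / ((w - q - y) * (w - p - y) * (q - p) * (p - q + y))"
  shows "f p q + f q p = 0"
proof -
  define E where "E = (\<lambda>p q. (l + p - r) * (q - r) * (l - y - w + q) * (w - p - y)
     - (w - q) * (l - w + p) * (p - r + y) * (l - y + q - r))"
  have nz: "p - q \<noteq> 0" "q - p \<noteq> 0" using assms(1) by auto
  have f: "f p q = E p q / ((w - q - y) * (w - p - y) * (q - p) * (p - q + y))"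
    "f q p = E q p / ((w - q - y) * (w - p - y) * (p - q) * (q - p + y))"
    using nz assms(2-5) unfolding f_def E_def by (simp_all add: divide_simps)
  \<comment> \<open>So \<open>E p q / (p - q + y)\<close> is symmetric in p and q, and only the
    factor q - p of the denominator changes sign.\<close>
  have "E p q * (q - p + y) = E q p * (p - q + y)"
    unfolding E_def by (simp add: algebra_simps)
  then have e: "E q p = E p q * ((q - p + y) / (p - q + y))"
    using assms(2) by (simp add: divide_simps)
  have g: "e / (c * s * t) + e * (s' / t) / (c * - s * s') = 0" if "s' \<noteq> 0" for c e s s' t :: 'a
    using that by (simp add: mult_ac)
  have "p - q = - (q - p)" by simp
  then show ?thesis unfolding f e using g[of "q - p + y" "E p q" "(w - q - y) * (w - p - y)" "q - p" "p - q + y"] assms(3)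
    by metis
qed

lemma eigval22_remove:
  assumes "finite J" "m \<in> J"
  shows "eigval22 z y w J = (w - z m) / (w - z m - y) * eigval22 z y w (J - {m})"
  using assms by (simp add: eigval22_def prod.remove)

lemma prod_remove_pts:
  assumes "finite J" "m \<in> J"
  shows "(\<Prod>j\<in>J. z j - z N) = (z m - z N) * (\<Prod>j\<in>J - {m}. z j - z N)"
  using assms by (simp add: prod.remove)

lemma top_coeff_eq_0: "finite J \<Longrightarrow> Suc n \<in> J \<Longrightarrow> m \<noteq> Suc n \<Longrightarrow> top_coeff z y n l J m = 0"
  unfolding top_coeff_def by (subst prod_zero[of "J - {m}"]) auto

text \<open>In the step for L_22 this compares the coefficients of the coordinate at J - {m} of the
  components with v_1 in the last factor. The products over J - {m} are common to all terms, and
  what is left is an identity in a = w - z_m and b = w - z_(n+1).\<close>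

lemma coef_identity_22:
  assumes "finite J" "m \<in> J" and l: "l \<noteq> 0" "l - y \<noteq> 0" "l + y \<noteq> 0"
  shows "(\<Prod>j\<in>J. z j - z (Suc n)) * (rB y l (w - z (Suc n)) * off_coeff z y w n (l + y) J m)
     + top_coeff z y n l J m * (rD y l (w - z (Suc n)) * eigval22 z y w (J - {m}))
     = eigval22 z y w J * top_coeff z y n (l + y) J m"
proof -
  define N where "N = Suc n"
  define A where "A = eigval22 z y w (J - {m})"
  define Q where "Q = (\<Prod>a=1..n. z m - z a + y)"
  define D where "D = (\<Prod>b\<in>J - {m}. 1 / ((z b - z m) * (z m - z b + y)))"
  define M where "M = (\<Prod>b\<in>J - {m}. z b - z N)"
  have c: "(\<Prod>b\<in>J - {m}. (z b - z N) / ((z b - z m) * (z m - z b + y))) = M * D"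
    by (simp add: M_def D_def flip: prod.distrib)
  have p: "(\<Prod>j\<in>J. z j - z N) = (z m - z N) * M"
    unfolding M_def by (rule prod_remove_pts[OF assms(1,2)])
  have nz: "w - z m - y \<noteq> 0" "w - z N - y \<noteq> 0" using wzy by auto
  define a where "a = w - z m"
  define b where "b = w - z N"
  have ab: "z m - z N = b - a" "l + z m - z N = l + (b - a)" "l - w + z m = l - a"
    "l + y + z m - z N = l + y + (b - a)" "l + y - w + z m = l + y - a" for l by (auto simp: a_def b_def)
  have "(b - a) * (rB y l b * - ((l + y - a) / ((l + y) * (l + y - y) * (a - y))))
     + (l + (b - a)) / (l * (l - y)) * rD y l b
     = a / (a - y) * ((l + y + (b - a)) / ((l + y) * (l + y - y)))"
    using l nz unfolding a_def[symmetric] b_def[symmetric] rB_def rD_def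
    by (simp add: divide_simps, simp add: algebra_simps)
  moreover have "(b - a) * M * (k1 * - (A * k2 * Q * D)) + k3 * Q * (M * D) * (k4 * A) = k5 * A * (k6 * Q * (M * D))"
    if "(b - a) * (k1 * - k2) + k3 * k4 = k5 * k6" for k1 k2 k3 k4 k5 k6 :: 'a
    using arg_cong[OF that, of "\<lambda>t. t * (A * Q * M * D)"] by (simp add: ring_distribs mult_ac)
  ultimately show ?thesis
    unfolding top_coeff_def off_coeff_def eigval22_remove[OF assms(1,2)] N_def[symmetric] c p A_def[symmetric] Q_def[symmetric] D_def[symmetric]
      a_def[symmetric] b_def[symmetric] ab
    by blast
qed

text \<open>As for L_22 the common products drop out. Passing from n to n + 1 in
  \<open>off_coeff\<close> shows as the additional factor z_m - z_(n+1) + y on the right.\<close>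

lemma coef_identity_21:
  assumes "finite J" "m \<in> J" and l: "l \<noteq> 0" "l - y \<noteq> 0" "l + y \<noteq> 0"
  shows "(\<Prod>j\<in>J. z j - z (Suc n)) * (rA y l (w - z (Suc n)) * off_coeff z y w n (l + y) J m)
     + top_coeff z y n l J m * (rC y l (w - z (Suc n)) * eigval22 z y w (J - {m}))
     = off_coeff z y w (Suc n) l J m * (\<Prod>j\<in>J - {m}. z j - z (Suc n))"
proof -
  define N where "N = Suc n"
  define A where "A = eigval22 z y w (J - {m})"
  define Q where "Q = (\<Prod>a=1..n. z m - z a + y)"
  define D where "D = (\<Prod>b\<in>J - {m}. 1 / ((z b - z m) * (z m - z b + y)))"
  define M where "M = (\<Prod>b\<in>J - {m}. z b - z N)"
  have c: "(\<Prod>b\<in>J - {m}. (z b - z N) / ((z b - z m) * (z m - z b + y))) = M * D"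
    by (simp add: M_def D_def flip: prod.distrib)
  have p: "(\<Prod>j\<in>J. z j - z N) = (z m - z N) * M"
    unfolding M_def by (rule prod_remove_pts[OF assms(1,2)])
  have q: "(\<Prod>a=1..N. z m - z a + y) = (z m - z N + y) * Q"
    unfolding Q_def N_def by (simp add: atLeastAtMostSuc_conv)
  have nz: "w - z m - y \<noteq> 0" "w - z N - y \<noteq> 0" using wzy by auto
  define a where "a = w - z m"
  define b where "b = w - z N"
  have ab: "z m - z N = b - a" "l + z m - z N = l + (b - a)" "l - w + z m = l - a"
    "l + y + z m - z N = l + y + (b - a)" "l + y - w + z m = l + y - a" "z m - z N + y = b - a + y" for l by (auto simp: a_def b_def)
  have "(b - a) * (rA y l b * - ((l + y - a) / ((l + y) * (l + y - y) * (a - y))))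
     + (l + (b - a)) / (l * (l - y)) * rC y l b
     = - ((l - a) / (l * (l - y) * (a - y)) * (b - a + y))"
    using l nz unfolding a_def[symmetric] b_def[symmetric] rA_def rC_def
    by (simp add: divide_simps, simp add: algebra_simps)
  moreover have "(b - a) * M * (k1 * - (A * k2 * Q * D)) + k3 * Q * (M * D) * (k4 * A) = - (A * k5 * (k6 * Q) * D) * M"
    if "(b - a) * (k1 * - k2) + k3 * k4 = - (k5 * k6)" for k1 k2 k3 k4 k5 k6 :: 'a
    using arg_cong[OF that, of "\<lambda>t. t * (A * Q * M * D)"] by (simp add: ring_distribs mult_ac)
  ultimately show ?thesis
    unfolding top_coeff_def off_coeff_def N_def[symmetric] c p q A_def[symmetric] Q_def[symmetric] D_def[symmetric] M_def[symmetric]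
      a_def[symmetric] b_def[symmetric] ab
    by blast
qed

text \<open>The factors that do not involve the pair itself form the constant \<open>C\<close>,
  which is symmetric in m and m'; the rest is \<open>pair_identity\<close>.\<close>

lemma coef_identity_pair:
  fixes l :: 'a and n :: nat
  assumes J: "finite J" "m \<in> J" "m' \<in> J" "m \<noteq> m'"
  defines "f \<equiv> \<lambda>m m'. top_coeff z y n l J m * off_coeff z y w n (l - y) (J - {m}) m'
     - off_coeff z y w (Suc n) l J m * top_coeff z y n (l - y) (J - {m}) m'"
  shows "f m m' + f m' m = 0"
proof -
  define N where "N = Suc n"
  define J' where "J' = J - {m, m'}"
  define A where "A = eigval22 z y w J'"
  define Q where "Q = (\<lambda>m. \<Prod>a=1..n. z m - z a + y)"
  define D where "D = (\<lambda>m. \<Prod>b\<in>J'. 1 / ((z b - z m) * (z m - z b + y)))"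
  define M where "M = (\<Prod>b\<in>J'. z b - z N)"
  define g where "g = (\<lambda>p q. (l + p - z N) * (q - z N) * (l - y - w + q) / ((q - p) * (p - q + y) * (w - q - y))
     - (w - q) * (l - w + p) * (p - z N + y) * (l - y + q - z N) / ((w - q - y) * (w - p - y) * (q - p) * (p - q + y)))"
  define C where "C = - (A * Q m * Q m' * M * D m * D m' / (l * (l - y) * (l - y) * (l - y - y)))"
  have key: "f a b = C * g (z a) (z b)" if "(a, b) = (m, m') \<or> (a, b) = (m', m)" for a b
  proof -
    have Js: "J - {a} - {b} = J'" "J - {b} - {a} = J'" and ab: "a \<in> J" "b \<in> J" "a \<noteq> b" using that J by (auto simp: J'_def)
    have Jf: "finite (J - {a})" "b \<in> J - {a}" using J(1) ab by auto
    have e1: "(\<Prod>b\<in>J - {a}. (z b - z N) / ((z b - z a) * (z a - z b + y))) = (z b - z N) / ((z b - z a) * (z a - z b + y)) * (M * D a)"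
      by (subst prod.remove[OF Jf]) (simp add: Js M_def D_def flip: prod.distrib)
    have e2: "(\<Prod>b\<in>J - {a}. 1 / ((z b - z a) * (z a - z b + y))) = 1 / ((z b - z a) * (z a - z b + y)) * D a"
      by (subst prod.remove[OF Jf]) (simp add: Js D_def)
    have e3: "(\<Prod>d\<in>J - {a} - {b}. (z d - z N) / ((z d - z b) * (z b - z d + y))) = M * D b"
      by (simp add: Js M_def D_def flip: prod.distrib)
    have e4: "eigval22 z y w (J - {a}) = (w - z b) / (w - z b - y) * A"
      by (subst eigval22_remove[OF Jf]) (simp add: Js A_def)
    have e5: "eigval22 z y w (J - {a} - {b}) = A" by (simp add: Js A_def)
    have e6: "(\<Prod>d=1..N. z a - z d + y) = (z a - z N + y) * Q a"
      unfolding Q_def N_def by (simp add: atLeastAtMostSuc_conv)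
    have C: "C = - (A * Q a * Q b * M * D a * D b / (l * (l - y) * (l - y) * (l - y - y)))"
      using that by (auto simp: C_def mult_ac)
    have t: "(l + za - zN) / (l * (l - y)) * ((zb - zN) / ((zb - za) * (za - zb + y)))
          * ((l - y - w + zb) / ((l - y) * (l - y - y) * (w - zb - y)))
        = (l + za - zN) * (zb - zN) * (l - y - w + zb) / ((zb - za) * (za - zb + y) * (w - zb - y)) / (l * (l - y) * (l - y) * (l - y - y))"
      "(w - zb) / (w - zb - y) * ((l - w + za) / (l * (l - y) * (w - za - y))) * (za - zN + y) * (1 / ((zb - za) * (za - zb + y)))
          * ((l - y + zb - zN) / ((l - y) * (l - y - y)))
        = (w - zb) * (l - w + za) * (za - zN + y) * (l - y + zb - zN) / ((w - zb - y) * (w - za - y) * (zb - za) * (za - zb + y)) / (l * (l - y) * (l - y) * (l - y - y))"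
      for za zb zN
      by (simp_all add: mult_ac)
    have gen: "k1 * Q a * (g1 * (M * D a)) * - (A * k2 * Q b * D b) - - (wb * A * k3 * (k4 * Q a) * (g2 * D a)) * (k5 * Q b * (M * D b))
       = - (A * Q a * Q b * M * D a * D b / L) * (t1 - t2)"
      if "k1 * g1 * k2 = t1 / L" "wb * k3 * k4 * g2 * k5 = t2 / L" for k1 g1 k2 wb k3 k4 g2 k5 t1 t2 L
    proof -
      have "k1 * Q a * (g1 * (M * D a)) * - (A * k2 * Q b * D b) - - (wb * A * k3 * (k4 * Q a) * (g2 * D a)) * (k5 * Q b * (M * D b))
       = - (A * Q a * Q b * M * D a * D b) * (k1 * g1 * k2 - wb * k3 * k4 * g2 * k5)" by (simp add: ring_distribs mult_ac)
      also have "\<dots> = - (A * Q a * Q b * M * D a * D b / L) * (t1 - t2)" unfolding that by (simp add: field_simps diff_divide_distrib)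
      finally show ?thesis .
    qed
    have Qf: "(\<Prod>a=1..n. z m - z a + y) = Q m" and Df: "(\<Prod>b\<in>J'. 1 / ((z b - z m) * (z m - z b + y))) = D m" for m
      by (simp_all add: Q_def D_def)
    show ?thesis
      unfolding f_def top_coeff_def off_coeff_def N_def[symmetric] e1 e2 e3 e4 e5 e6 C g_def
      unfolding Js Df Qf
      by (rule gen[OF t])
  qed
  have "g (z m) (z m') + g (z m') (z m) = 0"
    unfolding g_def using J(4) z_inj zy wzy by (intro pair_identity) auto
  then show ?thesis by (simp add: key flip: distrib_left)
qed

text \<open>The second formula is only needed to close the induction for the first one.\<close>

lemma wS_laxop:
  assumes "\<And>m::int. l + of_int m * y \<noteq> 0" "J \<subseteq> {1..n}"
  shows "wS z y n l (laxop z y w n l False False u) J = eigval22 z y w J * wS z y n (l + y) u J"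
    and "wS z y n l (laxop z y w n l False True u) J = (\<Sum>m\<in>J. off_coeff z y w n l J m * wS z y n (l - y) u (J - {m}))"
  using assms
proof (induction n arbitrary: l u J)
  case 0
  {
    case 1 then show ?case by (simp add: wS_def eigval22_def)
  next
    case 2 then show ?case by (simp add: wS_def)
  }
next
  case (Suc n)
  have gp: "l + y + of_int m * y \<noteq> 0" "l - y + of_int m * y \<noteq> 0" if "\<And>m::int. l + of_int m * y \<noteq> 0" for m :: int and l
    using that[of "m + 1"] that[of "m - 1"] by (auto simp: algebra_simps)
  have ln: "l \<noteq> 0" "l - y \<noteq> 0" "l + y \<noteq> 0" if "\<And>m::int. l + of_int m * y \<noteq> 0" for l
    using that[of 0] that[of "-1"] that[of 1] by auto
  let ?x = "w - z (Suc n)"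
  have sub: "J \<subseteq> {1..n}" if "J \<subseteq> {1..Suc n}" "Suc n \<notin> J" for J
  proof
    fix a assume "a \<in> J"
    then have "a \<in> {1..Suc n}" "a \<noteq> Suc n" using that by auto
    then show "a \<in> {1..n}" by auto
  qed
  \<comment> \<open>The induction hypothesis is restricted to subsets of {1..n}. When J contains n +
    1, the factor in front of both sides is zero, so the multiplied equations hold for all J in
    question.\<close>
  have P22: "(\<Prod>j\<in>J. z j - z (Suc n)) * wS z y n l (laxop z y w n l False False v) J
      = (\<Prod>j\<in>J. z j - z (Suc n)) * (eigval22 z y w J * wS z y n (l + y) v J)"
    and P21: "(\<Prod>j\<in>J. z j - z (Suc n)) * wS z y n l (laxop z y w n l False True v) J
      = (\<Prod>j\<in>J. z j - z (Suc n)) * (\<Sum>m\<in>J. off_coeff z y w n l J m * wS z y n (l - y) v (J - {m}))"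
    if "\<And>m::int. l + of_int m * y \<noteq> 0" "J \<subseteq> {1..Suc n}" for l v J
  proof -
    have "finite J" using that(2) finite_subset by blast
    then have "(\<Prod>j\<in>J. z j - z (Suc n)) = 0 \<or> J \<subseteq> {1..n}" using sub[OF that(2)] by auto
    then show "(\<Prod>j\<in>J. z j - z (Suc n)) * wS z y n l (laxop z y w n l False False v) J
      = (\<Prod>j\<in>J. z j - z (Suc n)) * (eigval22 z y w J * wS z y n (l + y) v J)"
      "(\<Prod>j\<in>J. z j - z (Suc n)) * wS z y n l (laxop z y w n l False True v) J
      = (\<Prod>j\<in>J. z j - z (Suc n)) * (\<Sum>m\<in>J. off_coeff z y w n l J m * wS z y n (l - y) v (J - {m}))"
      using Suc.IH[OF that(1)] by auto
  qed
  \<comment> \<open>If n + 1 is still in J - {m}, \<open>top_coeff\<close> vanishes; otherwise the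
    induction hypothesis applies to J - {m}.\<close>
  have C22: "top_coeff z y n l' J m * wS z y n l (laxop z y w n l False False v) (J - {m})
      = top_coeff z y n l' J m * (eigval22 z y w (J - {m}) * wS z y n (l + y) v (J - {m}))"
    and C21: "top_coeff z y n l' J m * wS z y n l (laxop z y w n l False True v) (J - {m})
      = top_coeff z y n l' J m * (\<Sum>m'\<in>J - {m}. off_coeff z y w n l (J - {m}) m' * wS z y n (l - y) v (J - {m} - {m'}))"
    if "\<And>m::int. l + of_int m * y \<noteq> 0" "J \<subseteq> {1..Suc n}" "m \<in> J" for l l' v J m
  proof -
    have "finite J" using that(2) finite_subset by blast
    then have "top_coeff z y n l' J m = 0 \<or> Suc n \<notin> J - {m}" using top_coeff_eq_0[of J n m l'] by auto
    then have "top_coeff z y n l' J m = 0 \<or> J - {m} \<subseteq> {1..n}" using sub[of "J - {m}"] that(2) by auto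
    then show "top_coeff z y n l' J m * wS z y n l (laxop z y w n l False False v) (J - {m})
      = top_coeff z y n l' J m * (eigval22 z y w (J - {m}) * wS z y n (l + y) v (J - {m}))"
      "top_coeff z y n l' J m * wS z y n l (laxop z y w n l False True v) (J - {m})
      = top_coeff z y n l' J m * (\<Sum>m'\<in>J - {m}. off_coeff z y w n l (J - {m}) m' * wS z y n (l - y) v (J - {m} - {m'}))"
      using Suc.IH[OF that(1)] by auto
  qed
  {
    case 1
    let ?u1 = "\<lambda>K. u (insert (Suc n) K)"
    let ?P = "\<Prod>j\<in>J. z j - z (Suc n)"
    have fin: "finite J" using 1(2) finite_subset by blast
    note l = ln[OF 1(1)]
    have a: "?P * wS z y n (l + y) (laxop z y w n (l + y) False True ?u1) J
      = ?P * (\<Sum>m\<in>J. off_coeff z y w n (l + y) J m * wS z y n l ?u1 (J - {m}))"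
      using P21[OF gp(1)[OF 1(1)] 1(2), of ?u1] by simp
    have b: "?P * wS z y n (l + y) (laxop z y w n (l + y) False False u) J = ?P * (eigval22 z y w J * wS z y n (l + y + y) u J)"
      using P22[OF gp(1)[OF 1(1)] 1(2), of u] by simp
    have c: "top_coeff z y n l J m * wS z y n (l - y) (laxop z y w n (l - y) False False ?u1) (J - {m})
      = top_coeff z y n l J m * (eigval22 z y w (J - {m}) * wS z y n l ?u1 (J - {m}))" if "m \<in> J" for m
      using C22[OF gp(2)[OF 1(1)] 1(2) that, of l ?u1] by simp
    have "wS z y (Suc n) l (laxop z y w (Suc n) l False False u) J
      = rB y l ?x * (?P * wS z y n (l + y) (laxop z y w n (l + y) False True ?u1) J)
      + ?P * wS z y n (l + y) (laxop z y w n (l + y) False False u) J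
      + (\<Sum>m\<in>J. rD y l ?x * (top_coeff z y n l J m * wS z y n (l - y) (laxop z y w n (l - y) False False ?u1) (J - {m})))"
      unfolding wS_Suc wS_slice by (simp add: ring_distribs mult.left_commute)
    also have "\<dots> = rB y l ?x * (?P * (\<Sum>m\<in>J. off_coeff z y w n (l + y) J m * wS z y n l ?u1 (J - {m})))
      + ?P * (eigval22 z y w J * wS z y n (l + y + y) u J)
      + (\<Sum>m\<in>J. rD y l ?x * (top_coeff z y n l J m * (eigval22 z y w (J - {m}) * wS z y n l ?u1 (J - {m}))))"
      unfolding a b by (simp only: c cong: sum.cong)
    also have "\<dots> = ?P * (eigval22 z y w J * wS z y n (l + y + y) u J)
      + (\<Sum>m\<in>J. (?P * (rB y l ?x * off_coeff z y w n (l + y) J m) + top_coeff z y n l J m * (rD y l ?x * eigval22 z y w (J - {m}))) * wS z y n l ?u1 (J - {m}))"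
      by (simp add: ring_distribs sum.distrib sum_distrib_left mult_ac)
    also have "(\<Sum>m\<in>J. (?P * (rB y l ?x * off_coeff z y w n (l + y) J m) + top_coeff z y n l J m * (rD y l ?x * eigval22 z y w (J - {m}))) * wS z y n l ?u1 (J - {m}))
      = (\<Sum>m\<in>J. eigval22 z y w J * top_coeff z y n (l + y) J m * wS z y n l ?u1 (J - {m}))"
      by (rule sum.cong[OF refl]) (simp only: coef_identity_22[OF fin _ l])
    also have "?P * (eigval22 z y w J * wS z y n (l + y + y) u J) + \<dots> = eigval22 z y w J * wS z y (Suc n) (l + y) u J"
      unfolding wS_Suc by (simp add: ring_distribs sum_distrib_left mult_ac)
    finally show ?case .
  next
    case 2
    let ?u1 = "\<lambda>K. u (insert (Suc n) K)"
    let ?P = "\<Prod>j\<in>J. z j - z (Suc n)"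
    have fin: "finite J" using 2(2) finite_subset by blast
    note l = ln[OF 2(1)]
    have a: "?P * wS z y n (l + y) (laxop z y w n (l + y) False True u) J
      = ?P * (\<Sum>m\<in>J. off_coeff z y w n (l + y) J m * wS z y n l u (J - {m}))"
      using P21[OF gp(1)[OF 2(1)] 2(2), of u] by simp
    have c: "top_coeff z y n l J m * wS z y n (l - y) (laxop z y w n (l - y) False True ?u1) (J - {m})
      = top_coeff z y n l J m * (\<Sum>m'\<in>J - {m}. off_coeff z y w n (l - y) (J - {m}) m' * wS z y n (l - y - y) ?u1 (J - {m} - {m'}))" if "m \<in> J" for m
      using C21[OF gp(2)[OF 2(1)] 2(2) that, of l ?u1] .
    have d: "top_coeff z y n l J m * wS z y n (l - y) (laxop z y w n (l - y) False False u) (J - {m})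
      = top_coeff z y n l J m * (eigval22 z y w (J - {m}) * wS z y n l u (J - {m}))" if "m \<in> J" for m
      using C22[OF gp(2)[OF 2(1)] 2(2) that, of l u] by simp
    let ?S = "\<lambda>m m'. wS z y n (l - y - y) ?u1 (J - {m} - {m'})"
    have "wS z y (Suc n) l (laxop z y w (Suc n) l False True u) J
      = rA y l ?x * (?P * wS z y n (l + y) (laxop z y w n (l + y) False True u) J)
      + (\<Sum>m\<in>J. top_coeff z y n l J m * wS z y n (l - y) (laxop z y w n (l - y) False True ?u1) (J - {m}))
      + (\<Sum>m\<in>J. rC y l ?x * (top_coeff z y n l J m * wS z y n (l - y) (laxop z y w n (l - y) False False u) (J - {m})))"
      unfolding wS_Suc wS_slice by (simp add: ring_distribs sum.distrib mult_ac)
    also have "\<dots> = rA y l ?x * (?P * (\<Sum>m\<in>J. off_coeff z y w n (l + y) J m * wS z y n l u (J - {m})))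
      + (\<Sum>m\<in>J. top_coeff z y n l J m * (\<Sum>m'\<in>J - {m}. off_coeff z y w n (l - y) (J - {m}) m' * ?S m m'))
      + (\<Sum>m\<in>J. rC y l ?x * (top_coeff z y n l J m * (eigval22 z y w (J - {m}) * wS z y n l u (J - {m}))))"
      unfolding a by (simp only: c d cong: sum.cong)
    also have "\<dots> = (\<Sum>m\<in>J. (?P * (rA y l ?x * off_coeff z y w n (l + y) J m) + top_coeff z y n l J m * (rC y l ?x * eigval22 z y w (J - {m}))) * wS z y n l u (J - {m}))
      + (\<Sum>m\<in>J. \<Sum>m'\<in>J - {m}. top_coeff z y n l J m * off_coeff z y w n (l - y) (J - {m}) m' * ?S m m')"
      by (simp add: ring_distribs sum.distrib sum_distrib_left mult_ac)
    also have "(\<Sum>m\<in>J. (?P * (rA y l ?x * off_coeff z y w n (l + y) J m) + top_coeff z y n l J m * (rC y l ?x * eigval22 z y w (J - {m}))) * wS z y n l u (J - {m}))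
      = (\<Sum>m\<in>J. off_coeff z y w (Suc n) l J m * (\<Prod>j\<in>J - {m}. z j - z (Suc n)) * wS z y n l u (J - {m}))"
      by (rule sum.cong[OF refl]) (simp only: coef_identity_21[OF fin _ l])
    \<comment> \<open>The terms of the difference of the two double sums change sign when m and m'
      are exchanged, because \<open>?S\<close> depends on the set of the two only.\<close>
    also have "(\<Sum>m\<in>J. \<Sum>m'\<in>J - {m}. top_coeff z y n l J m * off_coeff z y w n (l - y) (J - {m}) m' * ?S m m')
       = (\<Sum>m\<in>J. \<Sum>m'\<in>J - {m}. off_coeff z y w (Suc n) l J m * top_coeff z y n (l - y) (J - {m}) m' * ?S m m')"
    proof -
      have "(\<Sum>m\<in>J. \<Sum>m'\<in>J - {m}. (top_coeff z y n l J m * off_coeff z y w n (l - y) (J - {m}) m'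
          - off_coeff z y w (Suc n) l J m * top_coeff z y n (l - y) (J - {m}) m') * ?S m m') = 0"
      proof (rule sum_antisym[OF fin])
        fix a b assume ab: "a \<in> J" "b \<in> J" "a \<noteq> b"
        have "J - {a} - {b} = J - {b} - {a}" by auto
        then show "(top_coeff z y n l J a * off_coeff z y w n (l - y) (J - {a}) b - off_coeff z y w (Suc n) l J a * top_coeff z y n (l - y) (J - {a}) b) * ?S a b
          + (top_coeff z y n l J b * off_coeff z y w n (l - y) (J - {b}) a - off_coeff z y w (Suc n) l J b * top_coeff z y n (l - y) (J - {b}) a) * ?S b a = 0"
          using coef_identity_pair[OF fin ab, of n l] by (simp flip: distrib_right)
      qed
      then show ?thesis by (simp add: left_diff_distrib sum_subtractf)
    qed
    also have "(\<Sum>m\<in>J. off_coeff z y w (Suc n) l J m * (\<Prod>j\<in>J - {m}. z j - z (Suc n)) * wS z y n l u (J - {m}))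
       + (\<Sum>m\<in>J. \<Sum>m'\<in>J - {m}. off_coeff z y w (Suc n) l J m * top_coeff z y n (l - y) (J - {m}) m' * ?S m m')
       = (\<Sum>m\<in>J. off_coeff z y w (Suc n) l J m * wS z y (Suc n) (l - y) u (J - {m}))"
      unfolding wS_Suc by (simp add: ring_distribs sum.distrib sum_distrib_left mult_ac)
    finally show ?case .
  }
qed

end

lemma cst_0 [simp]: "cst 0 = 0" and cst_1 [simp]: "cst 1 = 1"
  and cst_add: "cst (a + b) = cst a + cst b" and cst_mult: "cst (a * b) = cst a * cst b"
  by (simp_all add: cst_def Zero_fract_def One_fract_def single_add mult_single)

subsection \<open>Substitution into rational functions\<close>

text \<open>Two cases are used: constants of the field of rational functions itself, for
  substitutions, and constant Laurent series in 1/w, for the expansion at infinity.\<close>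

locale coeff_hom =
  fixes emb :: "complex \<Rightarrow> 'b::field"
  assumes emb_0 [simp]: "emb 0 = 0" and emb_1 [simp]: "emb 1 = 1"
    and emb_add: "emb (a + b) = emb a + emb b" and emb_mult: "emb (a * b) = emb a * emb b"
begin

definition monom_eval :: "(var \<Rightarrow> 'b) \<Rightarrow> (var \<Rightarrow>\<^sub>0 nat) \<Rightarrow> 'b" where
  "monom_eval \<sigma> m = (\<Prod>v\<in>Poly_Mapping.keys m. \<sigma> v ^ Poly_Mapping.lookup m v)"

lemma monom_eval_superset:
  assumes "finite S" "Poly_Mapping.keys m \<subseteq> S"
  shows "monom_eval \<sigma> m = (\<Prod>v\<in>S. \<sigma> v ^ Poly_Mapping.lookup m v)"
  unfolding monom_eval_def using assms by (intro prod.mono_neutral_left) (auto simp: in_keys_iff)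

lemma monom_eval_0 [simp]: "monom_eval \<sigma> 0 = 1"
  by (simp add: monom_eval_def)

lemma monom_eval_add: "monom_eval \<sigma> (m + m') = monom_eval \<sigma> m * monom_eval \<sigma> m'"
proof -
  let ?S = "Poly_Mapping.keys m \<union> Poly_Mapping.keys m'"
  have "monom_eval \<sigma> (m + m') = (\<Prod>v\<in>?S. \<sigma> v ^ Poly_Mapping.lookup (m + m') v)"
    by (rule monom_eval_superset) (use keys_add[of m m'] in auto)
  also have "\<dots> = (\<Prod>v\<in>?S. \<sigma> v ^ Poly_Mapping.lookup m v) * (\<Prod>v\<in>?S. \<sigma> v ^ Poly_Mapping.lookup m' v)"
    by (simp add: lookup_add power_add prod.distrib)
  finally show ?thesis by (simp add: monom_eval_superset[of ?S])
qed

lemma mpoly_eval_superset: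
  assumes "finite S" "Poly_Mapping.keys p \<subseteq> S"
  shows "mpoly_eval emb \<sigma> p = (\<Sum>m\<in>S. emb (Poly_Mapping.lookup p m) * monom_eval \<sigma> m)"
  unfolding mpoly_eval_def monom_eval_def using assms
  by (intro sum.mono_neutral_left) (auto simp: in_keys_iff)

lemma mpoly_eval_0 [simp]: "mpoly_eval emb \<sigma> 0 = 0"
  by (simp add: mpoly_eval_def)

lemma mpoly_eval_add: "mpoly_eval emb \<sigma> (p + q) = mpoly_eval emb \<sigma> p + mpoly_eval emb \<sigma> q"
proof -
  let ?S = "Poly_Mapping.keys p \<union> Poly_Mapping.keys q"
  have "mpoly_eval emb \<sigma> (p + q) = (\<Sum>m\<in>?S. emb (Poly_Mapping.lookup (p + q) m) * monom_eval \<sigma> m)"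
    by (rule mpoly_eval_superset) (use keys_add[of p q] in auto)
  then show ?thesis
    by (simp add: mpoly_eval_superset[of ?S] lookup_add emb_add ring_distribs sum.distrib)
qed

lemma mpoly_eval_sum: "mpoly_eval emb \<sigma> (\<Sum>i\<in>A. p i) = (\<Sum>i\<in>A. mpoly_eval emb \<sigma> (p i))"
  by (induction A rule: infinite_finite_induct) (simp_all add: mpoly_eval_add)

lemma mpoly_eval_single: "mpoly_eval emb \<sigma> (Poly_Mapping.single m c) = emb c * monom_eval \<sigma> m"
  by (subst mpoly_eval_superset[of "{m}"]) auto

lemma mpoly_eval_1 [simp]: "mpoly_eval emb \<sigma> 1 = 1"
  using mpoly_eval_single[of \<sigma> 0 1] by simp

end

lemma poly_mapping_sum_single:
  "p = (\<Sum>m\<in>Poly_Mapping.keys p. Poly_Mapping.single m (Poly_Mapping.lookup p m))"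
proof (rule poly_mapping_eqI)
  fix k
  have "(\<Sum>m\<in>Poly_Mapping.keys p. Poly_Mapping.lookup (Poly_Mapping.single m (Poly_Mapping.lookup p m)) k)
    = (\<Sum>m\<in>Poly_Mapping.keys p. if m = k then Poly_Mapping.lookup p m else 0)"
    by (rule sum.cong) (auto simp: lookup_single)
  then show "Poly_Mapping.lookup p k = Poly_Mapping.lookup (\<Sum>m\<in>Poly_Mapping.keys p. Poly_Mapping.single m (Poly_Mapping.lookup p m)) k"
    by (simp add: lookup_sum in_keys_iff)
qed

context coeff_hom
begin

lemma mpoly_eval_mult: "mpoly_eval emb \<sigma> (p * q) = mpoly_eval emb \<sigma> p * mpoly_eval emb \<sigma> q"
proof -
  let ?s = "\<lambda>p m. Poly_Mapping.single m (Poly_Mapping.lookup p m)"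
  have "p * q = (\<Sum>m\<in>Poly_Mapping.keys p. \<Sum>m'\<in>Poly_Mapping.keys q. ?s p m * ?s q m')"
    by (simp flip: poly_mapping_sum_single sum_product)
  also have "mpoly_eval emb \<sigma> \<dots> = (\<Sum>m\<in>Poly_Mapping.keys p. \<Sum>m'\<in>Poly_Mapping.keys q.
      mpoly_eval emb \<sigma> (?s p m) * mpoly_eval emb \<sigma> (?s q m'))"
    by (simp add: mpoly_eval_sum mult_single mpoly_eval_single monom_eval_add emb_mult mult_ac)
  also have "\<dots> = mpoly_eval emb \<sigma> p * mpoly_eval emb \<sigma> q"
    by (simp flip: sum_product mpoly_eval_sum poly_mapping_sum_single)
  finally show ?thesis .
qed

text \<open>Outside this set the value of \<open>subst_into\<close> is unspecified, so the
  homomorphism rules below all assume membership.\<close>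

definition sdef :: "(var \<Rightarrow> 'b) \<Rightarrow> ratf \<Rightarrow> bool" where
  "sdef \<sigma> f \<longleftrightarrow> (\<exists>a b. f = Fraction_Field.Fract a b \<and> mpoly_eval emb \<sigma> b \<noteq> 0)"

text \<open>Two admissible fractions agree after cross multiplication, which is an equation of
  polynomials and is preserved by evaluation.\<close>

lemma subst_into_Fract:
  assumes "mpoly_eval emb \<sigma> b \<noteq> 0"
  shows "subst_into emb \<sigma> (Fraction_Field.Fract a b) = mpoly_eval emb \<sigma> a / mpoly_eval emb \<sigma> b"
  unfolding subst_into_def
proof (rule the_equality)
  show "\<exists>a' b'. Fraction_Field.Fract a b = Fraction_Field.Fract a' b' \<and> mpoly_eval emb \<sigma> b' \<noteq> 0
     \<and> mpoly_eval emb \<sigma> a / mpoly_eval emb \<sigma> b = mpoly_eval emb \<sigma> a' / mpoly_eval emb \<sigma> b'"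
    using assms by blast
next
  fix r assume "\<exists>a' b'. Fraction_Field.Fract a b = Fraction_Field.Fract a' b' \<and> mpoly_eval emb \<sigma> b' \<noteq> 0
     \<and> r = mpoly_eval emb \<sigma> a' / mpoly_eval emb \<sigma> b'"
  then obtain a' b' where 1: "Fraction_Field.Fract a b = Fraction_Field.Fract a' b'" "mpoly_eval emb \<sigma> b' \<noteq> 0"
     "r = mpoly_eval emb \<sigma> a' / mpoly_eval emb \<sigma> b'" by blast
  have "b \<noteq> 0" "b' \<noteq> 0" using assms 1(2) by auto
  then have "a * b' = a' * b" using 1(1) by (simp add: eq_fract)
  then have "mpoly_eval emb \<sigma> a * mpoly_eval emb \<sigma> b' = mpoly_eval emb \<sigma> a' * mpoly_eval emb \<sigma> b"
    by (simp flip: mpoly_eval_mult)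
  then show "r = mpoly_eval emb \<sigma> a / mpoly_eval emb \<sigma> b"
    unfolding 1(3) using assms 1(2) by (simp add: frac_eq_eq)
qed

lemma sdefE:
  assumes "sdef \<sigma> f"
  obtains a b where "f = Fraction_Field.Fract a b" "mpoly_eval emb \<sigma> b \<noteq> 0" "b \<noteq> 0"
    "subst_into emb \<sigma> f = mpoly_eval emb \<sigma> a / mpoly_eval emb \<sigma> b"
  using assms subst_into_Fract unfolding sdef_def by (metis mpoly_eval_0)

lemma sdef_FractI: "mpoly_eval emb \<sigma> b \<noteq> 0 \<Longrightarrow> sdef \<sigma> (Fraction_Field.Fract a b)"
  unfolding sdef_def by blast

lemma sdef_poly [simp]: "sdef \<sigma> (Fraction_Field.Fract p 1)"
  by (rule sdef_FractI) simp

lemma subst_poly [simp]: "subst_into emb \<sigma> (Fraction_Field.Fract p 1) = mpoly_eval emb \<sigma> p"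
  by (subst subst_into_Fract) simp_all

lemma sdef_0 [simp]: "sdef \<sigma> 0" and sdef_1 [simp]: "sdef \<sigma> 1"
  by (simp_all add: Zero_fract_def One_fract_def)

lemma subst_0 [simp]: "subst_into emb \<sigma> 0 = 0" and subst_1 [simp]: "subst_into emb \<sigma> 1 = 1"
  by (simp_all add: Zero_fract_def One_fract_def)

lemma sdef_cst [simp]: "sdef \<sigma> (cst c)" by (simp add: cst_def)
lemma sdef_X [simp]: "sdef \<sigma> (X v)" by (simp add: X_def)

lemma subst_cst [simp]: "subst_into emb \<sigma> (cst c) = emb c"
  by (simp add: cst_def mpoly_eval_single)

lemma subst_X [simp]: "subst_into emb \<sigma> (X v) = \<sigma> v"
  by (simp add: X_def mpoly_eval_single monom_eval_def)

lemma subst_add_aux: assumes "sdef \<sigma> f" "sdef \<sigma> g"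
  shows "sdef \<sigma> (f + g) \<and> subst_into emb \<sigma> (f + g) = subst_into emb \<sigma> f + subst_into emb \<sigma> g"
proof -
  obtain a b where 1: "f = Fraction_Field.Fract a b" "mpoly_eval emb \<sigma> b \<noteq> 0" "b \<noteq> 0"
    "subst_into emb \<sigma> f = mpoly_eval emb \<sigma> a / mpoly_eval emb \<sigma> b" using assms(1) by (rule sdefE)
  obtain c d where 2: "g = Fraction_Field.Fract c d" "mpoly_eval emb \<sigma> d \<noteq> 0" "d \<noteq> 0"
    "subst_into emb \<sigma> g = mpoly_eval emb \<sigma> c / mpoly_eval emb \<sigma> d" using assms(2) by (rule sdefE)
  have 3: "f + g = Fraction_Field.Fract (a * d + c * b) (b * d)" using 1 2 by simp
  have 4: "mpoly_eval emb \<sigma> (b * d) \<noteq> 0" using 1 2 by (simp add: mpoly_eval_mult)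
  show ?thesis unfolding 3 1(4) 2(4)
    using sdef_FractI[OF 4] subst_into_Fract[OF 4] 1(2) 2(2) by (simp add: mpoly_eval_mult mpoly_eval_add field_simps)
qed

lemma subst_mult_aux: assumes "sdef \<sigma> f" "sdef \<sigma> g"
  shows "sdef \<sigma> (f * g) \<and> subst_into emb \<sigma> (f * g) = subst_into emb \<sigma> f * subst_into emb \<sigma> g"
proof -
  obtain a b where 1: "f = Fraction_Field.Fract a b" "mpoly_eval emb \<sigma> b \<noteq> 0" "b \<noteq> 0"
    "subst_into emb \<sigma> f = mpoly_eval emb \<sigma> a / mpoly_eval emb \<sigma> b" using assms(1) by (rule sdefE)
  obtain c d where 2: "g = Fraction_Field.Fract c d" "mpoly_eval emb \<sigma> d \<noteq> 0" "d \<noteq> 0"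
    "subst_into emb \<sigma> g = mpoly_eval emb \<sigma> c / mpoly_eval emb \<sigma> d" using assms(2) by (rule sdefE)
  have 3: "f * g = Fraction_Field.Fract (a * c) (b * d)" using 1 2 by simp
  have 4: "mpoly_eval emb \<sigma> (b * d) \<noteq> 0" using 1 2 by (simp add: mpoly_eval_mult)
  show ?thesis unfolding 3 1(4) 2(4)
    using sdef_FractI[OF 4] subst_into_Fract[OF 4] 1(2) 2(2) by (simp add: mpoly_eval_mult field_simps)
qed

lemma sdef_add [simp]: "sdef \<sigma> f \<Longrightarrow> sdef \<sigma> g \<Longrightarrow> sdef \<sigma> (f + g)" using subst_add_aux by blast
lemma sdef_mult [simp]: "sdef \<sigma> f \<Longrightarrow> sdef \<sigma> g \<Longrightarrow> sdef \<sigma> (f * g)" using subst_mult_aux by blast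
lemma subst_add: "sdef \<sigma> f \<Longrightarrow> sdef \<sigma> g \<Longrightarrow> subst_into emb \<sigma> (f + g) = subst_into emb \<sigma> f + subst_into emb \<sigma> g"
  using subst_add_aux by blast
lemma subst_mult: "sdef \<sigma> f \<Longrightarrow> sdef \<sigma> g \<Longrightarrow> subst_into emb \<sigma> (f * g) = subst_into emb \<sigma> f * subst_into emb \<sigma> g"
  using subst_mult_aux by blast

lemma emb_uminus_1: "emb (- 1) = - 1"
  using emb_add[of 1 "- 1"] by (simp add: eq_neg_iff_add_eq_0 add.commute)

lemma cst_uminus_1: "cst (- 1) = - 1"
  using cst_add[of 1 "- 1"] by (simp add: eq_neg_iff_add_eq_0 add.commute)

lemma sdef_uminus [simp]: "sdef \<sigma> f \<Longrightarrow> sdef \<sigma> (- f)"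
  using sdef_mult[of \<sigma> "cst (- 1)" f] sdef_cst[of \<sigma> "- 1"] by (simp add: cst_uminus_1)

lemma subst_uminus: "sdef \<sigma> f \<Longrightarrow> subst_into emb \<sigma> (- f) = - subst_into emb \<sigma> f"
  using subst_mult[of \<sigma> "cst (- 1)" f] subst_cst[of \<sigma> "- 1"] sdef_cst[of \<sigma> "- 1"]
  by (simp add: cst_uminus_1 emb_uminus_1)

lemma sdef_diff [simp]: "sdef \<sigma> f \<Longrightarrow> sdef \<sigma> g \<Longrightarrow> sdef \<sigma> (f - g)"
  using sdef_add[of \<sigma> f "- g"] by simp

lemma subst_diff: "sdef \<sigma> f \<Longrightarrow> sdef \<sigma> g \<Longrightarrow> subst_into emb \<sigma> (f - g) = subst_into emb \<sigma> f - subst_into emb \<sigma> g"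
  using subst_add[of \<sigma> f "- g"] by (simp add: subst_uminus)

lemma subst_inverse_aux:
  assumes "sdef \<sigma> f" "subst_into emb \<sigma> f \<noteq> 0"
  shows "sdef \<sigma> (inverse f) \<and> subst_into emb \<sigma> (inverse f) = inverse (subst_into emb \<sigma> f)"
proof -
  obtain a b where 1: "f = Fraction_Field.Fract a b" "mpoly_eval emb \<sigma> b \<noteq> 0" "b \<noteq> 0"
    "subst_into emb \<sigma> f = mpoly_eval emb \<sigma> a / mpoly_eval emb \<sigma> b" using assms(1) by (rule sdefE)
  have 4: "mpoly_eval emb \<sigma> a \<noteq> 0" using 1 assms(2) by auto
  show ?thesis unfolding 1(4) unfolding 1(1)
    using sdef_FractI[OF 4] subst_into_Fract[OF 4] by simp
qed

lemma sdef_divide: "sdef \<sigma> f \<Longrightarrow> sdef \<sigma> g \<Longrightarrow> subst_into emb \<sigma> g \<noteq> 0 \<Longrightarrow> sdef \<sigma> (f / g)"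
  and subst_divide: "sdef \<sigma> f \<Longrightarrow> sdef \<sigma> g \<Longrightarrow> subst_into emb \<sigma> g \<noteq> 0 \<Longrightarrow>
     subst_into emb \<sigma> (f / g) = subst_into emb \<sigma> f / subst_into emb \<sigma> g"
  using subst_inverse_aux[of \<sigma> g] by (simp_all add: divide_inverse subst_mult)

lemma sdef_sum: "(\<And>i. i \<in> A \<Longrightarrow> sdef \<sigma> (f i)) \<Longrightarrow> sdef \<sigma> (\<Sum>i\<in>A. f i)"
  by (induction A rule: infinite_finite_induct) simp_all

lemma subst_sum: "(\<And>i. i \<in> A \<Longrightarrow> sdef \<sigma> (f i)) \<Longrightarrow> subst_into emb \<sigma> (\<Sum>i\<in>A. f i) = (\<Sum>i\<in>A. subst_into emb \<sigma> (f i))"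
  by (induction A rule: infinite_finite_induct) (simp_all add: sdef_sum subst_add)

lemma sdef_prod: "(\<And>i. i \<in> A \<Longrightarrow> sdef \<sigma> (f i)) \<Longrightarrow> sdef \<sigma> (\<Prod>i\<in>A. f i)"
  by (induction A rule: infinite_finite_induct) simp_all

lemma subst_prod: "(\<And>i. i \<in> A \<Longrightarrow> sdef \<sigma> (f i)) \<Longrightarrow> subst_into emb \<sigma> (\<Prod>i\<in>A. f i) = (\<Prod>i\<in>A. subst_into emb \<sigma> (f i))"
  by (induction A rule: infinite_finite_induct) (simp_all add: sdef_prod subst_mult)

lemma sdef_power: "sdef \<sigma> f \<Longrightarrow> sdef \<sigma> (f ^ n)"
  by (induction n) simp_all

lemma subst_power: "sdef \<sigma> f \<Longrightarrow> subst_into emb \<sigma> (f ^ n) = subst_into emb \<sigma> f ^ n"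
  by (induction n) (simp_all add: subst_mult sdef_power)

lemma sdef_of_nat [simp]: "sdef \<sigma> (of_nat n)"
  by (induction n) simp_all

lemma subst_of_nat [simp]: "subst_into emb \<sigma> (of_nat n) = of_nat n"
  by (induction n) (simp_all add: subst_add)

lemma sdef_of_int [simp]: "sdef \<sigma> (of_int n)"
  by (cases n) (simp_all only: of_int_minus of_int_of_nat_eq sdef_uminus sdef_of_nat)

lemma subst_of_int [simp]: "subst_into emb \<sigma> (of_int n) = of_int n"
  by (cases n) (simp_all only: of_int_minus of_int_of_nat_eq subst_uminus sdef_of_nat subst_of_nat)

end

interpretation rat: coeff_hom cst
  by unfold_locales (simp_all add: cst_add cst_mult)

lemma Fract_sum: "Fraction_Field.Fract (\<Sum>i\<in>A. p i) (1::mpoly) = (\<Sum>i\<in>A. Fraction_Field.Fract (p i) 1)"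
proof (induction A rule: infinite_finite_induct)
  case (insert x F)
  then show ?case by (simp flip: insert.IH)
qed (simp_all add: Zero_fract_def)

lemma Fract_single:
  "Fraction_Field.Fract (Poly_Mapping.single m c) 1 = cst c * rat.monom_eval X m"
proof -
  have p: "Fraction_Field.Fract (Poly_Mapping.single (Poly_Mapping.single v n) 1) 1 = X v ^ n" for v n
  proof (induction n)
    case 0 show ?case by (simp add: One_fract_def)
  next
    case (Suc n)
    have "X v ^ Suc n = X v * Fraction_Field.Fract (Poly_Mapping.single (Poly_Mapping.single v n) 1) 1" by (simp add: Suc)
    also have "\<dots> = Fraction_Field.Fract (Poly_Mapping.single (Poly_Mapping.single v (Suc n)) 1) 1"
      unfolding X_def by (simp add: mult_single flip: single_add)
    finally show ?case by simp
  qed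
  have q: "Fraction_Field.Fract (Poly_Mapping.single (\<Sum>v\<in>S. Poly_Mapping.single v (k v)) 1) 1 = (\<Prod>v\<in>S. X v ^ k v)" if "finite S" for S k
    using that
  proof (induction S)
    case empty show ?case by (simp add: One_fract_def)
  next
    case (insert v S)
    then show ?case by (simp add: mult_single flip: p[of v] insert.IH)
  qed
  have "Fraction_Field.Fract (Poly_Mapping.single m 1) 1 = rat.monom_eval X m"
    unfolding rat.monom_eval_def by (simp flip: q poly_mapping_sum_single)
  then show ?thesis
    unfolding cst_def by (simp add: mult_single flip: \<open>_ = rat.monom_eval X m\<close>)
qed

lemma mpoly_eval_X: "mpoly_eval cst X p = Fraction_Field.Fract p 1"
proof -
  have "mpoly_eval cst X p = (\<Sum>m\<in>Poly_Mapping.keys p. cst (Poly_Mapping.lookup p m) * rat.monom_eval X m)"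
    by (rule rat.mpoly_eval_superset) auto
  also have "\<dots> = Fraction_Field.Fract (\<Sum>m\<in>Poly_Mapping.keys p. Poly_Mapping.single m (Poly_Mapping.lookup p m)) 1"
    by (simp add: Fract_sum Fract_single)
  finally show ?thesis by (simp flip: poly_mapping_sum_single)
qed

lemma mpoly_eval_cong:
  assumes "\<And>m v. m \<in> Poly_Mapping.keys p \<Longrightarrow> v \<in> Poly_Mapping.keys m \<Longrightarrow> \<sigma> v = \<tau> v"
  shows "mpoly_eval emb \<sigma> p = mpoly_eval emb \<tau> p"
  unfolding mpoly_eval_def using assms by (intro sum.cong refl arg_cong2[where f = "(*)"] prod.cong) auto

context coeff_hom
begin

lemma subst_mpoly_eval:
  assumes "\<And>v. sdef \<tau> (\<sigma> v)"
  shows "sdef \<tau> (mpoly_eval cst \<sigma> p)"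
    and "subst_into emb \<tau> (mpoly_eval cst \<sigma> p) = mpoly_eval emb (\<lambda>v. subst_into emb \<tau> (\<sigma> v)) p"
proof -
  have 1: "sdef \<tau> (rat.monom_eval \<sigma> m)" for m
    unfolding rat.monom_eval_def using assms by (intro sdef_prod sdef_power)
  have 2: "subst_into emb \<tau> (rat.monom_eval \<sigma> m) = monom_eval (\<lambda>v. subst_into emb \<tau> (\<sigma> v)) m" for m
    unfolding rat.monom_eval_def monom_eval_def using assms by (subst subst_prod) (auto intro: sdef_power simp: subst_power)
  have 3: "mpoly_eval cst \<sigma> p = (\<Sum>m\<in>Poly_Mapping.keys p. cst (Poly_Mapping.lookup p m) * rat.monom_eval \<sigma> m)"
    by (rule rat.mpoly_eval_superset) auto
  show "sdef \<tau> (mpoly_eval cst \<sigma> p)" unfolding 3 by (intro sdef_sum sdef_mult sdef_cst 1)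
  have "subst_into emb \<tau> (mpoly_eval cst \<sigma> p) = (\<Sum>m\<in>Poly_Mapping.keys p. emb (Poly_Mapping.lookup p m) * monom_eval (\<lambda>v. subst_into emb \<tau> (\<sigma> v)) m)"
    unfolding 3 by (subst subst_sum) (auto simp: subst_mult 1 2)
  then show "subst_into emb \<tau> (mpoly_eval cst \<sigma> p) = mpoly_eval emb (\<lambda>v. subst_into emb \<tau> (\<sigma> v)) p"
    by (subst mpoly_eval_superset[of "Poly_Mapping.keys p"]) auto
qed

end

text \<open>A substitution that fixes the variables in S does not change such a denominator, so it
  is defined on all of \<open>dens S\<close>, whatever it does to the variables of the
  numerator.\<close>

definition dens :: "var set \<Rightarrow> ratf set" where
  "dens S = {Fraction_Field.Fract a b | a b. b \<noteq> 0 \<and> Fraction_Field.Fract b 1 \<in> polys S}"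

lemma Fract1_inject: "Fraction_Field.Fract a (1::mpoly) = Fraction_Field.Fract b 1 \<longleftrightarrow> a = b"
  by (simp add: eq_fract)

lemma Fract1_eq_0: "Fraction_Field.Fract a (1::mpoly) = 0 \<longleftrightarrow> a = 0"
  by (simp add: Zero_fract_def eq_fract)

lemma poly_in_polys_iff: "Fraction_Field.Fract b 1 \<in> polys S \<longleftrightarrow> (\<forall>m\<in>Poly_Mapping.keys b. Poly_Mapping.keys m \<subseteq> S)"
  unfolding polys_def by (auto simp: Fract1_inject)

lemma mpoly_eval_fixed:
  assumes "Fraction_Field.Fract b 1 \<in> polys S" "\<And>v. v \<in> S \<Longrightarrow> \<sigma> v = X v"
  shows "mpoly_eval cst \<sigma> b = Fraction_Field.Fract b 1"
  unfolding mpoly_eval_X[symmetric]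
  using assms by (intro mpoly_eval_cong) (auto simp: poly_in_polys_iff)

lemma dens_sdef:
  assumes "f \<in> dens S" "\<And>v. v \<in> S \<Longrightarrow> \<sigma> v = X v"
  shows "rat.sdef \<sigma> f"
proof -
  obtain a b where ab: "f = Fraction_Field.Fract a b" "b \<noteq> 0" "Fraction_Field.Fract b 1 \<in> polys S"
    using assms(1) by (auto simp: dens_def)
  then show ?thesis using mpoly_eval_fixed[OF ab(3) assms(2)]
    by (metis rat.sdef_FractI Fract1_eq_0)
qed

lemma dens_subst_comp:
  assumes "f \<in> dens S" "\<And>v. v \<in> S \<Longrightarrow> \<sigma> v = X v" "\<And>v. v \<in> S \<Longrightarrow> \<tau> v = X v" "\<And>v. rat.sdef \<tau> (\<sigma> v)"
  shows "subst \<tau> (subst \<sigma> f) = subst (\<lambda>v. subst \<tau> (\<sigma> v)) f"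
proof -
  obtain a b where ab: "f = Fraction_Field.Fract a b" "b \<noteq> 0" "Fraction_Field.Fract b 1 \<in> polys S"
    using assms(1) by (auto simp: dens_def)
  have 1: "mpoly_eval cst \<sigma> b = Fraction_Field.Fract b 1" "mpoly_eval cst \<tau> b = Fraction_Field.Fract b 1"
    "mpoly_eval cst (\<lambda>v. subst \<tau> (\<sigma> v)) b = Fraction_Field.Fract b 1"
    using assms(2,3) by (auto intro!: mpoly_eval_fixed[OF ab(3)])
  have nz: "Fraction_Field.Fract b 1 \<noteq> 0" using ab by (simp add: Fract1_eq_0)
  have "subst \<sigma> f = mpoly_eval cst \<sigma> a / Fraction_Field.Fract b 1"
    unfolding ab(1) using nz 1 by (subst rat.subst_into_Fract) auto
  also have "subst \<tau> \<dots> = subst \<tau> (mpoly_eval cst \<sigma> a) / subst \<tau> (Fraction_Field.Fract b 1)"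
    using nz 1 by (intro rat.subst_divide rat.subst_mpoly_eval assms(4)) auto
  also have "\<dots> = mpoly_eval cst (\<lambda>v. subst \<tau> (\<sigma> v)) a / mpoly_eval cst (\<lambda>v. subst \<tau> (\<sigma> v)) b"
    using assms(4) 1 by (simp add: rat.subst_mpoly_eval)
  also have "\<dots> = subst (\<lambda>v. subst \<tau> (\<sigma> v)) f"
    unfolding ab(1) using nz 1 by (subst rat.subst_into_Fract) auto
  finally show ?thesis .
qed

section \<open>Subrings of the field of rational functions\<close>

definition is_subring :: "ratf set \<Rightarrow> bool" where
  "is_subring R \<longleftrightarrow> 0 \<in> R \<and> 1 \<in> R \<and> (\<forall>a\<in>R. \<forall>b\<in>R. a + b \<in> R \<and> a * b \<in> R \<and> a - b \<in> R)"

lemma is_subringI: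
  assumes "1 \<in> R" "\<And>a b. a \<in> R \<Longrightarrow> b \<in> R \<Longrightarrow> a + b \<in> R" "\<And>a b. a \<in> R \<Longrightarrow> b \<in> R \<Longrightarrow> a * b \<in> R" "- 1 \<in> R"
  shows "is_subring R"
proof -
  have 1: "- b \<in> R" if "b \<in> R" for b using assms(3)[OF assms(4) that] by simp
  have 2: "a - b \<in> R" if "a \<in> R" "b \<in> R" for a b using assms(2)[OF that(1) 1[OF that(2)]] by simp
  then show ?thesis unfolding is_subring_def using assms 2[OF assms(1) assms(1)] by auto
qed

context
  fixes R :: "ratf set" assumes R: "is_subring R"
begin
lemma is_subring_0: "0 \<in> R" and is_subring_1: "1 \<in> R" using R by (auto simp: is_subring_def)
lemma is_subring_add: "a \<in> R \<Longrightarrow> b \<in> R \<Longrightarrow> a + b \<in> R" using R by (auto simp: is_subring_def)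
lemma is_subring_mult: "a \<in> R \<Longrightarrow> b \<in> R \<Longrightarrow> a * b \<in> R" using R by (auto simp: is_subring_def)
lemma is_subring_diff: "a \<in> R \<Longrightarrow> b \<in> R \<Longrightarrow> a - b \<in> R" using R by (auto simp: is_subring_def)
lemma is_subring_uminus: "a \<in> R \<Longrightarrow> - a \<in> R" using is_subring_diff[OF is_subring_0] by simp
lemma is_subring_sum: "(\<And>i. i \<in> A \<Longrightarrow> f i \<in> R) \<Longrightarrow> (\<Sum>i\<in>A. f i) \<in> R"
  by (induction A rule: infinite_finite_induct) (auto intro: is_subring_0 is_subring_add)
lemma is_subring_prod: "(\<And>i. i \<in> A \<Longrightarrow> f i \<in> R) \<Longrightarrow> (\<Prod>i\<in>A. f i) \<in> R"
  by (induction A rule: infinite_finite_induct) (auto intro: is_subring_1 is_subring_mult)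
lemma is_subring_power: "a \<in> R \<Longrightarrow> a ^ n \<in> R"
  by (induction n) (auto intro: is_subring_1 is_subring_mult)
lemma is_subring_of_nat: "of_nat n \<in> R"
  by (induction n) (auto intro: is_subring_0 is_subring_1 is_subring_add)
lemma is_subring_of_int: "of_int n \<in> R"
  by (cases n) (simp_all only: of_int_minus of_int_of_nat_eq is_subring_of_nat is_subring_uminus)
end

lemmas is_subring_intros = is_subring_0 is_subring_1 is_subring_add is_subring_mult is_subring_diff is_subring_uminus is_subring_sum is_subring_prod is_subring_power is_subring_of_nat is_subring_of_int

lemma cst_uminus_1: "cst (- 1) = - 1"
  by (rule rat.cst_uminus_1)

lemma polys_mono: "S \<subseteq> S' \<Longrightarrow> polys S \<subseteq> polys S'"
  unfolding polys_def by fastforce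

lemma cst_in_polys [simp]: "cst c \<in> polys S"
  by (auto simp: cst_def poly_in_polys_iff)

lemma X_in_polys [simp]: "X v \<in> polys S \<longleftrightarrow> v \<in> S"
  by (auto simp: X_def poly_in_polys_iff)

lemma polys_is_subring: "is_subring (polys S)"
proof (rule is_subringI)
  show "1 \<in> polys S" using cst_in_polys[of 1 S] by simp
  show "- 1 \<in> polys S" using cst_in_polys[of "- 1" S] by (simp add: cst_uminus_1)
  fix a b assume "a \<in> polys S" "b \<in> polys S"
  then obtain p q where pq: "a = Fraction_Field.Fract p 1" "b = Fraction_Field.Fract q 1"
    "\<forall>m\<in>Poly_Mapping.keys p. Poly_Mapping.keys m \<subseteq> S" "\<forall>m\<in>Poly_Mapping.keys q. Poly_Mapping.keys m \<subseteq> S"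
    by (auto simp: polys_def)
  have "\<forall>m\<in>Poly_Mapping.keys (p + q). Poly_Mapping.keys m \<subseteq> S" using keys_add[of p q] pq by blast
  then show "a + b \<in> polys S" unfolding pq by (simp add: poly_in_polys_iff)
  have "Poly_Mapping.keys m \<subseteq> S" if "m \<in> Poly_Mapping.keys (p * q)" for m
  proof -
    obtain m1 m2 where "m = m1 + m2" "m1 \<in> Poly_Mapping.keys p" "m2 \<in> Poly_Mapping.keys q"
      using keys_mult[of p q] \<open>m \<in> _\<close> by auto
    then show ?thesis using keys_add[of m1 m2] pq by blast
  qed
  then show "a * b \<in> polys S" unfolding pq by (simp add: poly_in_polys_iff)
qed

lemma polys_induct [consumes 1, case_names cst X add mult]:
  assumes "f \<in> polys S" and c: "\<And>c. P (cst c)" and x: "\<And>v. v \<in> S \<Longrightarrow> P (X v)"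
    and a: "\<And>f g. f \<in> polys S \<Longrightarrow> g \<in> polys S \<Longrightarrow> P f \<Longrightarrow> P g \<Longrightarrow> P (f + g)"
    and m: "\<And>f g. f \<in> polys S \<Longrightarrow> g \<in> polys S \<Longrightarrow> P f \<Longrightarrow> P g \<Longrightarrow> P (f * g)"
  shows "P f"
proof -
  obtain p where p: "f = Fraction_Field.Fract p 1" "\<forall>m\<in>Poly_Mapping.keys p. Poly_Mapping.keys m \<subseteq> S"
    using assms(1) by (auto simp: polys_def)
  let ?Q = "\<lambda>f. f \<in> polys S \<and> P f"
  have pw: "?Q (X v ^ k)" if "v \<in> S" for v k
    by (induction k) (use c[of 1] is_subring_1[OF polys_is_subring] in \<open>auto intro!: m x that is_subring_mult[OF polys_is_subring] is_subring_power[OF polys_is_subring]\<close>)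
  have mo: "?Q (\<Prod>v\<in>A. X v ^ k v)" if "A \<subseteq> S" for A k
    using that by (induction A rule: infinite_finite_induct)
      (use c[of 1] is_subring_1[OF polys_is_subring] pw in \<open>auto intro!: m is_subring_mult[OF polys_is_subring]\<close>)
  have su: "?Q (\<Sum>i\<in>A. g i)" if "\<And>i. i \<in> A \<Longrightarrow> ?Q (g i)" for A and g :: "(var \<Rightarrow>\<^sub>0 nat) \<Rightarrow> ratf"
    using that by (induction A rule: infinite_finite_induct)
      (use c[of 0] is_subring_0[OF polys_is_subring] in \<open>auto intro!: a is_subring_add[OF polys_is_subring]\<close>)
  have "?Q f" unfolding p(1) mpoly_eval_X[symmetric] mpoly_eval_def
    by (rule su) (use mo p(2) c in \<open>auto intro!: m is_subring_mult[OF polys_is_subring]\<close>)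
  then show ?thesis ..
qed

lemma polys_subset:
  assumes "is_subring R" "\<And>c. cst c \<in> R" "\<And>v. v \<in> S \<Longrightarrow> X v \<in> R"
  shows "polys S \<subseteq> R"
proof
  fix f assume "f \<in> polys S" then show "f \<in> R"
    by (induction rule: polys_induct) (auto intro: assms is_subring_intros[OF assms(1)])
qed

lemma (in coeff_hom) sdef_polys: "f \<in> polys S \<Longrightarrow> sdef \<sigma> f"
  by (auto simp: polys_def)

lemma polys_subst:
  assumes "f \<in> polys S" "is_subring R" "\<And>c. cst c \<in> R" "\<And>v. v \<in> S \<Longrightarrow> \<sigma> v \<in> R"
  shows "subst \<sigma> f \<in> R"
  using assms(1)
  by (induction rule: polys_induct)
    (auto simp: assms rat.subst_add rat.subst_mult rat.sdef_polys intro: is_subring_intros[OF assms(2)])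

lemma subst_fixed_polys:
  assumes "f \<in> polys S" "\<And>v. v \<in> S \<Longrightarrow> \<sigma> v = X v"
  shows "subst \<sigma> f = f"
  using assms(1)
  by (induction rule: polys_induct) (auto simp: assms rat.subst_add rat.subst_mult rat.sdef_polys)

lemma polys_subst_cong:
  assumes "f \<in> polys S" "\<And>v. v \<in> S \<Longrightarrow> \<sigma> v = \<tau> v"
  shows "subst \<sigma> f = subst \<tau> f"
  using assms(1)
  by (induction rule: polys_induct) (auto simp: assms rat.subst_add rat.subst_mult rat.sdef_polys)

lemma ratfuns_polys: "polys S \<subseteq> ratfuns S"
  unfolding ratfuns_def using is_subring_1[OF polys_is_subring[of S]] by force

lemma ratfuns_mono: "S \<subseteq> S' \<Longrightarrow> ratfuns S \<subseteq> ratfuns S'"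
  unfolding ratfuns_def using polys_mono[of S S'] by fastforce

lemma ratfuns_is_subring: "is_subring (ratfuns S)"
proof (rule is_subringI)
  note P = is_subring_intros[OF polys_is_subring[of S]]
  show "1 \<in> ratfuns S" using ratfuns_polys P(2) by blast
  show "- 1 \<in> ratfuns S" using ratfuns_polys P(2,6) by blast
  fix a b assume "a \<in> ratfuns S" "b \<in> ratfuns S"
  then obtain f g f' g' where *: "a = f / g" "b = f' / g'" "f \<in> polys S" "g \<in> polys S" "g \<noteq> 0"
     "f' \<in> polys S" "g' \<in> polys S" "g' \<noteq> 0" by (auto simp: ratfuns_def)
  have "a + b = (f * g' + f' * g) / (g * g')" "a * b = (f * f') / (g * g')" using * by (simp_all add: add_frac_eq)
  moreover have "f * g' + f' * g \<in> polys S" "f * f' \<in> polys S" "g * g' \<in> polys S" "g * g' \<noteq> 0" using * P by auto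
  ultimately show "a + b \<in> ratfuns S" "a * b \<in> ratfuns S" unfolding ratfuns_def by blast+
qed

lemma ratfuns_inverse: "a \<in> ratfuns S \<Longrightarrow> inverse a \<in> ratfuns S"
proof -
  assume "a \<in> ratfuns S"
  then obtain f g where *: "a = f / g" "f \<in> polys S" "g \<in> polys S" "g \<noteq> 0" by (auto simp: ratfuns_def)
  show ?thesis
  proof (cases "a = 0")
    case True then show ?thesis using is_subring_0[OF ratfuns_is_subring] by simp
  next
    case False
    then have "inverse a = g / f" "f \<noteq> 0" using * by auto
    then show ?thesis using * unfolding ratfuns_def by blast
  qed
qed

lemma ratfuns_divide: "a \<in> ratfuns S \<Longrightarrow> b \<in> ratfuns S \<Longrightarrow> a / b \<in> ratfuns S"
  unfolding divide_inverse by (intro is_subring_mult[OF ratfuns_is_subring] ratfuns_inverse)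

lemma X_in_ratfuns: "v \<in> S \<Longrightarrow> X v \<in> ratfuns S"
  by (rule subsetD[OF ratfuns_polys]) simp

lemma subst_fixed_ratfuns:
  assumes "f \<in> ratfuns S" "\<And>v. v \<in> S \<Longrightarrow> \<sigma> v = X v"
  shows "rat.sdef \<sigma> f" "subst \<sigma> f = f"
proof -
  obtain a b where ab: "f = a / b" "a \<in> polys S" "b \<in> polys S" "b \<noteq> 0" using assms(1) by (auto simp: ratfuns_def)
  have s: "subst \<sigma> a = a" "subst \<sigma> b = b" using ab assms(2) by (auto intro: subst_fixed_polys)
  show "rat.sdef \<sigma> f" "subst \<sigma> f = f" unfolding ab(1)
    using ab s by (auto simp: rat.sdef_polys rat.subst_divide intro!: rat.sdef_divide)
qed

subsection \<open>Everywhere defined substitutions\<close>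

context coeff_hom
begin

text \<open>Injectivity on polynomials: no denominator can become zero, so the substitution is
  defined on the whole field.\<close>

definition total :: "(var \<Rightarrow> 'b) \<Rightarrow> bool" where
  "total \<sigma> \<longleftrightarrow> (\<forall>p. p \<noteq> 0 \<longrightarrow> mpoly_eval emb \<sigma> p \<noteq> 0)"

lemma total_sdef: "total \<sigma> \<Longrightarrow> sdef \<sigma> f"
  by (cases f) (auto simp: total_def intro: sdef_FractI)

lemma total_subst_eq_0: "total \<sigma> \<Longrightarrow> subst_into emb \<sigma> f = 0 \<longleftrightarrow> f = 0"
proof
  assume t: "total \<sigma>" and 0: "subst_into emb \<sigma> f = 0"
  obtain a b where ab: "f = Fraction_Field.Fract a b" "mpoly_eval emb \<sigma> b \<noteq> 0" "b \<noteq> 0"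
    "subst_into emb \<sigma> f = mpoly_eval emb \<sigma> a / mpoly_eval emb \<sigma> b" by (rule sdefE[OF total_sdef[OF t]])
  then have "a = 0" using t 0 by (auto simp: total_def)
  then show "f = 0" using ab by (simp add: Zero_fract_def eq_fract)
qed simp

lemma total_divide: "total \<sigma> \<Longrightarrow> subst_into emb \<sigma> (f / g) = subst_into emb \<sigma> f / subst_into emb \<sigma> g"
  using subst_divide[OF total_sdef total_sdef] total_subst_eq_0[of \<sigma> g] by (cases "g = 0") auto

lemma subst_comp:
  assumes "rat.sdef \<sigma> f" "total \<tau>"
  shows "subst_into emb \<tau> (subst \<sigma> f) = subst_into emb (\<lambda>v. subst_into emb \<tau> (\<sigma> v)) f"
proof -
  obtain a b where ab: "f = Fraction_Field.Fract a b" "mpoly_eval cst \<sigma> b \<noteq> 0" "b \<noteq> 0"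
    "subst \<sigma> f = mpoly_eval cst \<sigma> a / mpoly_eval cst \<sigma> b" by (rule rat.sdefE[OF assms(1)])
  note e = subst_mpoly_eval(2)[of \<tau> \<sigma>, OF total_sdef[OF assms(2)]]
  have "mpoly_eval emb (\<lambda>v. subst_into emb \<tau> (\<sigma> v)) b \<noteq> 0"
    using ab(2) total_subst_eq_0[OF assms(2), of "mpoly_eval cst \<sigma> b"] e[of b] by simp
  then show ?thesis
    unfolding ab(4) unfolding ab(1) by (subst subst_into_Fract) (simp_all add: total_divide[OF assms(2)] e)
qed

end

text \<open>A polynomial in the kernel of the first substitution would be in the kernel of the
  composite, which is the identity.\<close>

lemma total_if_left_inverse:
  assumes "\<And>v. rat.sdef \<tau> (\<sigma> v)" "\<And>v. subst \<tau> (\<sigma> v) = X v"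
  shows "rat.total \<sigma>"
  unfolding rat.total_def
proof safe
  fix p :: mpoly assume "p \<noteq> 0" "mpoly_eval cst \<sigma> p = 0"
  then have "subst \<tau> (mpoly_eval cst \<sigma> p) = 0" by simp
  then have "mpoly_eval cst X p = 0" using rat.subst_mpoly_eval(2)[of \<tau> \<sigma> p] assms by simp
  then show False using \<open>p \<noteq> 0\<close> by (simp add: mpoly_eval_X Fract1_eq_0)
qed

lemma subst_X_id: "subst X f = f"
proof -
  have "rat.total X" by (rule total_if_left_inverse[of X X]) simp_all
  then obtain a b where ab: "f = Fraction_Field.Fract a b" "mpoly_eval cst X b \<noteq> 0" "b \<noteq> 0"
    "subst X f = mpoly_eval cst X a / mpoly_eval cst X b" by (metis rat.sdefE rat.total_sdef)
  then show ?thesis by (simp add: mpoly_eval_X)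
qed

lemma shift_total: "rat.total (\<lambda>v. if v = VLam then lam + of_int m * yy else X v)"
  by (rule total_if_left_inverse[of "\<lambda>v. if v = VLam then lam - of_int m * yy else X v"])
    (simp_all add: rat.subst_add rat.subst_diff rat.subst_mult)

lemma shift_add: "shift m (f + g) = shift m f + shift m g"
  and shift_mult: "shift m (f * g) = shift m f * shift m g"
  and shift_diff: "shift m (f - g) = shift m f - shift m g"
  and shift_uminus: "shift m (- f) = - shift m f"
  and shift_divide: "shift m (f / g) = shift m f / shift m g"
  and shift_sum: "shift m (\<Sum>i\<in>A. h i) = (\<Sum>i\<in>A. shift m (h i))"
  and shift_prod: "shift m (\<Prod>i\<in>A. h i) = (\<Prod>i\<in>A. shift m (h i))"
  and shift_power: "shift m (f ^ k) = shift m f ^ k"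
  and shift_0 [simp]: "shift m 0 = 0" and shift_1 [simp]: "shift m 1 = 1"
  and shift_of_int [simp]: "shift m (of_int j) = of_int j"
  and shift_cst [simp]: "shift m (cst c) = cst c"
  and shift_eq_0: "shift m f = 0 \<longleftrightarrow> f = 0"
  using rat.total_sdef[OF shift_total]
  unfolding shift_def
  by (simp_all add: rat.subst_add rat.subst_mult rat.subst_diff rat.subst_uminus rat.subst_sum rat.subst_prod
      rat.subst_power rat.total_divide[OF shift_total] rat.total_subst_eq_0[OF shift_total])

lemma shift_X: "shift m (X v) = (if v = VLam then lam + of_int m * yy else X v)"
  by (simp add: shift_def)

lemma shift_shift: "shift m (shift m' f) = shift (m + m') f"
proof -
  have "subst (\<lambda>v. if v = VLam then lam + of_int m * yy else X v) (subst (\<lambda>v. if v = VLam then lam + of_int m' * yy else X v) f)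
    = subst (\<lambda>v. subst (\<lambda>v. if v = VLam then lam + of_int m * yy else X v) (if v = VLam then lam + of_int m' * yy else X v)) f"
    by (rule rat.subst_comp[OF rat.total_sdef[OF shift_total] shift_total])
  also have "(\<lambda>v. subst (\<lambda>v. if v = VLam then lam + of_int m * yy else X v) (if v = VLam then lam + of_int m' * yy else X v))
     = (\<lambda>v. if v = VLam then lam + of_int (m + m') * yy else X v)"
    by (auto simp: fun_eq_iff rat.subst_add rat.subst_mult ring_distribs)
  finally show ?thesis unfolding shift_def .
qed

lemma shift_id [simp]: "shift 0 f = f"
proof -
  have "(\<lambda>v. if v = VLam then lam + of_int 0 * yy else X v) = X" by auto
  then show ?thesis unfolding shift_def using subst_X_id by metis
qed

lemma shift_fixed: "f \<in> ratfuns S \<Longrightarrow> VLam \<notin> S \<Longrightarrow> shift m f = f"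
  unfolding shift_def by (rule subst_fixed_ratfuns(2)[of f S]) auto

lemma X_inject [simp]: "X v = X v' \<longleftrightarrow> v = v'"
proof
  assume "X v = X v'"
  then have "subst (\<lambda>u. if u = v then 1 else 0) (X v) = subst (\<lambda>u. if u = v then 1 else 0) (X v')" by simp
  then show "v = v'" by (simp split: if_splits)
qed simp

lemma X_nonzero [simp]: "X v \<noteq> 0"
proof
  assume "X v = 0"
  then have "subst (\<lambda>u. 1) (X v) = 0" by simp
  then show False by simp
qed

subsection \<open>Coefficient rings\<close>

lemma lam_int_nonzero: "lam + of_int l * yy \<noteq> 0"
proof
  assume "lam + of_int l * yy = 0"
  then have "subst (\<lambda>v. if v = VLam then 1 else 0) (lam + of_int l * yy) = 0" by simp
  then show False by (simp add: rat.subst_add rat.subst_mult)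
qed

lemma prod_list_lam_nonzero: "(\<Prod>l\<leftarrow>ls. lam + of_int l * yy) \<noteq> 0"
  by (induction ls) (simp_all add: lam_int_nonzero)

lemma L_lam_yI: "f \<in> polys {VLam, VY} \<Longrightarrow> f / (\<Prod>l\<leftarrow>ls. lam + of_int l * yy) \<in> L_lam_y"
  unfolding L_lam_y_def by blast

lemma polys_L_lam_y: "polys {VLam, VY} \<subseteq> L_lam_y"
  using L_lam_yI[of _ "[]"] by auto

lemma L_lam_y_is_subring: "is_subring L_lam_y"
proof (rule is_subringI)
  note P = is_subring_intros[OF polys_is_subring[of "{VLam, VY}"]]
  show "1 \<in> L_lam_y" "- 1 \<in> L_lam_y" using polys_L_lam_y P(2) P(6)[OF P(2)] by blast+
  fix a b assume "a \<in> L_lam_y" "b \<in> L_lam_y"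
  then obtain f g ls ls' where *: "a = f / (\<Prod>l\<leftarrow>ls. lam + of_int l * yy)" "b = g / (\<Prod>l\<leftarrow>ls'. lam + of_int l * yy)"
     "f \<in> polys {VLam, VY}" "g \<in> polys {VLam, VY}" by (auto simp: L_lam_y_def)
  let ?p = "\<lambda>ls. \<Prod>l\<leftarrow>ls. lam + of_int l * yy"
  have pl: "?p ls \<in> polys {VLam, VY}" for ls by (induction ls) (auto intro!: P)
  have "a + b = (f * ?p ls' + g * ?p ls) / ?p (ls @ ls')" "a * b = (f * g) / ?p (ls @ ls')"
    unfolding * using prod_list_lam_nonzero[of ls] prod_list_lam_nonzero[of ls'] by (simp_all add: field_simps)
  then show "a + b \<in> L_lam_y" "a * b \<in> L_lam_y"
    using L_lam_yI[of "f * ?p ls' + g * ?p ls" "ls @ ls'"] L_lam_yI[of "f * g" "ls @ ls'"] pl *(3,4) P(3,4) by metis+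
qed

lemma prod_span_mult: "a \<in> A \<Longrightarrow> b \<in> B \<Longrightarrow> a * b \<in> prod_span A B"
  unfolding prod_span_def by (rule CollectI, rule exI[of _ 1], rule exI[of _ "\<lambda>_. a"], rule exI[of _ "\<lambda>_. b"]) auto

lemma prod_span_add:
  assumes "x \<in> prod_span A B" "x' \<in> prod_span A B"
  shows "x + x' \<in> prod_span A B"
proof -
  obtain N :: nat and a b where 1: "x = (\<Sum>i<N. a i * b i)" "\<forall>i<N. a i \<in> A" "\<forall>i<N. b i \<in> B"
    using assms(1) by (auto simp: prod_span_def)
  obtain N' :: nat and a' b' where 2: "x' = (\<Sum>i<N'. a' i * b' i)" "\<forall>i<N'. a' i \<in> A" "\<forall>i<N'. b' i \<in> B"
    using assms(2) by (auto simp: prod_span_def)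
  have s: "(\<Sum>i<N + M. f i) = (\<Sum>i<N. f i) + (\<Sum>i<M. f (N + i))" for M and f :: "nat \<Rightarrow> ratf"
    by (induction M) (simp_all add: add.assoc)
  let ?a = "\<lambda>i. if i < N then a i else a' (i - N)" and ?b = "\<lambda>i. if i < N then b i else b' (i - N)"
  have "x + x' = (\<Sum>i<N + N'. ?a i * ?b i)" unfolding 1(1) 2(1) s by simp
  moreover have "\<forall>i<N + N'. ?a i \<in> A" "\<forall>i<N + N'. ?b i \<in> B" using 1 2 by simp_all
  ultimately have "x + x' = (\<Sum>i<N + N'. ?a i * ?b i) \<and> (\<forall>i<N + N'. ?a i \<in> A) \<and> (\<forall>i<N + N'. ?b i \<in> B)"
    by (rule conjI[OF _ conjI])
  then show ?thesis unfolding prod_span_def mem_Collect_eq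
    by (rule exI[of _ "N + N'", OF exI[of _ ?a, OF exI[of _ ?b]]])
qed

lemma prod_span_0: "0 \<in> prod_span A B"
  unfolding prod_span_def by (rule CollectI, rule exI[of _ 0]) auto

lemma prod_span_sum: "(\<And>i. i \<in> I \<Longrightarrow> f i \<in> prod_span A B) \<Longrightarrow> (\<Sum>i\<in>I. f i) \<in> prod_span A B"
  by (induction I rule: infinite_finite_induct) (auto intro: prod_span_add prod_span_0)

lemma prod_span_induct [consumes 1, case_names zero mult add]:
  assumes "x \<in> prod_span A B" "P 0" "\<And>a b. a \<in> A \<Longrightarrow> b \<in> B \<Longrightarrow> P (a * b)"
    "\<And>x y. x \<in> prod_span A B \<Longrightarrow> y \<in> prod_span A B \<Longrightarrow> P x \<Longrightarrow> P y \<Longrightarrow> P (x + y)"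
  shows "P x"
proof -
  obtain N :: nat and a b where 1: "x = (\<Sum>i<N. a i * b i)" "\<forall>i<N. a i \<in> A" "\<forall>i<N. b i \<in> B"
    using assms(1) by (auto simp: prod_span_def)
  have "(\<Sum>i<M. a i * b i) \<in> prod_span A B \<and> P (\<Sum>i<M. a i * b i)" if "M \<le> N" for M
    using that
  proof (induction M)
    case 0 then show ?case using assms(2) by (simp add: prod_span_0)
  next
    case (Suc M)
    then have "a M \<in> A" "b M \<in> B" using 1 by auto
    then show ?case using Suc assms(3,4) prod_span_mult[of "a M" A "b M" B] prod_span_add by auto
  qed
  then show ?thesis unfolding 1(1) by blast
qed

lemma prod_span_is_subring:
  assumes "is_subring A" "is_subring B"
  shows "is_subring (prod_span A B)"
proof (rule is_subringI)
  note A = is_subring_intros[OF assms(1)] and B = is_subring_intros[OF assms(2)]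
  show "1 \<in> prod_span A B" using prod_span_mult[OF A(2) B(2)] by simp
  show "- 1 \<in> prod_span A B" using prod_span_mult[OF A(6)[OF A(2)] B(2)] by simp
  show "x + y \<in> prod_span A B" if "x \<in> prod_span A B" "y \<in> prod_span A B" for x y
    using that by (rule prod_span_add)
  fix x y assume "x \<in> prod_span A B" and y: "y \<in> prod_span A B"
  then show "x * y \<in> prod_span A B"
  proof (induction x rule: prod_span_induct)
    case (mult a b)
    show ?case using y
    proof (induction y rule: prod_span_induct)
      case (mult a' b')
      have "a * b * (a' * b') = (a * a') * (b * b')" by (simp add: mult_ac)
      then show ?case using prod_span_mult[of "a * a'" A "b * b'" B] mult \<open>a \<in> A\<close> \<open>b \<in> B\<close> A(4) B(4) by metis
    qed (auto intro: prod_span_0 prod_span_add simp: distrib_left)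
  qed (auto intro: prod_span_0 prod_span_add simp: distrib_right)
qed

lemma prod_span_left: "1 \<in> B \<Longrightarrow> A \<subseteq> prod_span A B" and prod_span_right: "1 \<in> A \<Longrightarrow> B \<subseteq> prod_span A B"
  using prod_span_mult[of _ A 1 B] prod_span_mult[of 1 A _ B] by auto

lemma prod_span_subset: "is_subring R \<Longrightarrow> A \<subseteq> R \<Longrightarrow> B \<subseteq> R \<Longrightarrow> prod_span A B \<subseteq> R"
proof
  fix x assume "is_subring R" "A \<subseteq> R" "B \<subseteq> R" "x \<in> prod_span A B"
  from this(4) show "x \<in> R" by (induction rule: prod_span_induct)
     (use \<open>is_subring R\<close> \<open>A \<subseteq> R\<close> \<open>B \<subseteq> R\<close> in \<open>auto intro: is_subring_intros\<close>)
qed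

lemma L_zy_is_subring: "is_subring (L_zy n)"
  unfolding L_zy_def by (rule ratfuns_is_subring)

lemma L_is_subring: "is_subring (L_lam_zy n)"
  unfolding L_lam_zy_def by (intro prod_span_is_subring L_lam_y_is_subring L_zy_is_subring)

lemma L_lam_y_L: "L_lam_y \<subseteq> L_lam_zy n" and L_zy_L: "L_zy n \<subseteq> L_lam_zy n"
  unfolding L_lam_zy_def using is_subring_1[OF L_lam_y_is_subring] is_subring_1[OF L_zy_is_subring]
  by (simp_all add: prod_span_left prod_span_right)

lemma polys_lam_y_zy: "polys (insert VLam (VZ ` {1..n} \<union> {VY})) \<subseteq> L_lam_zy n"
proof (rule polys_subset[OF L_is_subring])
  show "cst c \<in> L_lam_zy n" for c
    by (rule subsetD[OF L_lam_y_L], rule subsetD[OF polys_L_lam_y], rule cst_in_polys)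
  fix v assume v: "v \<in> insert VLam (VZ ` {1..n} \<union> {VY})"
  show "X v \<in> L_lam_zy n"
  proof (cases "v = VLam")
    case True
    then show ?thesis by (intro subsetD[OF L_lam_y_L] subsetD[OF polys_L_lam_y]) simp
  next
    case False
    then show ?thesis using v by (intro subsetD[OF L_zy_L]) (simp add: L_zy_def X_in_ratfuns)
  qed
qed

lemma cst_L: "cst c \<in> L_lam_zy n" and lam_L: "lam \<in> L_lam_zy n" and yy_L: "yy \<in> L_lam_zy n"
  and zz_L: "i \<in> {1..n} \<Longrightarrow> zz i \<in> L_lam_zy n"
proof -
  have "cst c \<in> polys (insert VLam (VZ ` {1..n} \<union> {VY}))" "lam \<in> polys (insert VLam (VZ ` {1..n} \<union> {VY}))"
    "yy \<in> polys (insert VLam (VZ ` {1..n} \<union> {VY}))" "i \<in> {1..n} \<Longrightarrow> zz i \<in> polys (insert VLam (VZ ` {1..n} \<union> {VY}))"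
    by simp_all
  then show "cst c \<in> L_lam_zy n" "lam \<in> L_lam_zy n" "yy \<in> L_lam_zy n" "i \<in> {1..n} \<Longrightarrow> zz i \<in> L_lam_zy n"
    using polys_lam_y_zy[of n] by blast+
qed

lemma inverse_lam_L: "inverse (lam + of_int l * yy) \<in> L_lam_zy n"
proof -
  have "1 / (lam + of_int l * yy) \<in> L_lam_y"
    using L_lam_yI[of 1 "[l]"] is_subring_1[OF polys_is_subring] by simp
  then show ?thesis using subsetD[OF L_lam_y_L[of n]] unfolding divide_inverse mult_1_left by blast
qed

lemma inverse_L_zy: "a \<in> L_zy n \<Longrightarrow> inverse a \<in> L_lam_zy n"
  using ratfuns_inverse[of a "VZ ` {1..n} \<union> {VY}"] L_zy_L[of n] unfolding L_zy_def by (meson subsetD)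

text \<open>The shift permutes the linear factors \<open>lam + of_int l * yy\<close> that are
  allowed in denominators, since l runs over all integers, and it fixes everything in z and
  y.\<close>

lemma L_shift: "f \<in> L_lam_zy n \<Longrightarrow> shift m f \<in> L_lam_zy n"
  unfolding L_lam_zy_def
proof (induction rule: prod_span_induct)
  case (mult a b)
  obtain f ls where f: "a = f / (\<Prod>l\<leftarrow>ls. lam + of_int l * yy)" "f \<in> polys {VLam, VY}"
    using mult(1) by (auto simp: L_lam_y_def)
  have "shift m (\<Prod>l\<leftarrow>ls. lam + of_int l * yy) = (\<Prod>l\<leftarrow>map ((+) m) ls. lam + of_int l * yy)"
    by (induction ls) (simp_all add: shift_add shift_mult shift_X ring_distribs)
  moreover have "shift m f \<in> polys {VLam, VY}"
    unfolding shift_def by (rule polys_subst[OF f(2) polys_is_subring]) (auto intro!: is_subring_intros[OF polys_is_subring])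
  ultimately have "shift m a \<in> L_lam_y" unfolding f shift_divide using L_lam_yI by metis
  moreover have "shift m b = b" using mult(2) unfolding L_zy_def by (rule shift_fixed) auto
  ultimately show ?case using prod_span_mult[OF _ mult(2)] by (simp add: shift_mult)
next
  case zero then show ?case by (simp add: prod_span_0)
next
  case (add x y)
  then show ?case by (simp add: prod_span_add shift_add)
qed

lemma L_ratfuns: "L_lam_zy n \<subseteq> ratfuns (insert VLam (VZ ` {1..n} \<union> {VY}))"
  unfolding L_lam_zy_def
proof (rule prod_span_subset[OF ratfuns_is_subring])
  let ?S = "insert VLam (VZ ` {1..n} \<union> {VY})"
  show "L_zy n \<subseteq> ratfuns ?S" unfolding L_zy_def by (rule ratfuns_mono) auto
  show "L_lam_y \<subseteq> ratfuns ?S"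
  proof
    fix a assume "a \<in> L_lam_y"
    then obtain f ls where f: "a = f / (\<Prod>l\<leftarrow>ls. lam + of_int l * yy)" "f \<in> polys {VLam, VY}"
      by (auto simp: L_lam_y_def)
    have "(\<Prod>l\<leftarrow>ls. lam + of_int l * yy) \<in> polys {VLam, VY}" for ls
      by (induction ls) (auto intro!: is_subring_intros[OF polys_is_subring])
    then have "a \<in> ratfuns {VLam, VY}" unfolding f(1) using f(2) ratfuns_polys by (intro ratfuns_divide) auto
    then show "a \<in> ratfuns ?S" using ratfuns_mono[of "{VLam, VY}" ?S] by auto
  qed
qed

lemma C_y_inv_is_subring: "is_subring C_y_inv"
proof (rule is_subringI)
  note P = is_subring_intros[OF polys_is_subring[of "{VY}"]]
  have p: "f \<in> polys {VY} \<Longrightarrow> f \<in> C_y_inv" for f unfolding C_y_inv_def by (rule CollectI, rule exI[of _ f], rule exI[of _ 0]) simp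
  show "1 \<in> C_y_inv" "- 1 \<in> C_y_inv" using p P(2) P(6)[OF P(2)] by auto
  have y: "yy \<noteq> 0" by simp
  fix a b assume "a \<in> C_y_inv" "b \<in> C_y_inv"
  then obtain f g m m' where *: "a = f / yy ^ m" "b = g / yy ^ m'" "f \<in> polys {VY}" "g \<in> polys {VY}" by (auto simp: C_y_inv_def)
  have "a + b = (f * yy ^ m' + g * yy ^ m) / yy ^ (m + m')" "a * b = (f * g) / yy ^ (m + m')"
    unfolding * using y by (simp_all add: field_simps power_add)
  moreover have "f * yy ^ m' + g * yy ^ m \<in> polys {VY}" "f * g \<in> polys {VY}" using *(3,4) by (auto intro!: P)
  ultimately show "a + b \<in> C_y_inv" "a * b \<in> C_y_inv" unfolding C_y_inv_def by blast+
qed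

lemma polys_y_C: "polys {VY} \<subseteq> C_y_inv"
proof
  fix f assume "f \<in> polys {VY}" then show "f \<in> C_y_inv" unfolding C_y_inv_def by (intro CollectI exI[of _ f] exI[of _ 0]) simp
qed

lemma inverse_y_C: "inverse yy \<in> C_y_inv"
  unfolding C_y_inv_def using is_subring_1[OF polys_is_subring] by (auto intro!: exI[of _ 1] exI[of _ "1::nat"] simp: divide_inverse)

lemma C_y_inv_ratfuns: "C_y_inv \<subseteq> ratfuns {VY}"
proof
  fix a assume "a \<in> C_y_inv"
  then obtain f m where f: "a = f / yy ^ m" "f \<in> polys {VY}" by (auto simp: C_y_inv_def)
  show "a \<in> ratfuns {VY}" unfolding f(1) using f(2) ratfuns_polys
    by (intro ratfuns_divide is_subring_power[OF ratfuns_is_subring] X_in_ratfuns) auto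
qed

lemma C_y_inv_L: "C_y_inv \<subseteq> L_lam_zy n"
proof -
  have "ratfuns {VY} \<subseteq> L_zy n" unfolding L_zy_def by (rule ratfuns_mono) auto
  then show ?thesis using C_y_inv_ratfuns L_zy_L by blast
qed

lemma dens_is_subring: "is_subring (dens S)"
proof (rule is_subringI)
  have p: "Fraction_Field.Fract p 1 \<in> dens S" for p
    unfolding dens_def using is_subring_1[OF polys_is_subring[of S]] by (force simp: One_fract_def)
  show "1 \<in> dens S" "- 1 \<in> dens S" using p[of 1] p[of "- 1"] by (simp_all add: One_fract_def)
  fix x y assume "x \<in> dens S" "y \<in> dens S"
  then obtain a b a' b' where *: "x = Fraction_Field.Fract a b" "b \<noteq> 0" "Fraction_Field.Fract b 1 \<in> polys S"
    "y = Fraction_Field.Fract a' b'" "b' \<noteq> 0" "Fraction_Field.Fract b' 1 \<in> polys S" by (auto simp: dens_def)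
  have "Fraction_Field.Fract (b * b') 1 \<in> polys S" using is_subring_mult[OF polys_is_subring *(3) *(6)] by simp
  moreover have "x + y = Fraction_Field.Fract (a * b' + a' * b) (b * b')" "x * y = Fraction_Field.Fract (a * a') (b * b')" "b * b' \<noteq> 0"
    using * by simp_all
  ultimately show "x + y \<in> dens S" "x * y \<in> dens S" unfolding dens_def by blast+
qed

lemma polys_dens: "polys S' \<subseteq> dens S"
  unfolding dens_def polys_def using is_subring_1[OF polys_is_subring[of S]] unfolding polys_def by (force simp: One_fract_def)

lemma ratfuns_dens: "ratfuns S \<subseteq> dens S"
proof
  fix x assume "x \<in> ratfuns S"
  then obtain f g where x: "x = f / g" "f \<in> polys S" "g \<in> polys S" "g \<noteq> 0" by (auto simp: ratfuns_def)
  then obtain p q where "f = Fraction_Field.Fract p 1" "g = Fraction_Field.Fract q 1" by (auto simp: polys_def)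
  then have "x = Fraction_Field.Fract p q" "q \<noteq> 0" "Fraction_Field.Fract q 1 \<in> polys S" using x by (auto simp: Fract1_eq_0)
  then show "x \<in> dens S" unfolding dens_def by blast
qed

subsection \<open>Equivariant cohomology and restriction to fixed points\<close>

lemma ring_on_simps [simp]:
  "carrier (ring_on S) = S" "mult (ring_on S) = (*)" "one (ring_on S) = 1" "zero (ring_on S) = 0" "add (ring_on S) = (+)"
  by (simp_all add: ring_on_def)

lemma ring_on_cring: "is_subring S \<Longrightarrow> cring (ring_on S)"
proof (rule cringI)
  assume S: "is_subring S"
  show "abelian_group (ring_on S)"
  proof (rule abelian_groupI)
    fix x assume "x \<in> carrier (ring_on S)"
    then show "\<exists>y\<in>carrier (ring_on S). y \<oplus>\<^bsub>ring_on S\<^esub> x = \<zero>\<^bsub>ring_on S\<^esub>"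
      by (intro bexI[of _ "- x"]) (auto intro: is_subring_uminus[OF S])
  qed (auto intro: is_subring_intros[OF S])
  show "comm_monoid (ring_on S)"
    by (rule comm_monoidI) (auto intro: is_subring_intros[OF S] simp: mult_ac)
qed (simp add: ring_distribs)

locale ring_on_quot =
  fixes S I :: "ratf set"
  assumes S: "is_subring S" and I: "ideal I (ring_on S)"
begin

abbreviation "Q \<equiv> ring_on S Quot I"
abbreviation "cls f \<equiv> I +>\<^bsub>ring_on S\<^esub> f"

lemma cls_eq_image: "cls f = (\<lambda>a. a + f) ` I"
  by (auto simp: a_r_coset_def r_coset_def)

lemma I_sub: "I \<subseteq> S" and I_0: "0 \<in> I"
  and I_add: "a \<in> I \<Longrightarrow> b \<in> I \<Longrightarrow> a + b \<in> I"
  and I_mult: "a \<in> I \<Longrightarrow> f \<in> S \<Longrightarrow> f * a \<in> I"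
proof -
  interpret ideal I "ring_on S" by (rule I)
  show "I \<subseteq> S" using a_subset by simp
  show "0 \<in> I" using additive_subgroup.zero_closed[OF additive_subgroup_axioms] by simp
  show "a \<in> I \<Longrightarrow> b \<in> I \<Longrightarrow> a + b \<in> I" using additive_subgroup.a_closed[OF additive_subgroup_axioms] by simp
  show "a \<in> I \<Longrightarrow> f \<in> S \<Longrightarrow> f * a \<in> I" using I_l_closed by simp
qed

lemma I_uminus: "a \<in> I \<Longrightarrow> - a \<in> I"
  using I_mult[of a "- 1"] is_subring_uminus[OF S is_subring_1[OF S]] by simp

lemma I_diff: "a \<in> I \<Longrightarrow> b \<in> I \<Longrightarrow> a - b \<in> I"
  using I_add[OF _ I_uminus] by fastforce

lemma cls_eq_iff: "cls f = cls g \<longleftrightarrow> f - g \<in> I"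
proof
  assume "cls f = cls g"
  moreover have "f \<in> cls f" unfolding cls_eq_image using I_0 by force
  ultimately obtain a where "a \<in> I" "f = a + g" unfolding cls_eq_image by auto
  then show "f - g \<in> I" by simp
next
  assume fg: "f - g \<in> I"
  show "cls f = cls g"
  proof
    show "cls f \<subseteq> cls g"
    proof
      fix x assume "x \<in> cls f"
      then obtain a where "a \<in> I" "x = a + f" unfolding cls_eq_image by auto
      then have "a + (f - g) \<in> I" "x = (a + (f - g)) + g" using I_add fg by auto
      then show "x \<in> cls g" unfolding cls_eq_image by blast
    qed
    show "cls g \<subseteq> cls f"
    proof
      fix x assume "x \<in> cls g"
      then obtain a where "a \<in> I" "x = a + g" unfolding cls_eq_image by auto
      then have "a - (f - g) \<in> I" "x = (a - (f - g)) + f" using I_diff fg by auto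
      then show "x \<in> cls f" unfolding cls_eq_image by blast
    qed
  qed
qed

lemma Q_carrier: "carrier Q = cls ` S"
  by (auto simp: FactRing_def A_RCOSETS_defs a_r_coset_def)

lemma Q_carrierE: assumes "c \<in> carrier Q" obtains f where "f \<in> S" "c = cls f"
  using assms unfolding Q_carrier by blast

lemma cls_in [simp]: "f \<in> S \<Longrightarrow> cls f \<in> carrier Q"
  unfolding Q_carrier by blast

lemma Q_zero: "\<zero>\<^bsub>Q\<^esub> = cls 0" and Q_one: "\<one>\<^bsub>Q\<^esub> = cls 1"
  by (simp_all add: FactRing_def cls_eq_image)

lemma cls_add: "f \<in> S \<Longrightarrow> g \<in> S \<Longrightarrow> cls f \<oplus>\<^bsub>Q\<^esub> cls g = cls (f + g)"
  and cls_mult: "f \<in> S \<Longrightarrow> g \<in> S \<Longrightarrow> cls f \<otimes>\<^bsub>Q\<^esub> cls g = cls (f * g)"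
  using ring_hom_add[OF ideal.rcos_ring_hom[OF I], of f g] ring_hom_mult[OF ideal.rcos_ring_hom[OF I], of f g] by simp_all

lemma Q_cring: "cring Q"
  by (rule ideal.quotient_is_cring[OF I ring_on_cring[OF S]])

text \<open>The hypothesis says that \<open>h\<close> does not depend on the representative, which
  makes the image of the class a singleton.\<close>

lemma the_elem_cls:
  assumes "\<And>a. a \<in> I \<Longrightarrow> h (a + f) = h f"
  shows "the_elem (h ` cls f) = h f"
proof -
  have "h ` cls f = {h f}" unfolding cls_eq_image using assms I_0 by (auto simp: image_iff)
  then show ?thesis by simp
qed

end

lemma ideal_ring_onI:
  assumes S: "is_subring S" and "I \<subseteq> S" "0 \<in> I" "\<And>a b. a \<in> I \<Longrightarrow> b \<in> I \<Longrightarrow> a + b \<in> I" "\<And>a f. a \<in> I \<Longrightarrow> f \<in> S \<Longrightarrow> f * a \<in> I"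
  shows "ideal I (ring_on S)"
proof (rule idealI)
  interpret cring "ring_on S" by (rule ring_on_cring[OF S])
  show "ring (ring_on S)" by (rule ring_axioms)
  have neg: "- a \<in> I" if "a \<in> I" for a using assms(5)[OF that is_subring_uminus[OF S is_subring_1[OF S]]] by simp
  show "subgroup I (add_monoid (ring_on S))"
  proof (rule group.subgroupI[OF a_group])
    show "I \<subseteq> carrier (add_monoid (ring_on S))" "I \<noteq> {}" using assms by auto
    fix a assume a: "a \<in> I"
    have "\<ominus>\<^bsub>ring_on S\<^esub> a = - a"
      using a neg[OF a] assms(2) by (intro minus_equality) auto
    then show "inv\<^bsub>add_monoid (ring_on S)\<^esub> a \<in> I" using neg[OF a] by (simp add: a_inv_def)
    show "a \<otimes>\<^bsub>add_monoid (ring_on S)\<^esub> b \<in> I" if "b \<in> I" for b using assms(4) a that by simp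
  qed
  show "x \<otimes>\<^bsub>ring_on S\<^esub> a \<in> I" "a \<otimes>\<^bsub>ring_on S\<^esub> x \<in> I" if "a \<in> I" "x \<in> carrier (ring_on S)" for a x
    using assms(5)[of a x] that by (simp_all add: mult.commute)
qed

lemma genideal_ring_on:
  assumes "is_subring S" "R \<subseteq> S"
  shows "ideal (genideal (ring_on S) R) (ring_on S)" "R \<subseteq> genideal (ring_on S) R"
    "ideal I (ring_on S) \<Longrightarrow> R \<subseteq> I \<Longrightarrow> genideal (ring_on S) R \<subseteq> I"
proof -
  interpret cring "ring_on S" by (rule ring_on_cring[OF assms(1)])
  show "ideal (genideal (ring_on S) R) (ring_on S)" "R \<subseteq> genideal (ring_on S) R"
    "ideal I (ring_on S) \<Longrightarrow> R \<subseteq> I \<Longrightarrow> genideal (ring_on S) R \<subseteq> I"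
    using genideal_ideal genideal_self genideal_minimal assms(2) by simp_all
qed

text \<open>The substitution that sends the Chern roots to the \<open>z\<close> with indices given by \<open>s\<close>; the index of
  the \<open>i\<close>-th root of the second group is \<open>k + i\<close>.\<close>

definition root_var :: "nat \<Rightarrow> nat \<Rightarrow> var" where
  "root_var k i = (if i \<le> k then VG1 i else VG2 (i - k))"

definition root_subst :: "nat \<Rightarrow> (nat \<Rightarrow> nat) \<Rightarrow> var \<Rightarrow> ratf" where
  "root_subst k s v = (case v of VG1 i \<Rightarrow> zz (s i) | VG2 i \<Rightarrow> zz (s (k + i)) | _ \<Rightarrow> X v)"

text \<open>The variables that no substitution for the Chern roots moves. Denominators in the rings
  of representatives contain no others, which makes all these substitutions defined there.\<close>

definition base_vars :: "var set" where
  "base_vars = {VLam, VY, VW} \<union> range VZ"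

lemma root_subst_base: "v \<in> base_vars \<Longrightarrow> root_subst k s v = X v"
  by (auto simp: base_vars_def root_subst_def)

lemma fixed_pt_base: "v \<in> base_vars \<Longrightarrow> fixed_pt n J v = X v"
  by (auto simp: base_vars_def fixed_pt_def)

lemma perm_var_base: "v \<in> base_vars \<Longrightarrow> perm_var \<sigma> \<tau> id v = v"
  by (auto simp: base_vars_def perm_var_def)

lemma root_subst_root_var: "1 \<le> i \<Longrightarrow> root_subst k s (root_var k i) = zz (s i)"
  by (auto simp: root_subst_def root_var_def)

lemma coeff_prod_linear_mem:
  assumes "is_subring R" "\<And>i. i \<in> A \<Longrightarrow> a i \<in> R"
  shows "coeff (\<Prod>i\<in>A. [:- a i, 1:]) j \<in> R"
  using assms(2)
proof (induction A arbitrary: j rule: infinite_finite_induct)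
  case (insert x F)
  have "coeff ([:- a x, 1:] * p) j = - a x * coeff p j + (case j of 0 \<Rightarrow> 0 | Suc j \<Rightarrow> coeff p j)" for p j
    by (cases j) (simp_all add: coeff_pCons)
  then show ?case using insert by (auto split: nat.split intro!: is_subring_intros[OF assms(1)])
qed (auto split: nat.split simp: is_subring_intros[OF assms(1)] coeff_pCons)

lemma (in coeff_hom) subst_coeff_prod_linear:
  assumes "\<And>i. i \<in> A \<Longrightarrow> sdef \<sigma> (a i)"
  shows "sdef \<sigma> (coeff (\<Prod>i\<in>A. [:- a i, 1:]) j) \<and>
    subst_into emb \<sigma> (coeff (\<Prod>i\<in>A. [:- a i, 1:]) j) = coeff (\<Prod>i\<in>A. [:- subst_into emb \<sigma> (a i), 1:]) j"
  using assms
proof (induction A arbitrary: j rule: infinite_finite_induct)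
  case (insert x F)
  have e: "coeff ([:- b, 1:] * p) j = - b * coeff p j + (case j of 0 \<Rightarrow> 0 | Suc j \<Rightarrow> coeff p j)" for p j and b :: "'c::field"
    by (cases j) (simp_all add: coeff_pCons)
  have 1: "sdef \<sigma> (a x)" "\<And>j. sdef \<sigma> (coeff (\<Prod>i\<in>F. [:- a i, 1:]) j)"
    "\<And>j. subst_into emb \<sigma> (coeff (\<Prod>i\<in>F. [:- a i, 1:]) j) = coeff (\<Prod>i\<in>F. [:- subst_into emb \<sigma> (a i), 1:]) j"
    using insert by auto
  show ?case unfolding prod.insert[OF insert(1,2)] e using 1
    by (auto split: nat.split simp: subst_add subst_diff subst_mult subst_uminus)
qed (auto split: nat.split simp: coeff_pCons)

section \<open>Rings of representatives of cohomology classes\<close>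

lemma T_polys_is_subring: "is_subring (T_polys n k)"
proof (rule is_subringI)
  note P = is_subring_intros[OF polys_is_subring[of "Gam_z_y n k"]]
  show "1 \<in> T_polys n k" "- 1 \<in> T_polys n k" unfolding T_polys_def using P(2) P(6)[OF P(2)]
    by (auto simp: rat.subst_uminus)
  fix a b assume "a \<in> T_polys n k" "b \<in> T_polys n k"
  then show "a + b \<in> T_polys n k" "a * b \<in> T_polys n k" unfolding T_polys_def
    by (auto intro!: P(3,4) simp: rat.subst_add rat.subst_mult rat.sdef_polys)
qed

lemma GL_polys_is_subring: "is_subring (GL_polys n k)"
proof (rule is_subringI)
  note P = is_subring_intros[OF polys_is_subring[of "Gam_z_y n k"]]
  show "1 \<in> GL_polys n k" "- 1 \<in> GL_polys n k" unfolding GL_polys_def using P(2) P(6)[OF P(2)]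
    by (auto simp: rat.subst_uminus)
  fix a b assume "a \<in> GL_polys n k" "b \<in> GL_polys n k"
  then show "a + b \<in> GL_polys n k" "a * b \<in> GL_polys n k" unfolding GL_polys_def
    by (auto intro!: P(3,4) simp: rat.subst_add rat.subst_mult rat.sdef_polys)
qed

definition HR :: "nat \<Rightarrow> nat \<Rightarrow> ratf set" where
  "HR n k = prod_span (T_polys n k) (L_lam_zy n)"

text \<open>The ring \<open>HR\<close> without the symmetry in the Chern roots, so that single roots
  are available for interpolation; the symmetry is restored later by averaging.\<close>

definition NR :: "nat \<Rightarrow> nat \<Rightarrow> ratf set" where
  "NR n k = prod_span (polys (Gam_z_y n k)) (L_lam_zy n)"

lemma HR_is_subring: "is_subring (HR n k)" and NR_is_subring: "is_subring (NR n k)"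
  unfolding HR_def NR_def by (intro prod_span_is_subring T_polys_is_subring L_is_subring polys_is_subring)+

lemma L_HR: "L_lam_zy n \<subseteq> HR n k" and T_HR: "T_polys n k \<subseteq> HR n k"
  and L_NR: "L_lam_zy n \<subseteq> NR n k" and polys_NR: "polys (Gam_z_y n k) \<subseteq> NR n k"
  unfolding HR_def NR_def using is_subring_1[OF T_polys_is_subring] is_subring_1[OF L_is_subring] is_subring_1[OF polys_is_subring]
  by (simp_all add: prod_span_left prod_span_right)

lemma HR_NR: "HR n k \<subseteq> NR n k"
  unfolding HR_def by (rule prod_span_subset[OF NR_is_subring _ L_NR]) (use polys_NR in \<open>auto simp: T_polys_def\<close>)

lemma L_ratfuns_base: "L_lam_zy n \<subseteq> ratfuns base_vars"
  by (rule order_trans[OF L_ratfuns ratfuns_mono]) (auto simp: base_vars_def)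

lemma NR_dens: "NR n k \<subseteq> dens base_vars"
  unfolding NR_def
  by (rule prod_span_subset[OF dens_is_subring polys_dens order_trans[OF L_ratfuns_base ratfuns_dens]])

lemma sdef_NR: "f \<in> NR n k \<Longrightarrow> (\<And>v. v \<in> base_vars \<Longrightarrow> \<sigma> v = X v) \<Longrightarrow> rat.sdef \<sigma> f"
  using dens_sdef NR_dens by blast

lemma subst_L: "f \<in> L_lam_zy n \<Longrightarrow> (\<And>v. v \<in> base_vars \<Longrightarrow> \<sigma> v = X v) \<Longrightarrow> subst \<sigma> f = f"
  by (rule subst_fixed_ratfuns(2)[of f base_vars]) (use L_ratfuns_base in auto)

lemma Gam_cases:
  assumes "v \<in> Gam_z_y n k" "k \<le> n"
  obtains i where "i \<in> {1..n}" "v = root_var k i" | i where "i \<in> {1..n}" "v = VZ i" | "v = VY"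
proof -
  consider i where "i \<in> {1..k}" "v = VG1 i" | i where "i \<in> {1..n-k}" "v = VG2 i" | i where "i \<in> {1..n}" "v = VZ i" | "v = VY"
    using assms(1) by (auto simp: Gam_z_y_def)
  then show thesis
  proof cases
    case (1 i) then show thesis using that(1)[of i] assms(2) by (auto simp: root_var_def)
  next
    case (2 i) then show thesis using that(1)[of "k + i"] assms(2) by (auto simp: root_var_def)
  qed (use that in auto)
qed

lemma root_var_Gam: "i \<in> {1..n} \<Longrightarrow> k \<le> n \<Longrightarrow> root_var k i \<in> Gam_z_y n k"
proof -
  assume i: "i \<in> {1..n}" and kn: "k \<le> n"
  then have "\<not> i \<le> k \<Longrightarrow> i - k \<in> {1..n - k}" by auto
  then show ?thesis using i by (auto simp: root_var_def Gam_z_y_def)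
qed

lemma prod_split_roots:
  assumes "k \<le> n"
  shows "(\<Prod>i=1..k. f (VG1 i)) * (\<Prod>i=1..n - k. f (VG2 i)) = (\<Prod>i=1..n. f (root_var k i))"
proof -
  have "{1..n} = {1..k} \<union> {k+1..n}" using assms by auto
  then have "(\<Prod>i=1..n. f (root_var k i)) = (\<Prod>i=1..k. f (root_var k i)) * (\<Prod>i=k+1..n. f (root_var k i))"
    by (simp add: prod.union_disjoint)
  also have "(\<Prod>i=1..k. f (root_var k i)) = (\<Prod>i=1..k. f (VG1 i))" by (rule prod.cong) (auto simp: root_var_def)
  also have "(\<Prod>i=k+1..n. f (root_var k i)) = (\<Prod>i=1..n - k. f (VG2 i))"
    by (rule prod.reindex_bij_witness[of _ "\<lambda>i. i + k" "\<lambda>i. i - k"]) (use assms in \<open>auto simp: root_var_def\<close>)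
  finally show ?thesis by simp
qed

definition rel_poly :: "nat \<Rightarrow> nat \<Rightarrow> ratf poly" where
  "rel_poly n k = (\<Prod>i=1..n. [:- X (root_var k i), 1:]) - (\<Prod>i=1..n. [:- zz i, 1:])"

lemma relations_eq: "k \<le> n \<Longrightarrow> relations n k = range (coeff (rel_poly n k))"
  unfolding relations_def rel_poly_def using prod_split_roots[of k n "\<lambda>v. [:- X v, 1:]"] by simp

text \<open>Since \<open>NR\<close> is a ring, these sums form the ideal of \<open>NR\<close> that
  the relations generate.\<close>

definition rel_ideal :: "nat \<Rightarrow> nat \<Rightarrow> ratf set" where
  "rel_ideal n k = prod_span (relations n k) (NR n k)"

lemma rel_ideal_add: "a \<in> rel_ideal n k \<Longrightarrow> b \<in> rel_ideal n k \<Longrightarrow> a + b \<in> rel_ideal n k"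
  and rel_ideal_0: "0 \<in> rel_ideal n k"
  unfolding rel_ideal_def by (rule prod_span_add, assumption+) (rule prod_span_0)

lemma rel_ideal_mult: "a \<in> rel_ideal n k \<Longrightarrow> f \<in> NR n k \<Longrightarrow> f * a \<in> rel_ideal n k"
  unfolding rel_ideal_def
proof (induction a rule: prod_span_induct)
  case (mult a b)
  then show ?case using prod_span_mult[of a "relations n k" "f * b" "NR n k"] is_subring_mult[OF NR_is_subring]
    by (simp add: mult_ac)
next
  case (add x y)
  then show ?case using prod_span_add by (simp add: distrib_left)
qed (simp add: prod_span_0)

lemma rel_ideal_diff: "a \<in> rel_ideal n k \<Longrightarrow> b \<in> rel_ideal n k \<Longrightarrow> a - b \<in> rel_ideal n k"
  using rel_ideal_add[OF _ rel_ideal_mult[of b n k "- 1"]] is_subring_uminus[OF NR_is_subring is_subring_1[OF NR_is_subring]] by simp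

lemma rel_ideal_sum: "(\<And>i. i \<in> A \<Longrightarrow> f i \<in> rel_ideal n k) \<Longrightarrow> (\<Sum>i\<in>A. f i) \<in> rel_ideal n k"
  unfolding rel_ideal_def by (rule prod_span_sum)

section \<open>Interpolation in the single Chern roots\<close>

context
  fixes n k :: nat
  assumes n1: "1 \<le> n" and kn: "k \<le> n"
begin

lemma rel_coeff_mem: "coeff (rel_poly n k) j \<in> rel_ideal n k"
  unfolding rel_ideal_def using prod_span_mult[of "coeff (rel_poly n k) j" "relations n k" 1 "NR n k"]
  by (simp add: relations_eq[OF kn] is_subring_1[OF NR_is_subring])

text \<open>At a Chern root the first product in \<open>rel_poly\<close> vanishes. The second is
  therefore a combination of the coefficients of \<open>rel_poly\<close>, with powers of the root as
  multipliers.\<close>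

lemma char_poly_mem: "i \<in> {1..n} \<Longrightarrow> (\<Prod>b=1..n. X (root_var k i) - zz b) \<in> rel_ideal n k"
proof -
  assume i: "i \<in> {1..n}"
  let ?x = "X (root_var k i)"
  have x: "?x \<in> NR n k" by (rule subsetD[OF polys_NR]) (simp add: root_var_Gam[OF i kn])
  have p: "poly (\<Prod>i\<in>A. [:- a i, 1:]) ?x = (\<Prod>i\<in>A. ?x - a i)" for A and a :: "nat \<Rightarrow> ratf"
    by (simp add: poly_prod)
  have "poly (rel_poly n k) ?x = (\<Prod>j=1..n. ?x - X (root_var k j)) - (\<Prod>b=1..n. ?x - zz b)"
    unfolding rel_poly_def poly_diff p by simp
  also have "(\<Prod>j=1..n. ?x - X (root_var k j)) = 0" using i by auto
  finally have "(\<Prod>b=1..n. ?x - zz b) = - poly (rel_poly n k) ?x" by simp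
  also have "\<dots> = (\<Sum>j\<le>degree (rel_poly n k). (- (?x ^ j)) * coeff (rel_poly n k) j)"
    unfolding poly_altdef sum_negf[symmetric] by (rule sum.cong) auto
  also have "\<dots> \<in> rel_ideal n k"
    by (intro rel_ideal_sum rel_ideal_mult rel_coeff_mem is_subring_uminus[OF NR_is_subring] is_subring_power[OF NR_is_subring] x)
  finally show ?thesis .
qed

definition lagrange :: "nat \<Rightarrow> ratf \<Rightarrow> ratf" where
  "lagrange a x = (\<Prod>b\<in>{1..n} - {a}. (x - zz b) * inverse (zz a - zz b))"

text \<open>Both sides are polynomials in x of degree less than n, and they agree at the n points
  z_c.\<close>

lemma sum_lagrange: "(\<Sum>a=1..n. lagrange a x) = 1"
proof -
  let ?p = "\<Sum>a=1..n. \<Prod>b\<in>{1..n} - {a}. Polynomial.smult (inverse (zz a - zz b)) [:- zz b, 1:]"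
  have ev: "poly ?p t = (\<Sum>a=1..n. lagrange a t)" for t
    by (simp add: poly_sum poly_prod lagrange_def algebra_simps)
  have "?p = 1"
  proof (rule poly_eqI_degree[of "zz ` {1..n}"])
    fix x assume "x \<in> zz ` {1..n}"
    then obtain c where c: "c \<in> {1..n}" "x = zz c" by auto
    have "lagrange a x = (if a = c then 1 else 0)" if "a \<in> {1..n}" for a
    proof (cases "a = c")
      case True
      have "lagrange a x = (\<Prod>b\<in>{1..n} - {a}. 1)" unfolding lagrange_def c(2) True by (rule prod.cong) auto
      then show ?thesis using True by simp
    next
      case False
      then show ?thesis unfolding lagrange_def c(2) using c(1) by auto
    qed
    then have "(\<Sum>a=1..n. lagrange a x) = (\<Sum>a=1..n. if a = c then 1 else 0)" by (intro sum.cong) auto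
    then show "poly ?p x = poly 1 x" unfolding ev using c(1) by simp
  next
    have crd: "card (zz ` {1..n}) = n" by (subst card_image) (auto intro!: inj_onI)
    have "degree (\<Prod>b\<in>{1..n} - {a}. Polynomial.smult (inverse (zz a - zz b)) [:- zz b, 1:]) \<le> n - 1" if "a \<in> {1..n}" for a
    proof -
      have "degree (\<Prod>b\<in>{1..n} - {a}. Polynomial.smult (inverse (zz a - zz b)) [:- zz b, 1:])
        \<le> (\<Sum>b\<in>{1..n} - {a}. degree (Polynomial.smult (inverse (zz a - zz b)) [:- zz b, 1:]))"
        using degree_prod_sum_le[of "{1..n} - {a}" "\<lambda>b. Polynomial.smult (inverse (zz a - zz b)) [:- zz b, 1:]"] by (simp add: o_def)
      also have "\<dots> \<le> (\<Sum>b\<in>{1..n} - {a}. 1)" by (rule sum_mono) (simp add: degree_pCons_eq_if)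
      also have "\<dots> = n - 1" using that by simp
      finally show ?thesis .
    qed
    then have "degree ?p \<le> n - 1" by (intro degree_sum_le) auto
    then show "degree ?p < card (zz ` {1..n})" "degree (1::ratf poly) < card (zz ` {1..n})" using n1 crd by auto
  qed
  then show ?thesis using ev[of x] by simp
qed

text \<open>A partition of unity that isolates the points where the \<open>i\<close>-th Chern root is \<open>z\<close> with index \<open>s(i)\<close>.
  Modulo the relations, the summands for non-injective \<open>s\<close> vanish.\<close>

definition point_idem :: "(nat \<Rightarrow> nat) \<Rightarrow> ratf" where
  "point_idem s = (\<Prod>i=1..n. lagrange (s i) (X (root_var k i)))"

lemma sum_point_idem: "(\<Sum>s\<in>PiE {1..n} (\<lambda>_. {1..n}). point_idem s) = 1"
  unfolding point_idem_def using prod_sum_PiE[of "{1..n}" "\<lambda>_. {1..n}" "\<lambda>i a. lagrange a (X (root_var k i))"]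
  by (simp only: sum_lagrange prod.neutral_const finite_atLeastAtMost ball_simps simp_thms)

lemma inv_z_L: "a \<in> {1..n} \<Longrightarrow> b \<in> {1..n} \<Longrightarrow> inverse (zz a - zz b) \<in> L_lam_zy n"
  by (intro inverse_L_zy) (auto simp: L_zy_def intro!: is_subring_diff[OF ratfuns_is_subring] X_in_ratfuns)

lemma lagrange_NR: "a \<in> {1..n} \<Longrightarrow> x \<in> NR n k \<Longrightarrow> lagrange a x \<in> NR n k"
  unfolding lagrange_def using zz_L[of _ n] L_NR[of n k] inv_z_L
  by (intro is_subring_prod[OF NR_is_subring] is_subring_mult[OF NR_is_subring] is_subring_diff[OF NR_is_subring]) auto

lemma root_NR: "i \<in> {1..n} \<Longrightarrow> X (root_var k i) \<in> NR n k"
  by (rule subsetD[OF polys_NR]) (simp add: root_var_Gam[OF _ kn])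

lemma point_idem_NR: "s \<in> {1..n} \<rightarrow> {1..n} \<Longrightarrow> point_idem s \<in> NR n k"
  unfolding point_idem_def by (intro is_subring_prod[OF NR_is_subring] lagrange_NR root_NR) auto

lemma root_subst_NR: "f \<in> NR n k \<Longrightarrow> s \<in> {1..n} \<rightarrow> {1..n} \<Longrightarrow> subst (root_subst k s) f \<in> L_lam_zy n"
  unfolding NR_def
proof (induction f rule: prod_span_induct)
  case (mult a b)
  have "subst (root_subst k s) a \<in> L_lam_zy n"
  proof (rule polys_subst[OF mult(1) L_is_subring cst_L])
    fix v assume "v \<in> Gam_z_y n k"
    then show "root_subst k s v \<in> L_lam_zy n"
      by (cases rule: Gam_cases[OF _ kn])
        (use mult(3) in \<open>auto simp: root_subst_root_var intro!: zz_L\<close>, auto simp: root_subst_def yy_L intro: zz_L)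
  qed
  moreover have "subst (root_subst k s) b = b" using mult(2) root_subst_base by (rule subst_L)
  moreover have "rat.sdef (root_subst k s) b" using mult(2) L_NR root_subst_base by (intro sdef_NR) auto
  ultimately show ?case using mult by (auto simp: rat.subst_mult rat.sdef_polys intro: is_subring_mult[OF L_is_subring])
next
  case zero then show ?case by (simp add: is_subring_0[OF L_is_subring])
next
  case (add x y)
  then have "rat.sdef (root_subst k s) x" "rat.sdef (root_subst k s) y"
    using root_subst_base by (auto intro!: sdef_NR simp: NR_def)
  then show ?case using add by (auto simp: rat.subst_add intro: is_subring_add[OF L_is_subring])
qed

text \<open>Multiplied by \<open>lagrange a x\<close>, the difference x - z_a is a unit times the
  product of all x - z_b, which for a Chern root x is a combination of the relations. This settles a
  single root, and the f with the property form a subring.\<close>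

lemma point_idem_eval:
  assumes s: "s \<in> {1..n} \<rightarrow> {1..n}" and "f \<in> NR n k"
  shows "(f - subst (root_subst k s) f) * point_idem s \<in> rel_ideal n k"
proof -
  let ?e = "subst (root_subst k s)"
  define G where "G = {f \<in> NR n k. (f - ?e f) * point_idem s \<in> rel_ideal n k}"
  have sd: "rat.sdef (root_subst k s) f" if "f \<in> NR n k" for f
    using that root_subst_base by (rule sdef_NR)
  have L: "f \<in> G" if "f \<in> L_lam_zy n" for f
  proof -
    have "?e f = f" using that root_subst_base by (rule subst_L)
    then show ?thesis using subsetD[OF L_NR that] rel_ideal_0 unfolding G_def by simp
  qed
  have eNR: "?e f \<in> NR n k" if "f \<in> NR n k" for f using root_subst_NR[OF that s] L_NR by auto
  have G: "is_subring G"
  proof (rule is_subringI)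
    show "1 \<in> G" "- 1 \<in> G" using L is_subring_1[OF L_is_subring] is_subring_uminus[OF L_is_subring] by auto
    fix a b assume ab: "a \<in> G" "b \<in> G"
    then have NR: "a \<in> NR n k" "b \<in> NR n k" unfolding G_def by auto
    have "(a + b - ?e (a + b)) * point_idem s = (a - ?e a) * point_idem s + (b - ?e b) * point_idem s"
      using sd NR by (simp add: rat.subst_add algebra_simps)
    then show "a + b \<in> G" using ab rel_ideal_add is_subring_add[OF NR_is_subring] unfolding G_def by auto
    have "(a * b - ?e (a * b)) * point_idem s = a * ((b - ?e b) * point_idem s) + ?e b * ((a - ?e a) * point_idem s)"
      using sd NR by (simp add: rat.subst_mult algebra_simps)
    then show "a * b \<in> G" using ab rel_ideal_add rel_ideal_mult NR eNR is_subring_mult[OF NR_is_subring] unfolding G_def by auto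
  qed
  have root: "X (root_var k i) \<in> G" if i: "i \<in> {1..n}" for i
  proof -
    let ?x = "X (root_var k i)" and ?a = "s i"
    have a: "?a \<in> {1..n}" using s i by auto
    have 1: "(?x - zz ?a) * lagrange ?a ?x = (\<Prod>b\<in>{1..n} - {?a}. inverse (zz ?a - zz b)) * (\<Prod>b=1..n. ?x - zz b)"
      unfolding lagrange_def prod.distrib using prod.remove[of "{1..n}" ?a "\<lambda>b. ?x - zz b"] a by simp
    have 2: "point_idem s = lagrange ?a ?x * (\<Prod>j\<in>{1..n} - {i}. lagrange (s j) (X (root_var k j)))"
      unfolding point_idem_def using prod.remove[of "{1..n}" i] i by simp
    have "(?x - ?e ?x) * point_idem s = (\<Prod>j\<in>{1..n} - {i}. lagrange (s j) (X (root_var k j)))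
       * ((\<Prod>b\<in>{1..n} - {?a}. inverse (zz ?a - zz b)) * (\<Prod>b=1..n. ?x - zz b))"
      unfolding 2 1[symmetric] using i by (simp add: root_subst_root_var mult_ac)
    also have "\<dots> \<in> rel_ideal n k"
      using s a inv_z_L L_NR[of n k]
      by (intro rel_ideal_mult char_poly_mem[OF i] is_subring_prod[OF NR_is_subring] lagrange_NR root_NR) auto
    finally show ?thesis unfolding G_def using root_NR[OF i] by auto
  qed
  have "polys (Gam_z_y n k) \<subseteq> G"
  proof (rule polys_subset[OF G])
    show "cst c \<in> G" for c using L cst_L by blast
    fix v assume "v \<in> Gam_z_y n k"
    then show "X v \<in> G" by (cases rule: Gam_cases[OF _ kn]) (use root L zz_L yy_L in auto)
  qed
  then have "NR n k \<subseteq> G" unfolding NR_def using L by (intro prod_span_subset[OF G]) auto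
  then show ?thesis using assms(2) unfolding G_def by auto
qed

text \<open>The z with indices s(i) miss some z_b, so some coefficient of the relations takes a
  nonzero value at s. This value involves only z and is therefore invertible, while its product with
  the idempotent lies in the ideal.\<close>

lemma point_idem_not_inj:
  assumes s: "s \<in> {1..n} \<rightarrow> {1..n}" and "\<not> inj_on s {1..n}"
  shows "point_idem s \<in> rel_ideal n k"
proof -
  let ?c = "coeff (\<Prod>i=1..n. [:- X (root_var k i), 1:])"
  let ?cs = "coeff (\<Prod>i=1..n. [:- zz (s i), 1:])"
  let ?cz = "coeff (\<Prod>i=1..n. [:- zz i, 1:])"
  have e: "subst (root_subst k s) (?c j) = ?cs j" for j
  proof -
    have "subst (root_subst k s) (?c j) = coeff (\<Prod>i=1..n. [:- subst (root_subst k s) (X (root_var k i)), 1:]) j"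
      using rat.subst_coeff_prod_linear[of "{1..n}" "root_subst k s" "\<lambda>i. X (root_var k i)" j] by simp
    also have "(\<Prod>i=1..n. [:- subst (root_subst k s) (X (root_var k i)), 1:]) = (\<Prod>i=1..n. [:- zz (s i), 1:])"
      by (rule prod.cong) (auto simp: root_subst_root_var)
    finally show ?thesis .
  qed
  have "?c j \<in> NR n k" for j by (rule coeff_prod_linear_mem[OF NR_is_subring]) (rule root_NR)
  then have 1: "(?c j - ?cs j) * point_idem s \<in> rel_ideal n k" for j using point_idem_eval[OF s] e by metis
  have "?c j - ?cz j = coeff (rel_poly n k) j" for j by (simp add: rel_poly_def)
  then have 2: "(?c j - ?cz j) * point_idem s \<in> rel_ideal n k" for j
    using rel_ideal_mult[OF rel_coeff_mem point_idem_NR[OF s], of j] by (simp add: mult.commute)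
  have 3: "(?cs j - ?cz j) * point_idem s \<in> rel_ideal n k" for j
    using rel_ideal_diff[OF 2[of j] 1[of j]] by (simp add: algebra_simps)
  have "\<exists>j. ?cs j \<noteq> ?cz j"
  proof (rule ccontr)
    assume "\<nexists>j. ?cs j \<noteq> ?cz j"
    then have eq: "(\<Prod>i=1..n. [:- zz (s i), 1:]) = (\<Prod>i=1..n. [:- zz i, 1:])" by (simp add: poly_eq_iff)
    have "s ` {1..n} \<noteq> {1..n}" using assms(2) eq_card_imp_inj_on[of "{1..n}" s] by auto
    moreover have "s ` {1..n} \<subseteq> {1..n}" using s by auto
    ultimately obtain b where b: "b \<in> {1..n}" "b \<notin> s ` {1..n}" by blast
    have "poly (\<Prod>i=1..n. [:- zz i, 1:]) (zz b) = 0" using b(1) by (auto simp: poly_prod)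
    moreover have "poly (\<Prod>i=1..n. [:- zz (s i), 1:]) (zz b) \<noteq> 0" using b(2) by (auto simp: poly_prod)
    ultimately show False using eq by simp
  qed
  then obtain j where j: "?cs j - ?cz j \<noteq> 0" by auto
  have "?cs j - ?cz j \<in> L_zy n" unfolding L_zy_def using s
    by (intro is_subring_diff[OF ratfuns_is_subring] coeff_prod_linear_mem[OF ratfuns_is_subring] X_in_ratfuns) auto
  then have "inverse (?cs j - ?cz j) \<in> NR n k" using inverse_L_zy L_NR by blast
  from rel_ideal_mult[OF 3[of j] this] show ?thesis using j by (simp flip: mult.assoc)
qed

lemma enum_J: "J \<in> subsets_k n k \<Longrightarrow> bij_betw (\<lambda>i. sorted_list_of_set J ! (i - 1)) {1..k} J"
  and enum_Jc: "J \<in> subsets_k n k \<Longrightarrow> bij_betw (\<lambda>i. sorted_list_of_set ({1..n} - J) ! (i - 1)) {1..n - k} ({1..n} - J)"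
proof -
  have g: "bij_betw (\<lambda>i. sorted_list_of_set A ! (i - 1)) {1..card A} A" if "finite A" for A :: "nat set"
  proof -
    have "bij_betw ((!) (sorted_list_of_set A)) {..<card A} A"
      using that by (intro bij_betw_nth) auto
    moreover have "bij_betw (\<lambda>i. i - 1) {1..card A} {..<card A}"
      by (rule bij_betw_byWitness[of _ Suc]) auto
    ultimately show ?thesis using bij_betw_trans[of "\<lambda>i. i - 1" "{1..card A}" "{..<card A}" "(!) (sorted_list_of_set A)" A] by (simp add: o_def)
  qed
  assume "J \<in> subsets_k n k"
  then have J: "J \<subseteq> {1..n}" "card J = k" "finite J" by (auto simp: subsets_k_def intro: finite_subset)
  show "bij_betw (\<lambda>i. sorted_list_of_set J ! (i - 1)) {1..k} J" using g[OF J(3)] J(2) by simp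
  have "card ({1..n} - J) = n - k" using J by (simp add: card_Diff_subset)
  then show "bij_betw (\<lambda>i. sorted_list_of_set ({1..n} - J) ! (i - 1)) {1..n - k} ({1..n} - J)"
    using g[of "{1..n} - J"] by simp
qed

lemma fixed_pt_VG1: "J \<in> subsets_k n k \<Longrightarrow> i \<in> {1..k} \<Longrightarrow> \<exists>j\<in>J. fixed_pt n J (VG1 i) = zz j"
  using bij_betwE[OF enum_J] by (auto simp: fixed_pt_def)

lemma fixed_pt_VG2: "J \<in> subsets_k n k \<Longrightarrow> i \<in> {1..n - k} \<Longrightarrow> \<exists>j\<in>{1..n} - J. fixed_pt n J (VG2 i) = zz j"
  using bij_betwE[OF enum_Jc] by (force simp: fixed_pt_def)

lemma perm_between:
  assumes "bij_betw f A B" "bij_betw g A B"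
  obtains p where "p permutes A" "\<And>i. i \<in> A \<Longrightarrow> g (p i) = f i"
proof
  let ?p = "\<lambda>i. if i \<in> A then inv_into A g (f i) else i"
  have "bij_betw (\<lambda>i. inv_into A g (f i)) A A"
    using bij_betw_trans[OF assms(1) bij_betw_inv_into[OF assms(2)]] by (simp add: o_def)
  then have "bij_betw ?p A A" by (simp cong: bij_betw_cong)
  then show "?p permutes A" by (intro bij_imp_permutes) auto
  show "g (?p i) = f i" if "i \<in> A" for i
    using that bij_betwE[OF assms(1)] assms(2) by (simp add: bij_betw_inv_into_right)
qed

text \<open>The substitution given by s differs from the one at the fixed point by a permutation
  within each group of Chern roots, and representatives are invariant under these.\<close>

lemma root_subst_inj:
  assumes s: "s \<in> {1..n} \<rightarrow> {1..n}" "inj_on s {1..n}" and f: "f \<in> HR n k"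
  shows "s ` {1..k} \<in> subsets_k n k" "subst (root_subst k s) f = subst (fixed_pt n (s ` {1..k})) f"
proof -
  let ?J = "s ` {1..k}"
  have sub: "{1..k} \<subseteq> {1..n}" using kn by auto
  have inj: "inj_on s {1..k}" using s(2) sub inj_on_subset by blast
  show J: "?J \<in> subsets_k n k" using s sub inj by (auto simp: subsets_k_def card_image)
  have surj: "s ` {1..n} = {1..n}" using s endo_inj_surj[of "{1..n}" s] by auto
  have b1: "bij_betw s {1..k} ?J" using inj by (simp add: bij_betw_def)
  have sh: "bij_betw (\<lambda>i. k + i) {1..n - k} ({1..n} - {1..k})"
    by (rule bij_betw_byWitness[of _ "\<lambda>i. i - k"]) (use kn in auto)
  have "bij_betw s ({1..n} - {1..k}) ({1..n} - ?J)"
    unfolding bij_betw_def using s(2) surj sub by (metis Diff_subset inj_on_image_set_diff inj_on_subset order_refl)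
  then have b2: "bij_betw (\<lambda>i. s (k + i)) {1..n - k} ({1..n} - ?J)"
    using bij_betw_trans[OF sh] by (simp add: o_def)
  obtain \<sigma> where \<sigma>: "\<sigma> permutes {1..k}" "\<And>i. i \<in> {1..k} \<Longrightarrow> sorted_list_of_set ?J ! (\<sigma> i - 1) = s i"
    using perm_between[OF b1 enum_J[OF J]] by metis
  obtain \<tau> where \<tau>: "\<tau> permutes {1..n-k}" "\<And>i. i \<in> {1..n-k} \<Longrightarrow> sorted_list_of_set ({1..n} - ?J) ! (\<tau> i - 1) = s (k + i)"
    using perm_between[OF b2 enum_Jc[OF J]] by metis
  have T: "subst (root_subst k s) a = subst (fixed_pt n ?J) a" if a: "a \<in> T_polys n k" for a
  proof -
    \<comment> \<open>The permutations may be inserted because \<open>a\<close> is invariant; they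
      turn the increasing enumerations of J and of its complement into the order given by s.\<close>
    have "subst (fixed_pt n ?J) a = subst (fixed_pt n ?J) (subst (\<lambda>v. X (perm_var \<sigma> \<tau> id v)) a)"
      using a \<sigma>(1) \<tau>(1) by (simp add: T_polys_def)
    also have "\<dots> = subst (\<lambda>v. subst (fixed_pt n ?J) (X (perm_var \<sigma> \<tau> id v))) a"
      by (rule dens_subst_comp[of _ base_vars])
        (use a polys_dens[of "Gam_z_y n k" base_vars] in \<open>auto simp: perm_var_base fixed_pt_base T_polys_def\<close>)
    also have "\<dots> = subst (root_subst k s) a"
    proof (rule polys_subst_cong)
      show "a \<in> polys (Gam_z_y n k)" using a by (simp add: T_polys_def)
      show "subst (fixed_pt n ?J) (X (perm_var \<sigma> \<tau> id v)) = root_subst k s v" if "v \<in> Gam_z_y n k" for v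
        using that \<sigma>(2) \<tau>(2) by (auto simp: Gam_z_y_def perm_var_def fixed_pt_def root_subst_def)
    qed
    finally show ?thesis by simp
  qed
  show "subst (root_subst k s) f = subst (fixed_pt n ?J) f"
    using f unfolding HR_def
  proof (induction f rule: prod_span_induct)
    case (mult a b)
    have "rat.sdef \<sigma> b" if "\<And>v. v \<in> base_vars \<Longrightarrow> \<sigma> v = X v" for \<sigma>
      using mult(2) L_NR that by (intro sdef_NR) auto
    then show ?case using mult T subst_L[OF mult(2) root_subst_base] subst_L[OF mult(2) fixed_pt_base]
      by (auto simp: rat.subst_mult rat.sdef_polys T_polys_def root_subst_base fixed_pt_base)
  next
    case (add x y)
    then have "x \<in> NR n k" "y \<in> NR n k" using HR_NR unfolding HR_def by auto
    then show ?case using add by (simp add: rat.subst_add sdef_NR root_subst_base fixed_pt_base)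
  qed simp
qed

text \<open>In the decomposition of f by the partition of unity, a non-injective s contributes an
  element of the ideal in any case, and an injective one contributes the value at a fixed point,
  which is zero.\<close>

lemma vanishing_rel_ideal:
  assumes "f \<in> HR n k" "\<And>J. J \<in> subsets_k n k \<Longrightarrow> subst (fixed_pt n J) f = 0"
  shows "f \<in> rel_ideal n k"
proof -
  have fN: "f \<in> NR n k" using assms(1) HR_NR by auto
  have "f = f * (\<Sum>s\<in>PiE {1..n} (\<lambda>_. {1..n}). point_idem s)" by (simp only: sum_point_idem mult_1_right)
  also have "\<dots> = (\<Sum>s\<in>PiE {1..n} (\<lambda>_. {1..n}). f * point_idem s)" by (rule sum_distrib_left)
  also have "\<dots> \<in> rel_ideal n k"
  proof (rule rel_ideal_sum)
    fix s assume "s \<in> PiE {1..n} (\<lambda>_. {1..n})"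
    then have s: "s \<in> {1..n} \<rightarrow> {1..n}" by auto
    show "f * point_idem s \<in> rel_ideal n k"
    proof (cases "inj_on s {1..n}")
      case True
      have "subst (root_subst k s) f = 0" using root_subst_inj[OF s True assms(1)] assms(2) by simp
      then show ?thesis using point_idem_eval[OF s fN] by simp
    next
      case False
      then show ?thesis by (intro rel_ideal_mult point_idem_not_inj s fN)
    qed
  qed
  finally show ?thesis .
qed

end

declare One_nat_def [simp del]

section \<open>Averaging over permutations of the Chern roots and of the z\<close>

abbreviation pm :: "(nat \<Rightarrow> nat) \<Rightarrow> (nat \<Rightarrow> nat) \<Rightarrow> (nat \<Rightarrow> nat) \<Rightarrow> ratf \<Rightarrow> ratf" where
  "pm \<sigma> \<tau> \<rho> \<equiv> subst (\<lambda>v. X (perm_var \<sigma> \<tau> \<rho> v))"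

text \<open>\<open>R\<close> is empty for invariants under the permutations of the Chern roots only, and \<open>{1..n}\<close> for
  the \<open>GL\<^sub>n\<close>-equivariant ones.\<close>

definition orbit_sum :: "nat \<Rightarrow> nat \<Rightarrow> nat set \<Rightarrow> ratf \<Rightarrow> ratf" where
  "orbit_sum n k R f = (\<Sum>\<sigma> | \<sigma> permutes {1..k}. \<Sum>\<tau> | \<tau> permutes {1..n - k}. \<Sum>\<rho> | \<rho> permutes R. pm \<sigma> \<tau> \<rho> f)"

definition inv_polys :: "nat \<Rightarrow> nat \<Rightarrow> nat set \<Rightarrow> ratf set" where
  "inv_polys n k R = {f \<in> polys (Gam_z_y n k).
     \<forall>\<sigma> \<tau> \<rho>. \<sigma> permutes {1..k} \<longrightarrow> \<tau> permutes {1..n - k} \<longrightarrow> \<rho> permutes R \<longrightarrow> pm \<sigma> \<tau> \<rho> f = f}"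

lemma T_polys_inv: "T_polys n k = inv_polys n k {}"
  by (auto simp: T_polys_def inv_polys_def)

lemma GL_polys_inv: "GL_polys n k = inv_polys n k {1..n}"
  by (auto simp: GL_polys_def inv_polys_def)

lemma perm_var_Gam:
  assumes "v \<in> Gam_z_y n k" "\<sigma> permutes {1..k}" "\<tau> permutes {1..n - k}" "\<rho> permutes R" "R \<subseteq> {1..n}"
  shows "perm_var \<sigma> \<tau> \<rho> v \<in> Gam_z_y n k"
  using assms permutes_in_image[OF assms(2)] permutes_in_image[OF assms(3)] permutes_in_image[OF permutes_subset[OF assms(4,5)]]
  by (auto simp: Gam_z_y_def perm_var_def)

lemma pm_polys:
  assumes "f \<in> polys (Gam_z_y n k)" "\<sigma> permutes {1..k}" "\<tau> permutes {1..n - k}" "\<rho> permutes R" "R \<subseteq> {1..n}"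
  shows "pm \<sigma> \<tau> \<rho> f \<in> polys (Gam_z_y n k)"
  using assms by (intro polys_subst[OF assms(1) polys_is_subring]) (auto intro: perm_var_Gam)

lemma pm_pm: "f \<in> polys S \<Longrightarrow> pm \<sigma> \<tau> \<rho> (pm \<sigma>' \<tau>' \<rho>' f) = pm (\<sigma> \<circ> \<sigma>') (\<tau> \<circ> \<tau>') (\<rho> \<circ> \<rho>') f"
proof -
  assume f: "f \<in> polys S"
  have "pm \<sigma> \<tau> \<rho> (pm \<sigma>' \<tau>' \<rho>' f) = subst (\<lambda>v. pm \<sigma> \<tau> \<rho> (X (perm_var \<sigma>' \<tau>' \<rho>' v))) f"
    by (rule dens_subst_comp[of f "{}"]) (use f polys_dens[of S "{}"] in auto)
  also have "(\<lambda>v. pm \<sigma> \<tau> \<rho> (X (perm_var \<sigma>' \<tau>' \<rho>' v))) = (\<lambda>v. X (perm_var (\<sigma> \<circ> \<sigma>') (\<tau> \<circ> \<tau>') (\<rho> \<circ> \<rho>') v))"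
    by (auto simp: fun_eq_iff perm_var_def split: var.split)
  finally show ?thesis .
qed

lemma orbit_sum_inv:
  assumes f: "f \<in> polys (Gam_z_y n k)" and R: "R \<subseteq> {1..n}"
  shows "orbit_sum n k R f \<in> inv_polys n k R"
  unfolding inv_polys_def
proof (intro CollectI conjI allI impI)
  note P = is_subring_intros[OF polys_is_subring[of "Gam_z_y n k"]]
  show "orbit_sum n k R f \<in> polys (Gam_z_y n k)"
    unfolding orbit_sum_def using f R by (auto intro!: P pm_polys)
  fix \<sigma> \<tau> \<rho> assume p: "\<sigma> permutes {1..k}" "\<tau> permutes {1..n - k}" "\<rho> permutes R"
  have sd: "rat.sdef \<sigma>'' (pm \<sigma>' \<tau>' \<rho>' f)" if "\<sigma>' permutes {1..k}" "\<tau>' permutes {1..n - k}" "\<rho>' permutes R" for \<sigma>' \<tau>' \<rho>' \<sigma>''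
    by (rule rat.sdef_polys[OF pm_polys[OF f that R]])
  have "pm \<sigma> \<tau> \<rho> (orbit_sum n k R f) = (\<Sum>\<sigma>' | \<sigma>' permutes {1..k}. \<Sum>\<tau>' | \<tau>' permutes {1..n - k}. \<Sum>\<rho>' | \<rho>' permutes R.
      pm (\<sigma> \<circ> \<sigma>') (\<tau> \<circ> \<tau>') (\<rho> \<circ> \<rho>') f)"
  proof -
    have 1: "pm \<sigma> \<tau> \<rho> (\<Sum>\<rho>' | \<rho>' permutes R. pm \<sigma>' \<tau>' \<rho>' f) = (\<Sum>\<rho>' | \<rho>' permutes R. pm (\<sigma> \<circ> \<sigma>') (\<tau> \<circ> \<tau>') (\<rho> \<circ> \<rho>') f)"
      if "\<sigma>' permutes {1..k}" "\<tau>' permutes {1..n - k}" for \<sigma>' \<tau>'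
      by (subst rat.subst_sum) (auto intro: sd that simp: pm_pm[OF f])
    have 2: "pm \<sigma> \<tau> \<rho> (\<Sum>\<tau>' | \<tau>' permutes {1..n - k}. \<Sum>\<rho>' | \<rho>' permutes R. pm \<sigma>' \<tau>' \<rho>' f)
      = (\<Sum>\<tau>' | \<tau>' permutes {1..n - k}. \<Sum>\<rho>' | \<rho>' permutes R. pm (\<sigma> \<circ> \<sigma>') (\<tau> \<circ> \<tau>') (\<rho> \<circ> \<rho>') f)"
      if "\<sigma>' permutes {1..k}" for \<sigma>'
      by (subst rat.subst_sum) (auto intro!: sd that rat.sdef_sum sum.cong 1)
    show ?thesis unfolding orbit_sum_def
      by (subst rat.subst_sum) (auto intro!: sd rat.sdef_sum sum.cong 2)
  qed
  also have "\<dots> = orbit_sum n k R f"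
    unfolding orbit_sum_def
    by (subst setum_permutations_compose_left[OF p(1), symmetric, where f = "\<lambda>s. \<Sum>\<tau>' | \<tau>' permutes {1..n - k}. \<Sum>\<rho>' | \<rho>' permutes R. pm s (\<tau> \<circ> \<tau>') (\<rho> \<circ> \<rho>') f"],
      rule sum.cong[OF refl],
      subst setum_permutations_compose_left[OF p(2), symmetric, where f = "\<lambda>t. \<Sum>\<rho>' | \<rho>' permutes R. pm _ t (\<rho> \<circ> \<rho>') f"],
      rule sum.cong[OF refl],
      rule setum_permutations_compose_left[OF p(3), symmetric])
  finally show "pm \<sigma> \<tau> \<rho> (orbit_sum n k R f) = orbit_sum n k R f" .
qed

lemma orbit_sum_of_inv:
  assumes "f \<in> inv_polys n k R"
  shows "orbit_sum n k R f = of_nat (card {\<sigma>. \<sigma> permutes {1..k}} * card {\<tau>. \<tau> permutes {1..n - k}} * card {\<rho>. \<rho> permutes R}) * f"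
  using assms unfolding orbit_sum_def inv_polys_def by (simp add: algebra_simps)

lemma cst_of_nat: "cst (of_nat m) = of_nat m"
  by (induction m) (simp_all add: cst_add)

lemma cst_inverse: "cst (inverse c) = inverse (cst c)"
proof (cases "c = 0")
  case False
  then have "cst (inverse c) * cst c = 1" by (simp flip: cst_mult)
  then show ?thesis by (metis inverse_unique mult.commute)
qed simp

lemma of_nat_ratf_nonzero [simp]: "of_nat (Suc m) \<noteq> (0::ratf)"
  unfolding cst_of_nat[symmetric] using of_nat_neq_0[of m, where 'a = complex]
  by (metis cst_1 cst_mult mult_zero_left right_inverse cst_0 zero_neq_one)

lemma of_nat_ratf_eq_0 [simp]: "of_nat m = (0::ratf) \<longleftrightarrow> m = 0"
  using of_nat_ratf_nonzero by (cases m) auto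

lemma perm_count_nonzero:
  assumes "finite R"
  shows "card {\<sigma>. \<sigma> permutes {1..k::nat}} * card {\<tau>. \<tau> permutes {1..m::nat}} * card {\<rho>. \<rho> permutes R} \<noteq> 0"
  using assms by (simp add: card_permutations[OF refl])

lemma coeff_linear_GL:
  shows "coeff (\<Prod>i=1..k. [:- g1 i, 1:]) j \<in> GL_polys n k"
    and "coeff (\<Prod>i=1..n - k. [:- g2 i, 1:]) j \<in> GL_polys n k"
    and "coeff (\<Prod>i=1..n. [:- zz i, 1:]) j \<in> GL_polys n k"
proof -
  have g: "coeff (\<Prod>i\<in>A. [:- X (f i), 1:]) j \<in> GL_polys n k"
    if f: "\<And>i. i \<in> A \<Longrightarrow> f i \<in> Gam_z_y n k"
      and p: "\<And>\<sigma> \<tau> \<rho>. \<sigma> permutes {1..k} \<Longrightarrow> \<tau> permutes {1..n - k} \<Longrightarrow> \<rho> permutes {1..n} \<Longrightarrow>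
          \<exists>\<pi>. \<pi> permutes A \<and> (\<forall>i\<in>A. perm_var \<sigma> \<tau> \<rho> (f i) = f (\<pi> i))" for A and f :: "nat \<Rightarrow> var"
    unfolding GL_polys_def
  proof (intro CollectI conjI allI impI)
    show "coeff (\<Prod>i\<in>A. [:- X (f i), 1:]) j \<in> polys (Gam_z_y n k)"
      by (rule coeff_prod_linear_mem[OF polys_is_subring]) (simp add: f)
    fix \<sigma> \<tau> \<rho> assume st: "\<sigma> permutes {1..k}" "\<tau> permutes {1..n - k}" "\<rho> permutes {1..n}"
    obtain \<pi> where \<pi>: "\<pi> permutes A" "\<forall>i\<in>A. perm_var \<sigma> \<tau> \<rho> (f i) = f (\<pi> i)" using p[OF st] by blast
    have "pm \<sigma> \<tau> \<rho> (coeff (\<Prod>i\<in>A. [:- X (f i), 1:]) j) = coeff (\<Prod>i\<in>A. [:- pm \<sigma> \<tau> \<rho> (X (f i)), 1:]) j"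
      using rat.subst_coeff_prod_linear[of A "\<lambda>v. X (perm_var \<sigma> \<tau> \<rho> v)" "\<lambda>i. X (f i)" j] by simp
    also have "(\<Prod>i\<in>A. [:- pm \<sigma> \<tau> \<rho> (X (f i)), 1:]) = (\<Prod>i\<in>A. ((\<lambda>i. [:- X (f i), 1:]) \<circ> \<pi>) i)"
      by (rule prod.cong) (simp_all add: \<pi>(2))
    also have "\<dots> = (\<Prod>i\<in>A. [:- X (f i), 1:])" by (rule prod.permute[OF \<pi>(1), symmetric])
    finally show "pm \<sigma> \<tau> \<rho> (coeff (\<Prod>i\<in>A. [:- X (f i), 1:]) j) = coeff (\<Prod>i\<in>A. [:- X (f i), 1:]) j" .
  qed
  show "coeff (\<Prod>i=1..k. [:- g1 i, 1:]) j \<in> GL_polys n k"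
    by (rule g) (auto simp: Gam_z_y_def perm_var_def)
  show "coeff (\<Prod>i=1..n - k. [:- g2 i, 1:]) j \<in> GL_polys n k"
    by (rule g) (auto simp: Gam_z_y_def perm_var_def)
  show "coeff (\<Prod>i=1..n. [:- zz i, 1:]) j \<in> GL_polys n k"
    by (rule g) (auto simp: Gam_z_y_def perm_var_def)
qed

lemma relations_GL: "relations n k \<subseteq> GL_polys n k"
  unfolding relations_def coeff_diff coeff_mult image_subset_iff
  by (auto intro!: is_subring_diff[OF GL_polys_is_subring] is_subring_sum[OF GL_polys_is_subring] is_subring_mult[OF GL_polys_is_subring] coeff_linear_GL)

lemma GL_T: "GL_polys n k \<subseteq> T_polys n k"
  unfolding GL_polys_def T_polys_def using permutes_id by auto

definition vanishing :: "nat \<Rightarrow> nat \<Rightarrow> ratf set" where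
  "vanishing n k = {f. \<forall>J\<in>subsets_k n k. subst (fixed_pt n J) f = 0}"

lemma fixed_pt_sdef: "f \<in> HR n k \<Longrightarrow> rat.sdef (fixed_pt n J) f"
  using HR_NR by (intro sdef_NR fixed_pt_base) auto

context
  fixes n k :: nat
  assumes n1: "1 \<le> n" and kn: "k \<le> n"
begin

lemma T_in_HR: "f \<in> T_polys n k \<Longrightarrow> f \<in> HR n k" and L_in_HR: "f \<in> L_lam_zy n \<Longrightarrow> f \<in> HR n k"
  using T_HR L_HR by blast+

text \<open>At a fixed point the roots become all of the z, those of J in the first group and the
  others in the second, so the two products of linear factors coincide.\<close>

lemma relations_vanish:
  assumes "r \<in> relations n k"
  shows "r \<in> vanishing n k"
  unfolding vanishing_def
proof (intro CollectI ballI)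
  fix J assume J: "J \<in> subsets_k n k"
  obtain j where r: "r = coeff (rel_poly n k) j" using assms relations_eq[OF kn] by auto
  have "subst (fixed_pt n J) r = coeff (\<Prod>i=1..n. [:- fixed_pt n J (root_var k i), 1:]) j
     - coeff (\<Prod>i=1..n. [:- fixed_pt n J (VZ i), 1:]) j"
    unfolding r rel_poly_def coeff_diff
    using rat.subst_coeff_prod_linear[of "{1..n}" "fixed_pt n J" "\<lambda>i. X (root_var k i)" j]
      rat.subst_coeff_prod_linear[of "{1..n}" "fixed_pt n J" zz j]
    by (simp add: rat.subst_diff)
  also have "(\<Prod>i=1..n. [:- fixed_pt n J (root_var k i), 1:])
    = (\<Prod>i=1..k. [:- fixed_pt n J (VG1 i), 1:]) * (\<Prod>i=1..n - k. [:- fixed_pt n J (VG2 i), 1:])"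
    by (rule prod_split_roots[OF kn, symmetric])
  also have "(\<Prod>i=1..k. [:- fixed_pt n J (VG1 i), 1:]) = (\<Prod>j\<in>J. [:- zz j, 1:])"
    by (simp add: fixed_pt_def prod.reindex_bij_betw[OF enum_J[OF n1 kn J], where g = "\<lambda>j. [:- zz j, 1:]"])
  also have "(\<Prod>i=1..n - k. [:- fixed_pt n J (VG2 i), 1:]) = (\<Prod>j\<in>{1..n} - J. [:- zz j, 1:])"
    by (simp add: fixed_pt_def prod.reindex_bij_betw[OF enum_Jc[OF n1 kn J], where g = "\<lambda>j. [:- zz j, 1:]"])
  also have "(\<Prod>j\<in>J. [:- zz j, 1:]) * (\<Prod>j\<in>{1..n} - J. [:- zz j, 1:]) = (\<Prod>i=1..n. [:- zz i, 1:])"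
    using J prod.subset_diff[of J "{1..n}" "\<lambda>j. [:- zz j, 1:]"] by (simp add: subsets_k_def mult.commute)
  also have "(\<Prod>i=1..n. [:- fixed_pt n J (VZ i), 1:]) = (\<Prod>i=1..n. [:- zz i, 1:])" by (simp add: fixed_pt_def)
  finally show "subst (fixed_pt n J) r = 0" by simp
qed

lemma relations_HR: "relations n k \<subseteq> HR n k"
  using relations_GL GL_T T_HR by blast

lemma HT_ring_HR: "HT_ring n k = ring_on (HR n k)"
  by (simp add: HT_ring_def HR_def)

lemma vanishing_ideal: "S \<subseteq> HR n k \<Longrightarrow> is_subring S \<Longrightarrow> ideal (S \<inter> vanishing n k) (ring_on S)"
proof (rule ideal_ring_onI)
  assume S: "S \<subseteq> HR n k" "is_subring S"
  show "is_subring S" by (rule S(2))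
  show "0 \<in> S \<inter> vanishing n k" using is_subring_0[OF S(2)] by (simp add: vanishing_def)
  have sd: "f \<in> S \<Longrightarrow> rat.sdef (fixed_pt n J) f" for f J using fixed_pt_sdef S(1) by auto
  show "a + b \<in> S \<inter> vanishing n k" if "a \<in> S \<inter> vanishing n k" "b \<in> S \<inter> vanishing n k" for a b
    using that sd is_subring_add[OF S(2)] by (auto simp: vanishing_def rat.subst_add)
  show "f * a \<in> S \<inter> vanishing n k" if "a \<in> S \<inter> vanishing n k" "f \<in> S" for a f
    using that sd is_subring_mult[OF S(2)] by (auto simp: vanishing_def rat.subst_mult)
qed simp

lemma pm_L: "b \<in> L_lam_zy n \<Longrightarrow> pm \<sigma> \<tau> id b = b"
  by (rule subst_L) (auto simp: perm_var_base)

lemma pm_HR: "f \<in> HR n k \<Longrightarrow> \<sigma> permutes {1..k} \<Longrightarrow> \<tau> permutes {1..n - k} \<Longrightarrow> pm \<sigma> \<tau> id f = f"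
  unfolding HR_def
proof (induction f rule: prod_span_induct)
  case (mult a b)
  have "rat.sdef (\<lambda>v. X (perm_var \<sigma> \<tau> id v)) b"
    using mult(2) L_NR by (intro sdef_NR) (auto simp: perm_var_base)
  moreover have "rat.sdef (\<lambda>v. X (perm_var \<sigma> \<tau> id v)) a" "pm \<sigma> \<tau> id a = a"
    using mult by (auto simp: T_polys_def rat.sdef_polys)
  ultimately show ?case using pm_L[OF mult(2)] by (simp only: rat.subst_mult)
next
  case (add x y)
  then have "x \<in> NR n k" "y \<in> NR n k" using HR_NR unfolding HR_def by auto
  then show ?case using add by (simp only: rat.subst_add sdef_NR perm_var_base)
qed simp

lemma NR_orbit_sum: "f \<in> NR n k \<Longrightarrow> orbit_sum n k {} f \<in> HR n k"
  unfolding NR_def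
proof (induction f rule: prod_span_induct)
  case (mult a b)
  have "rat.sdef (\<lambda>v. X (perm_var \<sigma> \<tau> id v)) b" for \<sigma> \<tau>
    using mult(2) L_NR by (intro sdef_NR) (auto simp: perm_var_base)
  then have "orbit_sum n k {} (a * b) = orbit_sum n k {} a * b"
    using mult by (simp add: orbit_sum_def rat.subst_mult rat.sdef_polys pm_L sum_distrib_right)
  then show ?case unfolding HR_def T_polys_inv using orbit_sum_inv[OF mult(1)] prod_span_mult mult(2) by auto
next
  case zero then show ?case by (simp add: orbit_sum_def is_subring_0[OF HR_is_subring])
next
  case (add x y)
  then have "x \<in> NR n k" "y \<in> NR n k" unfolding NR_def by auto
  then have "orbit_sum n k {} (x + y) = orbit_sum n k {} x + orbit_sum n k {} y"
    by (simp add: orbit_sum_def rat.subst_add sdef_NR perm_var_base sum.distrib)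
  then show ?case using add is_subring_add[OF HR_is_subring] by simp
qed

text \<open>The relations are invariant under permutations of the roots, so they can be taken out of
  the sum and only their cofactors are averaged.\<close>

lemma orbit_sum_rel_ideal: "f \<in> rel_ideal n k \<Longrightarrow> orbit_sum n k {} f \<in> HT_ideal n k"
proof -
  note gi = genideal_ring_on[OF HR_is_subring relations_HR]
  interpret Q: ring_on_quot "HR n k" "HT_ideal n k"
    by (rule ring_on_quot.intro) (simp_all add: HT_ideal_def HT_ring_HR gi HR_is_subring)
  show "f \<in> rel_ideal n k \<Longrightarrow> orbit_sum n k {} f \<in> HT_ideal n k"
    unfolding rel_ideal_def
  proof (induction f rule: prod_span_induct)
    case (mult r g)
    have r: "r \<in> HR n k" using mult(1) relations_HR by auto
    have "rat.sdef (\<lambda>v. X (perm_var \<sigma> \<tau> id v)) r" "rat.sdef (\<lambda>v. X (perm_var \<sigma> \<tau> id v)) g" for \<sigma> \<tau>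
      using r HR_NR mult(2) by (auto intro!: sdef_NR simp: perm_var_base)
    then have "orbit_sum n k {} (r * g) = orbit_sum n k {} g * r"
      using r by (simp add: orbit_sum_def rat.subst_mult pm_HR sum_distrib_left mult.commute)
    then show ?case using Q.I_mult[of r "orbit_sum n k {} g"] gi(2) mult(1) NR_orbit_sum[OF mult(2)]
      by (auto simp: HT_ideal_def HT_ring_HR)
  next
    case zero then show ?case by (simp add: orbit_sum_def Q.I_0)
  next
    case (add x y)
    then have "x \<in> rel_ideal n k" "y \<in> rel_ideal n k" unfolding rel_ideal_def by auto
    then have "x \<in> NR n k" "y \<in> NR n k"
      using prod_span_subset[OF NR_is_subring[of n k], of "relations n k" "NR n k"] relations_HR HR_NR unfolding rel_ideal_def by blast+
    then have "orbit_sum n k {} (x + y) = orbit_sum n k {} x + orbit_sum n k {} y"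
      by (simp add: orbit_sum_def rat.subst_add sdef_NR perm_var_base sum.distrib)
    then show ?case using add Q.I_add by simp
  qed
qed

text \<open>A vanishing element lies in the ideal of the larger ring \<open>NR\<close> by
  \<open>vanishing_rel_ideal\<close>. Averaging brings the cofactors back to \<open>HR\<close> at
  the price of the order of the group, which is invertible in characteristic zero.\<close>

lemma HT_ideal_eq: "HT_ideal n k = HR n k \<inter> vanishing n k"
proof
  note gi = genideal_ring_on[OF HR_is_subring relations_HR]
  show "HT_ideal n k \<subseteq> HR n k \<inter> vanishing n k"
    unfolding HT_ideal_def HT_ring_HR
    by (rule gi(3)[OF vanishing_ideal[OF order_refl HR_is_subring]]) (use relations_HR relations_vanish in auto)
  interpret Q: ring_on_quot "HR n k" "HT_ideal n k"
    by (rule ring_on_quot.intro) (simp_all add: HT_ideal_def HT_ring_HR gi HR_is_subring)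
  show "HR n k \<inter> vanishing n k \<subseteq> HT_ideal n k"
  proof
    fix f assume f: "f \<in> HR n k \<inter> vanishing n k"
    let ?N = "card {\<sigma>. \<sigma> permutes {1..k}} * card {\<tau>. \<tau> permutes {1..n - k}}"
    have N: "?N \<noteq> 0" using perm_count_nonzero[of "{}" k "n - k"] by simp
    have "f \<in> rel_ideal n k" using f by (intro vanishing_rel_ideal[OF n1 kn]) (auto simp: vanishing_def)
    then have "orbit_sum n k {} f \<in> HT_ideal n k" by (rule orbit_sum_rel_ideal)
    also have "orbit_sum n k {} f = of_nat ?N * f"
      using f pm_HR by (simp add: orbit_sum_def algebra_simps)
    finally have "inverse (of_nat ?N) * (of_nat ?N * f) \<in> HT_ideal n k"
    proof (rule Q.I_mult)
      have "cst (inverse (of_nat ?N)) \<in> HR n k" by (rule L_in_HR[OF cst_L])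
      then show "inverse (of_nat ?N) \<in> HR n k" by (simp only: cst_inverse cst_of_nat)
    qed
    moreover have "of_nat ?N \<noteq> (0::ratf)" unfolding of_nat_ratf_eq_0 by (rule N)
    moreover have "a \<noteq> 0 \<Longrightarrow> inverse a * (a * f) = f" for a by simp
    ultimately show "f \<in> HT_ideal n k" by metis
  qed
qed

lemma HT_quot: "ring_on_quot (HR n k) (HT_ideal n k)"
  by (rule ring_on_quot.intro) (simp_all add: HR_is_subring HT_ideal_eq vanishing_ideal)

section \<open>Classes and their values at the fixed points\<close>

lemma HT_L_eq: "HT_L n k = ring_on (HR n k) Quot HT_ideal n k"
  by (simp add: HT_L_def HT_ring_HR)

lemma HT_class_eq: "HT_class n k f = HT_ideal n k +>\<^bsub>ring_on (HR n k)\<^esub> f"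
  by (simp add: HT_class_def HT_ring_HR)

lemma HT_cring: "cring (HT_L n k)"
  unfolding HT_L_eq by (rule ring_on_quot.Q_cring[OF HT_quot])

lemma HT_class_carrier: "f \<in> HR n k \<Longrightarrow> HT_class n k f \<in> carrier (HT_L n k)"
  unfolding HT_L_eq HT_class_eq by (rule ring_on_quot.cls_in[OF HT_quot])

lemma HT_carrierE:
  assumes "c \<in> carrier (HT_L n k)"
  obtains f where "f \<in> HR n k" "c = HT_class n k f"
  using ring_on_quot.Q_carrierE[OF HT_quot] assms unfolding HT_L_eq HT_class_eq by metis

lemma restr_class: "f \<in> HR n k \<Longrightarrow> J \<in> subsets_k n k \<Longrightarrow> restr n J (HT_class n k f) = subst (fixed_pt n J) f"
  unfolding restr_def HT_class_eq
  by (rule ring_on_quot.the_elem_cls[OF HT_quot])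
    (auto simp: HT_ideal_eq vanishing_def rat.subst_add fixed_pt_sdef)

lemma fixed_pt_T: "f \<in> T_polys n k \<Longrightarrow> J \<in> subsets_k n k \<Longrightarrow> subst (fixed_pt n J) f \<in> polys (VZ ` {1..n} \<union> {VY})"
proof -
  assume f: "f \<in> T_polys n k" and J: "J \<in> subsets_k n k"
  then have Jn: "J \<subseteq> {1..n}" by (simp add: subsets_k_def)
  show ?thesis
  proof (rule polys_subst[OF _ polys_is_subring])
    show "f \<in> polys (Gam_z_y n k)" using f by (simp add: T_polys_def)
    fix v assume "v \<in> Gam_z_y n k"
    then show "fixed_pt n J v \<in> polys (VZ ` {1..n} \<union> {VY})"
      using fixed_pt_VG1[OF n1 kn J] fixed_pt_VG2[OF n1 kn J] Jn
      by (auto simp: Gam_z_y_def) (auto simp: fixed_pt_def)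
  qed simp
qed

lemma polys_zy_L: "polys (VZ ` {1..n} \<union> {VY}) \<subseteq> L_lam_zy n"
  using polys_mono[of "VZ ` {1..n} \<union> {VY}" "insert VLam (VZ ` {1..n} \<union> {VY})"] polys_lam_y_zy[of n] by auto

lemma fixed_pt_L: "b \<in> L_lam_zy n \<Longrightarrow> subst (fixed_pt n J) b = b"
  by (erule subst_L) (rule fixed_pt_base)

lemma fixed_pt_mult: "f \<in> HR n k \<Longrightarrow> g \<in> HR n k \<Longrightarrow> subst (fixed_pt n J) (f * g) = subst (fixed_pt n J) f * subst (fixed_pt n J) g"
  and fixed_pt_add: "f \<in> HR n k \<Longrightarrow> g \<in> HR n k \<Longrightarrow> subst (fixed_pt n J) (f + g) = subst (fixed_pt n J) f + subst (fixed_pt n J) g"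
  by (simp_all add: rat.subst_mult rat.subst_add fixed_pt_sdef)

lemma fixed_pt_HR: "f \<in> HR n k \<Longrightarrow> J \<in> subsets_k n k \<Longrightarrow> subst (fixed_pt n J) f \<in> L_lam_zy n"
  unfolding HR_def
proof (induction f rule: prod_span_induct)
  case (mult a b)
  then have "a \<in> HR n k" "b \<in> HR n k" using T_in_HR L_in_HR by simp_all
  then show ?case using fixed_pt_mult fixed_pt_L[OF mult(2)] subsetD[OF polys_zy_L fixed_pt_T[OF mult(1,3)]] mult(2) is_subring_mult[OF L_is_subring]
    by simp
next
  case (add x y)
  then show ?case using fixed_pt_add is_subring_add[OF L_is_subring] by (simp add: HR_def)
qed (simp add: is_subring_0[OF L_is_subring])

lemma restr_L: "c \<in> carrier (HT_L n k) \<Longrightarrow> J \<in> subsets_k n k \<Longrightarrow> restr n J c \<in> L_lam_zy n"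
  by (metis HT_carrierE restr_class fixed_pt_HR)

lemma HT_eqI:
  assumes "c \<in> carrier (HT_L n k)" "d \<in> carrier (HT_L n k)" "\<And>J. J \<in> subsets_k n k \<Longrightarrow> restr n J c = restr n J d"
  shows "c = d"
proof -
  obtain f g where fg: "f \<in> HR n k" "c = HT_class n k f" "g \<in> HR n k" "d = HT_class n k g"
    using assms HT_carrierE by metis
  then have "f - g \<in> HT_ideal n k" using assms(3)
    by (auto simp: HT_ideal_eq vanishing_def restr_class rat.subst_diff fixed_pt_sdef intro: is_subring_diff[OF HR_is_subring])
  then show ?thesis unfolding fg(2,4) HT_class_eq using ring_on_quot.cls_eq_iff[OF HT_quot] by blast
qed

lemma restr_mult: "c \<in> carrier (HT_L n k) \<Longrightarrow> d \<in> carrier (HT_L n k) \<Longrightarrow> J \<in> subsets_k n k \<Longrightarrow>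
    restr n J (c \<otimes>\<^bsub>HT_L n k\<^esub> d) = restr n J c * restr n J d"
  and restr_add: "c \<in> carrier (HT_L n k) \<Longrightarrow> d \<in> carrier (HT_L n k) \<Longrightarrow> J \<in> subsets_k n k \<Longrightarrow>
    restr n J (c \<oplus>\<^bsub>HT_L n k\<^esub> d) = restr n J c + restr n J d"
proof -
  assume cd: "c \<in> carrier (HT_L n k)" "d \<in> carrier (HT_L n k)" and J: "J \<in> subsets_k n k"
  obtain f g where fg: "f \<in> HR n k" "c = HT_class n k f" "g \<in> HR n k" "d = HT_class n k g"
    using cd HT_carrierE by metis
  have "c \<otimes>\<^bsub>HT_L n k\<^esub> d = HT_class n k (f * g)" "c \<oplus>\<^bsub>HT_L n k\<^esub> d = HT_class n k (f + g)"
    unfolding fg(2,4) unfolding HT_class_eq HT_L_eq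
    using fg ring_on_quot.cls_mult[OF HT_quot] ring_on_quot.cls_add[OF HT_quot] by auto
  then show "restr n J (c \<otimes>\<^bsub>HT_L n k\<^esub> d) = restr n J c * restr n J d"
    "restr n J (c \<oplus>\<^bsub>HT_L n k\<^esub> d) = restr n J c + restr n J d"
    using fg J by (simp_all add: restr_class is_subring_mult[OF HR_is_subring] is_subring_add[OF HR_is_subring] fixed_pt_mult fixed_pt_add)
qed

lemma restr_zero: "J \<in> subsets_k n k \<Longrightarrow> restr n J \<zero>\<^bsub>HT_L n k\<^esub> = 0"
  using ring_on_quot.Q_zero[OF HT_quot] restr_class[OF is_subring_0[OF HR_is_subring]]
  unfolding HT_L_eq HT_class_eq by simp

lemma restr_finsum:
  assumes "finite A" "\<And>i. i \<in> A \<Longrightarrow> g i \<in> carrier (HT_L n k)" "J \<in> subsets_k n k"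
  shows "restr n J (finsum (HT_L n k) g A) = (\<Sum>i\<in>A. restr n J (g i))"
proof -
  interpret cring "HT_L n k" by (rule HT_cring)
  show ?thesis using assms
    by (induction A) (auto simp: restr_zero restr_add finsum_insert)
qed

text \<open>\<open>P J'\<close> vanishes at the fixed point of J unless J is contained in J', that
  is, equal to it, since both have k elements. \<open>D J\<close> is the value of \<open>P J\<close>
  at the fixed point of J itself. As a product over all the first roots, \<open>P J'\<close> is
  symmetric in them.\<close>

lemma HT_interpolation:
  assumes v: "\<And>J. J \<in> subsets_k n k \<Longrightarrow> v J \<in> L_lam_zy n"
  obtains c where "c \<in> carrier (HT_L n k)" "\<And>J. J \<in> subsets_k n k \<Longrightarrow> restr n J c = v J"
proof -
  define P where "P = (\<lambda>J. \<Prod>i=1..k. \<Prod>a\<in>{1..n} - J. g1 i - zz a)"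
  define D where "D = (\<lambda>J. \<Prod>j\<in>J. \<Prod>a\<in>{1..n} - J. zz j - zz a)"
  define f where "f = (\<Sum>J\<in>subsets_k n k. P J * (inverse (D J) * v J))"
  have fin: "finite (subsets_k n k)" unfolding subsets_k_def by (rule finite_subset[of _ "Pow {1..n}"]) auto
  have PT: "P J \<in> T_polys n k" for J
    unfolding T_polys_def
  proof (intro CollectI conjI allI impI)
    show "P J \<in> polys (Gam_z_y n k)" unfolding P_def
      by (auto intro!: is_subring_prod[OF polys_is_subring] is_subring_diff[OF polys_is_subring] simp: Gam_z_y_def)
    fix \<sigma> \<tau> assume s: "\<sigma> permutes {1..k}" "\<tau> permutes {1..n - k}"
    have "pm \<sigma> \<tau> id (P J) = (\<Prod>i=1..k. ((\<lambda>i. \<Prod>a\<in>{1..n} - J. g1 i - zz a) \<circ> \<sigma>) i)"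
      unfolding P_def by (simp add: rat.subst_prod rat.sdef_prod rat.subst_diff perm_var_def)
    also have "\<dots> = P J" unfolding P_def by (rule prod.permute[OF s(1), symmetric])
    finally show "pm \<sigma> \<tau> id (P J) = P J" .
  qed
  have DL: "inverse (D J) \<in> L_lam_zy n" if "J \<in> subsets_k n k" for J
    using that unfolding D_def
    by (intro inverse_L_zy) (auto simp: L_zy_def subsets_k_def intro!: is_subring_prod[OF ratfuns_is_subring] is_subring_diff[OF ratfuns_is_subring] X_in_ratfuns)
  have term_HR: "P J * (inverse (D J) * v J) \<in> HR n k" if "J \<in> subsets_k n k" for J
    unfolding HR_def using that by (intro prod_span_mult PT is_subring_mult[OF L_is_subring] DL v)
  have fHR: "f \<in> HR n k" unfolding f_def by (intro is_subring_sum[OF HR_is_subring] term_HR)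
  have ev: "subst (fixed_pt n J) f = v J" if J: "J \<in> subsets_k n k" for J
  proof -
    have e: "subst (fixed_pt n J) (P J') = (\<Prod>j\<in>J. \<Prod>a\<in>{1..n} - J'. zz j - zz a)" for J'
    proof -
      have "subst (fixed_pt n J) (P J') = (\<Prod>i=1..k. \<Prod>a\<in>{1..n} - J'. zz (sorted_list_of_set J ! (i - 1)) - zz a)"
        unfolding P_def by (simp add: rat.subst_prod rat.sdef_prod rat.subst_diff fixed_pt_def)
      also have "\<dots> = (\<Prod>j\<in>J. \<Prod>a\<in>{1..n} - J'. zz j - zz a)"
        by (rule prod.reindex_bij_betw[OF enum_J[OF n1 kn J]])
      finally show ?thesis .
    qed
    have t: "subst (fixed_pt n J) (P J' * (inverse (D J') * v J')) = (if J' = J then v J else 0)" if J': "J' \<in> subsets_k n k" for J'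
    proof -
      have "inverse (D J') * v J' \<in> L_lam_zy n" using J' by (intro is_subring_mult[OF L_is_subring] DL v)
      then have "subst (fixed_pt n J) (P J' * (inverse (D J') * v J')) = (\<Prod>j\<in>J. \<Prod>a\<in>{1..n} - J'. zz j - zz a) * (inverse (D J') * v J')"
        using T_in_HR[OF PT[of J']] L_in_HR by (simp add: fixed_pt_mult e fixed_pt_L)
      also have "\<dots> = (if J' = J then v J else 0)"
      proof (cases "J' = J")
        case True
        have "D J \<noteq> 0" unfolding D_def using J by (auto simp: subsets_k_def dest: finite_subset)
        then show ?thesis using True by (simp add: D_def flip: mult.assoc)
      next
        case False
        have fJ: "finite J" "finite J'" using J J' by (auto simp: subsets_k_def dest: finite_subset)
        have "\<not> J \<subseteq> J'" using False J J' fJ card_subset_eq[OF fJ(2), of J] by (auto simp: subsets_k_def)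
        then obtain j where "j \<in> J" "j \<notin> J'" by auto
        moreover have "j \<in> {1..n}" using \<open>j \<in> J\<close> J by (auto simp: subsets_k_def)
        ultimately have "(\<Prod>j\<in>J. \<Prod>a\<in>{1..n} - J'. zz j - zz a) = 0" using fJ by (intro prod_zero bexI[of _ j]) auto
        then show ?thesis using False by simp
      qed
      finally show ?thesis .
    qed
    have "subst (fixed_pt n J) f = (\<Sum>J'\<in>subsets_k n k. if J' = J then v J else 0)"
      unfolding f_def by (subst rat.subst_sum) (auto intro!: fixed_pt_sdef term_HR sum.cong t)
    then show ?thesis using J fin by simp
  qed
  show thesis using that[of "HT_class n k f"] fHR ev by (simp add: HT_class_carrier restr_class)
qed

lemma T_shift: "a \<in> T_polys n k \<Longrightarrow> shift m a = a"
  by (rule shift_fixed[of _ "Gam_z_y n k"]) (use ratfuns_polys in \<open>auto simp: T_polys_def Gam_z_y_def\<close>)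

lemma HR_shift:
  assumes "f \<in> HR n k" "J \<in> subsets_k n k"
  shows "shift m f \<in> HR n k \<and> subst (fixed_pt n J) (shift m f) = shift m (subst (fixed_pt n J) f)"
  using assms(1) unfolding HR_def
proof (induction f rule: prod_span_induct)
  case (mult a b)
  then have ab: "a \<in> HR n k" "b \<in> HR n k" "shift m b \<in> HR n k" using T_in_HR L_in_HR L_shift by simp_all
  have "shift m (subst (fixed_pt n J) a) = subst (fixed_pt n J) a"
    by (rule shift_fixed[of _ "VZ ` {1..n} \<union> {VY}"]) (use fixed_pt_T[OF mult(1) assms(2)] ratfuns_polys in auto)
  then show ?case
    using ab mult prod_span_mult[of a "T_polys n k" "shift m b" "L_lam_zy n"] L_shift[OF mult(2), of m]
    by (simp add: shift_mult T_shift fixed_pt_mult fixed_pt_L)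
next
  case (add x y)
  then have "x \<in> HR n k" "y \<in> HR n k" "shift m x \<in> HR n k" "shift m y \<in> HR n k" by (auto simp: HR_def)
  then show ?case using add prod_span_add by (simp add: shift_add fixed_pt_add)
qed (simp add: prod_span_0)

lemma subsets_k_nonempty: "subsets_k n k \<noteq> {}"
  using kn by (auto simp: subsets_k_def intro!: exI[of _ "{1..k}"])

lemma HT_shift_class: "f \<in> HR n k \<Longrightarrow> HT_shift n k m (HT_class n k f) = HT_class n k (shift m f)"
proof -
  assume f: "f \<in> HR n k"
  obtain J0 where J0: "J0 \<in> subsets_k n k" using subsets_k_nonempty by auto
  have "the_elem ((\<lambda>f. HT_class n k (shift m f)) ` (HT_ideal n k +>\<^bsub>ring_on (HR n k)\<^esub> f)) = HT_class n k (shift m f)"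
  proof (rule ring_on_quot.the_elem_cls[OF HT_quot])
    fix a assume "a \<in> HT_ideal n k"
    then have "shift m a \<in> HT_ideal n k" using HR_shift[of a _ m] J0 by (auto simp: HT_ideal_eq vanishing_def)
    moreover have "shift m (a + f) - shift m f = shift m a" by (simp add: shift_add)
    ultimately show "HT_class n k (shift m (a + f)) = HT_class n k (shift m f)"
      unfolding HT_class_eq using ring_on_quot.cls_eq_iff[OF HT_quot] by metis
  qed
  then show ?thesis by (simp add: HT_shift_def HT_class_eq)
qed

lemma HT_shift_carrier: "c \<in> carrier (HT_L n k) \<Longrightarrow> HT_shift n k m c \<in> carrier (HT_L n k)"
proof -
  assume "c \<in> carrier (HT_L n k)"
  then obtain f where f: "f \<in> HR n k" "c = HT_class n k f" by (rule HT_carrierE)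
  obtain J0 where J0: "J0 \<in> subsets_k n k" using subsets_k_nonempty by auto
  show ?thesis using f HR_shift[OF f(1) J0] by (simp add: HT_shift_class HT_class_carrier)
qed

lemma restr_shift: "c \<in> carrier (HT_L n k) \<Longrightarrow> J \<in> subsets_k n k \<Longrightarrow> restr n J (HT_shift n k m c) = shift m (restr n J c)"
proof -
  assume "c \<in> carrier (HT_L n k)" and J: "J \<in> subsets_k n k"
  then obtain f where f: "f \<in> HR n k" "c = HT_class n k f" by (auto elim: HT_carrierE)
  show ?thesis using f HR_shift[OF f(1) J] J by (simp add: HT_shift_class restr_class)
qed

end

subsection \<open>Power sums\<close>

text \<open>Split off one index a. Summing over all values of a in B and subtracting the values
  already taken gives a power sum times a shorter sum, minus shorter sums in which the exponent of a
  is merged with that of some c.\<close>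

lemma symmetrized_monomial:
  fixes x :: "nat \<Rightarrow> ratf"
  assumes R: "is_subring R" and fB: "finite B" and p: "\<And>s. (\<Sum>b\<in>B. x b ^ s) \<in> R" and "finite A"
  shows "(\<Sum>\<phi> | \<phi> \<in> PiE A (\<lambda>_. B) \<and> inj_on \<phi> A. \<Prod>a\<in>A. x (\<phi> a) ^ e a) \<in> R"
  using \<open>finite A\<close>
proof (induction A arbitrary: e)
  case empty
  then show ?case by (simp add: is_subring_1[OF R])
next
  case (insert a A)
  let ?I = "\<lambda>A. {\<phi>. \<phi> \<in> PiE A (\<lambda>_. B) \<and> inj_on \<phi> A}"
  let ?m = "\<lambda>e \<phi>. \<Prod>a\<in>A. x (\<phi> a) ^ e a"
  have fin: "finite (?I A)" by (rule finite_subset[of _ "PiE A (\<lambda>_. B)"]) (auto intro: finite_PiE insert fB)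
  \<comment> \<open>An injection of the larger set is an injection of A together with a value b
    outside its image.\<close>
  have "(\<Sum>\<phi>\<in>?I (insert a A). \<Prod>c\<in>insert a A. x (\<phi> c) ^ e c) = (\<Sum>(\<phi>, b)\<in>(SIGMA \<phi>:?I A. B - \<phi> ` A). x b ^ e a * ?m e \<phi>)"
  proof (rule sum.reindex_bij_witness[of _ "\<lambda>(\<phi>, b). \<phi>(a := b)" "\<lambda>\<phi>. (\<phi>(a := undefined), \<phi> a)"])
    fix \<phi> assume "\<phi> \<in> ?I (insert a A)"
    then have \<phi>: "\<phi> \<in> PiE (insert a A) (\<lambda>_. B)" "inj_on \<phi> (insert a A)" by auto
    have "\<phi>(a := undefined) \<in> PiE A (\<lambda>_. B)" using \<phi>(1) insert(2) by (auto simp: PiE_iff extensional_def)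
    moreover have "inj_on (\<phi>(a := undefined)) A" using \<phi>(2) insert(2) by (auto simp: inj_on_def)
    moreover have "\<phi> a \<in> B - (\<phi>(a := undefined)) ` A" using \<phi> insert(2) by (auto simp: inj_on_def)
    ultimately show "(\<phi>(a := undefined), \<phi> a) \<in> (SIGMA \<phi>:?I A. B - \<phi> ` A)" by auto
    show "(case (\<phi>(a := undefined), \<phi> a) of (\<phi>, b) \<Rightarrow> x b ^ e a * ?m e \<phi>) = (\<Prod>c\<in>insert a A. x (\<phi> c) ^ e c)"
    proof -
      have "(\<Prod>c\<in>A. x ((\<phi>(a := undefined)) c) ^ e c) = ?m e \<phi>"
        by (rule prod.cong[OF refl]) (metis fun_upd_other insert(2))
      then show ?thesis using insert(1,2) by simp
    qed
  next
    fix q assume "q \<in> (SIGMA \<phi>:?I A. B - \<phi> ` A)"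
    then obtain \<phi> b where q: "q = (\<phi>, b)" "\<phi> \<in> PiE A (\<lambda>_. B)" "inj_on \<phi> A" "b \<in> B" "b \<notin> \<phi> ` A" by auto
    have "\<phi> a = undefined" using q(2) insert(2) by (auto simp: PiE_iff extensional_def)
    then show "((case q of (\<phi>, b) \<Rightarrow> \<phi>(a := b))(a := undefined), (case q of (\<phi>, b) \<Rightarrow> \<phi>(a := b)) a) = q"
      using q(1) by auto
    have "\<phi>(a := b) \<in> PiE (insert a A) (\<lambda>_. B)" using q by (auto simp: PiE_iff extensional_def)
    moreover have "inj_on (\<phi>(a := b)) (insert a A)" using q insert(2) by (auto simp: inj_on_def)
    ultimately show "(case q of (\<phi>, b) \<Rightarrow> \<phi>(a := b)) \<in> ?I (insert a A)" using q(1) by auto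
  qed auto
  also have "\<dots> = (\<Sum>\<phi>\<in>?I A. \<Sum>b\<in>B - \<phi> ` A. x b ^ e a * ?m e \<phi>)"
    using fin fB by (intro sum.Sigma[symmetric]) auto
  also have "\<dots> = (\<Sum>\<phi>\<in>?I A. (\<Sum>b\<in>B. x b ^ e a) * ?m e \<phi> - (\<Sum>c\<in>A. ?m (e(c := e c + e a)) \<phi>))"
  proof (rule sum.cong[OF refl])
    fix \<phi> assume "\<phi> \<in> ?I A"
    then have \<phi>: "\<phi> ` A \<subseteq> B" "inj_on \<phi> A" by auto
    have "(\<Sum>b\<in>\<phi> ` A. x b ^ e a) * ?m e \<phi> = (\<Sum>c\<in>A. x (\<phi> c) ^ e a * ?m e \<phi>)"
      using \<phi>(2) by (simp add: sum.reindex sum_distrib_right)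
    also have "\<dots> = (\<Sum>c\<in>A. ?m (e(c := e c + e a)) \<phi>)"
    proof (rule sum.cong[OF refl])
      fix c assume c: "c \<in> A"
      have "(\<Prod>d\<in>A - {c}. x (\<phi> d) ^ (e(c := e c + e a)) d) = (\<Prod>d\<in>A - {c}. x (\<phi> d) ^ e d)" by (rule prod.cong) auto
      then show "x (\<phi> c) ^ e a * ?m e \<phi> = ?m (e(c := e c + e a)) \<phi>"
        using prod.remove[OF insert(1) c, of "\<lambda>d. x (\<phi> d) ^ e d"] prod.remove[OF insert(1) c, of "\<lambda>d. x (\<phi> d) ^ (e(c := e c + e a)) d"]
        by (simp add: power_add mult_ac)
    qed
    finally show "(\<Sum>b\<in>B - \<phi> ` A. x b ^ e a * ?m e \<phi>) = (\<Sum>b\<in>B. x b ^ e a) * ?m e \<phi> - (\<Sum>c\<in>A. ?m (e(c := e c + e a)) \<phi>)"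
      using sum_diff[OF fB \<phi>(1), of "\<lambda>b. x b ^ e a"] by (simp add: left_diff_distrib flip: sum_distrib_right)
  qed
  also have "\<dots> = (\<Sum>b\<in>B. x b ^ e a) * (\<Sum>\<phi>\<in>?I A. ?m e \<phi>) - (\<Sum>c\<in>A. \<Sum>\<phi>\<in>?I A. ?m (e(c := e c + e a)) \<phi>)"
    by (simp only: sum_subtractf sum_distrib_left sum.swap[of _ "?I A" A])
  also have "\<dots> \<in> R"
    by (intro is_subring_diff[OF R] is_subring_mult[OF R] is_subring_sum[OF R] p insert.IH)
  finally show ?case .
qed

text \<open>The permutations of a finite set are its injective self-maps, to which
  \<open>symmetrized_monomial\<close> applies.\<close>

lemma permutation_monomial:
  fixes x :: "nat \<Rightarrow> ratf"
  assumes R: "is_subring R" and fB: "finite B" and p: "\<And>s. (\<Sum>b\<in>B. x b ^ s) \<in> R"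
  shows "(\<Sum>\<pi> | \<pi> permutes B. \<Prod>a\<in>B. x (\<pi> a) ^ e a) \<in> R"
proof -
  have "(\<Sum>\<pi> | \<pi> permutes B. \<Prod>a\<in>B. x (\<pi> a) ^ e a) = (\<Sum>\<phi> | \<phi> \<in> PiE B (\<lambda>_. B) \<and> inj_on \<phi> B. \<Prod>a\<in>B. x (\<phi> a) ^ e a)"
  proof (rule sum.reindex_bij_witness[of _ "\<lambda>\<phi> i. if i \<in> B then \<phi> i else i" "\<lambda>\<pi>. restrict \<pi> B"])
    fix \<pi> assume "\<pi> \<in> {\<pi>. \<pi> permutes B}"
    then have \<pi>: "\<pi> permutes B" by simp
    show "(\<lambda>i. if i \<in> B then restrict \<pi> B i else i) = \<pi>" using \<pi> by (auto simp: fun_eq_iff permutes_not_in)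
    show "restrict \<pi> B \<in> {\<phi>. \<phi> \<in> PiE B (\<lambda>_. B) \<and> inj_on \<phi> B}"
      using permutes_in_image[OF \<pi>] permutes_inj_on[OF \<pi>] by (auto simp: inj_on_def)
  next
    fix \<phi> assume "\<phi> \<in> {\<phi>. \<phi> \<in> PiE B (\<lambda>_. B) \<and> inj_on \<phi> B}"
    then have \<phi>: "\<phi> \<in> PiE B (\<lambda>_. B)" "inj_on \<phi> B" by auto
    have "\<phi> ` B = B" using \<phi> fB endo_inj_surj[of B \<phi>] by auto
    then have "bij_betw (\<lambda>i. if i \<in> B then \<phi> i else i) B B"
      using \<phi>(2) by (simp add: bij_betw_def inj_on_def)
    then show "(\<lambda>i. if i \<in> B then \<phi> i else i) \<in> {\<pi>. \<pi> permutes B}" by (auto intro: bij_imp_permutes)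
    show "restrict (\<lambda>i. if i \<in> B then \<phi> i else i) B = \<phi>" using \<phi>(1) by (auto simp: fun_eq_iff PiE_iff extensional_def)
  qed simp
  then show ?thesis using symmetrized_monomial[OF R fB p fB] by simp
qed

text \<open>The orbit sum of a monomial is a product of three sums over permutations, one for each
  group of variables, times a power of y. An invariant polynomial is a multiple of its own orbit
  sum, hence a combination of orbit sums of monomials.\<close>

lemma GL_polys_generated:
  assumes R: "is_subring R" and c: "\<And>c. cst c \<in> R" and y: "yy \<in> R"
    and p1: "\<And>s. (\<Sum>i=1..k. g1 i ^ s) \<in> R" and p2: "\<And>s. (\<Sum>i=1..n - k. g2 i ^ s) \<in> R"
    and pz: "\<And>s. (\<Sum>i=1..n. zz i ^ s) \<in> R"
  shows "GL_polys n k \<subseteq> R"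
proof
  fix f assume f: "f \<in> GL_polys n k"
  let ?G = "Gam_z_y n k"
  have finG: "finite ?G" by (simp add: Gam_z_y_def)
  have mono: "orbit_sum n k {1..n} (\<Prod>v\<in>?G. X v ^ e v) \<in> R" for e
  proof -
    let ?A = "\<lambda>\<sigma>. \<Prod>i=1..k. g1 (\<sigma> i) ^ e (VG1 i)" and ?B = "\<lambda>\<tau>. \<Prod>i=1..n - k. g2 (\<tau> i) ^ e (VG2 i)"
      and ?C = "\<lambda>\<rho>. \<Prod>i=1..n. zz (\<rho> i) ^ e (VZ i)"
    have pr: "(\<Prod>v\<in>?G. h v) = (\<Prod>i=1..k. h (VG1 i)) * (\<Prod>i=1..n - k. h (VG2 i)) * (\<Prod>i=1..n. h (VZ i)) * h VY" for h :: "var \<Rightarrow> ratf"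
      unfolding Gam_z_y_def
      by (subst prod.union_disjoint; (subst prod.union_disjoint)?; (subst prod.union_disjoint)?)
        (auto simp: prod.reindex inj_on_def)
    have "pm \<sigma> \<tau> \<rho> (\<Prod>v\<in>?G. X v ^ e v) = (\<Prod>v\<in>?G. X (perm_var \<sigma> \<tau> \<rho> v) ^ e v)" for \<sigma> \<tau> \<rho>
      by (simp add: rat.subst_prod rat.sdef_power rat.subst_power)
    then have "pm \<sigma> \<tau> \<rho> (\<Prod>v\<in>?G. X v ^ e v) = ?A \<sigma> * ?B \<tau> * ?C \<rho> * yy ^ e VY" for \<sigma> \<tau> \<rho>
      by (simp add: pr perm_var_def)
    then have "orbit_sum n k {1..n} (\<Prod>v\<in>?G. X v ^ e v)
       = (\<Sum>\<sigma> | \<sigma> permutes {1..k}. ?A \<sigma>) * (\<Sum>\<tau> | \<tau> permutes {1..n - k}. ?B \<tau>) * (\<Sum>\<rho> | \<rho> permutes {1..n}. ?C \<rho>) * yy ^ e VY"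
      unfolding orbit_sum_def by (simp only: sum_distrib_left[symmetric] sum_distrib_right[symmetric])
    also have "\<dots> \<in> R"
      by (intro is_subring_mult[OF R] is_subring_power[OF R] y permutation_monomial[OF R] p1 p2 pz) auto
    finally show ?thesis .
  qed
  obtain p where p: "f = Fraction_Field.Fract p 1" "\<forall>m\<in>Poly_Mapping.keys p. Poly_Mapping.keys m \<subseteq> ?G"
    using f by (auto simp: GL_polys_def polys_def)
  let ?m = "\<lambda>m. \<Prod>v\<in>?G. X v ^ Poly_Mapping.lookup m v"
  have "f = (\<Sum>m\<in>Poly_Mapping.keys p. cst (Poly_Mapping.lookup p m) * rat.monom_eval X m)"
    unfolding p(1) mpoly_eval_X[symmetric] by (rule rat.mpoly_eval_superset) auto
  also have "\<dots> = (\<Sum>m\<in>Poly_Mapping.keys p. cst (Poly_Mapping.lookup p m) * ?m m)"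
    using p(2) by (intro sum.cong refl) (simp add: rat.monom_eval_superset[OF finG])
  finally have fe: "f = (\<Sum>m\<in>Poly_Mapping.keys p. cst (Poly_Mapping.lookup p m) * ?m m)" .
  have sd: "rat.sdef \<sigma> (?m m)" for \<sigma> m by (intro rat.sdef_prod rat.sdef_power) simp
  have "orbit_sum n k {1..n} f = (\<Sum>m\<in>Poly_Mapping.keys p. cst (Poly_Mapping.lookup p m) * orbit_sum n k {1..n} (?m m))"
  proof -
    have "pm \<sigma> \<tau> \<rho> f = (\<Sum>m\<in>Poly_Mapping.keys p. cst (Poly_Mapping.lookup p m) * pm \<sigma> \<tau> \<rho> (?m m))" for \<sigma> \<tau> \<rho>
      unfolding fe by (subst rat.subst_sum) (simp_all add: sd rat.subst_mult)
    then show ?thesis unfolding orbit_sum_def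
      by (simp add: sum_distrib_left sum.swap[of _ "Poly_Mapping.keys p"])
  qed
  also have "\<dots> \<in> R" by (intro is_subring_sum[OF R] is_subring_mult[OF R] c mono)
  finally have 1: "orbit_sum n k {1..n} f \<in> R" .
  let ?N = "card {\<sigma>. \<sigma> permutes {1..k}} * card {\<tau>. \<tau> permutes {1..n - k}} * card {\<rho>. \<rho> permutes {1..n}}"
  have 2: "orbit_sum n k {1..n} f = of_nat ?N * f"
    by (rule orbit_sum_of_inv) (use f in \<open>simp add: GL_polys_inv\<close>)
  have N: "of_nat ?N \<noteq> (0::ratf)" unfolding of_nat_ratf_eq_0 by (rule perm_count_nonzero) simp
  have "inverse (of_nat ?N) \<in> R" using c[of "inverse (of_nat ?N)"] by (simp only: cst_inverse cst_of_nat)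
  then have "inverse (of_nat ?N) * (of_nat ?N * f) \<in> R" using is_subring_mult[OF R _ 1] unfolding 2 by blast
  moreover have "a \<noteq> 0 \<Longrightarrow> inverse a * (a * f) = f" for a by simp
  ultimately show "f \<in> R" using N by metis
qed

section \<open>Newton's identities by generating series\<close>

definition lin_fps :: "nat set \<Rightarrow> (nat \<Rightarrow> ratf) \<Rightarrow> ratf fps" where
  "lin_fps A x = (\<Prod>i\<in>A. 1 - fps_const (x i) * fps_X)"

text \<open>The coefficient of index s is the power sum of degree s + 1, because up to sign this is
  the logarithmic derivative of \<open>lin_fps\<close>, whose coefficients are the signed elementary
  symmetric polynomials.\<close>

definition psum_fps :: "nat set \<Rightarrow> (nat \<Rightarrow> ratf) \<Rightarrow> ratf fps" where
  "psum_fps A x = Abs_fps (\<lambda>s. \<Sum>i\<in>A. x i ^ Suc s)"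

lemma geom_fps: "(1 - fps_const c * fps_X) * Abs_fps (\<lambda>s. c ^ Suc s) = fps_const (c::ratf)"
proof (rule fps_ext)
  fix m show "((1 - fps_const c * fps_X) * Abs_fps (\<lambda>s. c ^ Suc s)) $ m = fps_const c $ m"
    by (cases m) (simp_all add: left_diff_distrib mult.assoc)
qed

lemma lin_fps_deriv: "finite A \<Longrightarrow> fps_deriv (lin_fps A x) = - (lin_fps A x * psum_fps A x)"
proof (induction A rule: finite_induct)
  case empty
  have "Abs_fps (\<lambda>s. 0) = (0 :: ratf fps)" by (rule fps_ext) simp
  then show ?case by (simp add: lin_fps_def psum_fps_def)
next
  case (insert a A)
  let ?g = "Abs_fps (\<lambda>s. x a ^ Suc s)" and ?l = "1 - fps_const (x a) * fps_X"
  have 1: "psum_fps (insert a A) x = ?g + psum_fps A x"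
    by (rule fps_ext) (use insert in \<open>simp add: psum_fps_def\<close>)
  have 2: "lin_fps (insert a A) x = ?l * lin_fps A x" using insert by (simp add: lin_fps_def)
  have "fps_deriv ?l = - fps_const (x a)" by simp
  then have "fps_deriv (lin_fps (insert a A) x) = - (fps_const (x a) * lin_fps A x) + ?l * fps_deriv (lin_fps A x)"
    unfolding 2 fps_deriv_mult by (simp only: mult_minus_left add.commute)
  also have "\<dots> = - (?l * ?g * lin_fps A x) - ?l * (lin_fps A x * psum_fps A x)"
    unfolding insert.IH geom_fps by simp
  also have "\<dots> = - (lin_fps (insert a A) x * psum_fps (insert a A) x)"
    unfolding 1 2 by (simp add: algebra_simps)
  finally show ?case .
qed

lemma lin_fps_0: "lin_fps A x $ 0 = 1"
  unfolding lin_fps_def by (induction A rule: infinite_finite_induct) (simp_all add: fps_mult_nth_0)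

text \<open>This is the coefficient of index m in \<open>lin_fps_deriv\<close>, solved for the term
  with j = 0, whose factor is the constant coefficient 1.\<close>

lemma newton:
  assumes "finite A"
  shows "(\<Sum>i\<in>A. x i ^ Suc m) = - (of_nat (Suc m) * lin_fps A x $ Suc m) - (\<Sum>j=1..m. lin_fps A x $ j * (\<Sum>i\<in>A. x i ^ Suc (m - j)))"
proof -
  have "of_nat (Suc m) * lin_fps A x $ Suc m = fps_deriv (lin_fps A x) $ m" by (simp only: fps_deriv_nth Suc_eq_plus1)
  also have "\<dots> = - (\<Sum>j=0..m. lin_fps A x $ j * (\<Sum>i\<in>A. x i ^ Suc (m - j)))"
    unfolding lin_fps_deriv[OF assms] by (simp add: fps_mult_nth psum_fps_def)
  also have "(\<Sum>j=0..m. lin_fps A x $ j * (\<Sum>i\<in>A. x i ^ Suc (m - j)))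
     = (\<Sum>i\<in>A. x i ^ Suc m) + (\<Sum>j=1..m. lin_fps A x $ j * (\<Sum>i\<in>A. x i ^ Suc (m - j)))"
    by (simp add: sum.atLeast_Suc_atMost lin_fps_0 One_nat_def)
  finally show ?thesis by simp
qed

text \<open>Reversing the coefficients turns the product of the X - x_i into that of the 1 - x_i X,
  so index m corresponds to degree \<open>card A - m\<close>.\<close>

lemma lin_fps_nth:
  assumes "finite A"
  shows "lin_fps A x $ m = (if m > card A then 0 else coeff (\<Prod>i\<in>A. [:- x i, 1:]) (card A - m))"
proof -
  have "fps_of_poly (\<Prod>i\<in>A. [:1, - x i:]) = lin_fps A x"
    unfolding lin_fps_def fps_of_poly_prod
    by (rule prod.cong) (auto simp: fps_of_poly_pCons)
  then have 1: "lin_fps A x $ m = coeff (\<Prod>i\<in>A. [:1, - x i:]) m" by (metis fps_of_poly_nth)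
  have r: "(\<Prod>i\<in>A. [:1, - x i:]) = reflect_poly (\<Prod>i\<in>A. [:- x i, 1:])"
  proof -
    have "reflect_poly [:- x i, 1:] = [:1, - x i:]" for i
      by (simp add: reflect_poly_def)
    then show ?thesis by (simp add: reflect_poly_prod)
  qed
  have d: "degree (\<Prod>i\<in>A. [:- x i, 1:]) = card A"
    using degree_prod_eq_sum_degree[of A "\<lambda>i. [:- x i, 1:]"] by simp
  show ?thesis unfolding 1 r coeff_reflect_poly d by simp
qed

subsection \<open>Expansion at infinity\<close>

abbreviation iemb :: "complex \<Rightarrow> ratf fls" where "iemb \<equiv> \<lambda>c. fls_const (cst c)"
abbreviation ivar :: "Defs.var \<Rightarrow> ratf fls" where
  "ivar \<equiv> \<lambda>v. if v = VW then fls_X_inv else fls_const (X v)"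
abbreviation wexp :: "ratf \<Rightarrow> ratf fls" where "wexp \<equiv> subst_into iemb ivar"

interpretation inf: coeff_hom iemb
  by unfold_locales (simp_all add: cst_add cst_mult fls_plus_const)

lemma fls_const_prod: "fls_const (\<Prod>i\<in>A. f i) = (\<Prod>i\<in>A. fls_const (f i :: ratf))"
  by (induction A rule: infinite_finite_induct) (simp_all flip: fls_const_mult_const)

lemma fls_nth_sum: "fls_nth (\<Sum>i\<in>A. f i) k = (\<Sum>i\<in>A. fls_nth (f i) k)"
  by (induction A rule: infinite_finite_induct) simp_all

lemma ivar_monom:
  "inf.monom_eval ivar m = fls_const (\<Prod>v\<in>Poly_Mapping.keys m - {VW}. X v ^ Poly_Mapping.lookup m v)
     * fls_X_inv ^ Poly_Mapping.lookup m VW"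
proof -
  let ?S = "insert VW (Poly_Mapping.keys m)"
  have "inf.monom_eval ivar m = (\<Prod>v\<in>?S. ivar v ^ Poly_Mapping.lookup m v)"
    by (rule inf.monom_eval_superset) auto
  also have "\<dots> = fls_X_inv ^ Poly_Mapping.lookup m VW * (\<Prod>v\<in>Poly_Mapping.keys m - {VW}. ivar v ^ Poly_Mapping.lookup m v)"
    by (subst prod.insert_remove) auto
  also have "(\<Prod>v\<in>Poly_Mapping.keys m - {VW}. ivar v ^ Poly_Mapping.lookup m v)
     = fls_const (\<Prod>v\<in>Poly_Mapping.keys m - {VW}. X v ^ Poly_Mapping.lookup m v)"
    unfolding fls_const_prod by (rule prod.cong) (auto simp: fls_const_power)
  finally show ?thesis by (simp only: mult.commute)
qed

text \<open>Let e be the degree in w of some monomial of p. The coefficient of the expansion at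
  exponent -e collects the monomials of p with this degree in w; if it were zero, their sum would be
  the zero polynomial.\<close>

lemma wexp_total: "inf.total ivar"
  unfolding inf.total_def
proof (intro allI impI notI)
  fix p :: mpoly assume p: "p \<noteq> 0" and 0: "mpoly_eval iemb ivar p = 0"
  obtain m0 where m0: "m0 \<in> Poly_Mapping.keys p" using p keys_eq_empty by fastforce
  let ?e = "Poly_Mapping.lookup m0 VW"
  let ?K = "{m \<in> Poly_Mapping.keys p. Poly_Mapping.lookup m VW = ?e}"
  let ?r = "\<lambda>m. \<Prod>v\<in>Poly_Mapping.keys m - {VW}. X v ^ Poly_Mapping.lookup m v"
  have mon: "rat.monom_eval X m = X VW ^ Poly_Mapping.lookup m VW * ?r m" for m
    by (subst rat.monom_eval_superset[of "insert VW (Poly_Mapping.keys m)"]) (auto simp: prod.insert_remove)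
  have "0 = fls_nth (mpoly_eval iemb ivar p) (- int ?e)" using 0 by simp
  also have "\<dots> = (\<Sum>m\<in>Poly_Mapping.keys p. cst (Poly_Mapping.lookup p m) * (?r m * (if Poly_Mapping.lookup m VW = ?e then 1 else 0)))"
    unfolding inf.mpoly_eval_superset[OF finite_keys order_refl] ivar_monom fls_nth_sum
    by (rule sum.cong) (auto simp: mult.assoc[symmetric] fls_const_mult_const)
  also have "\<dots> = (\<Sum>m\<in>?K. cst (Poly_Mapping.lookup p m) * ?r m)"
    by (rule sum.mono_neutral_cong_right) auto
  finally have "0 = X VW ^ ?e * (\<Sum>m\<in>?K. cst (Poly_Mapping.lookup p m) * ?r m)" by simp
  also have "\<dots> = (\<Sum>m\<in>?K. cst (Poly_Mapping.lookup p m) * rat.monom_eval X m)"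
    unfolding sum_distrib_left by (rule sum.cong) (auto simp: mon)
  also have "\<dots> = Fraction_Field.Fract (\<Sum>m\<in>?K. Poly_Mapping.single m (Poly_Mapping.lookup p m)) 1"
    by (simp add: Fract_sum Fract_single)
  finally have z: "0 = Fraction_Field.Fract (\<Sum>m\<in>?K. Poly_Mapping.single m (Poly_Mapping.lookup p m)) 1" .
  have "(\<Sum>m\<in>?K. Poly_Mapping.single m (Poly_Mapping.lookup p m)) = 0"
    by (rule Fract1_eq_0[THEN iffD1, OF z[symmetric]])
  then have "Poly_Mapping.lookup (\<Sum>m\<in>?K. Poly_Mapping.single m (Poly_Mapping.lookup p m)) m0 = 0" by simp
  moreover have "Poly_Mapping.lookup (\<Sum>m\<in>?K. Poly_Mapping.single m (Poly_Mapping.lookup p m)) m0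
     = (\<Sum>m\<in>?K. if m = m0 then Poly_Mapping.lookup p m else 0)"
    unfolding lookup_sum by (rule sum.cong) (auto simp: lookup_single)
  ultimately show False using m0 by (simp add: in_keys_iff)
qed

lemmas wexp_sdef = inf.total_sdef[OF wexp_total]
lemmas wexp_divide = inf.total_divide[OF wexp_total]

lemma wexp_ratfuns:
  assumes "f \<in> ratfuns S" "VW \<notin> S"
  shows "wexp f = fls_const f"
proof -
  have p: "wexp g = fls_const g" if "g \<in> polys S" for g
    using that
  proof (induction rule: polys_induct)
    case (X v) then show ?case using assms(2) by auto
  qed (simp_all add: inf.subst_add inf.subst_mult wexp_sdef fls_plus_const)
  obtain a b where "f = a / b" "a \<in> polys S" "b \<in> polys S" using assms(1) by (auto simp: ratfuns_def)
  then show ?thesis by (simp add: wexp_divide p fls_const_divide_const)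
qed

lemma winf_coeff_eq: "winf_coeff s f = fls_nth (wexp f) (int s)"
  by (simp add: winf_coeff_def)

text \<open>\<open>(w - x) / (w - x - y)\<close> as a series in \<open>1/w\<close>.\<close>

definition shift_fps :: "ratf \<Rightarrow> ratf fps" where
  "shift_fps x = Abs_fps (\<lambda>s. if s = 0 then 1 else yy * (x + yy) ^ (s - 1))"

definition ratio_fps :: "nat set \<Rightarrow> (nat \<Rightarrow> ratf) \<Rightarrow> ratf fps" where
  "ratio_fps A x = (\<Prod>i\<in>A. shift_fps (x i))"

lemma shift_fps_mult: "shift_fps x * (1 - fps_const (x + yy) * fps_X) = 1 - fps_const x * fps_X"
proof (rule fps_ext)
  fix m show "(shift_fps x * (1 - fps_const (x + yy) * fps_X)) $ m = (1 - fps_const x * fps_X) $ m"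
  proof -
    have "shift_fps x * (1 - fps_const (x + yy) * fps_X) = shift_fps x - fps_const (x + yy) * (fps_X * shift_fps x)"
      by (simp add: algebra_simps)
    then show ?thesis
      by (cases m; cases "m - 1") (auto simp: shift_fps_def algebra_simps One_nat_def)
  qed
qed

lemma wexp_linear_ratio:
  assumes "x \<in> ratfuns S" "VW \<notin> S"
  shows "wexp ((ww - x) / (ww - x - yy)) = fps_to_fls (shift_fps x)"
proof -
  have c: "wexp x = fls_const x" by (rule wexp_ratfuns[OF assms])
  \<comment> \<open>Taking out the common factor w from numerator and denominator leaves power
    series in 1/w with constant term 1.\<close>
  have l: "fls_X_inv - fls_const a = fls_X_inv * fps_to_fls (1 - fps_const a * fps_X)" for a :: ratf
    by (rule fls_eqI) (auto simp: fls_times_fps_to_fls fls_X_inv_times_conv_shift)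
  have nz: "1 - fps_const (x + yy) * fps_X \<noteq> 0"
  proof
    assume "1 - fps_const (x + yy) * fps_X = 0"
    then have "(1 - fps_const (x + yy) * fps_X) $ 0 = 0" by simp
    then show False by simp
  qed
  have "wexp ((ww - x) / (ww - x - yy)) = (fls_X_inv - fls_const x) / (fls_X_inv - fls_const (x + yy))"
  proof -
    have "wexp (ww - x - yy) = fls_X_inv - fls_const (x + yy)"
      by (simp add: inf.subst_diff wexp_sdef c flip: fls_plus_const)
    then show ?thesis by (simp add: wexp_divide inf.subst_diff wexp_sdef c)
  qed
  also have "\<dots> = fps_to_fls (1 - fps_const x * fps_X) / fps_to_fls (1 - fps_const (x + yy) * fps_X)"
    unfolding l by simp
  also have "\<dots> = fps_to_fls (shift_fps x)"
    unfolding shift_fps_mult[of x, symmetric] fls_times_fps_to_fls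
    using nz by (simp del: fps_to_fls_minus)
  finally show ?thesis .
qed

lemma wexp_ratio:
  assumes "\<And>i. i \<in> A \<Longrightarrow> x i \<in> ratfuns S" "VW \<notin> S"
  shows "wexp (\<Prod>i\<in>A. (ww - x i) / (ww - x i - yy)) = fps_to_fls (ratio_fps A x)"
  using assms(1)
proof (induction A rule: infinite_finite_induct)
  case (insert a A)
  then have "wexp ((ww - x a) / (ww - x a - yy)) = fps_to_fls (shift_fps (x a))"
    "wexp (\<Prod>i\<in>A. (ww - x i) / (ww - x i - yy)) = fps_to_fls (ratio_fps A x)"
    using wexp_linear_ratio[OF _ assms(2)] by auto
  then show ?case unfolding ratio_fps_def prod.insert[OF insert(1,2)]
    by (simp only: inf.subst_mult[OF wexp_sdef wexp_sdef] fls_times_fps_to_fls)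
qed (simp_all add: ratio_fps_def)

lemma winf_ratio:
  assumes "\<And>i. i \<in> A \<Longrightarrow> x i \<in> ratfuns S" "VW \<notin> S"
  shows "winf_coeff s (\<Prod>i\<in>A. (ww - x i) / (ww - x i - yy)) = ratio_fps A x $ s"
  unfolding winf_coeff_eq by (subst wexp_ratio[OF assms]) auto

lemma a_coeff_eq: "a_coeff k s = ratio_fps {1..k} g1 $ s"
  unfolding a_coeff_def by (rule winf_ratio[of _ _ "range VG1"]) (auto intro: X_in_ratfuns)

text \<open>With z_i - y in place of the root, the factor has the form (w - x) / (w - x - y) of the
  other series, so \<open>ratio_fps\<close> serves for both.\<close>

lemma b_coeff_eq: "b_coeff n s = ratio_fps {1..n} (\<lambda>i. zz i - yy) $ s"
proof -
  have "(\<Prod>i=1..n. (ww - zz i + yy) / (ww - zz i)) = (\<Prod>i=1..n. (ww - (zz i - yy)) / (ww - (zz i - yy) - yy))"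
    by (rule prod.cong) auto
  then show ?thesis unfolding b_coeff_def
    by (simp only:) (rule winf_ratio[of _ _ "insert VY (range VZ)"], auto intro!: is_subring_diff[OF ratfuns_is_subring] X_in_ratfuns)
qed

lemma ratio_fps_mem:
  assumes R: "is_subring R" "yy \<in> R" and "\<And>i. i \<in> A \<Longrightarrow> x i \<in> R"
  shows "ratio_fps A x $ s \<in> R"
  using assms(3)
proof (induction A arbitrary: s rule: infinite_finite_induct)
  case (insert a A)
  have "shift_fps (x a) $ j \<in> R" for j
    using insert by (auto simp: shift_fps_def intro!: is_subring_intros[OF R(1)] R(2))
  then show ?case using insert by (auto simp: ratio_fps_def fps_mult_nth intro!: is_subring_sum[OF R(1)] is_subring_mult[OF R(1)])
qed (auto simp: ratio_fps_def is_subring_intros[OF R(1)])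

lemma ratio_fps_subst:
  assumes y: "\<sigma> VY = yy" and "\<And>i. i \<in> A \<Longrightarrow> rat.sdef \<sigma> (x i)"
  shows "rat.sdef \<sigma> (ratio_fps A x $ s) \<and> subst \<sigma> (ratio_fps A x $ s) = ratio_fps A (\<lambda>i. subst \<sigma> (x i)) $ s"
  using assms(2)
proof (induction A arbitrary: s rule: infinite_finite_induct)
  case (insert a A)
  have "rat.sdef \<sigma> (shift_fps (x a) $ j) \<and> subst \<sigma> (shift_fps (x a) $ j) = shift_fps (subst \<sigma> (x a)) $ j" for j
    using insert y by (auto simp: shift_fps_def rat.subst_mult rat.subst_power rat.subst_add rat.sdef_power)
  then show ?case using insert
    by (auto simp: ratio_fps_def fps_mult_nth rat.subst_sum rat.subst_mult rat.sdef_sum)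
qed (auto simp: ratio_fps_def)

lemma ratio_fps_0 [simp]: "ratio_fps A x $ 0 = 1"
  unfolding ratio_fps_def by (induction A rule: infinite_finite_induct) (simp_all add: shift_fps_def fps_mult_nth_0)

text \<open>The product of \<open>ratio_fps\<close> with \<open>lin_fps\<close> of the x_i + y is
  \<open>lin_fps\<close> of the x_i. Differentiate this equation and cancel \<open>lin_fps\<close>,
  whose constant coefficient is 1.\<close>

lemma ratio_fps_deriv:
  assumes "finite A"
  shows "fps_deriv (ratio_fps A x) = ratio_fps A x * (psum_fps A (\<lambda>i. x i + yy) - psum_fps A x)"
proof -
  let ?r = "ratio_fps A x" and ?f = "lin_fps A (\<lambda>i. x i + yy)" and ?p = "psum_fps A (\<lambda>i. x i + yy)"
  have e: "?r * ?f = lin_fps A x"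
    unfolding ratio_fps_def lin_fps_def prod.distrib[symmetric] by (rule prod.cong) (auto simp: shift_fps_mult)
  have "fps_deriv ?r * ?f - ?r * ?f * ?p = fps_deriv (?r * ?f)"
    by (simp add: lin_fps_deriv[OF assms] algebra_simps)
  also have "\<dots> = - (?r * ?f * psum_fps A x)" unfolding e by (rule lin_fps_deriv[OF assms])
  finally have "?f * fps_deriv ?r = ?f * (?r * (?p - psum_fps A x))" by (simp add: algebra_simps)
  moreover have "?f \<noteq> 0" using lin_fps_0[of A "\<lambda>i. x i + yy"] by auto
  ultimately show ?thesis by simp
qed

text \<open>By \<open>ratio_fps_deriv\<close> the coefficients determine recursively the differences
  \<open>?q\<close> between the power sums of the x_i + y and those of the x_i. In the binomial
  expansion of \<open>?q s\<close> the power sum of highest degree is that of degree s, with factor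
  (s + 1) y; dividing by this factor needs the inverse of y.\<close>

lemma ratio_determines_power_sums:
  assumes R: "is_subring R" "C_y_inv \<subseteq> R" and fA: "finite A" and r: "\<And>s. ratio_fps A x $ s \<in> R"
  shows "(\<Sum>i\<in>A. x i ^ s) \<in> R"
proof -
  let ?q = "\<lambda>m. \<Sum>i\<in>A. (x i + yy) ^ Suc m - x i ^ Suc m"
  have q: "?q m \<in> R" for m
  proof (induction m rule: less_induct)
    case (less m)
    have "of_nat (Suc m) * ratio_fps A x $ Suc m = fps_deriv (ratio_fps A x) $ m" by (simp only: fps_deriv_nth Suc_eq_plus1)
    also have "\<dots> = (\<Sum>j=0..m. ratio_fps A x $ j * ?q (m - j))"
      unfolding ratio_fps_deriv[OF fA] by (simp add: fps_mult_nth psum_fps_def sum_subtractf)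
    also have "\<dots> = ?q m + (\<Sum>j=1..m. ratio_fps A x $ j * ?q (m - j))"
      by (simp add: sum.atLeast_Suc_atMost One_nat_def)
    finally have "?q m = of_nat (Suc m) * ratio_fps A x $ Suc m - (\<Sum>j=1..m. ratio_fps A x $ j * ?q (m - j))" by simp
    also have "\<dots> \<in> R"
      by (intro is_subring_diff[OF R(1)] is_subring_sum[OF R(1)] is_subring_mult[OF R(1)] is_subring_of_nat[OF R(1)] r less) auto
    finally show ?case .
  qed
  have y: "yy \<in> R" "inverse yy \<in> R" using R(2) inverse_y_C subsetD[OF polys_y_C, of yy] by auto
  show ?thesis
  proof (induction s rule: less_induct)
    case (less s)
    let ?p = "\<lambda>s. \<Sum>i\<in>A. x i ^ s"
    have "?q s = (\<Sum>i\<in>A. \<Sum>j\<le>s. of_nat (Suc s choose j) * x i ^ j * yy ^ (Suc s - j))"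
      by (rule sum.cong) (simp_all only: binomial_ring sum.atMost_Suc, simp)
    also have "\<dots> = (\<Sum>j\<le>s. of_nat (Suc s choose j) * yy ^ (Suc s - j) * ?p j)"
      by (subst sum.swap) (rule sum.cong[OF refl], simp add: sum_distrib_left sum_distrib_right mult_ac)
    also have "\<dots> = (\<Sum>j<s. of_nat (Suc s choose j) * yy ^ (Suc s - j) * ?p j) + of_nat (Suc s) * yy * ?p s"
      by (simp flip: lessThan_Suc_atMost)
    finally have e: "of_nat (Suc s) * yy * ?p s = ?q s - (\<Sum>j<s. of_nat (Suc s choose j) * yy ^ (Suc s - j) * ?p j)" by simp
    have 1: "of_nat (Suc s) * yy * ?p s \<in> R" unfolding e
      by (intro is_subring_diff[OF R(1)] q is_subring_sum[OF R(1)] is_subring_mult[OF R(1)] is_subring_of_nat[OF R(1)] is_subring_power[OF R(1)] y less) auto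
    have "cst (inverse (of_nat (Suc s))) \<in> R" using R(2) polys_y_C cst_in_polys by blast
    then have "inverse (of_nat (Suc s)) \<in> R" by (simp only: cst_inverse cst_of_nat)
    then have "inverse (of_nat (Suc s)) * inverse yy * (of_nat (Suc s) * yy * ?p s) \<in> R"
      by (intro is_subring_mult[OF R(1)] 1 y)
    moreover have "inverse a * inverse b * (a * b * c) = c" if "a \<noteq> 0" "b \<noteq> 0" for a b c :: ratf using that by (simp add: field_simps)
    note this[OF of_nat_ratf_nonzero[of s] X_nonzero[of VY], of "?p s"]
    ultimately show ?case by (simp only:)
  qed
qed

subsection \<open>The algebra \<open>A\<^sub>k\<close>\<close>

definition AR :: "nat \<Rightarrow> nat \<Rightarrow> ratf set" where
  "AR n k = prod_span (GL_polys n k) C_y_inv"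

lemma AR_is_subring: "is_subring (AR n k)"
  unfolding AR_def by (intro prod_span_is_subring GL_polys_is_subring C_y_inv_is_subring)

lemma GL_AR: "f \<in> GL_polys n k \<Longrightarrow> f \<in> AR n k" and C_AR: "f \<in> C_y_inv \<Longrightarrow> f \<in> AR n k"
  using prod_span_left[of C_y_inv "GL_polys n k"] prod_span_right[of "GL_polys n k" C_y_inv]
    is_subring_1[OF GL_polys_is_subring] is_subring_1[OF C_y_inv_is_subring] unfolding AR_def by blast+

lemma AR_HR: "AR n k \<subseteq> HR n k"
  unfolding AR_def
proof (rule prod_span_subset[OF HR_is_subring])
  show "GL_polys n k \<subseteq> HR n k" using GL_T T_HR by (rule order_trans)
  show "C_y_inv \<subseteq> HR n k" using C_y_inv_L L_HR by (rule order_trans)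
qed

lemma A_ring_AR: "A_ring n k = ring_on (AR n k)"
  by (simp add: A_ring_def AR_def)

lemma relations_AR: "relations n k \<subseteq> AR n k"
  using relations_GL GL_AR by blast

lemma perm_var_VY: "perm_var \<sigma> \<tau> \<rho> VY = VY"
  by (simp add: perm_var_def)

definition root_psum :: "nat \<Rightarrow> nat \<Rightarrow> nat \<Rightarrow> ratf" where
  "root_psum n k s = (\<Sum>i=1..n. X (root_var k i) ^ s)"

lemma power_sums_AR: "(\<Sum>i=1..k. g1 i ^ s) \<in> AR n k" "(\<Sum>i=1..n - k. g2 i ^ s) \<in> AR n k" "(\<Sum>i=1..n. zz i ^ s) \<in> AR n k"
proof -
  have g: "(\<Sum>i\<in>A. X (f i) ^ s) \<in> GL_polys n k"
    if f: "\<And>i. i \<in> A \<Longrightarrow> f i \<in> Gam_z_y n k"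
      and p: "\<And>\<sigma> \<tau> \<rho>. \<sigma> permutes {1..k} \<Longrightarrow> \<tau> permutes {1..n - k} \<Longrightarrow> \<rho> permutes {1..n} \<Longrightarrow>
          \<exists>\<pi>. \<pi> permutes A \<and> (\<forall>i\<in>A. perm_var \<sigma> \<tau> \<rho> (f i) = f (\<pi> i))" for A and f :: "nat \<Rightarrow> var"
    unfolding GL_polys_def
  proof (intro CollectI conjI allI impI)
    show "(\<Sum>i\<in>A. X (f i) ^ s) \<in> polys (Gam_z_y n k)"
      using f by (auto intro!: is_subring_sum[OF polys_is_subring] is_subring_power[OF polys_is_subring])
    fix \<sigma> \<tau> \<rho> assume st: "\<sigma> permutes {1..k}" "\<tau> permutes {1..n - k}" "\<rho> permutes {1..n}"
    obtain \<pi> where \<pi>: "\<pi> permutes A" "\<forall>i\<in>A. perm_var \<sigma> \<tau> \<rho> (f i) = f (\<pi> i)" using p[OF st] by blast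
    have "pm \<sigma> \<tau> \<rho> (\<Sum>i\<in>A. X (f i) ^ s) = (\<Sum>i\<in>A. ((\<lambda>i. X (f i) ^ s) \<circ> \<pi>) i)"
      using \<pi>(2) by (simp add: rat.subst_sum rat.sdef_power rat.subst_power)
    also have "\<dots> = (\<Sum>i\<in>A. X (f i) ^ s)" by (rule sum.permute[OF \<pi>(1), symmetric])
    finally show "pm \<sigma> \<tau> \<rho> (\<Sum>i\<in>A. X (f i) ^ s) = (\<Sum>i\<in>A. X (f i) ^ s)" .
  qed
  show "(\<Sum>i=1..k. g1 i ^ s) \<in> AR n k" "(\<Sum>i=1..n - k. g2 i ^ s) \<in> AR n k" "(\<Sum>i=1..n. zz i ^ s) \<in> AR n k"
    by (rule GL_AR, rule g, auto simp: Gam_z_y_def perm_var_def)+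
qed

context
  fixes n k :: nat
  assumes n1: "1 \<le> n" and kn: "k \<le> n"
begin

lemma root_psum_split: "root_psum n k s = (\<Sum>i=1..k. g1 i ^ s) + (\<Sum>i=1..n - k. g2 i ^ s)"
proof -
  have "{1..n} = {1..k} \<union> {k+1..n}" using kn by auto
  then have "root_psum n k s = (\<Sum>i=1..k. X (root_var k i) ^ s) + (\<Sum>i=k+1..n. X (root_var k i) ^ s)"
    unfolding root_psum_def by (simp add: sum.union_disjoint)
  also have "(\<Sum>i=1..k. X (root_var k i) ^ s) = (\<Sum>i=1..k. g1 i ^ s)" by (rule sum.cong) (auto simp: root_var_def)
  also have "(\<Sum>i=k+1..n. X (root_var k i) ^ s) = (\<Sum>i=1..n - k. g2 i ^ s)"
    by (rule sum.reindex_bij_witness[of _ "\<lambda>i. i + k" "\<lambda>i. i - k"]) (use kn in \<open>auto simp: root_var_def\<close>)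
  finally show ?thesis by simp
qed

lemma A_genideal: "ideal (A_ideal n k) (ring_on (AR n k))" "relations n k \<subseteq> A_ideal n k"
  "ideal I (ring_on (AR n k)) \<Longrightarrow> relations n k \<subseteq> I \<Longrightarrow> A_ideal n k \<subseteq> I"
  using genideal_ring_on[OF AR_is_subring relations_AR] by (simp_all add: A_ideal_def A_ring_AR)

lemma A_quot: "ring_on_quot (AR n k) (A_ideal n k)"
  by (rule ring_on_quot.intro) (simp_all add: AR_is_subring A_genideal)

lemmas AI_add = ring_on_quot.I_add[OF A_quot] and AI_mult = ring_on_quot.I_mult[OF A_quot]
  and AI_diff = ring_on_quot.I_diff[OF A_quot] and AI_0 = ring_on_quot.I_0[OF A_quot]

lemma AI_sum: "(\<And>i. i \<in> S \<Longrightarrow> f i \<in> A_ideal n k) \<Longrightarrow> (\<Sum>i\<in>S. f i) \<in> A_ideal n k"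
  by (induction S rule: infinite_finite_induct) (auto intro: AI_add AI_0)

lemma A_ideal_vanishing: "A_ideal n k \<subseteq> AR n k \<inter> vanishing n k"
  by (rule A_genideal(3)[OF vanishing_ideal[OF n1 kn AR_HR AR_is_subring]])
    (use relations_AR relations_vanish[OF n1 kn] in auto)

lemma elementary_AR: "lin_fps {1..n} zz $ m \<in> AR n k"
  unfolding lin_fps_nth[OF finite_atLeastAtMost]
  using coeff_linear_GL(3)[of n _ k] by (auto intro: GL_AR is_subring_0[OF AR_is_subring])

lemma elementary_diff: "lin_fps {1..n} (\<lambda>i. X (root_var k i)) $ m - lin_fps {1..n} zz $ m \<in> A_ideal n k"
proof (cases "m > n")
  case True
  then show ?thesis by (simp add: lin_fps_nth AI_0)
next
  case False
  then have "lin_fps {1..n} (\<lambda>i. X (root_var k i)) $ m - lin_fps {1..n} zz $ m = coeff (rel_poly n k) (n - m)"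
    by (simp add: lin_fps_nth rel_poly_def)
  then show ?thesis using A_genideal(2) relations_eq[OF kn] by auto
qed

lemma root_psum_AR: "root_psum n k s \<in> AR n k"
  unfolding root_psum_split by (intro is_subring_add[OF AR_is_subring] power_sums_AR)

text \<open>Modulo the relations, the Chern roots and the z have the same elementary symmetric
  polynomials, and Newton's identities express the power sums by these in the same way.\<close>

lemma psum_relation: "(\<Sum>i=1..n. zz i ^ s) - root_psum n k s \<in> A_ideal n k"
proof (induction s rule: less_induct)
  case (less s)
  show ?case
  proof (cases s)
    case 0 then show ?thesis by (simp add: root_psum_def AI_0)
  next
    case (Suc m)
    let ?e = "\<lambda>j. lin_fps {1..n} (\<lambda>i. X (root_var k i)) $ j" and ?f = "\<lambda>j. lin_fps {1..n} zz $ j"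
    let ?p = "\<lambda>s. root_psum n k s" and ?q = "\<lambda>s. \<Sum>i=1..n. zz i ^ s"
    have p: "?p (Suc m) = - (of_nat (Suc m) * ?e (Suc m)) - (\<Sum>j=1..m. ?e j * ?p (Suc (m - j)))"
      unfolding root_psum_def by (rule newton) simp
    have q: "?q (Suc m) = - (of_nat (Suc m) * ?f (Suc m)) - (\<Sum>j=1..m. ?f j * ?q (Suc (m - j)))"
      by (rule newton) simp
    have "?q (Suc m) - ?p (Suc m) = of_nat (Suc m) * (?e (Suc m) - ?f (Suc m))
       + (\<Sum>j=1..m. ?p (Suc (m - j)) * (?e j - ?f j) - ?f j * (?q (Suc (m - j)) - ?p (Suc (m - j))))"
      unfolding p[of ] q by (simp add: algebra_simps sum.distrib sum_subtractf)
    also have "\<dots> \<in> A_ideal n k"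
    proof (intro AI_add AI_sum)
      show "of_nat (Suc m) * (?e (Suc m) - ?f (Suc m)) \<in> A_ideal n k"
        by (rule AI_mult[OF elementary_diff is_subring_of_nat[OF AR_is_subring]])
      fix j assume "j \<in> {1..m}"
      then have "?q (Suc (m - j)) - ?p (Suc (m - j)) \<in> A_ideal n k" using Suc by (intro less) auto
      then show "?p (Suc (m - j)) * (?e j - ?f j) - ?f j * (?q (Suc (m - j)) - ?p (Suc (m - j))) \<in> A_ideal n k"
        by (rule AI_diff[OF AI_mult[OF elementary_diff root_psum_AR] AI_mult[OF _ elementary_AR]])
    qed
    finally show ?thesis using Suc by simp
  qed
qed

definition root_vars :: "var set" where
  "root_vars = VG1 ` {1..k} \<union> VG2 ` {1..n - k} \<union> {VY}"

text \<open>Of the generators only the power sums of the z involve z, and each is congruent to the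
  power sum of all Chern roots. A representative without z is wanted because restriction to a fixed
  point merely renames its variables.\<close>

lemma A_reduce: "f \<in> AR n k \<Longrightarrow> \<exists>g\<in>AR n k \<inter> ratfuns root_vars. f - g \<in> A_ideal n k"
proof -
  let ?S = "AR n k \<inter> ratfuns root_vars"
  have S: "is_subring ?S"
    using is_subring_intros[OF AR_is_subring] is_subring_intros[OF ratfuns_is_subring] by (intro is_subringI) auto
  define R where "R = {f \<in> AR n k. \<exists>g\<in>?S. f - g \<in> A_ideal n k}"
  have SR: "?S \<subseteq> R" unfolding R_def using AI_0 by force
  have R: "is_subring R"
  proof (rule is_subringI)
    show "1 \<in> R" "- 1 \<in> R" using SR is_subring_1[OF S] is_subring_uminus[OF S is_subring_1[OF S]] by auto
    fix a b assume "a \<in> R" "b \<in> R"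
    then obtain g h where *: "a \<in> AR n k" "b \<in> AR n k" "g \<in> ?S" "h \<in> ?S" "a - g \<in> A_ideal n k" "b - h \<in> A_ideal n k"
      by (auto simp: R_def)
    have "a + b - (g + h) = (a - g) + (b - h)" by simp
    then have "a + b - (g + h) \<in> A_ideal n k" using AI_add * by metis
    then show "a + b \<in> R" unfolding R_def using * is_subring_add[OF S *(3,4)] is_subring_add[OF AR_is_subring] by blast
    have "a * b - g * h = a * (b - h) + h * (a - g)" by (simp add: algebra_simps)
    moreover have "a * (b - h) + h * (a - g) \<in> A_ideal n k" using * by (intro AI_add AI_mult) auto
    ultimately have "a * b - g * h \<in> A_ideal n k" by simp
    then show "a * b \<in> R" unfolding R_def using * is_subring_mult[OF S *(3,4)] is_subring_mult[OF AR_is_subring] by blast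
  qed
  have C: "C_y_inv \<subseteq> R"
  proof
    fix c assume "c \<in> C_y_inv"
    then have "c \<in> ?S" using C_AR C_y_inv_ratfuns ratfuns_mono[of "{VY}" root_vars] by (auto simp: root_vars_def)
    then show "c \<in> R" using SR by auto
  qed
  have p1: "(\<Sum>i=1..k. g1 i ^ s) \<in> ?S" and p2: "(\<Sum>i=1..n - k. g2 i ^ s) \<in> ?S" for s
    using power_sums_AR by (auto intro!: is_subring_sum[OF ratfuns_is_subring] is_subring_power[OF ratfuns_is_subring] X_in_ratfuns simp: root_vars_def)
  have "GL_polys n k \<subseteq> R"
  proof (rule GL_polys_generated[OF R])
    show "cst c \<in> R" for c using C polys_y_C cst_in_polys by blast
    show "yy \<in> R" using C subsetD[OF polys_y_C, of yy] by auto
    show "(\<Sum>i=1..k. g1 i ^ s) \<in> R" "(\<Sum>i=1..n - k. g2 i ^ s) \<in> R" for s using p1 p2 SR by blast+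
    show "(\<Sum>i=1..n. zz i ^ s) \<in> R" for s
    proof -
      have "root_psum n k s \<in> ?S" unfolding root_psum_split by (rule is_subring_add[OF S p1 p2])
      then show ?thesis unfolding R_def using psum_relation power_sums_AR(3) by blast
    qed
  qed
  then have "AR n k \<subseteq> R" unfolding AR_def[of n k] by (intro prod_span_subset[OF R _ C])
  then show "f \<in> AR n k \<Longrightarrow> \<exists>g\<in>?S. f - g \<in> A_ideal n k" by (auto simp: R_def)
qed

text \<open>For a representative in the roots and y alone, restriction to x_J renames the roots to
  distinct z. This can be undone, so the representative is zero if its restriction is.\<close>

lemma A_ideal_if_restr_0:
  assumes f: "f \<in> AR n k" and J: "J \<in> subsets_k n k" and 0: "subst (fixed_pt n J) f = 0"
  shows "f \<in> A_ideal n k"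
proof -
  obtain g where g: "g \<in> AR n k" "g \<in> ratfuns root_vars" "f - g \<in> A_ideal n k" using A_reduce[OF f] by auto
  have "subst (fixed_pt n J) (f - g) = 0" using A_ideal_vanishing g(3) J by (auto simp: vanishing_def)
  then have g0: "subst (fixed_pt n J) g = 0"
    using 0 f g(1) AR_HR by (subst (asm) rat.subst_diff) (auto intro: fixed_pt_sdef)
  define e1 where "e1 = (\<lambda>i. sorted_list_of_set J ! (i - 1))"
  define e2 where "e2 = (\<lambda>i. sorted_list_of_set ({1..n} - J) ! (i - 1))"
  have b: "bij_betw e1 {1..k} J" "bij_betw e2 {1..n - k} ({1..n} - J)"
    unfolding e1_def e2_def by (rule enum_J[OF n1 kn J], rule enum_Jc[OF n1 kn J])
  \<comment> \<open>The renaming that undoes \<open>fixed_pt n J\<close> on the roots.\<close>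
  define \<tau> where "\<tau> = (\<lambda>v. case v of VZ a \<Rightarrow> if a \<in> J then g1 (inv_into {1..k} e1 a) else g2 (inv_into {1..n - k} e2 a) | _ \<Rightarrow> X v)"
  have t: "\<tau> (VZ (e1 i)) = g1 i" if "i \<in> {1..k}" for i
    using that bij_betwE[OF b(1)] b(1) by (auto simp: \<tau>_def bij_betw_inv_into_left)
  have t2: "\<tau> (VZ (e2 i)) = g2 i" if "i \<in> {1..n - k}" for i
    using that bij_betwE[OF b(2)] b(2) by (auto simp: \<tau>_def bij_betw_inv_into_left)
  have sd: "rat.sdef \<tau> (fixed_pt n J v)" for v by (auto simp: fixed_pt_def split: var.split)
  \<comment> \<open>Only y occurs in the denominators of \<open>AR\<close>, and both substitutions
    fix it, so they may be composed.\<close>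
  have "GL_polys n k \<subseteq> dens {VY}" using polys_dens[of "Gam_z_y n k" "{VY}"] by (auto simp: GL_polys_def)
  moreover have "C_y_inv \<subseteq> dens {VY}" using C_y_inv_ratfuns ratfuns_dens by (rule order_trans)
  ultimately have "AR n k \<subseteq> dens {VY}" unfolding AR_def by (intro prod_span_subset[OF dens_is_subring])
  then have "subst \<tau> (subst (fixed_pt n J) g) = subst (\<lambda>v. subst \<tau> (fixed_pt n J v)) g"
    using g(1) sd by (intro dens_subst_comp[of _ "{VY}"]) (auto simp: fixed_pt_def \<tau>_def)
  also have "\<dots> = g"
    by (rule subst_fixed_ratfuns(2)[OF g(2)]) (use t t2 in \<open>auto simp: root_vars_def fixed_pt_def e1_def e2_def\<close>, simp add: \<tau>_def)
  finally have "g = 0" using g0 by simp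
  then show ?thesis using g(3) by simp
qed

lemma A_ideal_eq: "A_ideal n k = AR n k \<inter> vanishing n k"
  using A_ideal_vanishing A_ideal_if_restr_0 subsets_k_nonempty[OF n1 kn] by (auto simp: vanishing_def)

lemma A_alg_eq: "A_alg n k = ring_on (AR n k) Quot A_ideal n k"
  by (simp add: A_alg_def A_ring_AR)

lemma A_class_eq: "A_class n k f = A_ideal n k +>\<^bsub>ring_on (AR n k)\<^esub> f"
  by (simp add: A_class_def A_ring_AR)

lemma A_cring: "cring (A_alg n k)"
  unfolding A_alg_eq by (rule ring_on_quot.Q_cring[OF A_quot])

lemma A_class_carrier: "f \<in> AR n k \<Longrightarrow> A_class n k f \<in> carrier (A_alg n k)"
  unfolding A_alg_eq A_class_eq by (rule ring_on_quot.cls_in[OF A_quot])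

lemma A_carrierE:
  assumes "c \<in> carrier (A_alg n k)"
  obtains f where "f \<in> AR n k" "c = A_class n k f"
  using ring_on_quot.Q_carrierE[OF A_quot] assms unfolding A_alg_eq A_class_eq by metis

lemma A_class_ops:
  "f \<in> AR n k \<Longrightarrow> g \<in> AR n k \<Longrightarrow> A_class n k f \<oplus>\<^bsub>A_alg n k\<^esub> A_class n k g = A_class n k (f + g)"
  "f \<in> AR n k \<Longrightarrow> g \<in> AR n k \<Longrightarrow> A_class n k f \<otimes>\<^bsub>A_alg n k\<^esub> A_class n k g = A_class n k (f * g)"
  "\<zero>\<^bsub>A_alg n k\<^esub> = A_class n k 0" "\<one>\<^bsub>A_alg n k\<^esub> = A_class n k 1"
  unfolding A_alg_eq A_class_eq
  by (simp_all add: ring_on_quot.cls_add[OF A_quot] ring_on_quot.cls_mult[OF A_quot]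
      ring_on_quot.Q_zero[OF A_quot] ring_on_quot.Q_one[OF A_quot])

lemma A_to_HT_class: "f \<in> AR n k \<Longrightarrow> A_to_HT n k (A_class n k f) = HT_class n k f"
  unfolding A_to_HT_def A_class_eq
proof (rule ring_on_quot.the_elem_cls[OF A_quot])
  fix a assume "a \<in> A_ideal n k"
  then have "a + f - f \<in> HT_ideal n k" using AR_HR by (auto simp: A_ideal_eq HT_ideal_eq[OF n1 kn])
  then show "HT_class n k (a + f) = HT_class n k f"
    unfolding HT_class_eq[OF n1 kn] using ring_on_quot.cls_eq_iff[OF HT_quot[OF n1 kn]] by metis
qed

definition A_val :: "nat set \<Rightarrow> ratf set \<Rightarrow> ratf" where
  "A_val J c = restr n J (A_to_HT n k c)"

lemma A_to_HT_carrier: "c \<in> carrier (A_alg n k) \<Longrightarrow> A_to_HT n k c \<in> carrier (HT_L n k)"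
  by (metis A_carrierE A_to_HT_class HT_class_carrier[OF n1 kn] AR_HR subsetD)

lemma A_val_class: "f \<in> AR n k \<Longrightarrow> J \<in> subsets_k n k \<Longrightarrow> A_val J (A_class n k f) = subst (fixed_pt n J) f"
  unfolding A_val_def using AR_HR by (subst A_to_HT_class) (auto intro!: restr_class[OF n1 kn])

text \<open>Neither the representatives nor their restrictions contain lambda.\<close>

lemma A_val_shift: "c \<in> carrier (A_alg n k) \<Longrightarrow> J \<in> subsets_k n k \<Longrightarrow> shift m (A_val J c) = A_val J c"
proof -
  assume c: "c \<in> carrier (A_alg n k)" and J: "J \<in> subsets_k n k"
  obtain f where f: "f \<in> AR n k" "c = A_class n k f" using c by (rule A_carrierE)
  have HR: "f \<in> HR n k" using f AR_HR by auto
  have "shift m f = f" if "f \<in> AR n k" using that unfolding AR_def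
  proof (induction f rule: prod_span_induct)
    case (mult a b)
    have "shift m a = a" by (rule T_shift[OF n1 kn]) (use mult GL_T in auto)
    moreover have "shift m b = b" by (rule shift_fixed[of _ "{VY}"]) (use mult C_y_inv_ratfuns in auto)
    ultimately show ?case by (simp add: shift_mult)
  qed (simp_all add: shift_add)
  then show ?thesis using HR_shift[OF n1 kn HR J, of m] f J by (simp add: A_val_class)
qed

lemma A_val_ops:
  assumes J: "J \<in> subsets_k n k"
  shows "c \<in> carrier (A_alg n k) \<Longrightarrow> d \<in> carrier (A_alg n k) \<Longrightarrow> A_val J (c \<oplus>\<^bsub>A_alg n k\<^esub> d) = A_val J c + A_val J d"
    "c \<in> carrier (A_alg n k) \<Longrightarrow> d \<in> carrier (A_alg n k) \<Longrightarrow> A_val J (c \<otimes>\<^bsub>A_alg n k\<^esub> d) = A_val J c * A_val J d"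
    "A_val J \<zero>\<^bsub>A_alg n k\<^esub> = 0" "A_val J \<one>\<^bsub>A_alg n k\<^esub> = 1"
proof -
  have HR: "f \<in> HR n k" if "f \<in> AR n k" for f using that AR_HR by auto
  assume "c \<in> carrier (A_alg n k)" "d \<in> carrier (A_alg n k)"
  then obtain f g where "f \<in> AR n k" "c = A_class n k f" "g \<in> AR n k" "d = A_class n k g" using A_carrierE by metis
  then show "A_val J (c \<oplus>\<^bsub>A_alg n k\<^esub> d) = A_val J c + A_val J d" "A_val J (c \<otimes>\<^bsub>A_alg n k\<^esub> d) = A_val J c * A_val J d"
    using J HR by (simp_all add: A_class_ops A_val_class is_subring_add[OF AR_is_subring] is_subring_mult[OF AR_is_subring] fixed_pt_add[OF n1 kn] fixed_pt_mult[OF n1 kn])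
next
  show "A_val J \<zero>\<^bsub>A_alg n k\<^esub> = 0" "A_val J \<one>\<^bsub>A_alg n k\<^esub> = 1"
    using J by (simp_all add: A_class_ops A_val_class is_subring_0[OF AR_is_subring] is_subring_1[OF AR_is_subring])
qed

text \<open>One fixed point suffices, because the representatives are symmetric in \<open>z\<close>.\<close>

lemma A_val_inject:
  assumes "c \<in> carrier (A_alg n k)" "d \<in> carrier (A_alg n k)" "J \<in> subsets_k n k" "A_val J c = A_val J d"
  shows "c = d"
proof -
  obtain f g where fg: "f \<in> AR n k" "c = A_class n k f" "g \<in> AR n k" "d = A_class n k g" using assms(1,2) A_carrierE by metis
  have "subst (fixed_pt n J) (f - g) = 0"
    using assms(3,4) fg AR_HR by (subst rat.subst_diff) (auto intro: fixed_pt_sdef simp: A_val_class)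
  then have "f - g \<in> A_ideal n k" by (rule A_ideal_if_restr_0[OF is_subring_diff[OF AR_is_subring fg(1,3)] assms(3)])
  then show ?thesis unfolding fg(2,4) A_class_eq using ring_on_quot.cls_eq_iff[OF A_quot] by blast
qed

lemma ratio_GL: "ratio_fps {1..k} g1 $ s \<in> GL_polys n k" "ratio_fps {1..n} (\<lambda>i. zz i - yy) $ s \<in> GL_polys n k"
proof -
  have g: "ratio_fps A x $ s \<in> GL_polys n k"
    if f: "\<And>i. i \<in> A \<Longrightarrow> x i \<in> polys (Gam_z_y n k)"
      and p: "\<And>\<sigma> \<tau> \<rho>. \<sigma> permutes {1..k} \<Longrightarrow> \<tau> permutes {1..n - k} \<Longrightarrow> \<rho> permutes {1..n} \<Longrightarrow>
          \<exists>\<pi>. \<pi> permutes A \<and> (\<forall>i\<in>A. pm \<sigma> \<tau> \<rho> (x i) = x (\<pi> i))" for A and x :: "nat \<Rightarrow> ratf"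
    unfolding GL_polys_def
  proof (intro CollectI conjI allI impI)
    show "ratio_fps A x $ s \<in> polys (Gam_z_y n k)"
      using f by (intro ratio_fps_mem[OF polys_is_subring]) (auto simp: Gam_z_y_def)
    fix \<sigma> \<tau> \<rho> assume st: "\<sigma> permutes {1..k}" "\<tau> permutes {1..n - k}" "\<rho> permutes {1..n}"
    obtain \<pi> where \<pi>: "\<pi> permutes A" "\<forall>i\<in>A. pm \<sigma> \<tau> \<rho> (x i) = x (\<pi> i)" using p[OF st] by blast
    have "pm \<sigma> \<tau> \<rho> (ratio_fps A x $ s) = ratio_fps A (\<lambda>i. pm \<sigma> \<tau> \<rho> (x i)) $ s"
      by (rule ratio_fps_subst[THEN conjunct2]) (auto intro: rat.sdef_polys[OF f] simp: perm_var_VY)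
    also have "ratio_fps A (\<lambda>i. pm \<sigma> \<tau> \<rho> (x i)) = (\<Prod>i\<in>A. ((\<lambda>i. shift_fps (x i)) \<circ> \<pi>) i)"
      unfolding ratio_fps_def using \<pi>(2) by simp
    also have "\<dots> = ratio_fps A x" unfolding ratio_fps_def by (rule prod.permute[OF \<pi>(1), symmetric])
    finally show "pm \<sigma> \<tau> \<rho> (ratio_fps A x $ s) = ratio_fps A x $ s" .
  qed
  show "ratio_fps {1..k} g1 $ s \<in> GL_polys n k"
    by (rule g) (auto simp: Gam_z_y_def perm_var_def)
  show "ratio_fps {1..n} (\<lambda>i. zz i - yy) $ s \<in> GL_polys n k"
  proof (rule g)
    show "zz i - yy \<in> polys (Gam_z_y n k)" if "i \<in> {1..n}" for i
      using that by (auto intro!: is_subring_diff[OF polys_is_subring] simp: Gam_z_y_def)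
  qed (auto simp: rat.subst_diff perm_var_def)
qed

lemma ab_AR: "a_coeff k s \<in> AR n k" "b_coeff n s \<in> AR n k"
  unfolding a_coeff_eq b_coeff_eq by (intro GL_AR ratio_GL)+

lemma A_val_ab:
  assumes J: "J \<in> subsets_k n k"
  shows "A_val J (A_class n k (a_coeff k s)) = ratio_fps J zz $ s" (is ?A)
    "A_val J (A_class n k (b_coeff n s)) = ratio_fps {1..n} (\<lambda>i. zz i - yy) $ s" (is ?B)
proof -
  have "A_val J (A_class n k (a_coeff k s)) = ratio_fps {1..k} (\<lambda>i. zz (sorted_list_of_set J ! (i - 1))) $ s"
    using ratio_fps_subst[of "fixed_pt n J" "{1..k}" g1 s] ab_AR J by (simp add: A_val_class a_coeff_eq fixed_pt_def)
  also have "ratio_fps {1..k} (\<lambda>i. zz (sorted_list_of_set J ! (i - 1))) = ratio_fps J zz"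
    unfolding ratio_fps_def by (rule prod.reindex_bij_betw[OF enum_J[OF n1 kn J]])
  finally show ?A .
  show ?B using ratio_fps_subst[of "fixed_pt n J" "{1..n}" "\<lambda>i. zz i - yy" s] ab_AR J
    by (simp add: A_val_class b_coeff_eq fixed_pt_def rat.subst_diff)
qed

text \<open>The \<open>a\<^sub>s\<close> give the power sums of the first Chern roots and the \<open>b\<^sub>s\<close> those of the \<open>z\<^sub>i\<close>; modulo the
  relations, the power sums of the second Chern roots are the differences.\<close>

lemma A_generated:
  assumes R: "is_subring R" "C_y_inv \<subseteq> R" "A_ideal n k \<subseteq> R" "\<And>s. a_coeff k s \<in> R" "\<And>s. b_coeff n s \<in> R"
  shows "AR n k \<subseteq> R"
proof -
  have p1: "(\<Sum>i=1..k. g1 i ^ s) \<in> R" for s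
    by (rule ratio_determines_power_sums[OF R(1,2)]) (use R(4) in \<open>auto simp: a_coeff_eq\<close>)
  have y: "yy \<in> R" using R(2) subsetD[OF polys_y_C, of yy] by auto
  have pz': "(\<Sum>i=1..n. (zz i - yy) ^ s) \<in> R" for s
    by (rule ratio_determines_power_sums[OF R(1,2)]) (use R(5) in \<open>auto simp: b_coeff_eq\<close>)
  have pz: "(\<Sum>i=1..n. zz i ^ s) \<in> R" for s
  proof -
    have "zz i ^ s = (\<Sum>j\<le>s. of_nat (s choose j) * (zz i - yy) ^ j * yy ^ (s - j))" for i
      using binomial_ring[of "zz i - yy" yy s] by simp
    then have "(\<Sum>i=1..n. zz i ^ s) = (\<Sum>j\<le>s. of_nat (s choose j) * (\<Sum>i=1..n. (zz i - yy) ^ j) * yy ^ (s - j))"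
      by (simp only: sum.swap[of _ "{1..n}"] sum_distrib_left sum_distrib_right)
    also have "\<dots> \<in> R"
      by (intro is_subring_sum[OF R(1)] is_subring_mult[OF R(1)] is_subring_of_nat[OF R(1)] is_subring_power[OF R(1)] pz' y)
    finally show ?thesis .
  qed
  have "GL_polys n k \<subseteq> R"
  proof (rule GL_polys_generated[OF R(1)])
    show "cst c \<in> R" for c using R(2) subsetD[OF polys_y_C cst_in_polys, of c] by auto
    show "yy \<in> R" by (rule y)
    show "(\<Sum>i=1..n - k. g2 i ^ s) \<in> R" for s
    proof -
      have "(\<Sum>i=1..n - k. g2 i ^ s) = (\<Sum>i=1..n. zz i ^ s) - (\<Sum>i=1..k. g1 i ^ s) - ((\<Sum>i=1..n. zz i ^ s) - root_psum n k s)"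
        unfolding root_psum_split by simp
      also have "\<dots> \<in> R" by (rule is_subring_diff[OF R(1) is_subring_diff[OF R(1) pz p1] subsetD[OF R(3) psum_relation]])
      finally show ?thesis .
    qed
  qed (fact p1 pz)+
  then show ?thesis unfolding AR_def by (intro prod_span_subset[OF R(1) _ R(2)])
qed

end

subsection \<open>The \<open>L\<close>-operator of the module\<close>

text \<open>\<open>R0\<close> with a free dynamical parameter, which changes when the last factor is
  split off.\<close>

definition R0g :: "ratf \<Rightarrow> nat \<Rightarrow> ratf \<Rightarrow> nat \<Rightarrow> vec \<Rightarrow> vec" where
  "R0g l n w a \<zeta> J =
     (\<Sum>S\<in>Pow {0, a}.
        Rmat (l - yy * of_int (h_sum {a + 1..n} J)) (w - zz a) yy ! pos0 a J ! pos0 a S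
          * \<zeta> ((J - {0, a}) \<union> S))"

lemma R0_R0g: "R0 n w = R0g lam n w"
  by (intro ext) (simp add: R0_def R0g_def)

lemma foldr_R0g_cong:
  assumes "\<And>K. K \<subseteq> {0..n} \<Longrightarrow> \<zeta> K = \<eta> K" "J \<subseteq> {0..n}" "set xs \<subseteq> {1..n}"
  shows "foldr (R0g l m w) xs \<zeta> J = foldr (R0g l m w) xs \<eta> J"
  using assms(2,3)
proof (induction xs arbitrary: J)
  case (Cons a xs)
  have "foldr (R0g l m w) xs \<zeta> ((J - {0, a}) \<union> S) = foldr (R0g l m w) xs \<eta> ((J - {0, a}) \<union> S)" if "S \<in> Pow {0, a}" for S
    using that Cons.prems by (intro Cons.IH) auto
  moreover have "R0g l m w a f J = R0g l m w a g J" if "\<And>S. S \<in> Pow {0, a} \<Longrightarrow> f ((J - {0, a}) \<union> S) = g ((J - {0, a}) \<union> S)" for f g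
    unfolding R0g_def using that by (intro sum.cong refl arg_cong2[where f = "(*)"]) auto
  ultimately show ?case unfolding foldr_Cons o_apply by blast
qed (simp add: assms(1))

lemma foldr_R0g_add:
  "foldr (R0g l m w) xs (\<lambda>K. \<zeta> K + \<eta> K) J = foldr (R0g l m w) xs \<zeta> J + foldr (R0g l m w) xs \<eta> J"
  by (induction xs arbitrary: J) (simp_all add: R0g_def distrib_left sum.distrib)

text \<open>The operators for \<open>xs\<close> do not touch the factor n + 1; it only adds 1 or -1
  to the sum of the h, which moves the parameter to l - y or l + y.\<close>

lemma foldr_R0g_slice:
  assumes "set xs \<subseteq> {1..n}"
  shows "foldr (R0g l (Suc n) w) xs \<zeta> J = foldr (R0g (if Suc n \<in> J then l - yy else l + yy) n w) xs
    (\<lambda>K. \<zeta> (if Suc n \<in> J then insert (Suc n) K else K)) (J - {Suc n})"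
  using assms
proof (induction xs arbitrary: J)
  case Nil
  show ?case by (simp add: insert_absorb)
next
  case (Cons a xs)
  let ?N = "Suc n" and ?J' = "J - {Suc n}"
  let ?l = "if ?N \<in> J then l - yy else l + yy"
  have a: "1 \<le> a" "a \<le> n" "?N \<noteq> a" using Cons.prems by auto
  have "{a + 1..?N} = insert ?N {a + 1..n}" using a by auto
  then have "h_sum {a + 1..?N} J = (if ?N \<in> J then 1 else - 1) + h_sum {a + 1..n} J"
    by (simp add: h_sum_def)
  moreover have "h_sum {a + 1..n} J = h_sum {a + 1..n} ?J'" unfolding h_sum_def by (rule sum.cong) auto
  ultimately have h: "l - yy * of_int (h_sum {a + 1..?N} J) = ?l - yy * of_int (h_sum {a + 1..n} ?J')"
    by (auto simp: algebra_simps)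
  have p: "pos0 a J = pos0 a ?J'" using a by (auto simp: pos0_def)
  have "foldr (R0g l ?N w) xs \<zeta> ((J - {0, a}) \<union> S)
    = foldr (R0g ?l n w) xs (\<lambda>K. \<zeta> (if ?N \<in> J then insert ?N K else K)) ((?J' - {0, a}) \<union> S)" if "S \<in> Pow {0, a}" for S
  proof -
    have 1: "?N \<in> (J - {0, a}) \<union> S \<longleftrightarrow> ?N \<in> J" using that a by auto
    have 2: "(J - {0, a}) \<union> S - {?N} = (?J' - {0, a}) \<union> S" using that a by auto
    show ?thesis using Cons by (simp only: Cons.IH[of "(J - {0, a}) \<union> S"] 1 2 list.set insert_subset)
  qed
  then show ?case unfolding foldr_Cons o_apply R0g_def h p by (simp only: cong: sum.cong)
qed

definition slot :: "bool \<Rightarrow> nat" where "slot b = (if b then 1 else 2)"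

lemma Pow_pair: "0 \<noteq> a \<Longrightarrow> (\<Sum>S\<in>Pow {0, a}. f S) = f {} + f {0} + f {a} + f {0, a}" for a :: nat and f :: "nat set \<Rightarrow> ratf"
proof -
  assume "0 \<noteq> a"
  moreover have "Pow {0, a} = {{}, {0}, {a}, {0, a}}" by (auto simp: Pow_insert)
  moreover have "{} \<noteq> {0::nat}" "{} \<noteq> {a}" "{} \<noteq> {0, a}" "{0} \<noteq> {a}" "{0} \<noteq> {0, a}" "{a} \<noteq> {0, a}"
    using \<open>0 \<noteq> a\<close> by auto
  ultimately show ?thesis by (simp add: add.assoc)
qed

text \<open>The operator in the factors 0 and n + 1 has an empty sum of h in its parameter. Its
  image is sorted by the state of the auxiliary factor, so that the remaining operators can be
  applied to each part.\<close>

lemma R0g_aux: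
  fixes n :: nat
  defines "N \<equiv> Suc n"
  assumes K: "K \<subseteq> {0..n}"
  shows "R0g l N w N (aux_tensor (slot j) u) (if b then insert N K else K) =
     aux_tensor 1 (\<lambda>M. if b then (if j then u (insert N M) else 0)
        else (if j then rA yy l (w - zz N) * u M else rB yy l (w - zz N) * u (insert N M))) K
   + aux_tensor 2 (\<lambda>M. if b then (if j then rC yy l (w - zz N) * u M else rD yy l (w - zz N) * u (insert N M))
        else (if j then 0 else u M)) K"
proof -
  have N: "0 \<noteq> N" "N \<notin> K" using K by (auto simp: N_def)
  have h: "h_sum {N + 1..N} J = 0" for J by (simp add: h_sum_def)
  have s: "insert N K - {0, N} = K - {0}" "K - {0, N} = K - {0}" "insert N (K - {0}) - {0} = insert N (K - {0})"
    "insert 0 (K - {0}) - {0} = K - {0}" "insert 0 (insert N (K - {0})) - {0} = insert N (K - {0})"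
    "K - {0} - {0} = K - {0}"
    using N by auto
  show ?thesis
    unfolding R0g_def Pow_pair[OF N(1)] h
    using N
    by (cases b; cases j; cases "0 \<in> K")
      (simp_all add: slot_def aux_tensor_def pos0_def Rmat_def rA_def rB_def rC_def rD_def s numeral_nat Un_insert_right)
qed

text \<open>In the product the operator in the factors 0 and n + 1 stands on the right and acts
  first; \<open>foldr_R0g_slice\<close> turns the others into an L-operator for n factors with moved
  parameter.\<close>

lemma foldr_laxop:
  assumes "I \<subseteq> {1..n}"
  shows "foldr (R0g l n w) [1..<Suc n] (aux_tensor (slot j) u) (if i then insert 0 I else I) = laxop zz yy w n l i j u I"
  using assms
proof (induction n arbitrary: l j u I)
  case 0
  then show ?case by (auto simp: aux_tensor_def slot_def)
next
  case (Suc n)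
  let ?N = "Suc n" and ?I' = "I - {Suc n}"
  let ?J = "if i then insert 0 I else I"
  let ?l = "if ?N \<in> I then l - yy else l + yy"
  have I': "?I' \<subseteq> {1..n}" using Suc.prems by (auto simp: le_Suc_eq)
  have J: "?N \<in> ?J \<longleftrightarrow> ?N \<in> I" "?J - {?N} = (if i then insert 0 ?I' else ?I')" by auto
  let ?f = "\<lambda>M. if ?N \<in> I then (if j then u (insert ?N M) else 0)
        else (if j then rA yy l (w - zz ?N) * u M else rB yy l (w - zz ?N) * u (insert ?N M))"
  let ?g = "\<lambda>M. if ?N \<in> I then (if j then rC yy l (w - zz ?N) * u M else rD yy l (w - zz ?N) * u (insert ?N M))
        else (if j then 0 else u M)"
  have u: "[1..<Suc ?N] = [1..<?N] @ [?N]" by simp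
  have "foldr (R0g l ?N w) [1..<Suc ?N] (aux_tensor (slot j) u) ?J
    = foldr (R0g l ?N w) [1..<?N] (R0g l ?N w ?N (aux_tensor (slot j) u)) ?J"
    unfolding u by simp
  also have "\<dots> = foldr (R0g ?l n w) [1..<?N] (\<lambda>K. R0g l ?N w ?N (aux_tensor (slot j) u) (if ?N \<in> I then insert ?N K else K))
      (if i then insert 0 ?I' else ?I')"
    by (subst foldr_R0g_slice) (auto simp only: J set_upt atLeastLessThanSuc_atLeastAtMost)
  also have "\<dots> = foldr (R0g ?l n w) [1..<?N] (\<lambda>K. aux_tensor 1 ?f K + aux_tensor 2 ?g K) (if i then insert 0 ?I' else ?I')"
  proof (rule foldr_R0g_cong[where n = n])
    show "(if i then insert 0 ?I' else ?I') \<subseteq> {0..n}" using I' by (auto split: if_splits)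
    show "set [1..<?N] \<subseteq> {1..n}" by auto
  qed (rule R0g_aux)
  also have "\<dots> = foldr (R0g ?l n w) [1..<?N] (aux_tensor (slot True) ?f) (if i then insert 0 ?I' else ?I')
    + foldr (R0g ?l n w) [1..<?N] (aux_tensor (slot False) ?g) (if i then insert 0 ?I' else ?I')"
    unfolding foldr_R0g_add by (simp add: slot_def)
  also have "\<dots> = laxop zz yy w n ?l i True ?f ?I' + laxop zz yy w n ?l i False ?g ?I'"
    by (simp only: Suc.IH[OF I'])
  also have "\<dots> = laxop zz yy w ?N l i j u I"
  proof -
    have z: "laxop zz yy w n l i j (\<lambda>M. 0) K = 0" for l i j K
      using laxop_scale[of zz yy w n l i j 0 "\<lambda>M. 0" K] by simp
    have "I - {?N} = I" if "?N \<notin> I" using that by auto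
    then show ?thesis by (cases "?N \<in> I"; cases j) (simp_all add: laxop_scale z)
  qed
  finally show ?case .
qed

lemma L_op_laxop:
  "L_op n (slot i) (slot j) w u I = (if I \<subseteq> {1..n} then laxop zz yy w n lam i j u I else 0)"
proof -
  have "(slot i = 1) = i" by (simp add: slot_def)
  then show ?thesis unfolding L_op_def L_full_def R0_R0g using foldr_laxop by simp
qed

text \<open>\<open>laxop\<close> is built from field operations, so it commutes with every map that
  respects them; the map of interest is the shift.\<close>

lemma laxop_hom:
  assumes "\<And>a b. f (a + b) = f a + f b" "\<And>a b. f (a * b) = f a * f b" "\<And>a b. f (a - b) = f a - f b"
    "\<And>a b. f (a / b) = f a / f b" "f 0 = (0::'b::field)" "\<And>a. f (- a) = - f a"
  shows "f (laxop z y w n l i j u I) = laxop (\<lambda>a. f (z a)) (f y) (f w) n (f l) i j (\<lambda>K. f (u K)) I"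
  by (induction n arbitrary: l j u I) (simp_all add: assms rA_def rB_def rC_def rD_def)

subsection \<open>Weight functions\<close>

text \<open>The ingredients of the weight function are repeated with a free parameter in place of
  lambda, since the induction on n moves it.\<close>

definition l_fung :: "ratf \<Rightarrow> nat \<Rightarrow> nat set \<Rightarrow> (nat \<Rightarrow> ratf) \<Rightarrow> nat \<Rightarrow> nat \<Rightarrow> ratf" where
  "l_fung l n I t r a = (let i = sorted_list_of_set I ! (r - 1) in
     if a < i then t r - zz a + yy
     else if a = i then l + t r - zz a - of_int (wt n i I) * yy
     else t r - zz a)"

definition pair_prod :: "nat \<Rightarrow> (nat \<Rightarrow> ratf) \<Rightarrow> ratf" where
  "pair_prod k t = (\<Prod>(a, b)\<in>{(a, b). 1 \<le> a \<and> a < b \<and> b \<le> k}. (t a - t b + yy) / (t a - t b))"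

definition W_termg :: "ratf \<Rightarrow> nat \<Rightarrow> nat set \<Rightarrow> (nat \<Rightarrow> ratf) \<Rightarrow> ratf" where
  "W_termg l n I t = (\<Prod>r=1..card I. \<Prod>a=1..n. l_fung l n I t r a) * pair_prod (card I) t"

definition W_fung :: "ratf \<Rightarrow> nat \<Rightarrow> nat set \<Rightarrow> (nat \<Rightarrow> ratf) \<Rightarrow> ratf" where
  "W_fung l n I t = yy ^ card I * (\<Sum>\<pi> | \<pi> permutes {1..card I}. W_termg l n I (\<lambda>i. t (\<pi> i)))"

definition C_idg :: "ratf \<Rightarrow> nat \<Rightarrow> int \<Rightarrow> nat set \<Rightarrow> ratf" where
  "C_idg l n r I = (\<Prod>i\<in>I. l - of_int (wt n i I + r) * yy)"

definition e_set :: "nat set \<Rightarrow> ratf" where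
  "e_set J = (\<Prod>a\<in>J. \<Prod>b\<in>J. (zz a - zz b + yy))"

lemma W_fun_g: "W_fun n I t = W_fung lam n I t" and C_id_g: "C_id n r I = C_idg lam n r I"
  by (simp_all add: W_fun_def W_fung_def W_term_def W_termg_def l_fun_def l_fung_def pair_prod_def C_id_def C_idg_def)

lemma e_fun_set:
  assumes "bij_betw e {1..k} J"
  shows "e_fun k (\<lambda>i. zz (e i)) = e_set J"
proof -
  have "e_fun k (\<lambda>i. zz (e i)) = (\<Prod>a=1..k. (\<lambda>a. \<Prod>b=1..k. (zz a - zz (e b) + yy)) (e a))"
    by (simp add: e_fun_def)
  also have "\<dots> = (\<Prod>a\<in>J. \<Prod>b=1..k. (zz a - zz (e b) + yy))" by (rule prod.reindex_bij_betw[OF assms])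
  also have "\<dots> = e_set J" unfolding e_set_def
    by (rule prod.cong[OF refl]) (rule prod.reindex_bij_betw[OF assms])
  finally show ?thesis .
qed

lemma pair_prod_Suc: "pair_prod (Suc k) t = pair_prod k t * (\<Prod>a=1..k. (t a - t (Suc k) + yy) / (t a - t (Suc k)))"
proof -
  let ?P = "\<lambda>k. {(a, b). 1 \<le> a \<and> a < b \<and> b \<le> k}"
  have fin: "finite (?P k)" by (rule finite_subset[of _ "{..k} \<times> {..k}"]) auto
  have "?P (Suc k) = ?P k \<union> (\<lambda>a. (a, Suc k)) ` {1..k}" by (auto simp: le_Suc_eq)
  then have "pair_prod (Suc k) t = pair_prod k t * (\<Prod>(a, b)\<in>(\<lambda>a. (a, Suc k)) ` {1..k}. (t a - t b + yy) / (t a - t b))"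
    unfolding pair_prod_def using fin by (simp only:) (rule prod.union_disjoint, auto)
  then show ?thesis by (simp add: prod.reindex inj_on_def)
qed

text \<open>In \<open>l_fung\<close> and \<open>C_idg\<close> this change of the weight by 1 or -1
  amounts to moving the parameter by y, in the same direction as the R-matrices move it.\<close>

lemma wt_Suc:
  assumes "I \<subseteq> {1..Suc n}" "i \<le> n"
  shows "wt (Suc n) i I = wt n i (I - {Suc n}) + (if Suc n \<in> I then 1 else - 1)"
proof -
  have fin: "finite I" using assms(1) finite_subset by blast
  have c: "{j \<in> {1..Suc n} - I. i < j} = {j \<in> {1..n} - (I - {Suc n}). i < j} \<union> (if Suc n \<in> I then {} else {Suc n})"
    using assms by (auto simp: le_Suc_eq)
  have d: "{j \<in> I. i < j} = {j \<in> I - {Suc n}. i < j} \<union> (if Suc n \<in> I then {Suc n} else {})" using assms(2) by auto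
  have "card {j \<in> {1..Suc n} - I. i < j} = card {j \<in> {1..n} - (I - {Suc n}). i < j} + (if Suc n \<in> I then 0 else 1)"
    unfolding c by (subst card_Un_disjoint) auto
  moreover have "card {j \<in> I. i < j} = card {j \<in> I - {Suc n}. i < j} + (if Suc n \<in> I then 1 else 0)"
    unfolding d by (subst card_Un_disjoint) (use fin in auto)
  ultimately show ?thesis unfolding wt_def by simp
qed

lemma wt_top: "I \<subseteq> {1..n} \<Longrightarrow> wt n n I = 0"
proof -
  assume I: "I \<subseteq> {1..n}"
  have "{j \<in> I. n < j} = {}" "{j \<in> {1..n} - I. n < j} = {}" using I by auto
  then show ?thesis by (simp only: wt_def card.empty)
qed

lemma sorted_nth_mem: "finite I \<Longrightarrow> r \<in> {1..card I} \<Longrightarrow> sorted_list_of_set I ! (r - 1) \<in> I"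
  by (metis Suc_le_eq atLeastAtMost_iff diff_Suc_less length_sorted_list_of_set nth_mem order_less_le_trans set_sorted_list_of_set Suc_diff_1 One_nat_def le_eq_less_or_eq zero_less_one less_le_trans)

lemma sorted_insert_max:
  assumes "I \<subseteq> {1..n}"
  shows "sorted_list_of_set (insert (Suc n) I) = sorted_list_of_set I @ [Suc n]"
proof -
  have fin: "finite I" using assms finite_subset by blast
  have "sorted (sorted_list_of_set I @ [Suc n])" using assms fin by (auto simp: sorted_append)
  moreover have "distinct (sorted_list_of_set I @ [Suc n])" using assms fin by auto
  moreover have "set (sorted_list_of_set I @ [Suc n]) = insert (Suc n) I" using fin by auto
  ultimately show ?thesis
    by (intro sorted_distinct_set_unique) (simp_all only: sorted_sorted_list_of_set distinct_sorted_list_of_set set_sorted_list_of_set finite_insert fin)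
qed

lemma W_termg_notin:
  assumes "I \<subseteq> {1..n}"
  shows "W_termg l (Suc n) I t = (\<Prod>r=1..card I. t r - zz (Suc n)) * W_termg (l + yy) n I t"
proof -
  have fin: "finite I" using assms finite_subset by blast
  have N: "Suc n \<notin> I" using assms by auto
  have "(\<Prod>a=1..Suc n. l_fung l (Suc n) I t r a) = (\<Prod>a=1..n. l_fung (l + yy) n I t r a) * (t r - zz (Suc n))"
    if r: "r \<in> {1..card I}" for r
  proof -
    let ?i = "sorted_list_of_set I ! (r - 1)"
    have i: "?i \<in> I" by (rule sorted_nth_mem[OF fin r])
    then have "?i \<le> n" using assms by auto
    then have "wt (Suc n) ?i I = wt n ?i I - 1" using wt_Suc[of I n ?i] assms N by (simp add: subset_iff le_SucI)
    then have w: "wt (Suc n) ?i I = wt n ?i I - 1" .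
    have "l_fung l (Suc n) I t r a = l_fung (l + yy) n I t r a" "l_fung l (Suc n) I t r (Suc n) = t r - zz (Suc n)" for a
      using \<open>?i \<le> n\<close> unfolding l_fung_def Let_def w by (auto simp: algebra_simps)
    then show ?thesis by simp
  qed
  then have "(\<Prod>r=1..card I. \<Prod>a=1..Suc n. l_fung l (Suc n) I t r a)
     = (\<Prod>r=1..card I. (\<Prod>a=1..n. l_fung (l + yy) n I t r a) * (t r - zz (Suc n)))" by (rule prod.cong[OF refl])
  then show ?thesis unfolding W_termg_def by (simp add: prod.distrib mult_ac)
qed

text \<open>What the index n + 1 adds to a term when it belongs to I: the row of the last variable,
  the factors of the other variables at a = n + 1, and the pairs with the last variable.\<close>

definition W_head :: "ratf \<Rightarrow> nat \<Rightarrow> nat \<Rightarrow> (nat \<Rightarrow> ratf) \<Rightarrow> ratf" where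
  "W_head l n k t = (\<Prod>r=1..k. t r - zz (Suc n)) * (\<Prod>a=1..n. t (Suc k) - zz a + yy) * (l + t (Suc k) - zz (Suc n))
     * (\<Prod>a=1..k. (t a - t (Suc k) + yy) / (t a - t (Suc k)))"

lemma W_termg_in:
  assumes "I \<subseteq> {1..n}"
  shows "W_termg l (Suc n) (insert (Suc n) I) t = W_head l n (card I) t * W_termg (l - yy) n I t"
proof -
  have fin: "finite I" using assms finite_subset by blast
  have N: "Suc n \<notin> I" using assms by auto
  let ?I = "insert (Suc n) I"
  have crd: "card ?I = Suc (card I)" using fin N by simp
  have 1: "(\<Prod>a=1..Suc n. l_fung l (Suc n) ?I t r a) = (\<Prod>a=1..n. l_fung (l - yy) n I t r a) * (t r - zz (Suc n))"
    if r: "r \<in> {1..card I}" for r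
  proof -
    let ?i = "sorted_list_of_set I ! (r - 1)"
    have i: "?i \<in> I" by (rule sorted_nth_mem[OF fin r])
    have s: "sorted_list_of_set ?I ! (r - 1) = ?i"
      using r fin by (auto simp: sorted_insert_max[OF assms] nth_append)
    have "?i \<le> n" using assms i by auto
    moreover have "wt (Suc n) ?i ?I = wt n ?i I + 1" using wt_Suc[of ?I n ?i] assms N \<open>?i \<le> n\<close> by (simp add: subset_iff le_SucI)
    ultimately have "l_fung l (Suc n) ?I t r a = l_fung (l - yy) n I t r a" "l_fung l (Suc n) ?I t r (Suc n) = t r - zz (Suc n)" for a
      unfolding l_fung_def Let_def s by (auto simp: algebra_simps)
    then show ?thesis by simp
  qed
  have s: "sorted_list_of_set ?I ! card I = Suc n"
    using fin by (simp add: sorted_insert_max[OF assms] nth_append)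
  have w: "wt (Suc n) (Suc n) ?I = 0" using assms by (intro wt_top) auto
  have "(\<Prod>a=1..n. l_fung l (Suc n) ?I t (Suc (card I)) a) = (\<Prod>a=1..n. t (Suc (card I)) - zz a + yy)"
    by (rule prod.cong) (simp_all add: l_fung_def Let_def s)
  then have 2: "(\<Prod>a=1..Suc n. l_fung l (Suc n) ?I t (Suc (card I)) a)
      = (\<Prod>a=1..n. t (Suc (card I)) - zz a + yy) * (l + t (Suc (card I)) - zz (Suc n))"
    by (simp add: l_fung_def Let_def s w)
  have "(\<Prod>r=1..card ?I. \<Prod>a=1..Suc n. l_fung l (Suc n) ?I t r a)
     = (\<Prod>r=1..card I. (\<Prod>a=1..n. l_fung (l - yy) n I t r a) * (t r - zz (Suc n)))
       * ((\<Prod>a=1..n. t (Suc (card I)) - zz a + yy) * (l + t (Suc (card I)) - zz (Suc n)))"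
    proof -
    have "(\<Prod>r=1..card I. \<Prod>a=1..Suc n. l_fung l (Suc n) ?I t r a) = (\<Prod>r=1..card I. (\<Prod>a=1..n. l_fung (l - yy) n I t r a) * (t r - zz (Suc n)))"
      by (rule prod.cong[OF refl 1])
    moreover have "(\<Prod>r=1..Suc (card I). f r) = (\<Prod>r=1..card I. f r) * f (Suc (card I))" for f :: "nat \<Rightarrow> ratf" by simp
    ultimately show ?thesis unfolding crd 2[symmetric] by (simp only:)
  qed
  then show ?thesis unfolding W_termg_def W_head_def crd pair_prod_Suc by (simp add: prod.distrib mult_ac)
qed

lemma C_idg_notin: "I \<subseteq> {1..n} \<Longrightarrow> C_idg l (Suc n) r I = C_idg (l + yy) n r I"
proof -
  assume I: "I \<subseteq> {1..n}"
  have "wt (Suc n) i I = wt n i I - 1" if "i \<in> I" for i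
  proof -
    have "i \<le> n" "Suc n \<notin> I" "I \<subseteq> {1..Suc n}" using I that by auto
    then show ?thesis using wt_Suc[of I n i] by simp
  qed
  then show ?thesis unfolding C_idg_def by (intro prod.cong refl) (simp only:, simp add: algebra_simps)
qed

text \<open>The index n + 1 has weight 0; for r = 0 and r = 1 it contributes l and l - y, the
  denominators in \<open>top_coeff\<close>.\<close>

lemma C_idg_in: "I \<subseteq> {1..n} \<Longrightarrow> C_idg l (Suc n) r (insert (Suc n) I) = (l - of_int r * yy) * C_idg (l - yy) n r I"
proof -
  assume I: "I \<subseteq> {1..n}"
  have fin: "finite I" "Suc n \<notin> I" using I finite_subset by (blast, auto)
  have "wt (Suc n) i (insert (Suc n) I) = wt n i I + 1" if "i \<in> I" for i
  proof -
    have "i \<le> n" "insert (Suc n) I \<subseteq> {1..Suc n}" using I that by auto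
    then show ?thesis using wt_Suc[of "insert (Suc n) I" n i] fin by simp
  qed
  moreover have "wt (Suc n) (Suc n) (insert (Suc n) I) = 0" using I by (intro wt_top) auto
  ultimately show ?thesis unfolding C_idg_def using fin by (auto simp: algebra_simps intro!: prod.cong)
qed

text \<open>The single factor y comes from a = b = m, the product from the pairs with exactly one
  entry m.\<close>

lemma e_set_remove:
  assumes "finite J" "m \<in> J"
  shows "e_set J = e_set (J - {m}) * yy * (\<Prod>b\<in>J - {m}. (zz b - zz m + yy) * (zz m - zz b + yy))"
proof -
  have r: "(\<Prod>b\<in>J. f b) = f m * (\<Prod>b\<in>J - {m}. f b)" for f :: "nat \<Rightarrow> ratf" using assms by (rule prod.remove)
  show ?thesis unfolding e_set_def r[of "\<lambda>a. \<Prod>b\<in>J. zz a - zz b + yy"] r prod.distrib by (simp add: mult_ac)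
qed

lemma zz_diff_yy: "zz a - zz b + yy \<noteq> 0"
proof
  assume "zz a - zz b + yy = 0"
  then have "subst (\<lambda>v. if v = VY then 1 else 0) (zz a - zz b + yy) = 0" by simp
  then show False by (simp add: rat.subst_add rat.subst_diff)
qed

text \<open>A permutation is determined by the image b of the last element and by a permutation of
  the first k elements.\<close>

lemma sum_permutations_top:
  fixes f :: "(nat \<Rightarrow> nat) \<Rightarrow> ratf"
  shows "(\<Sum>\<pi> | \<pi> permutes {1..Suc k}. f \<pi>) = (\<Sum>b=1..Suc k. \<Sum>q | q permutes {1..k}. f (transpose (Suc k) b \<circ> q))"
proof -
  have "{1..Suc k} = insert (Suc k) {1..k}" by auto
  then show ?thesis using sum_over_permutations_insert[of "{1..k}" "Suc k" f] by simp
qed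

text \<open>The permutations are grouped by the point that is put for the last variable. This point
  is the m in the recursion of \<open>wG\<close>, and the inner sum is the weight function for n
  factors at the remaining points.\<close>

lemma W_fung_eq:
  assumes "\<And>m::int. l + of_int m * yy \<noteq> 0" "I \<subseteq> {1..n}" "inj_on e {1..card I}"
  shows "W_fung l n I (\<lambda>i. zz (e i)) = C_idg l n 0 I * C_idg l n 1 I * e_set (e ` {1..card I}) * wG zz yy n l I (e ` {1..card I})"
  using assms
proof (induction n arbitrary: l I e)
  case 0
  then have "I = {}" by simp
  moreover have "pair_prod 0 t = 1" for t unfolding pair_prod_def by (rule prod.neutral) auto
  ultimately show ?case by (simp add: W_fung_def W_termg_def C_idg_def e_set_def)
next
  case (Suc n)
  let ?N = "Suc n"
  have gp: "l + yy + of_int m * yy \<noteq> 0" "l - yy + of_int m * yy \<noteq> 0" for m :: int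
    using Suc.prems(1)[of "m + 1"] Suc.prems(1)[of "m - 1"] by (auto simp: algebra_simps)
  have l: "l \<noteq> 0" "l - yy \<noteq> 0" using Suc.prems(1)[of 0] Suc.prems(1)[of "-1"] by auto
  have fin: "finite I" using Suc.prems(2) finite_subset by blast
  show ?case
  proof (cases "?N \<in> I")
    case False
    then have I: "I \<subseteq> {1..n}" using Suc.prems(2) by (auto simp: le_Suc_eq)
    let ?J = "e ` {1..card I}"
    have t: "W_termg l ?N I (\<lambda>i. zz (e (\<pi> i))) = (\<Prod>j\<in>?J. zz j - zz ?N) * W_termg (l + yy) n I (\<lambda>i. zz (e (\<pi> i)))"
      if p: "\<pi> permutes {1..card I}" for \<pi>
    proof -
      have "(\<Prod>r=1..card I. zz (e (\<pi> r)) - zz ?N) = (\<Prod>r=1..card I. zz (e r) - zz ?N)"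
        using prod.permute[OF p, of "\<lambda>r. zz (e r) - zz ?N"] by (simp add: o_def)
      also have "\<dots> = (\<Prod>j\<in>?J. zz j - zz ?N)" using Suc.prems(3) by (simp add: prod.reindex)
      finally show ?thesis unfolding W_termg_notin[OF I] by simp
    qed
    have "W_fung l ?N I (\<lambda>i. zz (e i)) = (\<Prod>j\<in>?J. zz j - zz ?N) * W_fung (l + yy) n I (\<lambda>i. zz (e i))"
    proof -
      have "(\<Sum>\<pi> | \<pi> permutes {1..card I}. W_termg l ?N I (\<lambda>i. zz (e (\<pi> i))))
        = (\<Sum>\<pi> | \<pi> permutes {1..card I}. (\<Prod>j\<in>?J. zz j - zz ?N) * W_termg (l + yy) n I (\<lambda>i. zz (e (\<pi> i))))"
        by (rule sum.cong[OF refl]) (simp add: t)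
      also have "\<dots> = (\<Prod>j\<in>?J. zz j - zz ?N) * (\<Sum>\<pi> | \<pi> permutes {1..card I}. W_termg (l + yy) n I (\<lambda>i. zz (e (\<pi> i))))"
        by (rule sum_distrib_left[symmetric])
      finally show ?thesis unfolding W_fung_def by (simp only: mult.left_commute)
    qed
    then show ?thesis using False by (simp add: Suc.IH[OF gp(1) I Suc.prems(3)] C_idg_notin[OF I])
  next
    case True
    define I' where "I' = I - {?N}"
    have I': "I' \<subseteq> {1..n}" using Suc.prems(2) by (auto simp: I'_def le_Suc_eq)
    have II: "I = insert ?N I'" "?N \<notin> I'" "finite I'" using True fin by (auto simp: I'_def)
    let ?k = "card I'"
    have crd: "card I = Suc ?k" using II by simp
    let ?J = "e ` {1..Suc ?k}"
    have inj: "inj_on e {1..Suc ?k}" using Suc.prems(3) crd by simp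
    \<comment> \<open>Exchanging the last position with b puts the point of \<open>e b\<close> for
      the last variable, while the first positions run through the other points.\<close>
    let ?e = "\<lambda>b i. e (transpose (Suc ?k) b i)"
    \<comment> \<open>Of the products \<open>B\<close> and \<open>B'\<close> that come from
      \<open>e_set_remove\<close>, \<open>B\<close> cancels the numerators of the pairs with the
      last variable and \<open>B'\<close> stays as a denominator of \<open>top_coeff\<close>. The
      single y there matches the additional power of y in W.\<close>
    have b1: "W_head l n ?k (\<lambda>i. zz (?e b i)) * W_fung (l - yy) n I' (\<lambda>i. zz (?e b i)) * yy
       = C_idg l ?N 0 I * C_idg l ?N 1 I * e_set ?J * (top_coeff zz yy n l ?J (e b) * wG zz yy n (l - yy) I' (?J - {e b}))"
      if b: "b \<in> {1..Suc ?k}" for b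
    proof -
      have tr: "transpose (Suc ?k) b permutes {1..Suc ?k}" by (rule permutes_swap_id) (use b in auto)
      have inje: "inj_on (?e b) {1..Suc ?k}"
      proof -
        have "inj_on (e \<circ> transpose (Suc ?k) b) {1..Suc ?k}"
          by (rule comp_inj_on[OF permutes_inj_on[OF tr]]) (simp only: permutes_image[OF tr] inj)
        then show ?thesis by (simp add: o_def)
      qed
      have im: "?e b ` {1..Suc ?k} = ?J" using permutes_image[OF tr] by (metis image_image)
      have top: "?e b (Suc ?k) = e b" by simp
      have un: "{1..Suc ?k} = insert (Suc ?k) {1..?k}" by auto
      have imk: "?e b ` {1..?k} = ?J - {e b}"
      proof -
        have "?e b (Suc ?k) \<notin> ?e b ` {1..?k}"
          by (subst inj_on_image_mem_iff[OF inje]) auto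
        moreover have "?J = insert (?e b (Suc ?k)) (?e b ` {1..?k})"
          unfolding im[symmetric] by (subst un) (rule image_insert)
        ultimately have "?e b ` {1..?k} = ?J - {?e b (Suc ?k)}" by blast
        then show ?thesis unfolding top .
      qed
      have injk: "inj_on (?e b) {1..?k}" by (rule inj_on_subset[OF inje]) auto
      have fJ: "finite ?J" "e b \<in> ?J" using b by auto
      let ?J' = "?J - {e b}" and ?m = "e b"
      have pr: "(\<Prod>r=1..?k. f (?e b r)) = (\<Prod>j\<in>?J'. f j)" for f :: "nat \<Rightarrow> ratf"
        unfolding imk[symmetric] using injk by (simp add: prod.reindex)
      have H: "W_head l n ?k (\<lambda>i. zz (?e b i)) = (\<Prod>j\<in>?J'. zz j - zz ?N) * (\<Prod>a=1..n. zz ?m - zz a + yy) * (l + zz ?m - zz ?N)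
         * (\<Prod>j\<in>?J'. (zz j - zz ?m + yy) / (zz j - zz ?m))"
        unfolding W_head_def top pr[of "\<lambda>j. zz j - zz ?N"] pr[of "\<lambda>j. (zz j - zz ?m + yy) / (zz j - zz ?m)"] ..
      have IH: "W_fung (l - yy) n I' (\<lambda>i. zz (?e b i)) = C_idg (l - yy) n 0 I' * C_idg (l - yy) n 1 I' * e_set ?J' * wG zz yy n (l - yy) I' ?J'"
        using Suc.IH[OF gp(2) I' injk] unfolding imk .
      define A where "A = (\<Prod>j\<in>?J'. zz j - zz ?N)"
      define B where "B = (\<Prod>j\<in>?J'. zz j - zz ?m + yy)"
      define D where "D = (\<Prod>j\<in>?J'. zz j - zz ?m)"
      define B' where "B' = (\<Prod>j\<in>?J'. zz ?m - zz j + yy)"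
      define Q where "Q = (\<Prod>a=1..n. zz ?m - zz a + yy)"
      have nz: "B' \<noteq> 0" "B \<noteq> 0" "D \<noteq> 0" using fJ zz_diff_yy by (auto simp: B_def B'_def D_def)
      have c: "top_coeff zz yy n l ?J ?m = (l + zz ?m - zz ?N) / (l * (l - yy)) * Q * (A / (D * B'))"
        unfolding top_coeff_def Q_def A_def D_def B'_def by (simp add: prod_dividef prod.distrib)
      have H': "W_head l n ?k (\<lambda>i. zz (?e b i)) = A * Q * (l + zz ?m - zz ?N) * (B / D)"
        unfolding H A_def Q_def B_def D_def by (simp add: prod_dividef)
      have E: "e_set ?J = e_set ?J' * yy * (B * B')"
        unfolding e_set_remove[OF fJ] B_def B'_def by (simp add: prod.distrib)
      have C: "C_idg l ?N 0 I = l * C_idg (l - yy) n 0 I'" "C_idg l ?N 1 I = (l - yy) * C_idg (l - yy) n 1 I'"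
        unfolding II(1) C_idg_in[OF I'] by simp_all
      show ?thesis unfolding H' IH c E C using l nz by (simp add: field_simps)
    qed
    have q: "W_head l n ?k (\<lambda>i. zz (?e b (p i))) = W_head l n ?k (\<lambda>i. zz (?e b i))" if p: "p permutes {1..?k}" for b p
    proof -
      have "p (Suc ?k) = Suc ?k" using permutes_not_in[OF p, of "Suc ?k"] by simp
      moreover have "(\<Prod>r=1..?k. f (p r)) = (\<Prod>r=1..?k. f r)" for f :: "nat \<Rightarrow> ratf"
        using prod.permute[OF p, of f] by (simp add: o_def)
      note this[of "\<lambda>r. zz (?e b r) - zz ?N"] this[of "\<lambda>r. (zz (?e b r) - zz (?e b (Suc ?k)) + yy) / (zz (?e b r) - zz (?e b (Suc ?k)))"]
      ultimately show ?thesis unfolding W_head_def by simp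
    qed
    have "W_fung l ?N I (\<lambda>i. zz (e i)) = yy ^ Suc ?k * (\<Sum>b=1..Suc ?k. \<Sum>p | p permutes {1..?k}.
        W_head l n ?k (\<lambda>i. zz (?e b (p i))) * W_termg (l - yy) n I' (\<lambda>i. zz (?e b (p i))))"
    proof -
      have "W_termg l ?N I t = W_head l n ?k t * W_termg (l - yy) n I' t" for t
        by (subst II(1)) (rule W_termg_in[OF I'])
      then show ?thesis unfolding W_fung_def crd sum_permutations_top by (simp only: o_apply)
    qed
    also have "\<dots> = (\<Sum>b=1..Suc ?k. W_head l n ?k (\<lambda>i. zz (?e b i)) * W_fung (l - yy) n I' (\<lambda>i. zz (?e b i)) * yy)"
    proof -
      have r1: "(\<Sum>p | p permutes {1..?k}. W_head l n ?k (\<lambda>i. zz (?e b (p i))) * W_termg (l - yy) n I' (\<lambda>i. zz (?e b (p i))))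
         = W_head l n ?k (\<lambda>i. zz (?e b i)) * (\<Sum>p | p permutes {1..?k}. W_termg (l - yy) n I' (\<lambda>i. zz (?e b (p i))))" for b
        unfolding sum_distrib_left by (rule sum.cong[OF refl], subst q) auto
      show ?thesis unfolding W_fung_def r1 sum_distrib_left[of "yy ^ Suc ?k"]
        by (rule sum.cong[OF refl]) (simp add: mult_ac)
    qed
    also have "\<dots> = (\<Sum>b=1..Suc ?k. C_idg l ?N 0 I * C_idg l ?N 1 I * e_set ?J * (top_coeff zz yy n l ?J (e b) * wG zz yy n (l - yy) I' (?J - {e b})))"
      by (rule sum.cong[OF refl b1])
    also have "\<dots> = C_idg l ?N 0 I * C_idg l ?N 1 I * e_set ?J * (\<Sum>m\<in>?J. top_coeff zz yy n l ?J m * wG zz yy n (l - yy) I' (?J - {m}))"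
      unfolding sum_distrib_left[symmetric] using inj by (simp add: sum.reindex)
    also have "(\<Sum>m\<in>?J. top_coeff zz yy n l ?J m * wG zz yy n (l - yy) I' (?J - {m})) = wG zz yy ?N l I ?J"
      using True by (simp add: top_coeff_def I'_def)
    finally show ?thesis unfolding crd .
  qed
qed

lemma W_tilde_eq:
  assumes I: "I \<subseteq> {1..n}" and e: "bij_betw e {1..card I} J"
  shows "W_tilde n I (\<lambda>i. zz (e i)) = wG zz yy n lam I J"
proof -
  have J: "e ` {1..card I} = J" "inj_on e {1..card I}" using e by (auto simp: bij_betw_def)
  have "C_idg lam n r I \<noteq> 0" for r
  proof -
    have "lam - of_int c * yy = lam + of_int (- c) * yy" for c by simp
    then have "lam - of_int (wt n i I + r) * yy \<noteq> 0" for i using lam_int_nonzero by metis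
    then show ?thesis unfolding C_idg_def using I finite_subset[of I "{1..n}"] by simp
  qed
  moreover have "finite J" using e bij_betw_finite by blast
  then have "e_set J \<noteq> 0" unfolding e_set_def using zz_diff_yy by simp
  ultimately show ?thesis
    using W_fung_eq[of lam I n e] lam_int_nonzero I J
    by (simp add: W_tilde_def W_fun_g C_id_g e_fun_set[OF e])
qed

section \<open>Support and coefficient ring of the fixed point values\<close>

lemma wG_card: "finite J \<Longrightarrow> I \<subseteq> {1..n} \<Longrightarrow> card I \<noteq> card J \<Longrightarrow> wG z y n l I J = 0"
proof (induction n arbitrary: l I J)
  case 0 then show ?case by auto
next
  case (Suc n)
  show ?case
  proof (cases "Suc n \<in> I")
    case True
    have fin: "finite I" using Suc.prems(2) finite_subset by blast
    have s: "I - {Suc n} \<subseteq> {1..n}" using Suc.prems(2) by (auto simp: le_Suc_eq)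
    have "wG z y n (l - y) (I - {Suc n}) (J - {m}) = 0" if "m \<in> J" for m
    proof (rule Suc.IH[OF _ s])
      have "card I > 0" "card J > 0" using True fin that Suc.prems(1) by (auto simp: card_gt_0_iff)
      then show "card (I - {Suc n}) \<noteq> card (J - {m})" using True fin that Suc.prems by simp
    qed (use Suc.prems in auto)
    then show ?thesis using True by (simp cong: sum.cong)
  next
    case False
    then have s: "I \<subseteq> {1..n}" using Suc.prems(2) by (auto simp: le_Suc_eq)
    show ?thesis using False Suc.IH[OF Suc.prems(1) s Suc.prems(3)] by simp
  qed
qed

text \<open>The ring is that of n + 1 + p points: an induction on the number of factors has to stay
  in the coefficient ring of the full number of points, and p counts those already split
  off.\<close>

lemma top_coeff_L:
  assumes "J \<subseteq> {1..Suc n}" "m \<in> J"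
  shows "top_coeff zz yy n (lam + of_int j * yy) J m \<in> L_lam_zy (Suc n + p)"
proof -
  note L = is_subring_intros[OF L_is_subring[of "Suc n + p"]]
  have z: "a \<in> {1..Suc n} \<Longrightarrow> zz a \<in> L_lam_zy (Suc n + p)" for a by (rule zz_L) auto
  have i: "a \<in> {1..Suc n} \<Longrightarrow> b \<in> {1..Suc n} \<Longrightarrow> inverse (zz a - zz b) \<in> L_lam_zy (Suc n + p)"
    "a \<in> {1..Suc n} \<Longrightarrow> b \<in> {1..Suc n} \<Longrightarrow> inverse (zz a - zz b + yy) \<in> L_lam_zy (Suc n + p)" for a b
    by (rule inverse_L_zy, auto simp: L_zy_def intro!: is_subring_add[OF ratfuns_is_subring] is_subring_diff[OF ratfuns_is_subring] X_in_ratfuns)+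
  have il: "inverse (lam + of_int j * yy - yy) \<in> L_lam_zy (Suc n + p)"
    using inverse_lam_L[of "j - 1" "Suc n + p"] by (simp add: algebra_simps)
  show ?thesis unfolding top_coeff_def divide_inverse inverse_mult_distrib
    using assms by (intro L z i il inverse_lam_L lam_L yy_L) auto
qed

lemma wG_L:
  assumes "J \<subseteq> {1..n + p}"
  shows "wG zz yy n (lam + of_int j * yy) I J \<in> L_lam_zy (n + p)"
  using assms
proof (induction n arbitrary: j I J p)
  case 0 then show ?case by (simp add: is_subring_intros[OF L_is_subring])
next
  case (Suc n)
  have e: "lam + of_int j * yy - yy = lam + of_int (j - 1) * yy" "lam + of_int j * yy + yy = lam + of_int (j + 1) * yy"
    by (simp_all add: algebra_simps)
  note L = is_subring_intros[OF L_is_subring[of "Suc n + p"]]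
  have z: "a \<in> {1..Suc n + p} \<Longrightarrow> zz a \<in> L_lam_zy (Suc n + p)" for a by (rule zz_L)
  have i: "a \<in> {1..Suc n + p} \<Longrightarrow> b \<in> {1..Suc n + p} \<Longrightarrow> inverse (zz a - zz b) \<in> L_lam_zy (Suc n + p)"
    "a \<in> {1..Suc n + p} \<Longrightarrow> b \<in> {1..Suc n + p} \<Longrightarrow> inverse (zz a - zz b + yy) \<in> L_lam_zy (Suc n + p)" for a b
    by (rule inverse_L_zy, auto simp: L_zy_def intro!: is_subring_add[OF ratfuns_is_subring] is_subring_diff[OF ratfuns_is_subring] X_in_ratfuns)+
  have il: "inverse (lam + of_int (j - 1) * yy) \<in> L_lam_zy (Suc n + p)" by (rule inverse_lam_L)
  have IH: "wG zz yy n (lam + of_int j' * yy) I' J' \<in> L_lam_zy (Suc n + p)" if "J' \<subseteq> {1..Suc n + p}" for j' I' J'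
    using Suc.IH[of J' "Suc p"] that by simp
  have fin: "finite J" using Suc.prems finite_subset by blast
  show ?case
  proof (cases "Suc n \<in> I")
    case True
    then show ?thesis
      using Suc.prems unfolding wG.simps if_P[OF True] e divide_inverse inverse_mult_distrib
      by (intro L z i il inverse_lam_L lam_L yy_L IH) auto
  next
    case False
    then show ?thesis
      using Suc.prems unfolding wG.simps if_not_P[OF False] e
      by (intro L z IH) auto
  qed
qed

subsection \<open>The stable envelope in fixed point coordinates\<close>

lemma generic_points_ratf: "generic_points zz yy ww"
proof
  show "(2::ratf) \<noteq> 0" using of_nat_ratf_nonzero[of 1] by simp
  show "zz a \<noteq> zz b" if "a \<noteq> b" for a b using that by simp
  show "zz a - zz b + yy \<noteq> 0" for a b by (rule zz_diff_yy)
  show "ww \<noteq> zz a" for a by simp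
  show "ww - zz a \<noteq> yy" for a
  proof
    assume "ww - zz a = yy"
    then have "subst (\<lambda>v. if v = VW then 1 else 0) (ww - zz a) = subst (\<lambda>v. if v = VW then 1 else 0) yy" by simp
    then show False by (simp add: rat.subst_diff)
  qed
qed

lemma wG_shift: "shift m (wG zz yy n l I J) = wG zz yy n (shift m l) I J"
  by (induction n arbitrary: l I J)
    (simp_all add: shift_sum shift_mult shift_prod shift_divide shift_add shift_diff shift_X)

lemma wS_shift: "shift m (wS zz yy n l u J) = wS zz yy n (shift m l) (vshift m u) J"
  by (simp add: wS_def shift_sum shift_mult wG_shift vshift_def)

lemma lam_step: "lam + of_int j * yy - yy = lam + of_int (j - 1) * yy" "lam + of_int j * yy + yy = lam + of_int (j + 1) * yy"
  by (simp_all add: algebra_simps)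

lemma wS_L:
  assumes "\<And>K. u K \<in> L_lam_zy (n + p)" "J \<subseteq> {1..n + p}"
  shows "wS zz yy n (lam + of_int j * yy) u J \<in> L_lam_zy (n + p)"
  unfolding wS_def by (intro is_subring_sum[OF L_is_subring] is_subring_mult[OF L_is_subring] assms(1) wG_L[OF assms(2)])

text \<open>For m = n + 1 the numerator l + z_m - z_(n+1) is l, and the differences z_b - z_(n+1)
  cancel. What remains is a unit of the coefficient ring, which is what triangularity needs.\<close>

lemma top_coeff_top:
  assumes "J \<subseteq> {1..n}"
  shows "top_coeff zz yy n (lam + of_int j * yy) (insert (Suc n) J) (Suc n) =
    inverse (lam + of_int (j - 1) * yy) * (\<Prod>a=1..n. zz (Suc n) - zz a + yy) * inverse (\<Prod>b\<in>J. zz (Suc n) - zz b + yy)"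
proof -
  have N: "Suc n \<notin> J" using assms by auto
  have "(\<Prod>b\<in>J. (zz b - zz (Suc n)) / ((zz b - zz (Suc n)) * (zz (Suc n) - zz b + yy))) = (\<Prod>b\<in>J. inverse (zz (Suc n) - zz b + yy))"
  proof (rule prod.cong[OF refl])
    fix b assume "b \<in> J"
    then have "zz b - zz (Suc n) \<noteq> 0" using N by auto
    then show "(zz b - zz (Suc n)) / ((zz b - zz (Suc n)) * (zz (Suc n) - zz b + yy)) = inverse (zz (Suc n) - zz b + yy)"
      by (simp add: divide_inverse mult.assoc[symmetric])
  qed
  also have "\<dots> = inverse (\<Prod>b\<in>J. zz (Suc n) - zz b + yy)" using prod_inversef[of "\<lambda>b. zz (Suc n) - zz b + yy" J] by (simp add: o_def)
  finally have pr: "(\<Prod>b\<in>J. (zz b - zz (Suc n)) / ((zz b - zz (Suc n)) * (zz (Suc n) - zz b + yy)))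
    = inverse (\<Prod>b\<in>J. zz (Suc n) - zz b + yy)" .
  have "l \<noteq> 0 \<Longrightarrow> (l + c - c) / (l * d) = inverse d" for l c d :: ratf by (simp add: divide_inverse mult.assoc[symmetric])
  note hd = this[OF lam_int_nonzero[of j], of "zz (Suc n)" "lam + of_int (j - 1) * yy"]
  have D: "insert (Suc n) J - {Suc n} = J" using N by auto
  show ?thesis unfolding top_coeff_def D pr lam_step hd ..
qed

lemma wS_Suc_top:
  assumes "J \<subseteq> {1..n}"
  shows "wS zz yy (Suc n) (lam + of_int j * yy) u (insert (Suc n) J) =
    top_coeff zz yy n (lam + of_int j * yy) (insert (Suc n) J) (Suc n) * wS zz yy n (lam + of_int (j - 1) * yy) (\<lambda>K. u (insert (Suc n) K)) J"
proof -
  interpret generic_points zz yy ww by (rule generic_points_ratf)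
  have fin: "finite J" using assms finite_subset by blast
  have N: "Suc n \<notin> J" using assms by auto
  have "(\<Sum>m\<in>insert (Suc n) J. top_coeff zz yy n (lam + of_int j * yy) (insert (Suc n) J) m * wS zz yy n (lam + of_int j * yy - yy) (\<lambda>K. u (insert (Suc n) K)) (insert (Suc n) J - {m}))
    = top_coeff zz yy n (lam + of_int j * yy) (insert (Suc n) J) (Suc n) * wS zz yy n (lam + of_int j * yy - yy) (\<lambda>K. u (insert (Suc n) K)) (insert (Suc n) J - {Suc n})"
  proof -
    have "top_coeff zz yy n (lam + of_int j * yy) (insert (Suc n) J) m = 0" if "m \<in> J" for m
      using that N fin by (intro top_coeff_eq_0) auto
    then show ?thesis using fin N by simp
  qed
  moreover have "insert (Suc n) J - {Suc n} = J" using N by auto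
  moreover have "(\<Prod>j\<in>insert (Suc n) J. zz j - zz (Suc n)) = 0" using fin by simp
  ultimately show ?thesis unfolding wS_Suc lam_step by simp
qed

text \<open>At sets containing n + 1 only the components with v_1 in the last factor enter. At the
  other sets the remaining components enter with the product of the z_j - z_(n+1) as factor. Solving
  in this order divides by units only.\<close>

lemma wS_surj:
  assumes "\<And>J. J \<subseteq> {1..n} \<Longrightarrow> v J \<in> L_lam_zy (n + p)"
  shows "\<exists>u. (\<forall>K. u K \<in> L_lam_zy (n + p)) \<and> (\<forall>J. J \<subseteq> {1..n} \<longrightarrow> wS zz yy n (lam + of_int j * yy) u J = v J)"
  using assms
proof (induction n arbitrary: j v p)
  case 0
  then have "v {} \<in> L_lam_zy p" by force
  then show ?case by (intro exI[of _ "\<lambda>K. v {}"]) (simp add: wS_def)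
next
  case (Suc n)
  let ?N = "Suc n" and ?l = "lam + of_int j * yy" and ?L = "L_lam_zy (Suc n + p)"
  note L = is_subring_intros[OF L_is_subring[of "Suc n + p"]]
  have z: "a \<in> {1..?N} \<Longrightarrow> zz a \<in> ?L" for a by (rule zz_L) auto
  have i: "a \<in> {1..?N} \<Longrightarrow> b \<in> {1..?N} \<Longrightarrow> zz a - zz b \<in> L_zy (Suc n + p)"
    "a \<in> {1..?N} \<Longrightarrow> b \<in> {1..?N} \<Longrightarrow> zz a - zz b + yy \<in> L_zy (Suc n + p)" for a b
    unfolding L_zy_def by (auto intro!: is_subring_add[OF ratfuns_is_subring] is_subring_diff[OF ratfuns_is_subring] X_in_ratfuns)
  let ?c = "\<lambda>J. top_coeff zz yy n ?l (insert ?N J) ?N"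
  have c0: "?c J \<noteq> 0" and cL: "inverse (?c J) \<in> ?L" if J: "J \<subseteq> {1..n}" for J
  proof -
    have fin: "finite J" using J finite_subset by blast
    show "?c J \<noteq> 0" unfolding top_coeff_top[OF J] using lam_int_nonzero zz_diff_yy fin by (simp del: of_int_diff)
    have "inverse (?c J) = (lam + of_int (j - 1) * yy) * inverse (\<Prod>a=1..n. zz ?N - zz a + yy) * (\<Prod>b\<in>J. zz ?N - zz b + yy)"
      unfolding top_coeff_top[OF J] by (simp add: mult_ac del: of_int_diff)
    also have "\<dots> \<in> ?L"
    proof (intro L lam_L yy_L z)
      show "inverse (\<Prod>a=1..n. zz ?N - zz a + yy) \<in> ?L"
        using i(2) by (intro inverse_L_zy is_subring_prod[OF L_zy_is_subring]) auto
    qed (use J in auto)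
    finally show "inverse (?c J) \<in> ?L" .
  qed
  have s: "{1..n} \<subseteq> {1..?N}" by auto
  \<comment> \<open>Components with v_1 in the last factor, from the sets that contain n +
    1.\<close>
  obtain u1 where u1: "\<forall>K. u1 K \<in> ?L" "\<forall>J. J \<subseteq> {1..n} \<longrightarrow> wS zz yy n (lam + of_int (j - 1) * yy) u1 J = inverse (?c J) * v (insert ?N J)"
  proof -
    have "inverse (?c J) * v (insert ?N J) \<in> L_lam_zy (n + Suc p)" if "J \<subseteq> {1..n}" for J
    proof -
      have "insert ?N J \<subseteq> {1..?N}" using that by auto
      then have "inverse (?c J) * v (insert ?N J) \<in> ?L" by (intro L(4) cL[OF that] Suc.prems)
      then show ?thesis by simp
    qed
    from Suc.IH[of "\<lambda>J. inverse (?c J) * v (insert ?N J)" "Suc p" "j - 1", OF this] show ?thesis using that by auto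
  qed
  let ?P = "\<lambda>J. \<Prod>j\<in>J. zz j - zz ?N"
  let ?w = "\<lambda>J. inverse (?P J) * (v J - (\<Sum>m\<in>J. top_coeff zz yy n ?l J m * wS zz yy n (lam + of_int (j - 1) * yy) u1 (J - {m})))"
  \<comment> \<open>The other components, from the sets without n + 1, after the known part is moved
    to the other side.\<close>
  obtain u0 where u0: "\<forall>K. u0 K \<in> ?L" "\<forall>J. J \<subseteq> {1..n} \<longrightarrow> wS zz yy n (lam + of_int (j + 1) * yy) u0 J = ?w J"
  proof -
    have "?w J \<in> L_lam_zy (n + Suc p)" if J: "J \<subseteq> {1..n}" for J
    proof -
      have J': "J \<subseteq> {1..?N}" using J s by auto
      have "inverse (?P J) \<in> ?L" by (intro inverse_L_zy is_subring_prod[OF L_zy_is_subring] i) (use J in auto)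
      moreover have "top_coeff zz yy n ?l J m \<in> ?L" if "m \<in> J" for m by (rule top_coeff_L[OF J' that])
      moreover have "wS zz yy n (lam + of_int (j - 1) * yy) u1 (J - {m}) \<in> ?L" for m
      proof -
        have "J - {m} \<subseteq> {1..n + Suc p}" using J by auto
        from wS_L[OF _ this, of u1 "j - 1"] show ?thesis using u1(1) by simp
      qed
      moreover have "v J \<in> ?L" by (rule Suc.prems[OF J'])
      ultimately show ?thesis using L(3-) by (simp add: is_subring_sum[OF L_is_subring])
    qed
    from Suc.IH[of ?w "Suc p" "j + 1", OF this] show ?thesis using that by auto
  qed
  define u where "u = (\<lambda>K. if ?N \<in> K then u1 (K - {?N}) else u0 K)"
  have r: "wS zz yy n l (\<lambda>K. u (insert ?N K)) J = wS zz yy n l u1 J" "wS zz yy n l u J = wS zz yy n l u0 J" for l J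
  proof -
    have nin: "?N \<notin> K" "insert ?N K - {?N} = K" if "K \<subseteq> {1..n}" for K using that by auto
    show "wS zz yy n l (\<lambda>K. u (insert ?N K)) J = wS zz yy n l u1 J"
      by (rule wS_cong) (simp only: u_def insertI1 if_True nin(2))
    show "wS zz yy n l u J = wS zz yy n l u0 J"
      by (rule wS_cong) (simp only: u_def nin(1) if_False)
  qed
  have "wS zz yy ?N ?l u J = v J" if J: "J \<subseteq> {1..?N}" for J
  proof (cases "?N \<in> J")
    case True
    define J' where "J' = J - {?N}"
    have J': "J' \<subseteq> {1..n}" "J = insert ?N J'" using J True by (auto simp: J'_def le_Suc_eq)
    show ?thesis unfolding J'(2) wS_Suc_top[OF J'(1)] r using u1(2) J'(1) c0[OF J'(1)] by simp
  next
    case False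
    then have J': "J \<subseteq> {1..n}" using J by (auto simp: le_Suc_eq)
    have fin: "finite J" using J finite_subset by blast
    have "?P J \<noteq> 0" using False fin by auto
    then show ?thesis unfolding wS_Suc lam_step r using u0(2) J' by (simp add: field_simps del: of_int_diff of_int_add)
  qed
  then show ?case using u0(1) u1(1) by (intro exI[of _ u]) (auto simp: u_def)
qed

lemma wS_inj:
  assumes "\<And>J. J \<subseteq> {1..n} \<Longrightarrow> wS zz yy n (lam + of_int j * yy) u J = 0" "K \<subseteq> {1..n}"
  shows "u K = 0"
  using assms
proof (induction n arbitrary: j u K)
  case 0
  then show ?case using "0.prems"(1)[of "{}"] by (simp add: wS_def)
next
  case (Suc n)
  let ?N = "Suc n" and ?l = "lam + of_int j * yy"
  have u1: "u (insert ?N K) = 0" if "K \<subseteq> {1..n}" for K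
  proof (rule Suc.IH[of "j - 1" "\<lambda>K. u (insert ?N K)", OF _ that])
    fix J assume J: "J \<subseteq> {1..n}"
    then have "insert ?N J \<subseteq> {1..?N}" by auto
    then have "wS zz yy ?N ?l u (insert ?N J) = 0" by (rule Suc.prems(1))
    moreover have "top_coeff zz yy n ?l (insert ?N J) ?N \<noteq> 0"
      unfolding top_coeff_top[OF J] using lam_int_nonzero zz_diff_yy finite_subset[OF J] by (simp del: of_int_diff)
    ultimately show "wS zz yy n (lam + of_int (j - 1) * yy) (\<lambda>K. u (insert ?N K)) J = 0"
      unfolding wS_Suc_top[OF J] by simp
  qed
  have u0: "u K = 0" if "K \<subseteq> {1..n}" for K
  proof (rule Suc.IH[of "j + 1" u, OF _ that])
    fix J assume J: "J \<subseteq> {1..n}"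
    then have J': "J \<subseteq> {1..?N}" and N: "?N \<notin> J" and fin: "finite J" by (auto intro: finite_subset)
    have "wS zz yy n l (\<lambda>K. u (insert ?N K)) J' = wS zz yy n l (\<lambda>K. 0) J'" for l J'
      using u1 by (intro wS_cong)
    then have "wS zz yy ?N ?l u J = (\<Prod>j\<in>J. zz j - zz ?N) * wS zz yy n (lam + of_int (j + 1) * yy) u J"
      unfolding wS_Suc lam_step by (simp add: wS_def)
    then show "wS zz yy n (lam + of_int (j + 1) * yy) u J = 0" using Suc.prems(1)[OF J'] N fin by auto
  qed
  show ?case
  proof (cases "?N \<in> K")
    case True
    then have "K - {?N} \<subseteq> {1..n}" "insert ?N (K - {?N}) = K" using Suc.prems(2) by (auto simp: le_Suc_eq)
    then show ?thesis using u1[of "K - {?N}"] by simp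
  next
    case False
    then have "K \<subseteq> {1..n}" using Suc.prems(2) by (auto simp: le_Suc_eq)
    then show ?thesis by (rule u0)
  qed
qed

abbreviation fp :: "nat \<Rightarrow> vec \<Rightarrow> nat set \<Rightarrow> ratf" where
  "fp n \<zeta> J \<equiv> wS zz yy n lam \<zeta> J"

lemma fp_inj:
  assumes "\<zeta> \<in> V n" "\<eta> \<in> V n" "\<And>J. J \<subseteq> {1..n} \<Longrightarrow> fp n \<zeta> J = fp n \<eta> J"
  shows "\<zeta> = \<eta>"
proof
  fix K
  show "\<zeta> K = \<eta> K"
  proof (cases "K \<subseteq> {1..n}")
    case True
    have "wS zz yy n (lam + of_int 0 * yy) (\<lambda>K. 1 * \<zeta> K + (- 1) * \<eta> K) J = 0" if "J \<subseteq> {1..n}" for J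
      unfolding wS_linear using assms(3)[OF that] by simp
    from wS_inj[OF this True] show ?thesis by simp
  qed (use assms(1,2) in \<open>simp add: V_def\<close>)
qed

lemma fp_surj:
  assumes "\<And>J. J \<subseteq> {1..n} \<Longrightarrow> v J \<in> L_lam_zy n"
  obtains \<zeta> where "\<zeta> \<in> V n" "\<And>J. J \<subseteq> {1..n} \<Longrightarrow> fp n \<zeta> J = v J"
proof -
  obtain u where u: "\<forall>K. u K \<in> L_lam_zy n" "\<forall>J. J \<subseteq> {1..n} \<longrightarrow> wS zz yy n (lam + of_int 0 * yy) u J = v J"
    using wS_surj[of n v 0 0] assms by auto
  let ?z = "\<lambda>K. if K \<subseteq> {1..n} then u K else 0"
  have "?z \<in> V n" using u(1) is_subring_0[OF L_is_subring] by (auto simp: V_def)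
  moreover have "fp n ?z J = fp n u J" for J by (rule wS_cong) auto
  ultimately show thesis using that[of ?z] u(2) by auto
qed

lemma fp_L: "\<zeta> \<in> V n \<Longrightarrow> J \<subseteq> {1..n} \<Longrightarrow> fp n \<zeta> J \<in> L_lam_zy n"
  using wS_L[of \<zeta> n 0 J 0] by (simp add: V_def)

lemma V_partD: "\<zeta> \<in> V_part n k \<Longrightarrow> \<zeta> \<in> V n" by (simp add: V_part_def)

lemma fp_V_part:
  assumes "\<zeta> \<in> V_part n k" "J \<subseteq> {1..n}" "J \<notin> subsets_k n k"
  shows "fp n \<zeta> J = 0"
  unfolding wS_def
proof (intro sum.neutral ballI)
  fix K assume K: "K \<in> Pow {1..n}"
  show "\<zeta> K * wG zz yy n lam K J = 0"
  proof (cases "K \<in> subsets_k n k")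
    case True
    then have "card K \<noteq> card J" using assms(2,3) by (auto simp: subsets_k_def)
    then show ?thesis using wG_card[of J K n zz yy lam] K assms(2) finite_subset[of J "{1..n}"] by simp
  qed (use assms(1) in \<open>simp add: V_part_def\<close>)
qed

text \<open>The part of the vector outside size k has no coordinates at sets of size k by
  \<open>wG_card\<close>, and none elsewhere by hypothesis, so it vanishes by
  \<open>wS_inj\<close>.\<close>

lemma V_partI:
  assumes \<zeta>: "\<zeta> \<in> V n" and 0: "\<And>J. J \<subseteq> {1..n} \<Longrightarrow> J \<notin> subsets_k n k \<Longrightarrow> fp n \<zeta> J = 0"
  shows "\<zeta> \<in> V_part n k"
proof -
  let ?u = "\<lambda>K. if K \<in> subsets_k n k then 0 else \<zeta> K"
  have "wS zz yy n (lam + of_int 0 * yy) ?u J = 0" if J: "J \<subseteq> {1..n}" for J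
  proof (cases "J \<in> subsets_k n k")
    case True
    have "?u K * wG zz yy n lam K J = 0" if "K \<in> Pow {1..n}" for K
    proof (cases "K \<in> subsets_k n k")
      case False
      then have "card K \<noteq> card J" using True that by (auto simp: subsets_k_def)
      then show ?thesis using wG_card[of J K n zz yy lam] that J finite_subset[of J "{1..n}"] by simp
    qed simp
    then show ?thesis unfolding wS_def by (simp add: sum.neutral)
  next
    case False
    have "?u K * wG zz yy n lam K J = \<zeta> K * wG zz yy n lam K J" if "K \<in> Pow {1..n}" for K
    proof (cases "K \<in> subsets_k n k")
      case True
      then have "card K \<noteq> card J" using False J by (auto simp: subsets_k_def)
      then show ?thesis using wG_card[of J K n zz yy lam] that J finite_subset[of J "{1..n}"] by simp
    qed simp
    then have "fp n ?u J = fp n \<zeta> J" unfolding wS_def by (rule sum.cong[OF refl])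
    then show ?thesis using 0[OF J False] by simp
  qed
  then have z: "?u K = 0" if "K \<subseteq> {1..n}" for K using wS_inj[OF _ that, of 0 ?u] by blast
  have "\<zeta> K = 0" if "K \<notin> subsets_k n k" for K
    using z[of K] that \<zeta> by (cases "K \<subseteq> {1..n}") (auto simp: V_def)
  then show ?thesis using \<zeta> by (simp add: V_part_def)
qed

lemma fp_inj_part:
  assumes "\<zeta> \<in> V_part n k" "\<eta> \<in> V_part n k" "\<And>J. J \<in> subsets_k n k \<Longrightarrow> fp n \<zeta> J = fp n \<eta> J"
  shows "\<zeta> = \<eta>"
  using assms fp_V_part by (intro fp_inj[of _ n]) (metis V_partD)+

lemma fp_surj_part:
  assumes "\<And>J. J \<in> subsets_k n k \<Longrightarrow> v J \<in> L_lam_zy n"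
  obtains \<zeta> where "\<zeta> \<in> V_part n k" "\<And>J. J \<in> subsets_k n k \<Longrightarrow> fp n \<zeta> J = v J"
proof -
  let ?v = "\<lambda>J. if J \<in> subsets_k n k then v J else 0"
  have "?v J \<in> L_lam_zy n" for J using assms is_subring_0[OF L_is_subring] by auto
  then obtain \<zeta> where z: "\<zeta> \<in> V n" "\<And>J. J \<subseteq> {1..n} \<Longrightarrow> fp n \<zeta> J = ?v J" using fp_surj[of n ?v] by metis
  show thesis
  proof (rule that)
    show "\<zeta> \<in> V_part n k" by (rule V_partI[OF z(1)]) (simp add: z(2))
    show "fp n \<zeta> J = v J" if "J \<in> subsets_k n k" for J
      using that z(2)[of J] by (auto simp: subsets_k_def)
  qed
qed

subsection \<open>The generators of the Gelfand-Zetlin algebra\<close>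

text \<open>Functions of w without a pole at infinity whose coefficients lie in the ring of the
  module; this makes the operators L_(22,s) preserve \<open>V n\<close>.\<close>

definition regular_at_infinity :: "nat \<Rightarrow> ratf set" where
  "regular_at_infinity n = {f. \<exists>g. wexp f = fps_to_fls g \<and> (\<forall>s. g $ s \<in> L_lam_zy n)}"

lemma L_wexp: "c \<in> L_lam_zy n \<Longrightarrow> wexp c = fls_const c"
  by (rule wexp_ratfuns[of _ "insert VLam (VZ ` {1..n} \<union> {VY})"]) (use L_ratfuns in auto)

lemma regular_L: "L_lam_zy n \<subseteq> regular_at_infinity n"
  unfolding regular_at_infinity_def
  by (auto simp: L_wexp is_subring_0[OF L_is_subring] intro!: exI[of _ "fps_const _"])

lemma regular_is_subring: "is_subring (regular_at_infinity n)"
proof (rule is_subringI)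
  show "1 \<in> regular_at_infinity n" "- 1 \<in> regular_at_infinity n"
    using regular_L is_subring_1[OF L_is_subring] is_subring_uminus[OF L_is_subring is_subring_1[OF L_is_subring]] by blast+
  fix a b assume "a \<in> regular_at_infinity n" "b \<in> regular_at_infinity n"
  then obtain f g where fg: "wexp a = fps_to_fls f" "\<forall>s. f $ s \<in> L_lam_zy n" "wexp b = fps_to_fls g" "\<forall>s. g $ s \<in> L_lam_zy n"
    by (auto simp: regular_at_infinity_def)
  have "wexp (a + b) = fps_to_fls (f + g)" "wexp (a * b) = fps_to_fls (f * g)"
    using fg by (simp_all add: inf.subst_add inf.subst_mult wexp_sdef fls_times_fps_to_fls)
  moreover have "\<forall>s. (f + g) $ s \<in> L_lam_zy n" "\<forall>s. (f * g) $ s \<in> L_lam_zy n"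
    using fg by (auto simp: fps_mult_nth intro!: is_subring_intros[OF L_is_subring])
  ultimately show "a + b \<in> regular_at_infinity n" "a * b \<in> regular_at_infinity n"
    unfolding regular_at_infinity_def by blast+
qed

lemma regular_winf: "f \<in> regular_at_infinity n \<Longrightarrow> winf_coeff s f \<in> L_lam_zy n"
  by (auto simp: regular_at_infinity_def winf_coeff_eq)

lemma regular_linear:
  assumes "a \<in> {1..n}"
  shows "(ww - zz a) / (ww - zz a - yy) \<in> regular_at_infinity n"
proof -
  have "wexp ((ww - zz a) / (ww - zz a - yy)) = fps_to_fls (shift_fps (zz a))"
    by (rule wexp_linear_ratio[of _ "range VZ"]) (auto intro: X_in_ratfuns)
  moreover have "shift_fps (zz a) $ s \<in> L_lam_zy n" for s
    using assms by (auto simp: shift_fps_def intro!: is_subring_intros[OF L_is_subring] yy_L zz_L)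
  ultimately show ?thesis by (auto simp: regular_at_infinity_def)
qed

lemma laxop_regular:
  assumes "\<And>K. u K \<in> L_lam_zy (n + p)"
  shows "laxop zz yy ww n (lam + of_int m * yy) i j u I \<in> regular_at_infinity (n + p)"
  using assms
proof (induction n arbitrary: m j u I p)
  case 0
  then show ?case using subsetD[OF regular_L, of "u I" p] is_subring_0[OF regular_is_subring] by simp
next
  case (Suc n)
  let ?R = "regular_at_infinity (Suc n + p)" and ?l = "lam + of_int m * yy" and ?x = "ww - zz (Suc n)"
  note R = is_subring_intros[OF regular_is_subring[of "Suc n + p"]]
  have LR: "c \<in> L_lam_zy (Suc n + p) \<Longrightarrow> c \<in> ?R" for c using regular_L by blast
  \<comment> \<open>All four entries are polynomials in this \<open>e\<close> with coefficients free
    of w, because 1 / (x - y) = (e - 1) / y.\<close>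
  define e where "e = ?x / (?x - yy)"
  have e: "e \<in> ?R" unfolding e_def by (rule regular_linear) auto
  have l: "?l \<in> ?R" "inverse ?l \<in> ?R" "yy \<in> ?R" "inverse yy \<in> ?R"
    by (rule LR, rule is_subring_add[OF L_is_subring lam_L is_subring_mult[OF L_is_subring is_subring_of_int[OF L_is_subring] yy_L]])
      (rule LR, rule inverse_lam_L yy_L subsetD[OF C_y_inv_L inverse_y_C])+
  have nz: "?l \<noteq> 0" "?x - yy \<noteq> 0" using lam_int_nonzero generic_points.wzy[OF generic_points_ratf] by auto
  have "rA yy ?l ?x = (?l + yy) * inverse ?l * e"
    "rB yy ?l ?x = - (yy * inverse ?l * (?l * (e - 1) * inverse yy + e))"
    "rC yy ?l ?x = - (yy * inverse ?l * (?l * (e - 1) * inverse yy - e))"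
    "rD yy ?l ?x = (?l - yy) * inverse ?l * e"
    using nz unfolding rA_def rB_def rC_def rD_def e_def
    by (simp_all add: divide_simps)
  then have r: "rA yy ?l ?x \<in> ?R" "rB yy ?l ?x \<in> ?R" "rC yy ?l ?x \<in> ?R" "rD yy ?l ?x \<in> ?R"
    using e l R by simp_all
  have IH: "laxop zz yy ww n (lam + of_int m' * yy) i j' u' I' \<in> ?R" if "\<And>K. u' K \<in> L_lam_zy (Suc n + p)" for m' j' u' I'
    using Suc.IH[of u' "Suc p"] that by simp
  have pm: "laxop zz yy ww n (?l - yy) i j' u I' \<in> ?R" "laxop zz yy ww n (?l + yy) i j' u I' \<in> ?R"
    "laxop zz yy ww n (?l - yy) i j' (\<lambda>K. u (insert (Suc n) K)) I' \<in> ?R"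
    "laxop zz yy ww n (?l + yy) i j' (\<lambda>K. u (insert (Suc n) K)) I' \<in> ?R" for j' I'
    unfolding lam_step by (rule IH, rule Suc.prems)+
  show ?case unfolding laxop.simps
    by (cases j; cases "Suc n \<in> I"; simp only: if_True if_False; intro R(3) R(4) r pm)
qed

lemma L22_eq: "Lt n 2 2 ww \<zeta> I = (if I \<subseteq> {1..n} then laxop zz yy ww n lam False False (vshift 1 \<zeta>) I else 0)"
  using L_op_laxop[of n False False ww "vshift 1 \<zeta>" I] by (simp add: Lt_def slot_def)

lemma winf_0 [simp]: "winf_coeff s 0 = 0"
  by (simp add: winf_coeff_eq)

lemma L22_coeff_V:
  assumes "\<zeta> \<in> V n"
  shows "L22_coeff n s \<zeta> \<in> V n"
proof -
  have "vshift 1 \<zeta> K \<in> L_lam_zy (n + 0)" for K using assms by (simp add: vshift_def V_def L_shift)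
  then have "laxop zz yy ww n (lam + of_int 0 * yy) False False (vshift 1 \<zeta>) I \<in> regular_at_infinity (n + 0)" for I
    by (rule laxop_regular)
  then show ?thesis unfolding V_def L22_coeff_def L22_eq using is_subring_0[OF L_is_subring] by (auto intro: regular_winf)
qed

lemma winf_scale:
  assumes "c \<in> L_lam_zy n"
  shows "winf_coeff s (f * c) = winf_coeff s f * c"
  unfolding winf_coeff_eq using assms by (simp add: inf.subst_mult wexp_sdef L_wexp)

lemma winf_sum: "winf_coeff s (\<Sum>i\<in>A. f i) = (\<Sum>i\<in>A. winf_coeff s (f i))"
  unfolding winf_coeff_eq by (simp add: inf.subst_sum wexp_sdef fls_nth_sum)

text \<open>Neither the weight functions at fixed points nor the shifted coordinate contain w, so
  taking a coefficient of the expansion commutes with the passage to fixed point coordinates and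
  only affects the eigenvalue.\<close>

lemma L22_coeff_fp:
  assumes \<zeta>: "\<zeta> \<in> V n" and J: "J \<subseteq> {1..n}"
  shows "fp n (L22_coeff n s \<zeta>) J = ratio_fps J zz $ s * shift 1 (fp n \<zeta> J)"
proof -
  have g: "wG zz yy n lam K J \<in> L_lam_zy n" for K using wG_L[of J n 0 0 K] J by simp
  have fpL: "shift 1 (fp n \<zeta> J) \<in> L_lam_zy n" by (intro L_shift fp_L \<zeta> J)
  have "wS zz yy n lam (laxop zz yy ww n lam False False (vshift 1 \<zeta>)) J = eigval22 zz yy ww J * wS zz yy n (lam + yy) (vshift 1 \<zeta>) J"
    by (rule generic_points.wS_laxop(1)[OF generic_points_ratf lam_int_nonzero J])
  also have "wS zz yy n (lam + yy) (vshift 1 \<zeta>) J = shift 1 (fp n \<zeta> J)"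
    by (simp add: wS_shift shift_X)
  finally have e: "(\<Sum>K\<in>Pow {1..n}. Lt n 2 2 ww \<zeta> K * wG zz yy n lam K J) = eigval22 zz yy ww J * shift 1 (fp n \<zeta> J)"
    by (simp add: wS_def L22_eq)
  have "fp n (L22_coeff n s \<zeta>) J = winf_coeff s (\<Sum>K\<in>Pow {1..n}. Lt n 2 2 ww \<zeta> K * wG zz yy n lam K J)"
    by (simp add: wS_def L22_coeff_def winf_sum winf_scale[OF g])
  also have "\<dots> = winf_coeff s (eigval22 zz yy ww J) * shift 1 (fp n \<zeta> J)"
    unfolding e by (rule winf_scale[OF fpL])
  also have "winf_coeff s (eigval22 zz yy ww J) = ratio_fps J zz $ s"
    unfolding eigval22_def by (rule winf_ratio[of _ _ "range VZ"]) (auto intro: X_in_ratfuns)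
  finally show ?thesis .
qed

text \<open>The shift in the outer operator moves the parameter of the inner one to lambda + y,
  which is the parameter that \<open>qminor\<close> uses when the outer column is 2 and the inner
  one is 1.\<close>

lemma Det_eq:
  assumes \<zeta>: "\<zeta> \<in> V n"
  shows "Det n ww \<zeta> I = (\<Prod>a=1..n. (ww - zz a + yy) / (ww - zz a)) * \<zeta> I"
proof (cases "I \<subseteq> {1..n}")
  case False
  then show ?thesis using \<zeta> L_op_laxop[of n False False] L_op_laxop[of n True False]
    by (simp add: Det_def Lt_def slot_def V_def)
next
  case True
  have s0: "vshift 1 (vshift (- 1) \<zeta>) = \<zeta>" by (simp add: vshift_def shift_shift)
  \<comment> \<open>The shift applies to the entire inner operator, coefficients and parameter
    included; on the vector it cancels the inverse shift.\<close>
  have in1: "vshift 1 (Lt n i 1 ww \<zeta>) K = laxop zz yy ww n (lam + yy) (i = 1) True \<zeta> K"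
    if "K \<subseteq> {1..n}" "i = 1 \<or> i = 2" for K i
  proof -
    have "Lt n i 1 ww \<zeta> K = laxop zz yy ww n lam (i = 1) True (vshift (- 1) \<zeta>) K"
      using that L_op_laxop[of n "i = 1" True ww "vshift (- 1) \<zeta>" K] by (auto simp: Lt_def slot_def)
    then have "vshift 1 (Lt n i 1 ww \<zeta>) K = shift 1 (laxop zz yy ww n lam (i = 1) True (vshift (- 1) \<zeta>) K)"
      by (simp add: vshift_def)
    also have "\<dots> = laxop (\<lambda>a. shift 1 (zz a)) (shift 1 yy) (shift 1 ww) n (shift 1 lam) (i = 1) True (\<lambda>K. shift 1 (vshift (- 1) \<zeta> K)) K"
      by (rule laxop_hom) (simp_all add: shift_add shift_mult shift_diff shift_divide shift_uminus)
    also have "(\<lambda>K. shift 1 (vshift (- 1) \<zeta> K)) = \<zeta>" using s0 by (simp add: vshift_def)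
    finally show ?thesis by (simp add: shift_X)
  qed
  have out: "Lt n i 2 (ww + yy) \<eta> I = laxop zz yy (ww + yy) n lam (i = 1) False (vshift 1 \<eta>) I" if "i = 1 \<or> i = 2" for i \<eta>
    using that True L_op_laxop[of n "i = 1" False "ww + yy" "vshift 1 \<eta>" I] by (auto simp: Lt_def slot_def)
  have 1: "Lt n 2 2 (ww + yy) (Lt n 1 1 ww \<zeta>) I = laxop zz yy (ww + yy) n lam False False (laxop zz yy ww n (lam + yy) True True \<zeta>) I"
  proof -
    have "Lt n 2 2 (ww + yy) (Lt n 1 1 ww \<zeta>) I = laxop zz yy (ww + yy) n lam False False (vshift 1 (Lt n 1 1 ww \<zeta>)) I"
      using out[of 2] by simp
    also have "\<dots> = laxop zz yy (ww + yy) n lam False False (laxop zz yy ww n (lam + yy) True True \<zeta>) I"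
      by (rule laxop_cong[OF _ True]) (use in1[of _ 1] in simp)
    finally show ?thesis .
  qed
  have 2: "Lt n 1 2 (ww + yy) (Lt n 2 1 ww \<zeta>) I = laxop zz yy (ww + yy) n lam True False (laxop zz yy ww n (lam + yy) False True \<zeta>) I"
  proof -
    have "Lt n 1 2 (ww + yy) (Lt n 2 1 ww \<zeta>) I = laxop zz yy (ww + yy) n lam True False (vshift 1 (Lt n 2 1 ww \<zeta>)) I"
      using out[of 1] by simp
    also have "\<dots> = laxop zz yy (ww + yy) n lam True False (laxop zz yy ww n (lam + yy) False True \<zeta>) I"
      by (rule laxop_cong[OF _ True]) (use in1[of _ 2] in simp)
    finally show ?thesis .
  qed
  have "Lt n 2 2 (ww + yy) (Lt n 1 1 ww \<zeta>) I - Lt n 1 2 (ww + yy) (Lt n 2 1 ww \<zeta>) I = qminor zz yy ww n lam False True \<zeta> I"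
    unfolding 1 2 qminor_def Let_def by simp
  also have "\<dots> = ((lam - yy * of_int (h_sum {1..n} I)) / lam) * (\<Prod>a=1..n. (ww - zz a + yy) / (ww - zz a)) * \<zeta> I"
    by (subst qminor_eq[OF _ _ lam_int_nonzero True])
      (simp_all add: generic_points.wz[OF generic_points_ratf] generic_points.wzy[OF generic_points_ratf])
  finally have q: "Lt n 2 2 (ww + yy) (Lt n 1 1 ww \<zeta>) I - Lt n 1 2 (ww + yy) (Lt n 2 1 ww \<zeta>) I
    = ((lam - yy * of_int (h_sum {1..n} I)) / lam) * (\<Prod>a=1..n. (ww - zz a + yy) / (ww - zz a)) * \<zeta> I" .
  have "lam - yy * of_int (h_sum {1..n} I) = lam + of_int (- h_sum {1..n} I) * yy" by simp
  then have "lam - yy * of_int (h_sum {1..n} I) \<noteq> 0" using lam_int_nonzero by metis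
  then show ?thesis unfolding Det_def q by simp
qed

lemma Det_coeff_eq: "\<zeta> \<in> V n \<Longrightarrow> Det_coeff n s \<zeta> = (\<lambda>I. b_coeff n s * \<zeta> I)"
  unfolding Det_coeff_def b_coeff_def by (rule ext) (simp add: Det_eq winf_scale[of _ n] V_def)

lemma b_coeff_L: "b_coeff n s \<in> L_lam_zy n"
  unfolding b_coeff_eq
  by (intro ratio_fps_mem[OF L_is_subring yy_L] is_subring_diff[OF L_is_subring] zz_L yy_L)

lemma L22_0_fp: "\<zeta> \<in> V n \<Longrightarrow> J \<subseteq> {1..n} \<Longrightarrow> fp n (L22_coeff n 0 \<zeta>) J = shift 1 (fp n \<zeta> J)"
  using L22_coeff_fp[of \<zeta> n J 0] by simp

text \<open>The expansion of the eigenvalue starts with 1, so in fixed point coordinates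
  \<open>L22_coeff n 0\<close> is the shift itself.\<close>

lemma L22_inv:
  assumes \<zeta>: "\<zeta> \<in> V n"
  shows "inv_into (V n) (L22_coeff n 0) \<zeta> \<in> V n"
    "J \<subseteq> {1..n} \<Longrightarrow> fp n (inv_into (V n) (L22_coeff n 0) \<zeta>) J = shift (- 1) (fp n \<zeta> J)"
proof -
  obtain \<eta> where \<eta>: "\<eta> \<in> V n" "\<And>J. J \<subseteq> {1..n} \<Longrightarrow> fp n \<eta> J = shift (- 1) (fp n \<zeta> J)"
    using fp_surj[of n "\<lambda>J. shift (- 1) (fp n \<zeta> J)"] L_shift fp_L[OF \<zeta>] by metis
  have "L22_coeff n 0 \<eta> = \<zeta>"
    by (rule fp_inj[OF L22_coeff_V[OF \<eta>(1)] \<zeta>]) (simp add: L22_0_fp \<eta> shift_shift)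
  moreover have "inj_on (L22_coeff n 0) (V n)"
  proof (rule inj_onI)
    fix a b assume ab: "a \<in> V n" "b \<in> V n" "L22_coeff n 0 a = L22_coeff n 0 b"
    have "fp n a J = fp n b J" if "J \<subseteq> {1..n}" for J
    proof -
      have "shift 1 (fp n a J) = shift 1 (fp n b J)" using L22_0_fp[OF ab(1) that] L22_0_fp[OF ab(2) that] ab(3) by simp
      then have "shift (- 1) (shift 1 (fp n a J)) = shift (- 1) (shift 1 (fp n b J))" by simp
      then show ?thesis by (simp add: shift_shift)
    qed
    then show "a = b" by (rule fp_inj[OF ab(1,2)])
  qed
  ultimately have "inv_into (V n) (L22_coeff n 0) \<zeta> = \<eta>" using \<eta>(1) by (metis inv_into_f_f)
  then show "inv_into (V n) (L22_coeff n 0) \<zeta> \<in> V n"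
    "J \<subseteq> {1..n} \<Longrightarrow> fp n (inv_into (V n) (L22_coeff n 0) \<zeta>) J = shift (- 1) (fp n \<zeta> J)"
    using \<eta> by simp_all
qed

subsection \<open>Laurent polynomials in the shift acting on fixed point values\<close>

text \<open>The effect on the value at x_J alone: neither multiplication by classes nor the shift
  mixes different fixed points.\<close>

definition act :: "nat \<Rightarrow> nat \<Rightarrow> (int \<Rightarrow> ratf set) \<Rightarrow> nat set \<Rightarrow> ratf \<Rightarrow> ratf" where
  "act n k a J x = (\<Sum>m | a m \<noteq> \<zero>\<^bsub>A_alg n k\<^esub>. A_val n k J (a m) * shift m x)"

lemma of_int_ratf_eq_0 [simp]: "of_int l = (0::ratf) \<longleftrightarrow> l = 0"
  by (cases l rule: int_cases2) simp_all

text \<open>By linearity \<open>lam ^ j\<close> may be replaced by any polynomial in \<open>lam\<close> whose coefficients are not shifted;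
  one that vanishes at \<open>lam + m * yy\<close> for all \<open>m \<noteq> m0\<close> isolates \<open>c m0\<close>.\<close>

lemma shift_independent:
  assumes M: "finite M" and z: "\<And>j. (\<Sum>m\<in>M. c m * shift m (lam ^ j)) = 0" and m0: "m0 \<in> M"
  shows "c m0 = 0"
proof -
  have pz: "(\<Sum>m\<in>M. c m * poly P (lam + of_int m * yy)) = 0" for P
  proof -
    have "(\<Sum>m\<in>M. c m * poly P (lam + of_int m * yy))
      = (\<Sum>m\<in>M. \<Sum>j\<le>degree P. poly.coeff P j * (c m * shift m (lam ^ j)))"
      by (rule sum.cong[OF refl]) (simp add: poly_altdef sum_distrib_left shift_power shift_X mult_ac)
    also have "\<dots> = (\<Sum>j\<le>degree P. poly.coeff P j * (\<Sum>m\<in>M. c m * shift m (lam ^ j)))"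
      by (subst sum.swap) (simp add: sum_distrib_left)
    finally show ?thesis by (simp add: z)
  qed
  let ?P = "\<Prod>m\<in>M - {m0}. [:- (lam + of_int m * yy), 1:]"
  have p: "poly ?P (lam + of_int m' * yy) = (\<Prod>m\<in>M - {m0}. of_int (m' - m) * yy)" for m'
    unfolding poly_prod by (rule prod.cong[OF refl]) (simp add: algebra_simps)
  have "poly ?P (lam + of_int m * yy) = 0" if "m \<in> M - {m0}" for m
    unfolding p by (rule prod_zero) (use M that in auto)
  then have "(\<Sum>m\<in>M. c m * poly ?P (lam + of_int m * yy)) = c m0 * poly ?P (lam + of_int m0 * yy)"
    by (subst sum.remove[OF M m0]) (simp add: sum.neutral)
  moreover have "poly ?P (lam + of_int m0 * yy) \<noteq> 0" unfolding p using M
    by (auto simp del: of_int_diff)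
  ultimately show ?thesis using pz[of ?P] by simp
qed

context
  fixes n k :: nat
  assumes n1: "1 \<le> n" and kn: "k \<le> n"
begin

lemma finite_subsets_k: "finite (subsets_k n k)"
  by (rule finite_subset[of _ "Pow {1..n}"]) (auto simp: subsets_k_def)

lemma subsets_k_sub: "J \<in> subsets_k n k \<Longrightarrow> J \<subseteq> {1..n}"
  by (simp add: subsets_k_def)

lemmas A_val_ops' = A_val_ops[OF n1 kn]

lemma A_carrier_0: "\<zero>\<^bsub>A_alg n k\<^esub> \<in> carrier (A_alg n k)" and A_carrier_1: "\<one>\<^bsub>A_alg n k\<^esub> \<in> carrier (A_alg n k)"
proof -
  interpret cring "A_alg n k" by (rule A_cring[OF n1 kn])
  show "\<zero>\<^bsub>A_alg n k\<^esub> \<in> carrier (A_alg n k)" "\<one>\<^bsub>A_alg n k\<^esub> \<in> carrier (A_alg n k)" by simp_all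
qed

lemma A_val_finsum:
  assumes "finite S" "\<And>i. i \<in> S \<Longrightarrow> g i \<in> carrier (A_alg n k)" "J \<in> subsets_k n k"
  shows "finsum (A_alg n k) g S \<in> carrier (A_alg n k)"
    "A_val n k J (finsum (A_alg n k) g S) = (\<Sum>i\<in>S. A_val n k J (g i))"
proof -
  interpret cring "A_alg n k" by (rule A_cring[OF n1 kn])
  show "finsum (A_alg n k) g S \<in> carrier (A_alg n k)" using assms(2) by (intro finsum_closed) auto
  show "A_val n k J (finsum (A_alg n k) g S) = (\<Sum>i\<in>S. A_val n k J (g i))"
    using assms(1,2) by (induction S) (simp_all add: A_val_ops'[OF assms(3)] finsum_insert Pi_iff)
qed

lemma D_carrier: "a \<in> carrier (A_delta n k) \<longleftrightarrow> (\<forall>m. a m \<in> carrier (A_alg n k)) \<and> finite {m. a m \<noteq> \<zero>\<^bsub>A_alg n k\<^esub>}"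
  by (simp add: A_delta_def Let_def)

lemma D_ops:
  "a \<otimes>\<^bsub>A_delta n k\<^esub> b = (\<lambda>m. finsum (A_alg n k) (\<lambda>i. a i \<otimes>\<^bsub>A_alg n k\<^esub> b (m - i)) {i. a i \<noteq> \<zero>\<^bsub>A_alg n k\<^esub>})"
  "a \<oplus>\<^bsub>A_delta n k\<^esub> b = (\<lambda>m. a m \<oplus>\<^bsub>A_alg n k\<^esub> b m)"
  "c \<odot>\<^bsub>A_delta n k\<^esub> a = (\<lambda>m. A_class n k c \<otimes>\<^bsub>A_alg n k\<^esub> a m)"
  "\<one>\<^bsub>A_delta n k\<^esub> = A_delta_monom n k \<one>\<^bsub>A_alg n k\<^esub> 0"
  by (simp_all add: A_delta_def Let_def A_delta_monom_def)

lemma act_superset: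
  assumes "finite M" "{m. a m \<noteq> \<zero>\<^bsub>A_alg n k\<^esub>} \<subseteq> M" "J \<in> subsets_k n k"
  shows "act n k a J x = (\<Sum>m\<in>M. A_val n k J (a m) * shift m x)"
  unfolding act_def using assms by (intro sum.mono_neutral_left) (auto simp: A_val_ops'(3))

lemma monom_carrier: "c \<in> carrier (A_alg n k) \<Longrightarrow> A_delta_monom n k c d \<in> carrier (A_delta n k)"
  unfolding D_carrier A_delta_monom_def
  by (auto simp: A_carrier_0 intro: finite_subset[of _ "{d}"])

lemma act_monom: "J \<in> subsets_k n k \<Longrightarrow> act n k (A_delta_monom n k c d) J x = A_val n k J c * shift d x"
  by (subst act_superset[of "{d}"]) (auto simp: A_delta_monom_def)

lemma act_one: "J \<in> subsets_k n k \<Longrightarrow> act n k \<one>\<^bsub>A_delta n k\<^esub> J x = x"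
  unfolding D_ops by (simp add: act_monom A_val_ops'(4))

lemma D_one_carrier: "\<one>\<^bsub>A_delta n k\<^esub> \<in> carrier (A_delta n k)"
  unfolding D_ops by (rule monom_carrier[OF A_carrier_1])

lemma D_add:
  assumes a: "a \<in> carrier (A_delta n k)" and b: "b \<in> carrier (A_delta n k)"
  shows "a \<oplus>\<^bsub>A_delta n k\<^esub> b \<in> carrier (A_delta n k)"
    "J \<in> subsets_k n k \<Longrightarrow> act n k (a \<oplus>\<^bsub>A_delta n k\<^esub> b) J x = act n k a J x + act n k b J x"
proof -
  interpret cring "A_alg n k" by (rule A_cring[OF n1 kn])
  let ?M = "{m. a m \<noteq> \<zero>\<^bsub>A_alg n k\<^esub>} \<union> {m. b m \<noteq> \<zero>\<^bsub>A_alg n k\<^esub>}"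
  have ab: "a m \<in> carrier (A_alg n k)" "b m \<in> carrier (A_alg n k)" for m using a b by (simp_all add: D_carrier)
  have M: "finite ?M" using a b by (simp add: D_carrier)
  have s: "{m. a m \<oplus>\<^bsub>A_alg n k\<^esub> b m \<noteq> \<zero>\<^bsub>A_alg n k\<^esub>} \<subseteq> ?M" by auto
  show "a \<oplus>\<^bsub>A_delta n k\<^esub> b \<in> carrier (A_delta n k)"
    unfolding D_carrier D_ops using ab finite_subset[OF s M] by simp
  assume J: "J \<in> subsets_k n k"
  have "act n k (a \<oplus>\<^bsub>A_delta n k\<^esub> b) J x = (\<Sum>m\<in>?M. A_val n k J (a m \<oplus>\<^bsub>A_alg n k\<^esub> b m) * shift m x)"
    unfolding D_ops by (rule act_superset[OF M s J])
  also have "\<dots> = (\<Sum>m\<in>?M. A_val n k J (a m) * shift m x) + (\<Sum>m\<in>?M. A_val n k J (b m) * shift m x)"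
    by (simp add: A_val_ops'(1)[OF J ab] distrib_right sum.distrib)
  also have "\<dots> = act n k a J x + act n k b J x"
    using act_superset[OF M _ J, of a x] act_superset[OF M _ J, of b x] by auto
  finally show "act n k (a \<oplus>\<^bsub>A_delta n k\<^esub> b) J x = act n k a J x + act n k b J x" .
qed

lemma D_mult:
  assumes a: "a \<in> carrier (A_delta n k)" and b: "b \<in> carrier (A_delta n k)"
  shows "a \<otimes>\<^bsub>A_delta n k\<^esub> b \<in> carrier (A_delta n k)"
    "J \<in> subsets_k n k \<Longrightarrow> act n k (a \<otimes>\<^bsub>A_delta n k\<^esub> b) J x = act n k a J (act n k b J x)"
proof -
  interpret cring "A_alg n k" by (rule A_cring[OF n1 kn])
  let ?A = "{m. a m \<noteq> \<zero>\<^bsub>A_alg n k\<^esub>}" and ?B = "{m. b m \<noteq> \<zero>\<^bsub>A_alg n k\<^esub>}"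
  \<comment> \<open>All exponents that the product of a term of \<open>a\<close> and a term of
    \<open>b\<close> can have.\<close>
  let ?M = "(\<lambda>(i, j). i + j) ` (?A \<times> ?B)"
  let ?p = "\<lambda>m. finsum (A_alg n k) (\<lambda>i. a i \<otimes>\<^bsub>A_alg n k\<^esub> b (m - i)) ?A"
  have ab: "a m \<in> carrier (A_alg n k)" "b m \<in> carrier (A_alg n k)" for m using a b by (simp_all add: D_carrier)
  have fin: "finite ?A" "finite ?B" using a b by (simp_all add: D_carrier)
  then have M: "finite ?M" by simp
  have s: "{m. ?p m \<noteq> \<zero>\<^bsub>A_alg n k\<^esub>} \<subseteq> ?M"
  proof
    fix m assume m: "m \<in> {m. ?p m \<noteq> \<zero>\<^bsub>A_alg n k\<^esub>}"
    show "m \<in> ?M"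
    proof (rule ccontr)
      assume "m \<notin> ?M"
      then have b0: "b (m - i) = \<zero>\<^bsub>A_alg n k\<^esub>" if "i \<in> ?A" for i
        using that by (force simp: image_iff)
      have "?p m = finsum (A_alg n k) (\<lambda>i. \<zero>\<^bsub>A_alg n k\<^esub>) ?A"
        by (rule finsum_cong') (use b0 ab in auto)
      then show False using m by simp
    qed
  qed
  have pc: "?p m \<in> carrier (A_alg n k)" for m
    by (rule finsum_closed) (use ab in auto)
  show "a \<otimes>\<^bsub>A_delta n k\<^esub> b \<in> carrier (A_delta n k)"
    unfolding D_carrier D_ops using finite_subset[OF s M] pc by simp
  assume J: "J \<in> subsets_k n k"
  let ?v = "A_val n k J"
  have v0: "?v \<zero>\<^bsub>A_alg n k\<^esub> = 0" by (rule A_val_ops'(3)[OF J])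
  \<comment> \<open>Reindexed by m = i + j; the shift of order i passes over the values of the
    \<open>b j\<close>, which are free of lambda.\<close>
  have inner: "(\<Sum>m\<in>?M. ?v (b (m - i)) * shift m x) = shift i (act n k b J x)" if i: "i \<in> ?A" for i
  proof -
    have "(\<Sum>m\<in>?M. ?v (b (m - i)) * shift m x) = (\<Sum>m\<in>(+) i ` ?B. ?v (b (m - i)) * shift m x)"
    proof (rule sum.mono_neutral_right[OF M])
      show "(+) i ` ?B \<subseteq> ?M" using i by auto
      show "\<forall>m\<in>?M - (+) i ` ?B. ?v (b (m - i)) * shift m x = 0"
      proof
        fix m assume m: "m \<in> ?M - (+) i ` ?B"
        have "m - i \<notin> ?B"
        proof
          assume "m - i \<in> ?B"
          then have "i + (m - i) \<in> (+) i ` ?B" by (rule imageI)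
          then show False using DiffD2[OF m] by simp
        qed
        then show "?v (b (m - i)) * shift m x = 0" by (simp add: v0)
      qed
    qed
    also have "\<dots> = (\<Sum>j\<in>?B. ?v (b j) * shift (i + j) x)"
      by (subst sum.reindex) (simp_all add: o_def)
    also have "\<dots> = shift i (act n k b J x)"
      unfolding act_def shift_sum shift_mult by (simp add: A_val_shift[OF n1 kn ab(2) J] shift_shift)
    finally show ?thesis .
  qed
  have "act n k (a \<otimes>\<^bsub>A_delta n k\<^esub> b) J x = (\<Sum>m\<in>?M. ?v (?p m) * shift m x)"
    unfolding D_ops by (rule act_superset[OF M s J])
  also have "\<dots> = (\<Sum>m\<in>?M. \<Sum>i\<in>?A. ?v (a i) * (?v (b (m - i)) * shift m x))"
    by (rule sum.cong[OF refl], subst A_val_finsum(2)[OF fin(1) _ J])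
      (simp_all add: ab A_val_ops'(2)[OF J ab(1) ab(2)] sum_distrib_right mult.assoc)
  also have "\<dots> = (\<Sum>i\<in>?A. ?v (a i) * (\<Sum>m\<in>?M. ?v (b (m - i)) * shift m x))"
    by (subst sum.swap) (simp add: sum_distrib_left)
  also have "\<dots> = (\<Sum>i\<in>?A. ?v (a i) * shift i (act n k b J x))"
    by (rule sum.cong[OF refl]) (simp only: inner)
  finally show "act n k (a \<otimes>\<^bsub>A_delta n k\<^esub> b) J x = act n k a J (act n k b J x)"
    unfolding act_def[of n k a] .
qed

lemma fixed_C: "c \<in> C_y_inv \<Longrightarrow> subst (fixed_pt n J) c = c"
  by (rule fixed_pt_L[OF n1 kn]) (rule subsetD[OF C_y_inv_L])

lemma D_smult:
  assumes a: "a \<in> carrier (A_delta n k)" and c: "c \<in> C_y_inv"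
  shows "c \<odot>\<^bsub>A_delta n k\<^esub> a \<in> carrier (A_delta n k)"
    "J \<in> subsets_k n k \<Longrightarrow> act n k (c \<odot>\<^bsub>A_delta n k\<^esub> a) J x = c * act n k a J x"
proof -
  interpret cring "A_alg n k" by (rule A_cring[OF n1 kn])
  let ?A = "{m. a m \<noteq> \<zero>\<^bsub>A_alg n k\<^esub>}"
  have ac: "a m \<in> carrier (A_alg n k)" for m using a by (simp add: D_carrier)
  have cA: "A_class n k c \<in> carrier (A_alg n k)" by (intro A_class_carrier[OF n1 kn] C_AR c)
  have fin: "finite ?A" using a by (simp add: D_carrier)
  have s: "{m. A_class n k c \<otimes>\<^bsub>A_alg n k\<^esub> a m \<noteq> \<zero>\<^bsub>A_alg n k\<^esub>} \<subseteq> ?A"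
  proof (rule Collect_mono, rule impI, rule notI)
    fix m assume "a m = \<zero>\<^bsub>A_alg n k\<^esub>" "A_class n k c \<otimes>\<^bsub>A_alg n k\<^esub> a m \<noteq> \<zero>\<^bsub>A_alg n k\<^esub>"
    then show False by (simp only: r_null[OF cA])
  qed
  show "c \<odot>\<^bsub>A_delta n k\<^esub> a \<in> carrier (A_delta n k)"
    unfolding D_carrier D_ops using ac cA finite_subset[OF s fin] by simp
  assume J: "J \<in> subsets_k n k"
  have "A_val n k J (A_class n k c) = c"
    by (simp add: A_val_class[OF n1 kn C_AR[OF c] J] fixed_C[OF c])
  then have "(\<Sum>m\<in>?A. A_val n k J (A_class n k c \<otimes>\<^bsub>A_alg n k\<^esub> a m) * shift m x) = c * act n k a J x"
    unfolding act_def by (simp add: A_val_ops'(2)[OF J cA ac] sum_distrib_left mult.assoc)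
  then show "act n k (c \<odot>\<^bsub>A_delta n k\<^esub> a) J x = c * act n k a J x"
    unfolding D_ops act_superset[OF fin s J] .
qed

text \<open>With powers of lambda as test functions each coefficient is isolated, and its value at
  one fixed point determines an element of A_k.\<close>

lemma act_inject:
  assumes a: "a \<in> carrier (A_delta n k)" and b: "b \<in> carrier (A_delta n k)" and J: "J \<in> subsets_k n k"
    and eq: "\<And>x. x \<in> L_lam_zy n \<Longrightarrow> act n k a J x = act n k b J x"
  shows "a = b"
proof
  fix m
  let ?M = "insert m ({m. a m \<noteq> \<zero>\<^bsub>A_alg n k\<^esub>} \<union> {m. b m \<noteq> \<zero>\<^bsub>A_alg n k\<^esub>})"
  have M: "finite ?M" using a b by (simp add: D_carrier)
  have "A_val n k J (a m) - A_val n k J (b m) = 0"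
  proof (rule shift_independent[OF M])
    fix j
    have "act n k a J (lam ^ j) = act n k b J (lam ^ j)"
      by (intro eq is_subring_power[OF L_is_subring] lam_L)
    moreover have "act n k a J (lam ^ j) = (\<Sum>m\<in>?M. A_val n k J (a m) * shift m (lam ^ j))"
      "act n k b J (lam ^ j) = (\<Sum>m\<in>?M. A_val n k J (b m) * shift m (lam ^ j))"
      by (rule act_superset[OF M _ J]; auto)+
    ultimately show "(\<Sum>m\<in>?M. (A_val n k J (a m) - A_val n k J (b m)) * shift m (lam ^ j)) = 0"
      by (simp add: left_diff_distrib sum_subtractf)
  qed simp
  then show "a m = b m" using a b by (intro A_val_inject[OF n1 kn _ _ J]) (auto simp: D_carrier)
qed

lemma A_delta_act:
  assumes a: "a \<in> carrier (A_delta n k)" and c: "c \<in> carrier (HT_L n k)"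
  shows "A_delta_act n k a c \<in> carrier (HT_L n k)"
    "J \<in> subsets_k n k \<Longrightarrow> restr n J (A_delta_act n k a c) = act n k a J (restr n J c)"
proof -
  interpret cring "HT_L n k" by (rule HT_cring[OF n1 kn])
  let ?M = "{m. a m \<noteq> \<zero>\<^bsub>A_alg n k\<^esub>}"
  have ac: "a m \<in> carrier (A_alg n k)" for m using a by (simp add: D_carrier)
  have fin: "finite ?M" using a by (simp add: D_carrier)
  note carr = A_to_HT_carrier[OF n1 kn ac] HT_shift_carrier[OF n1 kn c]
  show "A_delta_act n k a c \<in> carrier (HT_L n k)"
    unfolding A_delta_act_def by (rule finsum_closed) (use carr in auto)
  assume J: "J \<in> subsets_k n k"
  show "restr n J (A_delta_act n k a c) = act n k a J (restr n J c)"
    unfolding A_delta_act_def act_def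
    by (subst restr_finsum[OF n1 kn fin _ J])
      (simp_all add: carr restr_mult[OF n1 kn carr J] restr_shift[OF n1 kn c J] A_val_def[OF n1 kn])
qed

subsection \<open>The stable envelope\<close>

text \<open>Interpolation provides the class, and the fixed point values determine it, so the
  definite description in \<open>kappa\<close> is met.\<close>

lemma kappa_restr:
  assumes I: "I \<in> subsets_k n k"
  shows "kappa n k I \<in> carrier (HT_L n k)"
    "J \<in> subsets_k n k \<Longrightarrow> restr n J (kappa n k I) = wG zz yy n lam I J"
proof -
  have W: "W_tilde n I (\<lambda>i. zz (sorted_list_of_set J ! (i - 1))) = wG zz yy n lam I J" if "J \<in> subsets_k n k" for J
    using I enum_J[OF n1 kn that] by (intro W_tilde_eq) (auto simp: subsets_k_def)
  have "wG zz yy n lam I J \<in> L_lam_zy n" if "J \<in> subsets_k n k" for J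
    using wG_L[of J n 0 0 I] subsets_k_sub[OF that] by simp
  then obtain c where c: "c \<in> carrier (HT_L n k)" "\<And>J. J \<in> subsets_k n k \<Longrightarrow> restr n J c = wG zz yy n lam I J"
    using HT_interpolation[OF n1 kn, of "\<lambda>J. wG zz yy n lam I J"] by blast
  have "kappa n k I = c" unfolding kappa_def
  proof (rule the_equality)
    show "c \<in> carrier (HT_L n k) \<and> (\<forall>J\<in>subsets_k n k. restr n J c = W_tilde n I (\<lambda>i. zz (sorted_list_of_set J ! (i - 1))))"
      using c W by simp
    fix d
    assume d: "d \<in> carrier (HT_L n k) \<and> (\<forall>J\<in>subsets_k n k. restr n J d = W_tilde n I (\<lambda>i. zz (sorted_list_of_set J ! (i - 1))))"
    then show "d = c" by (intro HT_eqI[OF n1 kn _ c(1)]) (simp_all add: c(2) W)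
  qed
  then show "kappa n k I \<in> carrier (HT_L n k)"
    "J \<in> subsets_k n k \<Longrightarrow> restr n J (kappa n k I) = wG zz yy n lam I J"
    using c by simp_all
qed

lemma Stab_restr:
  assumes \<zeta>: "\<zeta> \<in> V_part n k"
  shows "Stab n k \<zeta> \<in> carrier (HT_L n k)"
    "J \<in> subsets_k n k \<Longrightarrow> restr n J (Stab n k \<zeta>) = fp n \<zeta> J"
proof -
  interpret cring "HT_L n k" by (rule HT_cring[OF n1 kn])
  have L: "\<zeta> I \<in> L_lam_zy n" for I using \<zeta> by (simp add: V_part_def V_def)
  note cl = HT_class_carrier[OF n1 kn L_in_HR[OF n1 kn L]]
  show "Stab n k \<zeta> \<in> carrier (HT_L n k)"
    unfolding Stab_def by (rule finsum_closed) (use cl kappa_restr(1) in auto)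
  assume J: "J \<in> subsets_k n k"
  have "restr n J (Stab n k \<zeta>) = (\<Sum>I\<in>subsets_k n k. \<zeta> I * wG zz yy n lam I J)"
    unfolding Stab_def
    by (subst restr_finsum[OF n1 kn finite_subsets_k _ J])
      (auto simp: cl kappa_restr restr_mult[OF n1 kn cl _ J] J restr_class[OF n1 kn L_in_HR[OF n1 kn L] J]
        fixed_pt_L[OF n1 kn L] intro!: sum.cong)
  also have "\<dots> = fp n \<zeta> J"
    unfolding wS_def by (rule sum.mono_neutral_left) (use \<zeta> in \<open>auto simp: subsets_k_def V_part_def\<close>)
  finally show "restr n J (Stab n k \<zeta>) = fp n \<zeta> J" .
qed

lemma Stab_bij: "bij_betw (Stab n k) (V_part n k) (carrier (HT_L n k))"
proof (rule bij_betwI')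
  fix \<zeta> \<eta> assume z: "\<zeta> \<in> V_part n k" "\<eta> \<in> V_part n k"
  show "Stab n k \<zeta> = Stab n k \<eta> \<longleftrightarrow> \<zeta> = \<eta>"
    using fp_inj_part[OF z] Stab_restr(2)[OF z(1)] Stab_restr(2)[OF z(2)] by metis
next
  fix c assume c: "c \<in> carrier (HT_L n k)"
  obtain \<zeta> where z: "\<zeta> \<in> V_part n k" "\<And>J. J \<in> subsets_k n k \<Longrightarrow> fp n \<zeta> J = restr n J c"
    using fp_surj_part[of n k "\<lambda>J. restr n J c"] restr_L[OF n1 kn c] by blast
  show "\<exists>\<zeta>\<in>V_part n k. c = Stab n k \<zeta>"
    by (rule bexI[OF _ z(1)], rule HT_eqI[OF n1 kn c Stab_restr(1)[OF z(1)]]) (simp add: z(2) Stab_restr(2)[OF z(1)])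
qed (rule Stab_restr(1))

end

subsection \<open>The isomorphism\<close>

text \<open>The coordinates determine the vector, so this relation determines f on the k-part;
  operators are compared through the maps that they induce on coordinates.\<close>

definition intertwines :: "nat \<Rightarrow> nat \<Rightarrow> (vec \<Rightarrow> vec) \<Rightarrow> (nat set \<Rightarrow> ratf \<Rightarrow> ratf) \<Rightarrow> bool" where
  "intertwines n k f \<phi> \<longleftrightarrow>
     (\<forall>\<zeta>\<in>V_part n k. f \<zeta> \<in> V_part n k \<and> (\<forall>J\<in>subsets_k n k. fp n (f \<zeta>) J = \<phi> J (fp n \<zeta> J)))"

lemma V_part_sub: "V_part n k \<subseteq> V n"
  by (auto simp: V_part_def)

lemma intertwines_cong:
  assumes "intertwines n k f \<phi>" "\<And>\<zeta>. \<zeta> \<in> V_part n k \<Longrightarrow> g \<zeta> = f \<zeta>"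
    "\<And>J x. J \<in> subsets_k n k \<Longrightarrow> \<psi> J x = \<phi> J x"
  shows "intertwines n k g \<psi>"
  using assms by (simp add: intertwines_def)

lemma intertwines_restrict:
  "V_part n k \<subseteq> U \<Longrightarrow> intertwines n k f \<phi> \<Longrightarrow> intertwines n k (restrict f U) \<phi>"
  by (erule intertwines_cong) auto

lemma intertwinesD:
  assumes "intertwines n k f \<phi>" "\<zeta> \<in> V_part n k"
  shows "f \<zeta> \<in> V_part n k" "J \<in> subsets_k n k \<Longrightarrow> fp n (f \<zeta>) J = \<phi> J (fp n \<zeta> J)"
  using assms by (simp_all add: intertwines_def)

lemma intertwines_scalar:
  assumes "c \<in> L_lam_zy n"
  shows "intertwines n k (\<lambda>\<zeta> I. c * \<zeta> I) (\<lambda>J x. c * x)"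
  unfolding intertwines_def
proof (intro ballI conjI)
  fix \<zeta> assume "\<zeta> \<in> V_part n k"
  then show "(\<lambda>I. c * \<zeta> I) \<in> V_part n k"
    by (simp add: V_part_def V_def is_subring_mult[OF L_is_subring assms])
qed (rule wS_scale)

lemma intertwines_add:
  assumes f: "intertwines n k f \<phi>" and g: "intertwines n k g \<psi>"
  shows "intertwines n k (\<lambda>\<zeta> I. f \<zeta> I + g \<zeta> I) (\<lambda>J x. \<phi> J x + \<psi> J x)"
  unfolding intertwines_def
proof (intro ballI conjI)
  fix \<zeta> assume z: "\<zeta> \<in> V_part n k"
  show "(\<lambda>I. f \<zeta> I + g \<zeta> I) \<in> V_part n k"
    using intertwinesD(1)[OF f z] intertwinesD(1)[OF g z]
    by (simp add: V_part_def V_def is_subring_add[OF L_is_subring])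
  fix J assume "J \<in> subsets_k n k"
  then show "fp n (\<lambda>I. f \<zeta> I + g \<zeta> I) J = \<phi> J (fp n \<zeta> J) + \<psi> J (fp n \<zeta> J)"
    by (simp add: wS_add intertwinesD(2)[OF f z] intertwinesD(2)[OF g z])
qed

lemma intertwines_comp:
  assumes f: "intertwines n k f \<phi>" and g: "intertwines n k g \<psi>" and U: "V_part n k \<subseteq> U"
  shows "intertwines n k (compose U f g) (\<lambda>J x. \<phi> J (\<psi> J x))"
  unfolding intertwines_def
proof (intro ballI conjI)
  fix \<zeta> assume z: "\<zeta> \<in> V_part n k"
  have c: "compose U f g \<zeta> = f (g \<zeta>)" using subsetD[OF U z] by (simp add: compose_def)
  note gz = intertwinesD[OF g z]
  show "compose U f g \<zeta> \<in> V_part n k" unfolding c by (rule intertwinesD(1)[OF f gz(1)])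
  fix J assume "J \<in> subsets_k n k"
  then show "fp n (compose U f g \<zeta>) J = \<phi> J (\<psi> J (fp n \<zeta> J))"
    unfolding c by (simp add: intertwinesD(2)[OF f gz(1)] gz(2))
qed

lemma intertwines_eqD:
  assumes f: "intertwines n k f \<phi>" and g: "intertwines n k g \<phi>" and z: "\<zeta> \<in> V_part n k"
  shows "f \<zeta> = g \<zeta>"
  by (rule fp_inj_part[OF intertwinesD(1)[OF f z] intertwinesD(1)[OF g z]])
    (simp add: intertwinesD(2)[OF f z] intertwinesD(2)[OF g z])

text \<open>Scaling and shifting keep zero coordinates zero, and the k-part is characterized by
  vanishing coordinates.\<close>

lemma intertwines_shift:
  assumes \<zeta>: "\<And>\<zeta>. \<zeta> \<in> V n \<Longrightarrow> f \<zeta> \<in> V n"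
    and fp: "\<And>\<zeta> J. \<zeta> \<in> V n \<Longrightarrow> J \<subseteq> {1..n} \<Longrightarrow> fp n (f \<zeta>) J = c J * shift m (fp n \<zeta> J)"
  shows "intertwines n k f (\<lambda>J x. c J * shift m x)"
  unfolding intertwines_def
proof (intro ballI conjI)
  fix \<zeta> assume z: "\<zeta> \<in> V_part n k"
  have s0: "shift m 0 = 0" using shift_diff[of m 0 0] by simp
  show "f \<zeta> \<in> V_part n k"
    by (rule V_partI[OF assms(1)[OF V_partD[OF z]]])
      (simp add: fp[OF V_partD[OF z]] fp_V_part[OF z] s0)
  fix J assume "J \<in> subsets_k n k"
  then show "fp n (f \<zeta>) J = c J * shift m (fp n \<zeta> J)"
    by (intro fp[OF V_partD[OF z]]) (simp add: subsets_k_def)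
qed

lemma intertwines_L22: "intertwines n k (L22_coeff n s) (\<lambda>J x. ratio_fps J zz $ s * shift 1 x)"
  by (rule intertwines_shift[OF L22_coeff_V L22_coeff_fp])

lemma intertwines_L22_0: "intertwines n k (L22_coeff n 0) (\<lambda>J x. shift 1 x)"
  using intertwines_L22[of n k 0] by simp

lemma intertwines_L22_inv: "intertwines n k (inv_into (V n) (L22_coeff n 0)) (\<lambda>J x. shift (- 1) x)"
  using intertwines_shift[of n "inv_into (V n) (L22_coeff n 0)" "\<lambda>J. 1" "- 1" k] L22_inv by simp

lemma intertwines_Det: "intertwines n k (Det_coeff n s) (\<lambda>J x. b_coeff n s * x)"
  by (rule intertwines_cong[OF intertwines_scalar[OF b_coeff_L]]) (auto intro: Det_coeff_eq V_partD)

lemma GZ_part_ops: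
  "carrier (GZ_part n k) = (\<lambda>b. restrict b (V_part n k)) ` GZ n"
  "f \<otimes>\<^bsub>GZ_part n k\<^esub> g = compose (V_part n k) f g"
  "\<one>\<^bsub>GZ_part n k\<^esub> = (\<lambda>\<zeta>\<in>V_part n k. \<zeta>)"
  "f \<oplus>\<^bsub>GZ_part n k\<^esub> g = (\<lambda>\<zeta>\<in>V_part n k. \<lambda>I. f \<zeta> I + g \<zeta> I)"
  "c \<odot>\<^bsub>GZ_part n k\<^esub> f = (\<lambda>\<zeta>\<in>V_part n k. \<lambda>I. c * f \<zeta> I)"
  by (simp_all add: GZ_part_def Let_def)

context
  fixes n k :: nat
  assumes n1: "1 \<le> n" and kn: "k \<le> n"
begin

lemmas act_m = act_monom[OF n1 kn]

lemma ex_actI: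
  "a \<in> carrier (A_delta n k) \<Longrightarrow> intertwines n k f (act n k a) \<Longrightarrow> \<exists>a\<in>carrier (A_delta n k). intertwines n k f (act n k a)"
  by blast

lemma ex_GZI:
  "b \<in> GZ n \<Longrightarrow> intertwines n k b \<phi> \<Longrightarrow> \<exists>b\<in>GZ n. intertwines n k b \<phi>"
  by blast

lemma GZ_intertwines: "f \<in> GZ n \<Longrightarrow> \<exists>a\<in>carrier (A_delta n k). intertwines n k f (act n k a)"
proof (induction f rule: GZ.induct)
  case (scalar c)
  show ?case
  proof (rule ex_actI[OF _ intertwines_restrict[OF V_part_sub intertwines_cong[OF intertwines_scalar]]])
    show "c \<in> L_lam_zy n" using scalar by (rule subsetD[OF C_y_inv_L])
    show "A_delta_monom n k (A_class n k c) 0 \<in> carrier (A_delta n k)"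
      by (intro monom_carrier[OF n1 kn] A_class_carrier[OF n1 kn] C_AR scalar)
    show "act n k (A_delta_monom n k (A_class n k c) 0) J x = c * x" if "J \<in> subsets_k n k" for J x
      using that by (simp add: act_m A_val_class[OF n1 kn C_AR[OF scalar]] fixed_C[OF n1 kn scalar])
  qed simp
next
  case (L22 s)
  show ?case
  proof (rule ex_actI[OF _ intertwines_restrict[OF V_part_sub intertwines_cong[OF intertwines_L22[of n k s]]]])
    show "A_delta_monom n k (A_class n k (a_coeff k s)) 1 \<in> carrier (A_delta n k)"
      by (intro monom_carrier[OF n1 kn] A_class_carrier[OF n1 kn] ab_AR[OF n1 kn])
    show "act n k (A_delta_monom n k (A_class n k (a_coeff k s)) 1) J x = ratio_fps J zz $ s * shift 1 x"
      if "J \<in> subsets_k n k" for J x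
      using that by (simp add: act_m A_val_ab[OF n1 kn])
  qed simp
next
  case L22_inv
  show ?case
  proof (rule ex_actI[OF _ intertwines_restrict[OF V_part_sub intertwines_cong[OF intertwines_L22_inv]]])
    show "A_delta_monom n k \<one>\<^bsub>A_alg n k\<^esub> (- 1) \<in> carrier (A_delta n k)"
      by (intro monom_carrier[OF n1 kn] A_carrier_1[OF n1 kn])
    show "act n k (A_delta_monom n k \<one>\<^bsub>A_alg n k\<^esub> (- 1)) J x = shift (- 1) x"
      if "J \<in> subsets_k n k" for J x
      using that by (simp add: act_m A_val_ops[OF n1 kn])
  qed simp
next
  case (Det s)
  show ?case
  proof (rule ex_actI[OF _ intertwines_restrict[OF V_part_sub intertwines_cong[OF intertwines_Det[of n k s]]]])
    show "A_delta_monom n k (A_class n k (b_coeff n s)) 0 \<in> carrier (A_delta n k)"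
      by (intro monom_carrier[OF n1 kn] A_class_carrier[OF n1 kn] ab_AR[OF n1 kn])
    show "act n k (A_delta_monom n k (A_class n k (b_coeff n s)) 0) J x = b_coeff n s * x"
      if "J \<in> subsets_k n k" for J x
      using that by (simp add: act_m A_val_ab(2)[OF n1 kn, folded b_coeff_eq])
  qed simp
next
  case (add f g)
  then obtain a b where ab: "a \<in> carrier (A_delta n k)" "b \<in> carrier (A_delta n k)"
    "intertwines n k f (act n k a)" "intertwines n k g (act n k b)" by blast
  show ?case
    by (rule ex_actI[OF D_add(1)[OF n1 kn ab(1,2)]
          intertwines_restrict[OF V_part_sub intertwines_cong[OF intertwines_add[OF ab(3,4)]]]]) (simp_all add: D_add(2)[OF n1 kn ab(1,2)])
next
  case (comp f g)
  then obtain a b where ab: "a \<in> carrier (A_delta n k)" "b \<in> carrier (A_delta n k)"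
    "intertwines n k f (act n k a)" "intertwines n k g (act n k b)" by blast
  show ?case
    by (rule ex_actI[OF D_mult(1)[OF n1 kn ab(1,2)] intertwines_cong[OF intertwines_comp[OF ab(3,4) V_part_sub]]])
      (simp_all add: D_mult(2)[OF n1 kn ab(1,2)])
qed

text \<open>Every x in the coefficient ring is the common value of all coordinates of some vector,
  so a and b agree on x at one fixed point.\<close>

lemma intertwines_unique:
  assumes f: "intertwines n k f (act n k a)" "intertwines n k f (act n k b)"
    and ab: "a \<in> carrier (A_delta n k)" "b \<in> carrier (A_delta n k)"
  shows "a = b"
proof -
  obtain J where J: "J \<in> subsets_k n k" using subsets_k_nonempty[OF n1 kn] by auto
  show ?thesis
  proof (rule act_inject[OF n1 kn ab J])
    fix x assume "x \<in> L_lam_zy n"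
    then obtain \<zeta> where z: "\<zeta> \<in> V_part n k" "\<And>J. J \<in> subsets_k n k \<Longrightarrow> fp n \<zeta> J = x"
      using fp_surj_part[of n k "\<lambda>_. x"] by blast
    show "act n k a J x = act n k b J x"
      using intertwinesD(2)[OF f(1) z(1) J] intertwinesD(2)[OF f(2) z(1) J] z(2)[OF J] by simp
  qed
qed

section \<open>Existence and uniqueness of \<open>alpha\<close>\<close>

definition alpha :: "(vec \<Rightarrow> vec) \<Rightarrow> int \<Rightarrow> ratf set" where
  "alpha b = (THE a. a \<in> carrier (A_delta n k) \<and> intertwines n k b (act n k a))"

lemma alphaI:
  assumes "a \<in> carrier (A_delta n k)" "intertwines n k b (act n k a)"
  shows "alpha b = a"
  unfolding alpha_def using assms intertwines_unique by (intro the_equality) blast+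

lemma alpha:
  assumes "b \<in> carrier (GZ_part n k)"
  shows "alpha b \<in> carrier (A_delta n k)" "intertwines n k b (act n k (alpha b))"
proof -
  obtain f where f: "f \<in> GZ n" "b = restrict f (V_part n k)" using assms by (auto simp: GZ_part_ops)
  obtain a where a: "a \<in> carrier (A_delta n k)" "intertwines n k f (act n k a)" using GZ_intertwines[OF f(1)] by blast
  have "intertwines n k b (act n k a)" unfolding f(2) by (rule intertwines_restrict[OF order_refl a(2)])
  then have "alpha b = a" using a(1) by (intro alphaI)
  then show "alpha b \<in> carrier (A_delta n k)" "intertwines n k b (act n k (alpha b))"
    using a(1) \<open>intertwines n k b (act n k a)\<close> by simp_all
qed

text \<open>Each equation follows from uniqueness once its right-hand side is seen to act on
  coordinates as the operator on the left does.\<close>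

lemma alpha_is_alpha: "is_alpha n k alpha"
  unfolding is_alpha_def
proof (intro conjI ballI allI)
  note U = order_refl[of "V_part n k"]
  show "alpha \<in> ring_hom (GZ_part n k) (A_delta n k)"
  proof (rule ring_hom_memI)
    fix b c assume b: "b \<in> carrier (GZ_part n k)" and c: "c \<in> carrier (GZ_part n k)"
    note B = alpha[OF b] and C = alpha[OF c]
    show "alpha (b \<otimes>\<^bsub>GZ_part n k\<^esub> c) = alpha b \<otimes>\<^bsub>A_delta n k\<^esub> alpha c"
      unfolding GZ_part_ops
      by (rule alphaI[OF D_mult(1)[OF n1 kn B(1) C(1)] intertwines_cong[OF intertwines_comp[OF B(2) C(2) U]]])
        (simp_all add: D_mult(2)[OF n1 kn B(1) C(1)])
    show "alpha (b \<oplus>\<^bsub>GZ_part n k\<^esub> c) = alpha b \<oplus>\<^bsub>A_delta n k\<^esub> alpha c"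
      unfolding GZ_part_ops
      by (rule alphaI[OF D_add(1)[OF n1 kn B(1) C(1)] intertwines_cong[OF intertwines_add[OF B(2) C(2)]]])
        (simp_all add: D_add(2)[OF n1 kn B(1) C(1)])
  next
    show "alpha \<one>\<^bsub>GZ_part n k\<^esub> = \<one>\<^bsub>A_delta n k\<^esub>"
      unfolding GZ_part_ops
      by (rule alphaI[OF D_one_carrier[OF n1 kn]]) (simp add: intertwines_def act_one[OF n1 kn])
  qed (rule alpha(1))
next
  fix c b assume c: "c \<in> C_y_inv" and b: "b \<in> carrier (GZ_part n k)"
  note B = alpha[OF b]
  have cL: "c \<in> L_lam_zy n" using c by (rule subsetD[OF C_y_inv_L])
  show "alpha (c \<odot>\<^bsub>GZ_part n k\<^esub> b) = c \<odot>\<^bsub>A_delta n k\<^esub> alpha b"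
    unfolding GZ_part_ops
    by (rule alphaI[OF D_smult(1)[OF n1 kn B(1) c]
          intertwines_cong[OF intertwines_comp[OF intertwines_scalar[OF cL] B(2) order_refl]]])
      (simp_all add: D_smult(2)[OF n1 kn B(1) c] compose_def)
next
  fix s
  show "alpha (restrict (L22_coeff n s) (V_part n k)) = A_delta_monom n k (A_class n k (a_coeff k s)) 1"
  proof (rule alphaI[OF _ intertwines_restrict[OF order_refl intertwines_cong[OF intertwines_L22[of n k s]]]])
    show "A_delta_monom n k (A_class n k (a_coeff k s)) 1 \<in> carrier (A_delta n k)"
      by (intro monom_carrier[OF n1 kn] A_class_carrier[OF n1 kn] ab_AR[OF n1 kn])
  qed (simp_all add: act_m A_val_ab[OF n1 kn])
  show "alpha (restrict (Det_coeff n s) (V_part n k)) = A_delta_monom n k (A_class n k (b_coeff n s)) 0"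
  proof (rule alphaI[OF _ intertwines_restrict[OF order_refl intertwines_cong[OF intertwines_Det[of n k s]]]])
    show "A_delta_monom n k (A_class n k (b_coeff n s)) 0 \<in> carrier (A_delta n k)"
      by (intro monom_carrier[OF n1 kn] A_class_carrier[OF n1 kn] ab_AR[OF n1 kn])
  qed (simp_all add: act_m A_val_ab(2)[OF n1 kn, folded b_coeff_eq])
qed

lemma restrict_GZ: "f \<in> GZ n \<Longrightarrow> restrict f (V_part n k) \<in> carrier (GZ_part n k)"
  by (simp add: GZ_part_ops)

lemma restrict_V: "restrict (restrict f (V n)) (V_part n k) = restrict f (V_part n k)"
  using V_part_sub[of n k] by (simp add: Int_absorb1)

text \<open>The prescribed values act as the generators do, and this agreement passes to sums and
  compositions; so any admissible map is pinned down by the action.\<close>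

lemma is_alpha_intertwines:
  assumes \<beta>: "is_alpha n k \<beta>" and f: "f \<in> GZ n"
  shows "intertwines n k f (act n k (\<beta> (restrict f (V_part n k))))"
proof -
  let ?U = "V_part n k" and ?G = "GZ_part n k" and ?D = "A_delta n k"
  have hom: "\<beta> \<in> ring_hom ?G ?D" using \<beta> by (simp add: is_alpha_def)
  have bc: "\<beta> (restrict g ?U) \<in> carrier ?D" if "g \<in> GZ n" for g
    by (rule ring_hom_closed[OF hom restrict_GZ[OF that]])
  have bL: "\<beta> (restrict (L22_coeff n s) ?U) = A_delta_monom n k (A_class n k (a_coeff k s)) 1"
    and bD: "\<beta> (restrict (Det_coeff n s) ?U) = A_delta_monom n k (A_class n k (b_coeff n s)) 0" for s
    using \<beta> by (simp_all add: is_alpha_def)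
  have one: "\<one>\<^bsub>?G\<^esub> \<in> carrier ?G"
  proof -
    have "restrict (\<lambda>\<zeta>\<in>V n. \<lambda>I. 1 * \<zeta> I) ?U \<in> carrier ?G"
      by (intro restrict_GZ GZ.scalar is_subring_1[OF C_y_inv_is_subring])
    then show ?thesis by (simp only: GZ_part_ops(3) restrict_V mult_1)
  qed
  show ?thesis using f
  proof (induction f rule: GZ.induct)
    case (scalar c)
    have cL: "c \<in> L_lam_zy n" using scalar by (rule subsetD[OF C_y_inv_L])
    have "restrict (\<lambda>\<zeta>\<in>V n. \<lambda>I. c * \<zeta> I) ?U = c \<odot>\<^bsub>?G\<^esub> \<one>\<^bsub>?G\<^esub>"
      unfolding restrict_V GZ_part_ops by (rule restrict_ext) simp
    moreover have "\<beta> (c \<odot>\<^bsub>?G\<^esub> \<one>\<^bsub>?G\<^esub>) = c \<odot>\<^bsub>?D\<^esub> \<beta> \<one>\<^bsub>?G\<^esub>"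
      using \<beta> scalar one by (simp add: is_alpha_def)
    moreover have "\<beta> \<one>\<^bsub>?G\<^esub> = \<one>\<^bsub>?D\<^esub>" by (rule ring_hom_one[OF hom])
    ultimately have b: "\<beta> (restrict (\<lambda>\<zeta>\<in>V n. \<lambda>I. c * \<zeta> I) ?U) = c \<odot>\<^bsub>?D\<^esub> \<one>\<^bsub>?D\<^esub>" by simp
    show ?case unfolding b
      by (rule intertwines_restrict[OF V_part_sub intertwines_cong[OF intertwines_scalar[OF cL]]])
        (simp_all add: D_smult(2)[OF n1 kn D_one_carrier[OF n1 kn] scalar] act_one[OF n1 kn])
  next
    case (L22 s)
    show ?case unfolding restrict_V bL
      by (rule intertwines_restrict[OF V_part_sub intertwines_cong[OF intertwines_L22[of n k s]]])
        (simp_all add: act_m A_val_ab[OF n1 kn])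
  next
    case L22_inv
    \<comment> \<open>The inverse of L_(22,0) has no prescribed image. It is a left inverse of an
      operator that is sent to the shift, which forces its image to act as the inverse
      shift.\<close>
    let ?i = "inv_into (V n) (L22_coeff n 0)"
    let ?i' = "restrict ?i ?U" and ?l = "restrict (L22_coeff n 0) ?U"
    have iG: "?i' \<in> carrier ?G" and lG: "?l \<in> carrier ?G"
      using restrict_GZ[OF GZ.L22_inv] restrict_GZ[OF GZ.L22] by (simp_all only: restrict_V)
    have c1: "intertwines n k (compose ?U ?i' ?l) (\<lambda>J x. x)"
      by (rule intertwines_cong[OF intertwines_comp[OF intertwines_restrict[OF order_refl intertwines_L22_inv]
            intertwines_restrict[OF order_refl intertwines_L22_0] order_refl]]) (simp_all add: shift_shift)
    have c2: "intertwines n k (\<lambda>\<zeta>\<in>?U. \<zeta>) (\<lambda>J x. x)" by (simp add: intertwines_def)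
    have "compose ?U ?i' ?l = (\<lambda>\<zeta>\<in>?U. \<zeta>)"
      by (rule extensionalityI[of _ ?U]; (rule intertwines_eqD[OF c1 c2])?) simp_all
    then have "\<beta> ?i' \<otimes>\<^bsub>?D\<^esub> \<beta> ?l = \<one>\<^bsub>?D\<^esub>"
      using ring_hom_mult[OF hom iG lG] ring_hom_one[OF hom] by (simp add: GZ_part_ops)
    then have "act n k (\<beta> ?i') J (act n k (\<beta> ?l) J x) = x" if "J \<in> subsets_k n k" for J x
      using D_mult(2)[OF n1 kn ring_hom_closed[OF hom iG] ring_hom_closed[OF hom lG] that, of x]
      by (simp add: act_one[OF n1 kn that])
    then have "act n k (\<beta> ?i') J (act n k (\<beta> ?l) J (shift (- 1) x)) = shift (- 1) x" if "J \<in> subsets_k n k" for J x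
      using that by simp
    then have e: "act n k (\<beta> ?i') J x = shift (- 1) x" if "J \<in> subsets_k n k" for J x
      using that by (simp add: bL act_m A_val_ab[OF n1 kn] shift_shift)
    show ?case unfolding restrict_V
      by (rule intertwines_restrict[OF V_part_sub intertwines_cong[OF intertwines_L22_inv refl e]])
  next
    case (Det s)
    show ?case unfolding restrict_V bD
      by (rule intertwines_restrict[OF V_part_sub intertwines_cong[OF intertwines_Det[of n k s]]])
        (simp_all add: act_m A_val_ab(2)[OF n1 kn, folded b_coeff_eq])
  next
    case (add f g)
    have "restrict (\<lambda>\<zeta>\<in>V n. \<lambda>I. f \<zeta> I + g \<zeta> I) ?U = restrict f ?U \<oplus>\<^bsub>?G\<^esub> restrict g ?U"
      unfolding restrict_V GZ_part_ops by (rule restrict_ext) simp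
    then have b: "\<beta> (restrict (\<lambda>\<zeta>\<in>V n. \<lambda>I. f \<zeta> I + g \<zeta> I) ?U) = \<beta> (restrict f ?U) \<oplus>\<^bsub>?D\<^esub> \<beta> (restrict g ?U)"
      using ring_hom_add[OF hom restrict_GZ[OF add(1)] restrict_GZ[OF add(2)]] by simp
    show ?case unfolding b
      by (rule intertwines_restrict[OF V_part_sub intertwines_cong[OF intertwines_add[OF add.IH]]])
        (simp_all add: D_add(2)[OF n1 kn bc[OF add(1)] bc[OF add(2)]] del: restrict_apply)
  next
    case (comp f g)
    have "restrict (compose (V n) f g) ?U = restrict f ?U \<otimes>\<^bsub>?G\<^esub> restrict g ?U"
      unfolding restrict_V GZ_part_ops compose_def
      by (rule restrict_ext) (simp add: intertwinesD(1)[OF comp.IH(2)])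
    then have b: "\<beta> (restrict (compose (V n) f g) ?U) = \<beta> (restrict f ?U) \<otimes>\<^bsub>?D\<^esub> \<beta> (restrict g ?U)"
      using ring_hom_mult[OF hom restrict_GZ[OF comp(1)] restrict_GZ[OF comp(2)]] by simp
    show ?case unfolding b
      by (rule intertwines_cong[OF intertwines_comp[OF comp.IH V_part_sub]])
        (simp_all add: D_mult(2)[OF n1 kn bc[OF comp(1)] bc[OF comp(2)]] del: restrict_apply)
  qed
qed

lemma is_alpha_unique:
  assumes \<beta>: "is_alpha n k \<beta>" and b: "b \<in> carrier (GZ_part n k)"
  shows "\<beta> b = alpha b"
proof -
  obtain f where f: "f \<in> GZ n" "b = restrict f (V_part n k)" using b by (auto simp: GZ_part_ops)
  have "\<beta> \<in> ring_hom (GZ_part n k) (A_delta n k)" using \<beta> by (simp add: is_alpha_def)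
  then have "\<beta> b \<in> carrier (A_delta n k)" using b by (rule ring_hom_closed)
  moreover have "intertwines n k b (act n k (\<beta> b))"
    using intertwines_restrict[OF order_refl is_alpha_intertwines[OF \<beta> f(1)]] f(2) by simp
  ultimately show ?thesis by (rule alphaI[symmetric])
qed

section \<open>Surjectivity of \<open>alpha\<close>\<close>

lemma GZ_shift: "\<exists>b\<in>GZ n. intertwines n k b (\<lambda>J x. shift m x)"
proof (induction m rule: int_induct[where k = 0])
  case base
  show ?case
    by (rule ex_GZI[OF GZ.scalar[OF is_subring_1[OF C_y_inv_is_subring]]],
        rule intertwines_restrict[OF V_part_sub intertwines_cong[OF intertwines_scalar[OF is_subring_1[OF L_is_subring]]]]) simp_all
next
  case (step1 m)
  then obtain b where b: "b \<in> GZ n" "intertwines n k b (\<lambda>J x. shift m x)" by blast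
  show ?case
    by (rule ex_GZI[OF GZ.comp[OF b(1) GZ.L22[of _ 0]]],
        rule intertwines_cong[OF intertwines_comp[OF b(2) intertwines_restrict[OF V_part_sub intertwines_L22_0] V_part_sub]])
      (simp_all add: shift_shift)
next
  case (step2 m)
  then obtain b where b: "b \<in> GZ n" "intertwines n k b (\<lambda>J x. shift m x)" by blast
  show ?case
    by (rule ex_GZI[OF GZ.comp[OF b(1) GZ.L22_inv]],
        rule intertwines_cong[OF intertwines_comp[OF b(2) intertwines_restrict[OF V_part_sub intertwines_L22_inv] V_part_sub]])
      (simp_all add: shift_shift)
qed

lemma GZ_scalar: "c \<in> C_y_inv \<Longrightarrow> \<exists>b\<in>GZ n. intertwines n k b (\<lambda>J x. c * x)"
  by (rule ex_GZI[OF GZ.scalar intertwines_restrict[OF V_part_sub intertwines_scalar[OF subsetD[OF C_y_inv_L]]]])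

lemma GZ_add:
  assumes "\<exists>b\<in>GZ n. intertwines n k b \<phi>" "\<exists>b\<in>GZ n. intertwines n k b \<psi>"
  shows "\<exists>b\<in>GZ n. intertwines n k b (\<lambda>J x. \<phi> J x + \<psi> J x)"
proof -
  obtain b c where bc: "b \<in> GZ n" "c \<in> GZ n" "intertwines n k b \<phi>" "intertwines n k c \<psi>" using assms by blast
  show ?thesis
    by (rule ex_GZI[OF GZ.add[OF bc(1,2)] intertwines_restrict[OF V_part_sub intertwines_add[OF bc(3,4)]]])
qed

lemma GZ_comp:
  assumes "\<exists>b\<in>GZ n. intertwines n k b \<phi>" "\<exists>b\<in>GZ n. intertwines n k b \<psi>"
  shows "\<exists>b\<in>GZ n. intertwines n k b (\<lambda>J x. \<phi> J (\<psi> J x))"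
proof -
  obtain b c where bc: "b \<in> GZ n" "c \<in> GZ n" "intertwines n k b \<phi>" "intertwines n k c \<psi>" using assms by blast
  show ?thesis
    by (rule ex_GZI[OF GZ.comp[OF bc(1,2)] intertwines_comp[OF bc(3,4) V_part_sub]])
qed

lemma GZ_cong:
  assumes "\<exists>b\<in>GZ n. intertwines n k b \<phi>" "\<And>J x. J \<in> subsets_k n k \<Longrightarrow> \<psi> J x = \<phi> J x"
  shows "\<exists>b\<in>GZ n. intertwines n k b \<psi>"
  using assms by (auto simp: intertwines_def)

text \<open>The f whose multiplication is realized form a subring. It contains the b_s, the a_s,
  because composing L_(22,s) with the inverse of L_(22,0) removes the shift, and the ideal, whose
  elements act by zero; so \<open>A_generated\<close> applies.\<close>

lemma GZ_mult:
  assumes "f \<in> AR n k"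
  shows "\<exists>b\<in>GZ n. intertwines n k b (\<lambda>J x. subst (fixed_pt n J) f * x)"
proof -
  define R where "R = {f \<in> AR n k. \<exists>b\<in>GZ n. intertwines n k b (\<lambda>J x. subst (fixed_pt n J) f * x)}"
  note RI = CollectI[of "\<lambda>f. f \<in> AR n k \<and> (\<exists>b\<in>GZ n. intertwines n k b (\<lambda>J x. subst (fixed_pt n J) f * x))", folded R_def]
  have HR: "f \<in> HR n k" if "f \<in> AR n k" for f using that by (rule subsetD[OF AR_HR])
  have scal: "C_y_inv \<subseteq> R"
  proof
    fix c assume c: "c \<in> C_y_inv"
    show "c \<in> R" by (intro RI conjI C_AR c GZ_cong[OF GZ_scalar[OF c]]) (simp add: fixed_C[OF n1 kn c])
  qed
  have "is_subring R"
  proof (rule is_subringI)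
    show "1 \<in> R" "- 1 \<in> R" using scal is_subring_1[OF C_y_inv_is_subring] is_subring_uminus[OF C_y_inv_is_subring is_subring_1[OF C_y_inv_is_subring]] by blast+
    fix f g assume fg: "f \<in> R" "g \<in> R"
    then have AR: "f \<in> AR n k" "g \<in> AR n k"
      and F: "\<exists>b\<in>GZ n. intertwines n k b (\<lambda>J x. subst (fixed_pt n J) f * x)"
      and G: "\<exists>b\<in>GZ n. intertwines n k b (\<lambda>J x. subst (fixed_pt n J) g * x)" by (simp_all add: R_def)
    show "f + g \<in> R"
      by (intro RI conjI is_subring_add[OF AR_is_subring] AR GZ_cong[OF GZ_add[OF F G]])
        (simp add: fixed_pt_add[OF n1 kn HR[OF AR(1)] HR[OF AR(2)]] distrib_right)
    show "f * g \<in> R"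
      by (intro RI conjI is_subring_mult[OF AR_is_subring] AR GZ_cong[OF GZ_comp[OF F G]])
        (simp add: fixed_pt_mult[OF n1 kn HR[OF AR(1)] HR[OF AR(2)]] mult.assoc)
  qed
  moreover have "A_ideal n k \<subseteq> R"
  proof
    fix f assume "f \<in> A_ideal n k"
    then have f: "f \<in> AR n k" "\<And>J. J \<in> subsets_k n k \<Longrightarrow> subst (fixed_pt n J) f = 0"
      by (simp_all add: A_ideal_eq[OF n1 kn] vanishing_def)
    show "f \<in> R" by (intro RI conjI f(1) GZ_cong[OF GZ_scalar[OF is_subring_0[OF C_y_inv_is_subring]]]) (simp add: f(2))
  qed
  moreover have "a_coeff k s \<in> R" for s
  proof (intro RI conjI ab_AR[OF n1 kn])
    have l: "\<exists>b\<in>GZ n. intertwines n k b (\<lambda>J x. ratio_fps J zz $ s * shift 1 x)"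
      by (rule ex_GZI[OF GZ.L22 intertwines_restrict[OF V_part_sub intertwines_L22]])
    show "\<exists>b\<in>GZ n. intertwines n k b (\<lambda>J x. subst (fixed_pt n J) (a_coeff k s) * x)"
      by (rule GZ_cong[OF GZ_comp[OF l GZ_shift[of "- 1"]]])
        (simp add: shift_shift A_val_ab(1)[OF n1 kn] A_val_class[OF n1 kn ab_AR(1)[OF n1 kn], symmetric])
  qed
  moreover have "b_coeff n s \<in> R" for s
  proof (intro RI conjI ab_AR[OF n1 kn])
    have l: "\<exists>b\<in>GZ n. intertwines n k b (\<lambda>J x. b_coeff n s * x)"
      by (rule ex_GZI[OF GZ.Det intertwines_restrict[OF V_part_sub intertwines_Det]])
    show "\<exists>b\<in>GZ n. intertwines n k b (\<lambda>J x. subst (fixed_pt n J) (b_coeff n s) * x)"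
      by (rule GZ_cong[OF l]) (simp add: fixed_pt_L[OF n1 kn b_coeff_L])
  qed
  ultimately have "AR n k \<subseteq> R" by (intro A_generated[OF n1 kn] scal)
  then show ?thesis using assms unfolding R_def by auto
qed

lemma GZ_act:
  assumes a: "a \<in> carrier (A_delta n k)"
  shows "\<exists>b\<in>GZ n. intertwines n k b (act n k a)"
proof -
  have "\<exists>b\<in>GZ n. intertwines n k b (\<lambda>J x. \<Sum>m\<in>M. A_val n k J (a m) * shift m x)" if "finite M" for M
    using that
  proof (induction M)
    case empty
    show ?case by (rule GZ_cong[OF GZ_scalar[OF is_subring_0[OF C_y_inv_is_subring]]]) simp
  next
    case (insert m M)
    have am: "a m \<in> carrier (A_alg n k)" using a by (simp add: D_carrier[OF n1 kn])
    obtain f where f: "f \<in> AR n k" "a m = A_class n k f" by (rule A_carrierE[OF n1 kn am])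
    show ?case
      by (rule GZ_cong[OF GZ_add[OF GZ_comp[OF GZ_mult[OF f(1)] GZ_shift[of m]] insert.IH]])
        (simp add: insert.hyps f(2) A_val_class[OF n1 kn f(1)])
  qed
  then show ?thesis unfolding act_def[abs_def] using a by (simp add: D_carrier[OF n1 kn])
qed

lemma alpha_bij: "bij_betw alpha (carrier (GZ_part n k)) (carrier (A_delta n k))"
proof (rule bij_betwI')
  fix b c assume b: "b \<in> carrier (GZ_part n k)" and c: "c \<in> carrier (GZ_part n k)"
  have ext: "b \<in> extensional (V_part n k)" "c \<in> extensional (V_part n k)"
    using b c by (auto simp: GZ_part_ops)
  show "alpha b = alpha c \<longleftrightarrow> b = c"
  proof
    assume e: "alpha b = alpha c"
    show "b = c"
      by (rule extensionalityI[OF ext], rule intertwines_eqD[OF alpha(2)[OF b] alpha(2)[OF c, folded e]])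
  qed simp
next
  fix a assume a: "a \<in> carrier (A_delta n k)"
  obtain f where f: "f \<in> GZ n" "intertwines n k f (act n k a)" using GZ_act[OF a] by blast
  show "\<exists>b\<in>carrier (GZ_part n k). a = alpha b"
    by (rule bexI[OF _ restrict_GZ[OF f(1)]]) (rule alphaI[OF a intertwines_restrict[OF order_refl f(2)], symmetric])
qed (rule alpha(1))

lemma Stab_alpha:
  assumes b: "b \<in> carrier (GZ_part n k)" and \<zeta>: "\<zeta> \<in> V_part n k"
  shows "Stab n k (b \<zeta>) = A_delta_act n k (alpha b) (Stab n k \<zeta>)"
proof (rule HT_eqI[OF n1 kn])
  note S = Stab_restr[OF n1 kn \<zeta>] and S' = Stab_restr[OF n1 kn intertwinesD(1)[OF alpha(2)[OF b] \<zeta>]]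
  show "Stab n k (b \<zeta>) \<in> carrier (HT_L n k)" by (rule S')
  show "A_delta_act n k (alpha b) (Stab n k \<zeta>) \<in> carrier (HT_L n k)"
    by (rule A_delta_act[OF n1 kn alpha(1)[OF b] S(1)])
  fix J assume J: "J \<in> subsets_k n k"
  show "restr n J (Stab n k (b \<zeta>)) = restr n J (A_delta_act n k (alpha b) (Stab n k \<zeta>))"
    by (simp add: S'(2)[OF J] A_delta_act(2)[OF n1 kn alpha(1)[OF b] S(1) J] S(2)[OF J]
        intertwinesD(2)[OF alpha(2)[OF b] \<zeta> J])
qed

end

theorem theorem10p3:
  fixes n k :: nat
  assumes "1 \<le> n" and "k \<le> n"
  shows "\<exists>\<alpha>. is_alpha n k \<alpha>
    \<and> (\<forall>\<beta>. is_alpha n k \<beta> \<longrightarrow> (\<forall>b\<in>carrier (GZ_part n k). \<beta> b = \<alpha> b))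
    \<and> \<alpha> \<in> ring_iso (GZ_part n k) (A_delta n k)
    \<and> bij_betw (Stab n k) (V_part n k) (carrier (HT_L n k))
    \<and> (\<forall>b\<in>carrier (GZ_part n k). \<forall>\<zeta>\<in>V_part n k.
         Stab n k (b \<zeta>) = A_delta_act n k (\<alpha> b) (Stab n k \<zeta>))"
proof (intro exI conjI allI impI ballI)
  note a = alpha_is_alpha[OF assms]
  show "is_alpha n k (alpha n k)" by (rule a)
  show "\<beta> b = alpha n k b" if "is_alpha n k \<beta>" "b \<in> carrier (GZ_part n k)" for \<beta> b
    by (rule is_alpha_unique[OF assms that])
  show "alpha n k \<in> ring_iso (GZ_part n k) (A_delta n k)"
    unfolding ring_iso_def using a alpha_bij[OF assms] by (simp add: is_alpha_def)
  show "bij_betw (Stab n k) (V_part n k) (carrier (HT_L n k))" by (rule Stab_bij[OF assms])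
  show "Stab n k (b \<zeta>) = A_delta_act n k (alpha n k b) (Stab n k \<zeta>)"
    if "b \<in> carrier (GZ_part n k)" "\<zeta> \<in> V_part n k" for b \<zeta>
    by (rule Stab_alpha[OF assms that])
qed

end
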